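(* Let $Y$ be a MUCOGARCH$(1,1)$ volatility process with parameters $A,B\in M_d(\mathbb{R})$, $C\in\mathbb{S}_d^{++}$ driven by a $d$-dimensional Lévy process $L$ with Lévy measure $\nu_L$. Assume that there is $\sigma_L\in\mathbb{R}^+$ with $\int_{\mathbb{R}^d}xx^*\nu_L(dx)=\sigma_LI_d$, that $\int_{\mathbb{R}^d}\|x\|^4\nu_L(dx)<\infty$, and that there is a real constant $\rho_L$ with $$\int_{\mathbb{R}^d}\operatorname{vec}(xx^* )\operatorname{vec}(xx^* )^*\,\nu_L(dx)=\rho_L\bigl(I_{d^2}+K_d+\operatorname{vec}(I_d)\operatorname{vec}(I_d)^*\bigr).$$ Put $$\mathscr{B}:=B\otimes I_d+I_d\otimes B+\sigma_LA\otimes A,\qquad \mathscr{A}:=(A\otimes A)\otimes(A\otimes A),\qquad \mathcal{R}:=\rho_L(\mathcal{Q}+\mathcal{K}_d\mathcal{Q}+I_{d^4}),$$ $$\mathscr{C}:=(B\otimes I_d+I_d\otimes B)\otimes I_{d^2}+I_{d^2}\otimes(B\otimes I_d+I_d\otimes B)+\sigma_L\bigl((A\otimes A)\otimes I_{d^2}+I_{d^2}\otimes(A\otimes A)\bigr)+\mathscr{A}\mathcal{R}.$$ (i) If $E(\|Y_0\|^2)<\infty$, then $$\frac{d}{dt}\operatorname{vec}\bigl(E(\operatorname{vec}(Y_t)\operatorname{vec}(Y_t)^* )\bigr)=\frac{d}{dt}E(\operatorname{vec}(Y_t)\otimes\operatorname{vec}(Y_t))$$ $$=\mathscr{C}\operatorname{vec}\bigl(E(\operatorname{vec}(Y_t)\operatorname{vec}(Y_t)^*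 )\bigr)+\bigl(\sigma_L(A\otimes A)\otimes I_{d^2}+\mathscr{A}\mathcal{R}\bigr)\bigl(\operatorname{vec}(C)\otimes E(\operatorname{vec}(Y_t))\bigr)$$ $$\quad+\bigl(\sigma_LI_{d^2}\otimes(A\otimes A)+\mathscr{A}\mathcal{R}\bigr)\bigl(E(\operatorname{vec}(Y_t))\otimes\operatorname{vec}(C)\bigr)+\mathscr{A}\mathcal{R}\bigl(\operatorname{vec}(C)\otimes\operatorname{vec}(C)\bigr).$$ (ii) If $Y$ is second-order stationary, then the stationary second moment $E(\operatorname{vec}(Y_0)\operatorname{vec}(Y_0)^* )$ satisfies $$\mathscr{B}E(\operatorname{vec}(Y_0)\operatorname{vec}(Y_0)^* )+E(\operatorname{vec}(Y_0)\operatorname{vec}(Y_0)^* )\mathscr{B}^*+(A\otimes A)\bigl[\mathbf{R}E(\operatorname{vec}(Y_0)\operatorname{vec}(Y_0)^* )\bigr](A^*\otimes A^* )$$ $$=-\sigma_L\bigl[(A\otimes A)\operatorname{vec}(C)E(\operatorname{vec}(Y_0))^*+E(\operatorname{vec}(Y_0))\operatorname{vec}(C)^*(A^*\otimes A^* )\bigr]$$ $$\quad-(A\otimes A)\bigl[\mathbf{R}\bigl(E(\operatorname{vec}(Y_0))\operatorname{vec}(C)^*+\operatorname{vec}(C)E(\operatorname{vec}(Y_0))^*+\operatorname{vec}(C)\operatorname{vec}(C)^*\bigr)\bigr](A^*\otimes A^* ),$$ with $\mathbf{R}:=\rho_L(\mathbf{Q}+K_d\mathbf{Q}+I_{d^2})$.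 Provided $\mathscr{C}$ is invertible, $E(\operatorname{vec}(Y_0)\operatorname{vec}(Y_0)^* )$ is given by $$\operatorname{vec}\bigl(E(\operatorname{vec}(Y_0)\operatorname{vec}(Y_0)^* )\bigr)=-\mathscr{C}^{-1}\Bigl[\mathscr{A}\mathcal{R}\bigl(\operatorname{vec}(C)\otimes\operatorname{vec}(C)\bigr)+\bigl(\sigma_L(A\otimes A)\otimes I_{d^2}+\mathscr{A}\mathcal{R}\bigr)\bigl(\operatorname{vec}(C)\otimes E(\operatorname{vec}(Y_0))\bigr)$$ $$\quad+\bigl(\sigma_LI_{d^2}\otimes(A\otimes A)+\mathscr{A}\mathcal{R}\bigr)\bigl(E(\operatorname{vec}(Y_0))\otimes\operatorname{vec}(C)\bigr)\Bigr].$$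
   Context: $M_n(\mathbb{R})$: real $n\times n$ matrices; $I_n$ the identity; $\mathbb{S}_d^+$ (resp. $\mathbb{S}_d^{++}$): positive semidefinite (resp. positive definite) symmetric $d\times d$ matrices; $X^*$ is the transpose; $X^{1/2}$ the positive semidefinite square root; $\otimes$ the Kronecker product; $\operatorname{vec}$ stacks the columns of a matrix; $\mathbb{R}^+=[0,\infty)$. $K_d\in M_{d^2}(\mathbb{R})$ is the commutation matrix: $K_d\operatorname{vec}(X)=\operatorname{vec}(X^* )$ for all $X\in M_d(\mathbb{R})$. $\mathbf{Q}:M_{d^2}(\mathbb{R})\to M_{d^2}(\mathbb{R})$ is the linear map $(\mathbf{Q}X)_{(k-1)d+l,(p-1)d+q}=X_{(k-1)d+p,(l-1)d+q}$ for $k,l,p,q\in\{1,\dots,d\}$. $\mathbf{R}$ is the linear map on $M_{d^2}(\mathbb{R})$ given by $\mathbf{R}X=\rho_L(\mathbf{Q}X+K_d(\mathbf{Q}X)+X)$. $\mathcal{Q}\in M_{d^4}(\mathbb{R})$ is the matrix of the linear map $\operatorname{vec}\circ\mathbf{Q}\circ\operatorname{vec}^{-1}$ on $\mathbb{R}^{d^4}$ and $\mathcal{K}_d\in M_{d^4}(\mathbb{R})$ the matrix of $x\mapsto\operatorname{vec}(K_d\operatorname{vec}^{-1}(x))$, with $\operatorname{vec}:M_{d^2}(\mathbb{R})\to\mathbb{R}^{d^4}$. All processes live on a filtered probability space satisfying the usual conditions; $L$ is a càdlàg $\mathbb{R}^d$-valued Lévy process with respect to this filtration, $L_0=0$; $Y_0$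 is $\mathcal{F}_0$-measurable. $[L,L]^{\mathfrak{d}}_t=\sum_{0\le s\le t}(\Delta L_s)(\Delta L_s)^*$. The MUCOGARCH$(1,1)$ volatility process with parameters $A,B,C$ driven by $L$ is the (unique) $\mathbb{S}_d^+$-valued càdlàg adapted solution of $$dY_t=(BY_{t-}+Y_{t-}B^* )\,dt+A(C+Y_{t-})^{1/2}\,d[L,L]_t^{\mathfrak{d}}\,(C+Y_{t-})^{1/2}A^*$$ with initial value $Y_0$ in $\mathbb{S}_d^+$. Second-order stationary means finite second moments, mean constant in time, and $\operatorname{cov}(\operatorname{vec}(Y_{t+h}),\operatorname{vec}(Y_t))$ depending only on $h\ge0$. *)

theory Defs
  imports "HOL-Probability.Probability"
begin

subsection \<open>Matrices\<close>

text \<open>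
  The dimension \<open>d\<close> is \<open>CARD('d)\<close>. The index sets \<open>{1..d\<^sup>2}\<close> and \<open>{1..d\<^sup>4}\<close> are replaced
  by the product types \<open>'d \<times> 'd\<close> and \<open>('d \<times> 'd) \<times> ('d \<times> 'd)\<close>: the pair \<open>(k, l)\<close> stands for the
  position \<open>(k - 1) d + l\<close>, and likewise \<open>(K, L)\<close> for \<open>(K - 1) d\<^sup>2 + L\<close>.
  Hence the \<open>(j, i)\<close> entry of \<open>vec X\<close> (column \<open>j\<close>, row \<open>i\<close>) is \<open>X $ i $ j\<close>.
\<close>

definition vec_mat :: "real^'n^'m \<Rightarrow> real^('n \<times> 'm)" where
  "vec_mat X = (\<chi> p. X $ snd p $ fst p)"

definition unvec :: "real^('n \<times> 'm) \<Rightarrow> real^'n^'m" where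
  "unvec x = (\<chi> i j. x $ (j, i))"

definition kron :: "real^'n^'m \<Rightarrow> real^'q^'p \<Rightarrow> real^('n \<times> 'q)^('m \<times> 'p)" (infixl \<open>\<otimes>\<close> 78) where
  "X \<otimes> Y = (\<chi> r c. X $ fst r $ fst c * Y $ snd r $ snd c)"

definition kron_vec :: "real^'n \<Rightarrow> real^'m \<Rightarrow> real^('n \<times> 'm)" (infixl \<open>\<otimes>\<^sub>v\<close> 78) where
  "x \<otimes>\<^sub>v y = (\<chi> p. x $ fst p * y $ snd p)"

text \<open>\<open>outer x y\<close> is the matrix \<open>x y\<^sup>*\<close>.\<close>

definition outer :: "real^'m \<Rightarrow> real^'n \<Rightarrow> real^'n^'m" where
  "outer x y = (\<chi> i j. x $ i * y $ j)"

definition psd :: "real^'n^'n \<Rightarrow> bool" where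
  "psd X \<longleftrightarrow> transpose X = X \<and> (\<forall>x. 0 \<le> x \<bullet> (X *v x))"

definition posdef :: "real^'n^'n \<Rightarrow> bool" where
  "posdef X \<longleftrightarrow> transpose X = X \<and> (\<forall>x. x \<noteq> 0 \<longrightarrow> 0 < x \<bullet> (X *v x))"

definition psd_sqrt :: "real^'n^'n \<Rightarrow> real^'n^'n" where
  "psd_sqrt X = (THE S. psd S \<and> S ** S = X)"

definition comm_mat :: "real^('d::finite \<times> 'd)^('d \<times> 'd)" where
  "comm_mat = matrix (\<lambda>x. vec_mat (transpose (unvec x)))"

definition Q_map :: "real^('d::finite \<times> 'd)^('d \<times> 'd) \<Rightarrow> real^('d \<times> 'd)^('d \<times> 'd)" where
  "Q_map X = (\<chi> r c. X $ (fst r, fst c) $ (snd r, snd c))"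

definition R_map :: "real \<Rightarrow> real^('d::finite \<times> 'd)^('d \<times> 'd) \<Rightarrow> real^('d \<times> 'd)^('d \<times> 'd)" where
  "R_map \<rho> X = \<rho> *\<^sub>R (Q_map X + comm_mat ** Q_map X + X)"

definition calQ :: "real^(('d::finite \<times> 'd) \<times> ('d \<times> 'd))^(('d \<times> 'd) \<times> ('d \<times> 'd))" where
  "calQ = matrix (\<lambda>x. vec_mat (Q_map (unvec x)))"

definition calK :: "real^(('d::finite \<times> 'd) \<times> ('d \<times> 'd))^(('d \<times> 'd) \<times> ('d \<times> 'd))" where
  "calK = matrix (\<lambda>x. vec_mat (comm_mat ** unvec x))"

definition calR :: "real \<Rightarrow> real^(('d::finite \<times> 'd) \<times> ('d \<times> 'd))^(('d \<times> 'd) \<times> ('d \<times> 'd))" where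
  "calR \<rho> = \<rho> *\<^sub>R (calQ + calK ** calQ + mat 1)"

definition scrB :: "real^'d^'d \<Rightarrow> real^'d^'d \<Rightarrow> real \<Rightarrow> real^('d::finite \<times> 'd)^('d \<times> 'd)" where
  "scrB A B \<sigma> = B \<otimes> mat 1 + mat 1 \<otimes> B + \<sigma> *\<^sub>R (A \<otimes> A)"

definition scrA :: "real^'d^'d \<Rightarrow> real^(('d::finite \<times> 'd) \<times> ('d \<times> 'd))^(('d \<times> 'd) \<times> ('d \<times> 'd))" where
  "scrA A = (A \<otimes> A) \<otimes> (A \<otimes> A)"

definition scrC :: "real^'d^'d \<Rightarrow> real^'d^'d \<Rightarrow> real \<Rightarrow> real
    \<Rightarrow> real^(('d::finite \<times> 'd) \<times> ('d \<times> 'd))^(('d \<times> 'd) \<times> ('d \<times> 'd))" where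
  "scrC A B \<sigma> \<rho> =
     (B \<otimes> mat 1 + mat 1 \<otimes> B) \<otimes> mat 1 + mat 1 \<otimes> (B \<otimes> mat 1 + mat 1 \<otimes> B)
     + \<sigma> *\<^sub>R ((A \<otimes> A) \<otimes> mat 1 + mat 1 \<otimes> (A \<otimes> A)) + scrA A ** calR \<rho>"

lemma vec_mat_unvec [simp]: "vec_mat (unvec x) = x"
  by (simp add: vec_mat_def unvec_def vec_eq_iff)

lemma unvec_vec_mat [simp]: "unvec (vec_mat X) = X"
  by (simp add: vec_mat_def unvec_def vec_eq_iff)

lemma comm_mat_vec: "comm_mat *v vec_mat X = vec_mat (transpose X)"
proof -
  have "linear (\<lambda>x::real^('a \<times> 'a). vec_mat (transpose (unvec x)))"
    by (rule linearI) (simp_all add: vec_mat_def transpose_def unvec_def vec_eq_iff)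
  then show ?thesis
    by (simp add: comm_mat_def matrix_works)
qed

lemma vec_mat_Q_map: "vec_mat (Q_map X) = calQ *v vec_mat X"
proof -
  have "linear (\<lambda>x::real^(('a \<times> 'a) \<times> ('a \<times> 'a)). vec_mat (Q_map (unvec x)))"
    by (rule linearI) (simp_all add: vec_mat_def Q_map_def unvec_def vec_eq_iff)
  then show ?thesis
    by (simp add: calQ_def matrix_works)
qed

lemma vec_mat_comm_mat_mult: "vec_mat (comm_mat ** X) = calK *v vec_mat X"
proof -
  have "linear (\<lambda>x::real^(('a \<times> 'a) \<times> ('a \<times> 'a)). vec_mat (comm_mat ** unvec x))"
    by (rule linearI)
      (simp_all add: vec_mat_def matrix_matrix_mult_def unvec_def vec_eq_iff
        distrib_left sum.distrib sum_distrib_left mult.left_commute)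
  then show ?thesis
    by (simp add: calK_def matrix_works)
qed

subsection \<open>Paths\<close>

text \<open>Processes have time set \<open>[0,\<infinity>)\<close>, so functions on \<open>real\<close> are only looked at there;
  the left limit at time 0 is by convention the value at time 0.\<close>

definition cadlag :: "(real \<Rightarrow> 'b::t2_space) \<Rightarrow> bool" where
  "cadlag f \<longleftrightarrow> (\<forall>t\<ge>0. continuous (at_right t) f) \<and> (\<forall>t>0. \<exists>l. (f \<longlongrightarrow> l) (at_left t))"

definition left_lim :: "(real \<Rightarrow> 'b::t2_space) \<Rightarrow> real \<Rightarrow> 'b" where
  "left_lim f t = (if t \<le> 0 then f 0 else Lim (at_left t) f)"

definition jump :: "(real \<Rightarrow> 'b::real_normed_vector) \<Rightarrow> real \<Rightarrow> 'b" where
  "jump f t = f t - left_lim f t"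

definition disc_qv :: "(real \<Rightarrow> real^'d) \<Rightarrow> real \<Rightarrow> real^'d^'d" where
  "disc_qv f t = (\<Sum>\<^sub>\<infinity>s\<in>{0..t}. outer (jump f s) (jump f s))"

text \<open>Lebesgue-Stieltjes integral over \<open>(0,t]\<close> against a right-continuous integrator \<open>g\<close> of
  bounded variation, written as a difference of increasing functions; the value
  does not depend on the decomposition.\<close>

definition has_LS_integral :: "(real \<Rightarrow> real) \<Rightarrow> (real \<Rightarrow> real) \<Rightarrow> real \<Rightarrow> real \<Rightarrow> bool" where
  "has_LS_integral h g t I \<longleftrightarrow>
     (\<exists>p n. mono p \<and> mono n \<and> (\<forall>s. continuous (at_right s) p) \<and> (\<forall>s. continuous (at_right s) n) \<and>
        (\<forall>s\<in>{0..t}. g s = p s - n s) \<and>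
        set_integrable (interval_measure p) {0<..t} h \<and>
        set_integrable (interval_measure n) {0<..t} h \<and>
        I = (LINT s:{0<..t}|interval_measure p. h s) - (LINT s:{0<..t}|interval_measure n. h s))"

text \<open>The matrix integral of \<open>X\<^sub>s dG\<^sub>s Z\<^sub>s\<close> over \<open>(0,t]\<close> has \<open>(i, j)\<close> entry
  \<open>\<Sum>k l. \<integral> X $ i $ k * Z $ l $ j dG $ k $ l\<close>.\<close>

definition has_matrix_LS_integral ::
  "(real \<Rightarrow> real^'k^'m) \<Rightarrow> (real \<Rightarrow> real^'l^'k) \<Rightarrow> (real \<Rightarrow> real^'n^'l) \<Rightarrow> real \<Rightarrow> real^'n^'m \<Rightarrow> bool" where
  "has_matrix_LS_integral X G Z t J \<longleftrightarrow>
     (\<exists>I. (\<forall>i j k l. has_LS_integral (\<lambda>s. X s $ i $ k * Z s $ l $ j) (\<lambda>s. G s $ k $ l) t (I i j k l)) \<and>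
          J = (\<chi> i j. \<Sum>k\<in>UNIV. \<Sum>l\<in>UNIV. I i j k l))"

subsection \<open>Processes\<close>

text \<open>Only the values \<open>F t\<close> with \<open>t \<ge> 0\<close> matter.\<close>

locale usual_filtered_space =
  prob_space M + complete_measure M + filtration "space M" "\<lambda>t. F (max 0 t)"
  for M :: "'a measure" and F :: "real \<Rightarrow> 'a measure" +
  assumes sets_F_subset: "\<And>t. 0 \<le> t \<Longrightarrow> sets (F t) \<subseteq> sets M"
    and null_sets_F: "null_sets M \<subseteq> sets (F 0)"
    and right_continuous_F: "\<And>t. 0 \<le> t \<Longrightarrow> sets (F t) = (\<Inter>s\<in>{t<..}. sets (F s))"

definition adapted :: "(real \<Rightarrow> 'a measure) \<Rightarrow> (real \<Rightarrow> 'a \<Rightarrow> 'b::topological_space) \<Rightarrow> bool" where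
  "adapted F X \<longleftrightarrow> (\<forall>t\<ge>0. X t \<in> borel_measurable (F t))"

text \<open>Stochastic continuity is not listed: it follows from right-continuity at 0 and
  stationarity of the increments.\<close>

definition levy_process ::
  "'a measure \<Rightarrow> (real \<Rightarrow> 'a measure) \<Rightarrow> (real \<Rightarrow> 'a \<Rightarrow> real^'d) \<Rightarrow> bool" where
  "levy_process M F L \<longleftrightarrow>
     adapted F L \<and>
     (AE \<omega> in M. L 0 \<omega> = 0) \<and>
     (AE \<omega> in M. cadlag (\<lambda>t. L t \<omega>)) \<and>
     (\<forall>s t. 0 \<le> s \<and> s \<le> t \<longrightarrow>
        prob_space.indep_set M (sets (F s))
          (sets (vimage_algebra (space M) (\<lambda>\<omega>. L t \<omega> - L s \<omega>) borel)) \<and>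
        distr M borel (\<lambda>\<omega>. L t \<omega> - L s \<omega>) = distr M borel (L (t - s)))"

text \<open>The Levy measure: the expected number of (nonzero) jumps of given size per unit time.\<close>

definition is_levy_measure ::
  "'a measure \<Rightarrow> (real \<Rightarrow> 'a \<Rightarrow> real^'d) \<Rightarrow> (real^'d) measure \<Rightarrow> bool" where
  "is_levy_measure M L \<nu> \<longleftrightarrow>
     sets \<nu> = sets borel \<and>
     (\<forall>S\<in>sets borel. emeasure \<nu> S =
        (\<integral>\<^sup>+\<omega>. emeasure (count_space UNIV)
            {s\<in>{0<..1}. jump (\<lambda>r. L r \<omega>) s \<in> S - {0}} \<partial>M))"

text \<open>Solution of the integrated equation, the stochastic integral being pathwise since
  \<open>disc_qv\<close> has paths of finite variation. The drift integrand is bounded and has countably many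
  discontinuities on \<open>{0..t}\<close>, so \<open>integral\<close> is a genuine integral there.\<close>

definition mucogarch_volatility ::
  "'a measure \<Rightarrow> (real \<Rightarrow> 'a measure) \<Rightarrow> (real \<Rightarrow> 'a \<Rightarrow> real^'d) \<Rightarrow>
   real^'d^'d \<Rightarrow> real^'d^'d \<Rightarrow> real^'d^'d \<Rightarrow> (real \<Rightarrow> 'a \<Rightarrow> real^'d^'d) \<Rightarrow> bool" where
  "mucogarch_volatility M F L A B C Y \<longleftrightarrow>
     adapted F Y \<and>
     (AE \<omega> in M. cadlag (\<lambda>t. Y t \<omega>)) \<and>
     (AE \<omega> in M. \<forall>t\<ge>0. psd (Y t \<omega>)) \<and>
     (AE \<omega> in M. \<forall>t\<ge>0.
        let Yl = left_lim (\<lambda>r. Y r \<omega>) in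
        \<exists>J. has_matrix_LS_integral (\<lambda>s. A ** psd_sqrt (C + Yl s)) (disc_qv (\<lambda>r. L r \<omega>))
              (\<lambda>s. psd_sqrt (C + Yl s) ** transpose A) t J \<and>
            Y t \<omega> = Y 0 \<omega> + integral {0..t} (\<lambda>s. B ** Yl s + Yl s ** transpose B) + J)"

definition cov_mat :: "'a measure \<Rightarrow> ('a \<Rightarrow> real^'m) \<Rightarrow> ('a \<Rightarrow> real^'n) \<Rightarrow> real^'n^'m" where
  "cov_mat M X Z = (\<integral>\<omega>. outer (X \<omega> - (\<integral>\<omega>'. X \<omega>' \<partial>M)) (Z \<omega> - (\<integral>\<omega>'. Z \<omega>' \<partial>M)) \<partial>M)"

definition second_order_stationary :: "'a measure \<Rightarrow> (real \<Rightarrow> 'a \<Rightarrow> real^'d^'d) \<Rightarrow> bool" where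
  "second_order_stationary M Y \<longleftrightarrow>
     (\<forall>t\<ge>0. Y t \<in> borel_measurable M \<and> integrable M (\<lambda>\<omega>. (norm (Y t \<omega>))\<^sup>2)) \<and>
     (\<forall>t\<ge>0. (\<integral>\<omega>. Y t \<omega> \<partial>M) = (\<integral>\<omega>. Y 0 \<omega> \<partial>M)) \<and>
     (\<forall>t\<ge>0. \<forall>h\<ge>0. cov_mat M (\<lambda>\<omega>. vec_mat (Y (t + h) \<omega>)) (\<lambda>\<omega>. vec_mat (Y t \<omega>))
                  = cov_mat M (\<lambda>\<omega>. vec_mat (Y h \<omega>)) (\<lambda>\<omega>. vec_mat (Y 0 \<omega>)))"

text \<open>\<open>EY\<close> is the expectation of \<open>vec Y\<close>, \<open>EYY\<close> that of \<open>vec Y (vec Y)\<^sup>*\<close>.\<close>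

definition EY :: "'a measure \<Rightarrow> ('a \<Rightarrow> real^'d^'d) \<Rightarrow> real^('d::finite \<times> 'd)" where
  "EY M X = (\<integral>\<omega>. vec_mat (X \<omega>) \<partial>M)"

definition EYY :: "'a measure \<Rightarrow> ('a \<Rightarrow> real^'d^'d) \<Rightarrow> real^('d::finite \<times> 'd)^('d \<times> 'd)" where
  "EYY M X = (\<integral>\<omega>. outer (vec_mat (X \<omega>)) (vec_mat (X \<omega>)) \<partial>M)"

end

theory Submission
  imports Defs
begin

text \<open>
  Let \<open>J\<close> be the sum of \<open>g (\<Delta>L)\<close> over the jump times in \<open>(a, b]\<close>. It is the limit of the sums of
  \<open>g\<close> over the increments of \<open>L\<close> along a grid, so Laplace transforms carry the independence and
  stationarity of the increments over to \<open>J\<close>, first when \<open>g\<close> vanishes near 0. Hence \<open>E J = (b - a) \<integral> g d\<nu>\<close>, and,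
  approximating on grids again, the sum of \<open>G\<^sub>s g (\<Delta>L\<^sub>s)\<close> over the jump times \<open>s \<le> t\<close> has expectation
  \<open>\<integral>\<^sub>0\<^sup>t E G\<^sub>s ds \<integral> g d\<nu>\<close> for every left-continuous adapted \<open>G\<close>, with the necessary integrability.

  Put \<open>V = C + Y\<^sub>s\<^sub>-\<close>. The jump of \<open>vec Y\<close> at \<open>s\<close> is \<open>(A V\<^sup>1\<^sup>/\<^sup>2 \<otimes> A V\<^sup>1\<^sup>/\<^sup>2) vec (\<Delta>L\<^sub>s \<Delta>L\<^sub>s\<^sup>*)\<close>. The product formula for paths of
  finite variation, applied to the entries of \<open>vec Y\<close>, turns each entry of \<open>vec Y (vec Y)\<^sup>*\<close> into a time
  integral plus a jump sum of this kind. Truncation and Gronwall's inequality give second moments that are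
  bounded on compact intervals, so expectations may be taken. The assumptions on \<open>\<nu>\<close> evaluate the
  integrals over the jumps, and
  \<open>(V\<^sup>1\<^sup>/\<^sup>2 \<otimes> V\<^sup>1\<^sup>/\<^sup>2) (I + K\<^sub>d + vec I (vec I)\<^sup>*) (V\<^sup>1\<^sup>/\<^sup>2 \<otimes> V\<^sup>1\<^sup>/\<^sup>2) = V \<otimes> V + K\<^sub>d (V \<otimes> V) + vec V (vec V)\<^sup>*\<close>
  with \<open>V \<otimes> V = \<^bold>Q (vec V (vec V)\<^sup>*)\<close> makes the result affine in the first two moments. Under
  stationarity the derivative vanishes.
\<close>

subsection \<open>Cadlag paths\<close>

text \<open>Laplace transforms enter because jump sums are unbounded: pathwise convergence of grid
  sums alone says nothing about expectations, while \<open>exp (- J)\<close> stays between 0 and 1.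
  The expectation returns as the limit of \<open>k (1 - exp (- J / k))\<close>, which lies below
  \<open>J\<close>, so infinite values need no separate treatment. Weights vanishing near 0 come
  first since only finitely many jumps on a compact interval exceed a given size.

  Left-continuity stands in for predictability: the value at the left end of a grid cell is known
  before the jumps in that cell, and it converges to the value at the jump time. The integrands
  contain square roots, so the root must be continuous on the positive definite cone.

  The rates involve left limits of \<open>Y\<close>, the theorem \<open>Y\<close> itself; almost
  surely \<open>L\<close> does not jump at a fixed time, so expectations agree. Gronwall's
  inequality needs finite quantities to start from, hence the truncation, whose indicator decreases
  in time and can be inserted under the integrals. Continuity of the moments is a by-product of
  their integral equations.\<close>

lemma cadlag_tendsto_right: "cadlag f \<Longrightarrow> 0 \<le> t \<Longrightarrow> (f \<longlongrightarrow> f t) (at_right t)"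
  by (auto simp: cadlag_def continuous_within)

lemma cadlag_tendsto_left:
  assumes "cadlag f" "0 < t"
  shows "(f \<longlongrightarrow> left_lim f t) (at_left t)"
proof -
  obtain l where l: "(f \<longlongrightarrow> l) (at_left t)"
    using assms by (auto simp: cadlag_def)
  then have "Lim (at_left t) f = l"
    by (intro tendsto_Lim) auto
  then show ?thesis using l assms by (simp add: left_lim_def)
qed

lemma left_lim_eqI: "0 < t \<Longrightarrow> (f \<longlongrightarrow> l) (at_left t) \<Longrightarrow> left_lim f t = l"
  by (auto simp: left_lim_def intro!: tendsto_Lim)

lemma eventually_at_left_pos: "0 < (t::real) \<Longrightarrow> \<forall>\<^sub>F s in at_left t. 0 < s"
  using eventually_at_left_real[of 0 t] by (auto elim: eventually_mono)

text \<open>Meant for the closed psd cone: left limits of \<open>Y\<close> remain in it, so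
  \<open>psd_sqrt (C + Yl s)\<close> is a genuine root at every time.\<close>

lemma left_lim_in_closed:
  assumes "cadlag f" "0 \<le> t" "closed S" "\<And>s. 0 \<le> s \<Longrightarrow> f s \<in> S"
  shows "left_lim f t \<in> S"
proof (cases "t = 0")
  case True
  then show ?thesis using assms by (simp add: left_lim_def)
next
  case False
  then have t: "0 < t" using assms by simp
  have "\<forall>\<^sub>F s in at_left t. f s \<in> S"
    using eventually_at_left_pos[OF t] by eventually_elim (use assms in auto)
  then show ?thesis
    using Lim_in_closed_set[OF \<open>closed S\<close> _ _ cadlag_tendsto_left[OF assms(1) t]] by auto
qed

text \<open>A left limit at \<open>s\<close> just below \<open>t\<close> is a limit of values taken
  in the same small left neighbourhood of \<open>t\<close>, so it stays in the closed ball of radius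
  \<open>e/2\<close>. This makes \<open>Yl\<close> a left-continuous process.\<close>

lemma left_lim_tendsto_left:
  fixes f :: "real \<Rightarrow> 'b::metric_space"
  assumes "cadlag f" "0 < t"
  shows "(left_lim f \<longlongrightarrow> left_lim f t) (at_left t)"
proof (rule tendstoI)
  fix e :: real assume "0 < e"
  then have "\<forall>\<^sub>F s in at_left t. dist (f s) (left_lim f t) < e/2"
    by (intro tendstoD[OF cadlag_tendsto_left[OF assms]]) auto
  then obtain b where b: "b < t" "\<And>s. b < s \<Longrightarrow> s < t \<Longrightarrow> dist (f s) (left_lim f t) < e/2"
    unfolding eventually_at_left_field by auto
  have "\<forall>\<^sub>F s in at_left t. s \<in> {max b 0<..<t}"
    using b assms by (intro eventually_at_left_real) auto
  then show "\<forall>\<^sub>F s in at_left t. dist (left_lim f s) (left_lim f t) < e"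
  proof eventually_elim
    case (elim s)
    then have s: "0 < s" "b < s" "s < t" by auto
    have "\<forall>\<^sub>F r in at_left s. f r \<in> cball (left_lim f t) (e/2)"
      using eventually_at_left_real[OF \<open>b < s\<close>]
      by eventually_elim (use b(2) s in \<open>auto simp: dist_commute intro!: less_imp_le\<close>)
    then have "left_lim f s \<in> cball (left_lim f t) (e/2)"
      by (intro Lim_in_closed_set[OF closed_cball _ _ cadlag_tendsto_left[OF assms(1) s(1)]]) auto
    then show ?case using \<open>0 < e\<close> by (auto simp: dist_commute)
  qed
qed

section \<open>Oscillation of cadlag paths on compact intervals\<close>

lemma cadlag_locally_small:
  fixes f :: "real \<Rightarrow> 'b::metric_space"
  assumes f: "cadlag f" and t: "0 \<le> t" and e: "0 < e"
  shows "\<exists>d>0. (\<forall>a b. t \<le> a \<and> t \<le> b \<and> a < t + d \<and> b < t + d \<longrightarrow> dist (f a) (f b) < e) \<and>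
               (\<forall>a b. t - d < a \<and> t - d < b \<and> 0 \<le> a \<and> 0 \<le> b \<and> a < t \<and> b < t \<longrightarrow> dist (f a) (f b) < e)"
proof -
  have "\<forall>\<^sub>F s in at_right t. dist (f s) (f t) < e/2"
    using e by (intro tendstoD[OF cadlag_tendsto_right[OF f t]]) auto
  then obtain b where b: "b > t" "\<And>s. t < s \<Longrightarrow> s < b \<Longrightarrow> dist (f s) (f t) < e/2"
    unfolding eventually_at_right_field by auto
  have b': "dist (f s) (f t) < e/2" if "t \<le> s" "s < b" for s
    using b that e by (cases "s = t") auto
  \<comment> \<open>At \<open>t = 0\<close> the left half is vacuous: no point is nonnegative and
    below 0, so any negative \<open>c\<close> serves.\<close>
  obtain c where c: "c < t" "\<And>s l. c < s \<Longrightarrow> s < t \<Longrightarrow> 0 \<le> s \<Longrightarrow> dist (f s) (left_lim f t) < e/2"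
  proof (cases "t = 0")
    case True
    then show ?thesis using that[of "-1"] by auto
  next
    case False
    then have "\<forall>\<^sub>F s in at_left t. dist (f s) (left_lim f t) < e/2"
      using t e by (intro tendstoD[OF cadlag_tendsto_left[OF f]]) auto
    then show ?thesis using that unfolding eventually_at_left_field by auto
  qed
  define m where "m = min (b - t) (t - c)"
  have m: "0 < m" "m \<le> b - t" "m \<le> t - c" using b c by (auto simp: m_def)
  show ?thesis
  proof (intro exI[of _ m] conjI allI impI)
    show "0 < m" by (rule m(1))
  next
    fix x y assume "t \<le> x \<and> t \<le> y \<and> x < t + m \<and> y < t + m"
    then show "dist (f x) (f y) < e"
      by (intro dist_triangle_half_l[of "f x" "f t" e "f y"] b') (use m in linarith)+
  next
    fix x y assume "t - m < x \<and> t - m < y \<and> 0 \<le> x \<and> 0 \<le> y \<and> x < t \<and> y < t"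
    then show "dist (f x) (f y) < e"
      by (intro dist_triangle_half_l[of "f x" "left_lim f t" e "f y"] c(2)) (use m in linarith)+
  qed
qed

text \<open>The two one-sided neighbourhoods are kept apart because \<open>f\<close> may jump at
  \<open>t\<close> itself. One radius per point is the input of the compactness arguments that
  follow.\<close>

lemma cadlag_small_gauge:
  fixes f :: "real \<Rightarrow> 'b::metric_space"
  assumes f: "cadlag f" and e: "0 < e"
  obtains d where "\<And>t. 0 \<le> t \<Longrightarrow> 0 < d t"
    "\<And>t a b. \<lbrakk>0 \<le> t; t \<le> a; t \<le> b; a < t + d t; b < t + d t\<rbrakk> \<Longrightarrow> dist (f a) (f b) < e"
    "\<And>t a b. \<lbrakk>0 \<le> t; t - d t < a; t - d t < b; 0 \<le> a; 0 \<le> b; a < t; b < t\<rbrakk> \<Longrightarrow> dist (f a) (f b) < e"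
proof -
  let ?P = "\<lambda>t d. 0 < d \<and> (\<forall>a b. t \<le> a \<and> t \<le> b \<and> a < t + d \<and> b < t + d \<longrightarrow> dist (f a) (f b) < e) \<and>
               (\<forall>a b. t - d < a \<and> t - d < b \<and> 0 \<le> a \<and> 0 \<le> b \<and> a < t \<and> b < t \<longrightarrow> dist (f a) (f b) < e)"
  define d where "d t = (SOME d. ?P t d)" for t
  have d: "?P t (d t)" if "0 \<le> t" for t
    unfolding d_def by (rule someI_ex[OF cadlag_locally_small[OF f that e]])
  show thesis
  proof (rule that[of d])
    fix t a b assume *: "0 \<le> t" "t \<le> a" "t \<le> b" "a < t + d t" "b < t + d t"
    show "dist (f a) (f b) < e" using d[OF *(1)] *(2-) by simp
  next
    fix t a b assume *: "0 \<le> t" "t - d t < a" "t - d t < b" "0 \<le> a" "0 \<le> b" "a < t" "b < t"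
    show "dist (f a) (f b) < e" using d[OF *(1)] *(2-) by simp
  qed (use d in simp)
qed

text \<open>\<open>D\<close> consists of the centres of a finite subcover by gauge balls. A short
  interval lies inside one of these balls, and unless it straddles the centre, the path oscillates
  on it by less than \<open>e\<close>.\<close>

lemma cadlag_big_increments:
  fixes f :: "real \<Rightarrow> 'b::metric_space"
  assumes f: "cadlag f" and e: "0 < e"
  shows "\<exists>D d. finite D \<and> D \<subseteq> {0..T} \<and> 0 < d \<and>
    (\<forall>a b. 0 \<le> a \<and> a < b \<and> b \<le> T \<and> b - a < d \<and> e \<le> dist (f a) (f b) \<longrightarrow> (\<exists>u\<in>D. a < u \<and> u \<le> b))"
proof (rule cadlag_small_gauge[OF f e])
  fix d assume d: "\<And>t. 0 \<le> t \<Longrightarrow> 0 < d t"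
    "\<And>t a b. \<lbrakk>0 \<le> t; t \<le> a; t \<le> b; a < t + d t; b < t + d t\<rbrakk> \<Longrightarrow> dist (f a) (f b) < e"
    "\<And>t a b. \<lbrakk>0 \<le> t; t - d t < a; t - d t < b; 0 \<le> a; 0 \<le> b; a < t; b < t\<rbrakk> \<Longrightarrow> dist (f a) (f b) < e"
  have "{0..T} \<subseteq> (\<Union>t\<in>{0..T}. ball t (d t))"
  proof
    fix x assume "x \<in> {0..T}"
    then show "x \<in> (\<Union>t\<in>{0..T}. ball t (d t))" using d(1)[of x] by (intro UN_I[of x]) auto
  qed
  then obtain D where D: "D \<subseteq> {0..T}" "finite D" "{0..T} \<subseteq> (\<Union>t\<in>D. ball t (d t))"
    by (rule compactE_image[OF compact_Icc[of 0 T] open_ball])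
  \<comment> \<open>\<open>r\<close> is a Lebesgue number of the finite cover.\<close>
  obtain r where r: "0 < r" "\<And>x. x \<in> {0..T} \<Longrightarrow> \<exists>G\<in>(\<lambda>t. ball t (d t)) ` D. ball x r \<subseteq> G"
    by (rule Heine_Borel_lemma[OF compact_Icc[of 0 T] D(3)]) auto
  show ?thesis
  proof (intro exI[of _ D] exI[of _ r] conjI allI impI)
    fix a b assume ab: "0 \<le> a \<and> a < b \<and> b \<le> T \<and> b - a < r \<and> e \<le> dist (f a) (f b)"
    then obtain u where u: "u \<in> D" "ball a r \<subseteq> ball u (d u)"
      using r(2)[of a] by auto
    have "a \<in> ball u (d u)" "b \<in> ball u (d u)"
      using u(2) ab r(1) by (auto simp: dist_real_def subset_eq)
    then have *: "\<bar>u - a\<bar> < d u" "\<bar>u - b\<bar> < d u" by (auto simp: dist_real_def)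
    have "0 \<le> u" using u D by auto
    \<comment> \<open>Otherwise both end points lie on the same side of the centre, the centre
      itself counting as right, and the increment would be small.\<close>
    have "a < u \<and> u \<le> b"
    proof (rule ccontr)
      assume "\<not> (a < u \<and> u \<le> b)"
      then consider "u \<le> a" | "b < u" using ab by linarith
      then have "dist (f a) (f b) < e"
      proof cases
        case 1
        show ?thesis by (rule d(2)[OF \<open>0 \<le> u\<close>]) (use 1 ab * in auto)
      next
        case 2
        show ?thesis by (rule d(3)[OF \<open>0 \<le> u\<close>]) (use 2 ab * in auto)
      qed
      then show False using ab by auto
    qed
    then show "\<exists>u\<in>D. a < u \<and> u \<le> b" using u by auto
  qed (use D r in auto)
qed

text \<open>A finite subcover suffices: on either side of a centre the path oscillates by less than
  1 within the gauge ball.\<close>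

lemma cadlag_bounded:
  fixes f :: "real \<Rightarrow> 'b::metric_space"
  assumes f: "cadlag f"
  shows "bounded (f ` {0..T})"
proof (rule cadlag_small_gauge[OF f zero_less_one])
  fix d assume d: "\<And>t. 0 \<le> t \<Longrightarrow> 0 < d t"
    "\<And>t a b. \<lbrakk>0 \<le> t; t \<le> a; t \<le> b; a < t + d t; b < t + d t\<rbrakk> \<Longrightarrow> dist (f a) (f b) < 1"
    "\<And>t a b. \<lbrakk>0 \<le> t; t - d t < a; t - d t < b; 0 \<le> a; 0 \<le> b; a < t; b < t\<rbrakk> \<Longrightarrow> dist (f a) (f b) < 1"
  have b: "bounded (f ` ({0..} \<inter> ball t (d t)))" if "0 \<le> t" for t
  proof -
    have 1: "bounded (f ` {t..<t + d t})"
      using d(2)[OF that, of t] d(1)[OF that]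
      by (auto simp: bounded_any_center[where a="f t"] intro!: exI[of _ 1] less_imp_le)
    have 2: "bounded (f ` ({0..} \<inter> {t - d t<..<t}))"
    proof (cases "{0..} \<inter> {t - d t<..<t} = {}")
      case False
      then obtain c where "c \<in> {0..} \<inter> {t - d t<..<t}" by blast
      then show ?thesis
        using d(3)[OF that, of c] by (auto simp: bounded_any_center[where a="f c"] intro!: exI[of _ 1] less_imp_le)
    qed (simp only: image_empty bounded_empty)
    have "f ` ({0..} \<inter> ball t (d t)) \<subseteq> f ` {t..<t + d t} \<union> f ` ({0..} \<inter> {t - d t<..<t})"
      by (rule order.trans[OF image_mono[of _ "{t..<t + d t} \<union> ({0..} \<inter> {t - d t<..<t})"]])
         (auto simp: dist_real_def)
    then show ?thesis using 1 2 by (meson bounded_subset bounded_Un)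
  qed
  have "{0..T} \<subseteq> (\<Union>t\<in>{0..T}. ball t (d t))"
  proof
    fix x assume "x \<in> {0..T}"
    then show "x \<in> (\<Union>t\<in>{0..T}. ball t (d t))" using d(1)[of x] by (intro UN_I[of x]) auto
  qed
  then obtain D where D: "D \<subseteq> {0..T}" "finite D" "{0..T} \<subseteq> (\<Union>t\<in>D. ball t (d t))"
    by (rule compactE_image[OF compact_Icc[of 0 T] open_ball])
  have "bounded (\<Union>t\<in>D. f ` ({0..} \<inter> ball t (d t)))"
    using D b by (intro bounded_UN) auto
  moreover have "f ` {0..T} \<subseteq> (\<Union>t\<in>D. f ` ({0..} \<inter> ball t (d t)))"
  proof
    fix y assume "y \<in> f ` {0..T}"
    then obtain x where x: "x \<in> {0..T}" "y = f x" by blast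
    obtain t where "t \<in> D" "x \<in> ball t (d t)" using x D(3) by blast
    then show "y \<in> (\<Union>t\<in>D. f ` ({0..} \<inter> ball t (d t)))" using x by (intro UN_I[of t] image_eqI[of _ _ x]) auto
  qed
  ultimately show ?thesis by (rule bounded_subset)
qed

lemma cadlag_norm_bound:
  fixes f :: "real \<Rightarrow> 'b::real_normed_vector"
  assumes "cadlag f"
  shows "\<exists>K. \<forall>t\<in>{0..T}. norm (f t) \<le> K \<and> norm (left_lim f t) \<le> K"
proof -
  obtain K where K: "\<And>t. t \<in> {0..T} \<Longrightarrow> norm (f t) \<le> K"
    using cadlag_bounded[OF assms, of T] unfolding bounded_iff by blast
  have "norm (left_lim f t) \<le> K" if t: "t \<in> {0..T}" for t
  proof (cases "t = 0")
    case False
    with t have "0 < t" by auto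
    have "\<forall>\<^sub>F s in at_left t. f s \<in> cball 0 K"
      using eventually_at_left_real[OF \<open>0 < t\<close>]
      by eventually_elim (use t in \<open>auto intro!: K\<close>)
    then have "left_lim f t \<in> cball 0 K"
      by (intro Lim_in_closed_set[OF closed_cball _ _ cadlag_tendsto_left[OF assms \<open>0 < t\<close>]]) auto
    then show ?thesis by auto
  qed (use K t in \<open>auto simp: left_lim_def\<close>)
  then show ?thesis using K by blast
qed

lemma jump_tendsto:
  fixes f :: "real \<Rightarrow> 'b::real_normed_vector"
  assumes "cadlag f" "0 < t"
  shows "((\<lambda>s. f t - f s) \<longlongrightarrow> jump f t) (at_left t)"
  unfolding jump_def by (intro tendsto_intros cadlag_tendsto_left assms)

lemma finite_gap_left:
  assumes "finite (D :: real set)"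
  shows "\<forall>\<^sub>F a in at_left u. D \<inter> {a<..<u} = {}"
proof -
  have "\<forall>\<^sub>F a in at_left u. \<forall>v\<in>D. \<not> (a < v \<and> v < u)"
  proof (intro eventually_ball_finite[OF assms] ballI)
    fix v
    show "\<forall>\<^sub>F a in at_left u. \<not> (a < v \<and> v < u)"
    proof (cases "v < u")
      case True
      show ?thesis by (rule eventually_mono[OF eventually_at_left_real[OF True]]) auto
    qed auto
  qed
  then show ?thesis by eventually_elim auto
qed

text \<open>A large jump at \<open>u\<close> shows up as a large increment over
  \<open>(s, u]\<close> for all \<open>s\<close> close to \<open>u\<close>. Such an interval meets
  the finite set \<open>D\<close> of \<open>cadlag_big_increments\<close>, and near \<open>u\<close>
  only in \<open>u\<close>.\<close>

lemma cadlag_finite_jumps: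
  fixes f :: "real \<Rightarrow> 'b::real_normed_vector"
  assumes f: "cadlag f" and e: "0 < e"
  shows "finite {u\<in>{0..T}. e < norm (jump f u)}"
proof -
  obtain D d where D: "finite D" "D \<subseteq> {0..T}" "0 < d"
    "\<And>a b. 0 \<le> a \<and> a < b \<and> b \<le> T \<and> b - a < d \<and> e \<le> dist (f a) (f b) \<Longrightarrow> (\<exists>u\<in>D. a < u \<and> u \<le> b)"
    using cadlag_big_increments[OF f e, of T] by auto
  have "u \<in> D" if u: "u \<in> {0..T}" "e < norm (jump f u)" for u
  proof -
    have "u \<noteq> 0" using u e by (auto simp: jump_def left_lim_def)
    then have "0 < u" using u by auto
    have 1: "\<forall>\<^sub>F s in at_left u. e < norm (f u - f s)"
      using order_tendstoD(1)[OF tendsto_norm[OF jump_tendsto[OF f \<open>0 < u\<close>]] u(2)] .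
    have 2: "\<forall>\<^sub>F s in at_left u. s \<in> {max 0 (u - d)<..<u}"
      using \<open>0 < u\<close> D by (intro eventually_at_left_real) auto
    have "\<forall>\<^sub>F s in at_left u. u \<in> D"
      using 1 2 finite_gap_left[OF D(1), of u]
    proof eventually_elim
      case (elim s)
      then obtain v where "v \<in> D" "s < v" "v \<le> u"
        using D(4)[of s u] u by (auto simp: dist_norm norm_minus_commute)
      then show ?case using elim(3) by (cases "v = u") auto
    qed
    then show ?thesis by auto
  qed
  then show ?thesis by (intro finite_subset[OF _ D(1)]) auto
qed

section \<open>Uniform grids and sums over increments\<close>

definition grid :: "real \<Rightarrow> real \<Rightarrow> nat \<Rightarrow> nat \<Rightarrow> real" where
  "grid a b n i = a + (b - a) * i / n"

text \<open>Cells are open on the left and closed on the right, hence the ceiling minus one instead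
  of the floor.\<close>

definition grid_index :: "real \<Rightarrow> real \<Rightarrow> nat \<Rightarrow> real \<Rightarrow> nat" where
  "grid_index a b n u = nat (\<lceil>n * (u - a) / (b - a)\<rceil> - 1)"

lemma grid_index:
  assumes "a < u" "u \<le> b" "0 < n"
  shows "grid_index a b n u < n" "grid a b n (grid_index a b n u) < u" "u \<le> grid a b n (Suc (grid_index a b n u))"
proof -
  define x where "x = n * (u - a) / (b - a)"
  have x: "0 < x" "x \<le> n"
    using assms by (auto simp: x_def field_simps)
  have c: "1 \<le> \<lceil>x\<rceil>" "\<lceil>x\<rceil> \<le> n" using x by linarith+
  have k: "real (grid_index a b n u) = of_int \<lceil>x\<rceil> - 1"
    using c by (simp add: grid_index_def x_def[symmetric])
  show "grid_index a b n u < n" using c k by linarith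
  have u: "u = a + (b - a) * x / n" using assms by (simp add: x_def)
  have "real (grid_index a b n u) < x" "x \<le> real (Suc (grid_index a b n u))" using k by linarith+
  then show "grid a b n (grid_index a b n u) < u" "u \<le> grid a b n (Suc (grid_index a b n u))"
    using assms unfolding grid_def u
    by (auto intro!: divide_strict_right_mono divide_right_mono mult_left_mono mult_strict_left_mono simp del: of_nat_Suc)
qed

lemma grid_step: "0 < n \<Longrightarrow> grid a b n (Suc i) = grid a b n i + (b - a) / n"
  by (simp add: grid_def field_simps)

lemma grid_0 [simp]: "grid a b n 0 = a" by (simp add: grid_def)
lemma grid_n: "0 < n \<Longrightarrow> grid a b n n = b" by (simp add: grid_def)

lemma grid_mono: "a \<le> b \<Longrightarrow> i \<le> j \<Longrightarrow> grid a b n i \<le> grid a b n j"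
  by (auto simp: grid_def intro!: divide_right_mono mult_left_mono)

lemma grid_le: "a \<le> b \<Longrightarrow> i \<le> n \<Longrightarrow> grid a b n i \<le> b"
  using grid_mono[of a b i n n] grid_n[of n a b] by (cases "n = 0") (auto simp: grid_def)

lemma grid_ge: "a \<le> b \<Longrightarrow> a \<le> grid a b n i"
  using grid_mono[of a b 0 i n] by simp

lemma grid_index_unique:
  assumes "a < b" "grid a b n i < u" "u \<le> grid a b n (Suc i)" "0 < n"
  shows "i = grid_index a b n u"
proof -
  define x where "x = n * (u - a) / (b - a)"
  have u: "u = a + (b - a) * x / n" using assms by (simp add: x_def)
  have "(b - a) * i / n < (b - a) * x / n" "(b - a) * x / n \<le> (b - a) * Suc i / n"
    using assms(2,3) unfolding grid_def u by auto
  then have "real i < x" "x \<le> real (Suc i)"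
    using assms(1,4) by (auto simp: divide_less_cancel divide_le_cancel simp del: of_nat_Suc)
  then have "\<lceil>x\<rceil> = int (Suc i)" by (intro ceiling_unique) auto
  then show ?thesis by (simp add: grid_index_def x_def[symmetric])
qed

lemma inv_n_tendsto: "(\<lambda>n. c / real n) \<longlonglongrightarrow> 0"
  by (rule tendsto_divide_0[OF tendsto_const filterlim_at_top_imp_at_infinity[OF filterlim_real_sequentially]])

text \<open>The left end of the cell of \<open>u\<close> is strictly below \<open>u\<close>, so it
  converges along \<open>at_left u\<close> and picks up left limits.\<close>

lemma grid_tendsto_at_left:
  assumes "a < u" "u \<le> b"
  shows "filterlim (\<lambda>n. grid a b n (grid_index a b n u)) (at_left u) sequentially"
proof -
  have *: "\<forall>\<^sub>F n in sequentially. grid a b n (grid_index a b n u) < u \<and> u - (b - a) / n \<le> grid a b n (grid_index a b n u)"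
    using eventually_gt_at_top[of 0]
  proof eventually_elim
    case (elim n)
    then show ?case using grid_index[OF assms elim] grid_step[OF elim, of a b "grid_index a b n u"] by auto
  qed
  have lim: "(\<lambda>n. u - (b - a) / real n) \<longlonglongrightarrow> u - 0"
    by (rule tendsto_diff[OF tendsto_const inv_n_tendsto])
  have ge: "\<forall>\<^sub>F n in sequentially. u - (b - a) / real n \<le> grid a b n (grid_index a b n u)"
    using * by eventually_elim simp
  have lt: "\<forall>\<^sub>F n in sequentially. grid a b n (grid_index a b n u) < u"
    using * by eventually_elim simp
  then have le: "\<forall>\<^sub>F n in sequentially. grid a b n (grid_index a b n u) \<le> u"
    by eventually_elim simp
  have "(\<lambda>n. grid a b n (grid_index a b n u)) \<longlonglongrightarrow> u"
    by (rule tendsto_sandwich[OF ge le lim[unfolded diff_0_right] tendsto_const])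
  moreover have "\<forall>\<^sub>F n in sequentially. grid a b n (grid_index a b n u) \<in> {..<u} \<and> grid a b n (grid_index a b n u) \<noteq> u"
    using lt by eventually_elim simp
  ultimately show ?thesis
    unfolding filterlim_at by (rule conjI[rotated])
qed

lemma gridr_tendsto:
  assumes "a < u" "u \<le> b"
  shows "(\<lambda>n. grid a b n (Suc (grid_index a b n u))) \<longlonglongrightarrow> u"
proof -
  have "(\<lambda>n. grid a b n (grid_index a b n u)) \<longlonglongrightarrow> u"
    using grid_tendsto_at_left[OF assms] unfolding filterlim_at by (rule conjunct2)
  then have "(\<lambda>n. grid a b n (grid_index a b n u) + (b - a) / n) \<longlonglongrightarrow> u + 0"
    by (rule tendsto_add[OF _ inv_n_tendsto])
  moreover have "\<forall>\<^sub>F n in sequentially. grid a b n (grid_index a b n u) + (b - a) / n = grid a b n (Suc (grid_index a b n u))"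
    using eventually_gt_at_top[of 0] by eventually_elim (simp add: grid_step)
  ultimately show ?thesis using Lim_transform_eventually by fastforce
qed

text \<open>The cells partition \<open>{a<..b}\<close>, so exactly one summand survives. Stated over
  a semiring because it serves real step processes as well as sums in
  \<open>ennreal\<close>.\<close>

lemma sum_grid_indicator:
  fixes k :: "nat \<Rightarrow> 'b::semiring_1"
  assumes "a < b" "0 < n"
  shows "(\<Sum>i<n. k i * indicator {grid a b n i<..grid a b n (Suc i)} u)
    = k (grid_index a b n u) * indicator {a<..b} u"
proof (cases "u \<in> {a<..b}")
  case True
  note g = grid_index[of a u b n]
  have "indicator {grid a b n i<..grid a b n (Suc i)} u = (if i = grid_index a b n u then 1 else (0::'b))" for i
  proof (cases "i = grid_index a b n u")
    case True
    then show ?thesis using g \<open>u \<in> {a<..b}\<close> assms by (simp add: indicator_def)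
  next
    case False
    then have "\<not> (grid a b n i < u \<and> u \<le> grid a b n (Suc i))"
      using grid_index_unique[OF assms(1) _ _ assms(2), of i u] by blast
    then show ?thesis using False by (simp add: indicator_def)
  qed
  then have "(\<Sum>i<n. k i * indicator {grid a b n i<..grid a b n (Suc i)} u)
      = (\<Sum>i<n. if i = grid_index a b n u then k i else 0)"
    by (simp add: if_distrib[of "\<lambda>x. k _ * x"] cong: if_cong)
  then show ?thesis using True g assms by (simp add: sum.delta)
next
  case False
  have "indicator {grid a b n i<..grid a b n (Suc i)} u = (0::'b)" if "i < n" for i
    using False grid_ge[of a b n i] grid_le[of a b "Suc i" n] assms that
    by (simp add: indicator_def) linarith
  then show ?thesis using False by simp
qed

text \<open>As \<open>\<phi>\<close> vanishes near 0, only cells with a large increment contribute,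
  and on a fine grid each of these contains exactly one point of a fixed finite set. The increment
  over such a cell tends to the jump.\<close>

lemma grid_sum_tendsto:
  fixes f :: "real \<Rightarrow> 'b::real_normed_vector" and \<phi> :: "'b \<Rightarrow> real"
  assumes f: "cadlag f" and ab: "0 \<le> a" "a < b" and e: "0 < e"
    and \<phi>: "continuous_on UNIV \<phi>" "\<And>x. \<phi> x \<noteq> 0 \<Longrightarrow> e < norm x"
  shows "\<exists>J. finite J \<and> J \<subseteq> {a<..b} \<and> (\<forall>u\<in>{a<..b} - J. \<phi> (jump f u) = 0) \<and>
    (\<lambda>n. \<Sum>i<n. \<phi> (f (grid a b n (Suc i)) - f (grid a b n i))) \<longlonglongrightarrow> (\<Sum>u\<in>J. \<phi> (jump f u))"
proof -
  obtain D d where D: "finite D" "D \<subseteq> {0..b}" "0 < d"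
    "\<And>a' b'. 0 \<le> a' \<and> a' < b' \<and> b' \<le> b \<and> b' - a' < d \<and> e \<le> dist (f a') (f b') \<Longrightarrow> (\<exists>u\<in>D. a' < u \<and> u \<le> b')"
    using cadlag_big_increments[OF f e, of b] by auto
  define D' where "D' = D \<inter> {a<..b}"
  \<comment> \<open>\<open>D'\<close> catches every cell whose increment can reach \<open>e\<close>.
    The large jumps are added so that \<open>\<phi>\<close> vanishes at all remaining jumps.\<close>
  define J where "J = D' \<union> {u\<in>{a<..b}. e < norm (jump f u)}"
  have "finite {u\<in>{a<..b}. e < norm (jump f u)}"
    by (rule finite_subset[OF _ cadlag_finite_jumps[OF f e, of b]]) (use ab in auto)
  then have fJ: "finite J" using D(1) by (simp add: J_def D'_def)
  have J: "J \<subseteq> {a<..b}" by (auto simp: J_def D'_def)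
  let ?i = "\<lambda>n u. grid_index a b n u"
  let ?t = "\<lambda>n u. \<phi> (f (grid a b n (Suc (?i n u))) - f (grid a b n (?i n u)))"
  have lim: "(\<lambda>n. \<Sum>u\<in>J. ?t n u) \<longlonglongrightarrow> (\<Sum>u\<in>J. \<phi> (jump f u))"
  proof (intro tendsto_sum)
    fix u assume "u \<in> J"
    then have u: "a < u" "u \<le> b" "0 < u" using J ab by auto
    have l: "(\<lambda>n. f (grid a b n (?i n u))) \<longlonglongrightarrow> left_lim f u"
      by (rule filterlim_compose[OF cadlag_tendsto_left[OF f u(3)] grid_tendsto_at_left[OF u(1,2)]])
    have "(f \<longlongrightarrow> f u) (at_right u)" by (rule cadlag_tendsto_right[OF f]) (use u in simp)
    then have fr: "\<forall>\<^sub>F v in at_right u. dist (f v) (f u) < q" if "0 < q" for q using that by (rule tendstoD)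
    \<comment> \<open>The right end of a cell may coincide with \<open>u\<close>, so it tends to
      \<open>u\<close> but not along \<open>at_right u\<close>; the case of equality is split
      off.\<close>
    have r: "(\<lambda>n. f (grid a b n (Suc (?i n u)))) \<longlonglongrightarrow> f u"
    proof (rule tendstoI)
      fix q :: real assume "0 < q"
      then obtain c where c: "c > u" "\<And>v. u < v \<Longrightarrow> v < c \<Longrightarrow> dist (f v) (f u) < q"
        using fr unfolding eventually_at_right_field by blast
      have "\<forall>\<^sub>F n in sequentially. grid a b n (Suc (?i n u)) < c"
        by (rule order_tendstoD(2)[OF gridr_tendsto[OF u(1,2)] c(1)])
      then show "\<forall>\<^sub>F n in sequentially. dist (f (grid a b n (Suc (?i n u)))) (f u) < q"
        using eventually_gt_at_top[of 0]
      proof eventually_elim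
        case (elim n)
        then show ?case using grid_index(3)[OF u(1,2) elim(2)] c(2)[of "grid a b n (Suc (?i n u))"] \<open>0 < q\<close>
          by (cases "grid a b n (Suc (?i n u)) = u") auto
      qed
    qed
    show "(\<lambda>n. ?t n u) \<longlonglongrightarrow> \<phi> (jump f u)"
      unfolding jump_def
      by (rule continuous_on_tendsto_compose[OF \<phi>(1) tendsto_diff[OF r l]]) auto
  qed
  have ev: "\<forall>\<^sub>F n in sequentially. (b - a) / real n < m" if "0 < m" for m
    using order_tendstoD(2)[OF inv_n_tendsto that] .
  \<comment> \<open>\<open>m\<close> separates the points of \<open>J\<close>: once the mesh is
    below \<open>m\<close>, no cell holds two of them.\<close>
  obtain m where m: "0 < m" "\<And>u v. u \<in> J \<Longrightarrow> v \<in> J \<Longrightarrow> u \<noteq> v \<Longrightarrow> m \<le> dist u v"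
  proof -
    have "\<exists>d>0. \<forall>v\<in>J. v \<noteq> u \<longrightarrow> d \<le> dist u v" for u using finite_set_avoid[OF fJ, of u] .
    then obtain d where d: "\<And>u. 0 < d u" "\<And>u v. v \<in> J \<Longrightarrow> v \<noteq> u \<Longrightarrow> d u \<le> dist u v" by metis
    show ?thesis
    proof (cases "J = {}")
      case False
      show ?thesis by (rule that[of "Min (d ` J)"])
         (use False fJ d in \<open>auto intro: order_trans[OF Min_le]\<close>)
    qed (use that[of 1] in auto)
  qed
  have "\<forall>\<^sub>F n in sequentially. (\<Sum>i<n. \<phi> (f (grid a b n (Suc i)) - f (grid a b n i))) = (\<Sum>u\<in>J. ?t n u)"
    using ev[OF m(1)] ev[OF D(3)] eventually_gt_at_top[of 0]
  proof eventually_elim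
    case (elim n)
    have inj: "inj_on (?i n) J"
    proof (rule inj_onI, rule ccontr)
      fix u v assume uv: "u \<in> J" "v \<in> J" "?i n u = ?i n v" "u \<noteq> v"
      have "u \<in> {a<..b}" "v \<in> {a<..b}" using uv J by auto
      then have "\<bar>u - v\<bar> < (b - a) / n"
        using grid_index[of a u b n] grid_index[of a v b n] elim uv grid_step[OF elim(3), of a b "?i n u"] by auto
      then show False using m(2)[OF uv(1,2,4)] elim by (auto simp: dist_real_def)
    qed
    \<comment> \<open>A nonzero term would mean an increment of size at least \<open>e\<close> over
      a cell shorter than \<open>d\<close>, which forces a point of \<open>D\<close> into the
      cell.\<close>
    have z: "\<phi> (f (grid a b n (Suc i)) - f (grid a b n i)) = 0" if "i < n" "i \<notin> ?i n ` J" for i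
    proof (rule ccontr)
      assume "\<phi> (f (grid a b n (Suc i)) - f (grid a b n i)) \<noteq> 0"
      then have "e \<le> dist (f (grid a b n i)) (f (grid a b n (Suc i)))"
        using \<phi>(2)[of "f (grid a b n (Suc i)) - f (grid a b n i)"] by (simp add: dist_norm norm_minus_commute)
      moreover have "0 \<le> grid a b n i" "grid a b n (Suc i) \<le> b" "grid a b n i \<ge> a"
        using grid_ge[of a b n i] grid_le[of a b "Suc i" n] ab that by auto
      ultimately obtain u where u: "u \<in> D" "grid a b n i < u" "u \<le> grid a b n (Suc i)"
        using D(4)[of "grid a b n i" "grid a b n (Suc i)"] grid_step[OF elim(3), of a b i] ab elim by auto
      then have "u \<in> J" using \<open>grid a b n i \<ge> a\<close> \<open>grid a b n (Suc i) \<le> b\<close> by (auto simp: J_def D'_def)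
      then show False using grid_index_unique[OF ab(2) u(2,3) elim(3)] that by auto
    qed
    have sub: "?i n ` J \<subseteq> {..<n}" using grid_index(1)[of a _ b n] J elim by auto
    have "(\<Sum>i<n. \<phi> (f (grid a b n (Suc i)) - f (grid a b n i))) = (\<Sum>i\<in>?i n ` J. \<phi> (f (grid a b n (Suc i)) - f (grid a b n i)))"
      by (rule sum.mono_neutral_right) (use z sub in auto)
    also have "\<dots> = (\<Sum>u\<in>J. ?t n u)" by (subst sum.reindex[OF inj]) simp
    finally show ?case .
  qed
  then have "(\<lambda>n. \<Sum>i<n. \<phi> (f (grid a b n (Suc i)) - f (grid a b n i))) \<longlonglongrightarrow> (\<Sum>u\<in>J. \<phi> (jump f u))"
    by (rule tendsto_cong[THEN iffD2, OF _ lim])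
  moreover have "\<phi> (jump f u) = 0" if "u \<in> {a<..b} - J" for u
    using that \<phi>(2)[of "jump f u"] by (auto simp: J_def)
  ultimately show ?thesis using fJ J by (intro exI[of _ J]) simp
qed

text \<open>A sum over uncountably many times, encoded as an integral against counting measure: it
  always has a value, and monotone convergence is inherited. The weight depends on time as well, so
  that a process times a function of the jump is covered.\<close>

definition jsum :: "(real \<Rightarrow> 'b::real_normed_vector) \<Rightarrow> (real \<Rightarrow> 'b \<Rightarrow> ennreal) \<Rightarrow> real \<Rightarrow> real \<Rightarrow> ennreal" where
  "jsum f w a b = (\<integral>\<^sup>+u. w u (jump f u) * indicator {a<..b} u \<partial>count_space UNIV)"

lemma jsum_mono: "(\<And>u x. u \<in> {a<..b} \<Longrightarrow> w u x \<le> w' u x) \<Longrightarrow> jsum f w a b \<le> jsum f w' a b"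
  unfolding jsum_def by (intro nn_integral_mono) (auto simp: indicator_def)

lemma jsum_cmult: "jsum f (\<lambda>u x. c * w u x) a b = c * jsum f w a b"
  unfolding jsum_def by (simp add: nn_integral_cmult mult.assoc)

lemma jsum_add: "jsum f (\<lambda>u x. w u x + w' u x) a b = jsum f w a b + jsum f w' a b"
  unfolding jsum_def by (simp add: nn_integral_add distrib_right)

lemma jsum_suminf: "jsum f (\<lambda>u x. \<Sum>i. w i u x) a b = (\<Sum>i. jsum f (w i) a b)"
  unfolding jsum_def by (subst nn_integral_suminf[symmetric]) (simp_all add: ennreal_suminf_multc)

lemma jsum_SUP:
  assumes "\<And>u x. incseq (\<lambda>i. w i u x)"
  shows "jsum f (\<lambda>u x. SUP i. w i u x) a b = (SUP i. jsum f (w i) a b)"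
proof -
  have "jsum f (\<lambda>u x. SUP i. w i u x) a b = (\<integral>\<^sup>+u. (SUP i. w i u (jump f u) * indicator {a<..b} u) \<partial>count_space UNIV)"
    unfolding jsum_def by (simp add: SUP_mult_right_ennreal)
  also have "\<dots> = (SUP i. jsum f (w i) a b)"
    unfolding jsum_def
    by (intro nn_integral_monotone_convergence_SUP)
       (use assms in \<open>auto simp: incseq_def le_fun_def intro!: mult_right_mono\<close>)
  finally show ?thesis .
qed

lemma jsum_split: "a \<le> b \<Longrightarrow> b \<le> c \<Longrightarrow> jsum f w a c = jsum f w a b + jsum f w b c"
  unfolding jsum_def
  by (subst nn_integral_add[symmetric]) (auto intro!: nn_integral_cong simp: indicator_def)

lemma jsum_finite_support:
  assumes "finite J" "J \<subseteq> {a<..b}" "\<forall>u\<in>{a<..b} - J. \<phi> (jump f u) = 0" "\<And>x. 0 \<le> \<phi> x"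
  shows "jsum f (\<lambda>u x. ennreal (\<phi> x)) a b = ennreal (\<Sum>u\<in>J. \<phi> (jump f u))"
proof -
  have "jsum f (\<lambda>u x. ennreal (\<phi> x)) a b = (\<Sum>u\<in>J. ennreal (\<phi> (jump f u)) * indicator {a<..b} u)"
    unfolding jsum_def by (rule nn_integral_count_space'[OF assms(1)]) (use assms in \<open>auto simp: indicator_def\<close>)
  also have "\<dots> = (\<Sum>u\<in>J. ennreal (\<phi> (jump f u)))"
    using assms(2) by (intro sum.cong refl) (auto simp: indicator_def)
  finally show ?thesis using assms by simp
qed

text \<open>Fatou's lemma on one side and the bound by the limit on the other give each of the two
  inequalities. No integrable majorant enters, so both sides may be infinite.\<close>

lemma nn_integral_eq_limit:
  fixes G H :: "nat \<Rightarrow> 'a \<Rightarrow> ennreal"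
  assumes [measurable]: "\<And>k. G k \<in> borel_measurable M" "\<And>k. H k \<in> borel_measurable N"
    and eq: "\<And>k. (\<integral>\<^sup>+x. G k x \<partial>M) = (\<integral>\<^sup>+x. H k x \<partial>N)"
    and G: "\<And>x. x \<in> space M \<Longrightarrow> (\<lambda>k. G k x) \<longlonglongrightarrow> g x" "\<And>k x. x \<in> space M \<Longrightarrow> G k x \<le> g x"
    and H: "\<And>x. x \<in> space N \<Longrightarrow> (\<lambda>k. H k x) \<longlonglongrightarrow> h x" "\<And>k x. x \<in> space N \<Longrightarrow> H k x \<le> h x"
  shows "(\<integral>\<^sup>+x. g x \<partial>M) = (\<integral>\<^sup>+x. h x \<partial>N)"
proof -
  have *: "(\<integral>\<^sup>+x. g x \<partial>M) \<le> (\<integral>\<^sup>+x. h x \<partial>N)"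
    if [measurable]: "\<And>k. G k \<in> borel_measurable M"
    and eq: "\<And>k. (\<integral>\<^sup>+x. G k x \<partial>M) = (\<integral>\<^sup>+x. H k x \<partial>N)"
    and G: "\<And>x. x \<in> space M \<Longrightarrow> (\<lambda>k. G k x) \<longlonglongrightarrow> g x"
    and H: "\<And>k x. x \<in> space N \<Longrightarrow> H k x \<le> h x"
    for M N :: "'a measure" and G H g h
  proof -
    have "(\<integral>\<^sup>+x. g x \<partial>M) = (\<integral>\<^sup>+x. liminf (\<lambda>k. G k x) \<partial>M)"
      by (intro nn_integral_cong lim_imp_Liminf[symmetric] G) simp_all
    also have "\<dots> \<le> liminf (\<lambda>k. \<integral>\<^sup>+x. G k x \<partial>M)"
      by (intro nn_integral_liminf) simp
    also have "\<dots> \<le> liminf (\<lambda>k::nat. \<integral>\<^sup>+x. h x \<partial>N)"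
      unfolding eq by (intro Liminf_mono always_eventually allI nn_integral_mono H)
    also have "\<dots> = (\<integral>\<^sup>+x. h x \<partial>N)" by (simp add: Liminf_const)
    finally show ?thesis .
  qed
  show ?thesis
    by (intro antisym *[of G M N H g h] *[of H N M G h g]) (use assms in auto)
qed

subsection \<open>Jump sums of a Levy process and the compensation formula\<close>

text \<open>Jump sums with random weights arise as almost everywhere limits only; on a complete
  space they are measurable nevertheless.\<close>

lemma borel_measurable_AE_complete:
  fixes X X' :: "'a \<Rightarrow> 'b::topological_space"
  assumes c: "complete_measure M" and [measurable]: "X' \<in> borel_measurable M" and ae: "AE x in M. X x = X' x"
  shows "X \<in> borel_measurable M"
proof (rule measurableI)
  fix S :: "'b set" assume [measurable]: "S \<in> sets borel"
  interpret complete_measure M by fact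
  have "X' -` S \<inter> space M \<in> sets M" by measurable
  moreover have "AE x in M. x \<in> X' -` S \<inter> space M \<longleftrightarrow> x \<in> X -` S \<inter> space M"
    using ae by eventually_elim auto
  ultimately show "X -` S \<inter> space M \<in> sets M"
    using in_sets_AE by blast
qed simp

text \<open>Path regularity is required at every outcome of \<open>space M\<close>, so that pathwise
  limits carry no exceptional sets; \<open>mucogarch_modification\<close> provides this.
  Independence appears as factorization of expectations. The Levy measure is tied to the jumps on
  open sets, the form in which superlevel sets of continuous weights arrive.\<close>

locale levy_jumps = prob_space M + complete_measure M for M :: "'a measure" +
  fixes F :: "real \<Rightarrow> 'a measure" and L :: "real \<Rightarrow> 'a \<Rightarrow> real^'d" and \<nu> :: "(real^'d) measure"
  assumes space_F: "0 \<le> t \<Longrightarrow> space (F t) = space M"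
    and sets_F: "0 \<le> t \<Longrightarrow> sets (F t) \<subseteq> sets M"
    and F_mono: "0 \<le> s \<Longrightarrow> s \<le> t \<Longrightarrow> sets (F s) \<subseteq> sets (F t)"
    and L_adapted: "0 \<le> t \<Longrightarrow> L t \<in> borel_measurable (F t)"
    and L_cadlag: "\<omega> \<in> space M \<Longrightarrow> cadlag (\<lambda>t. L t \<omega>)"
    and indep_incr: "\<lbrakk>0 \<le> s; s \<le> t; Z \<in> borel_measurable (F s); \<And>\<omega>. 0 \<le> Z \<omega>; \<And>\<omega>. Z \<omega> \<le> c;
        f \<in> borel_measurable borel; \<And>x. 0 \<le> f x; \<And>x. f x \<le> (1::real)\<rbrakk>
      \<Longrightarrow> expectation (\<lambda>\<omega>. Z \<omega> * f (L t \<omega> - L s \<omega>)) = expectation Z * expectation (\<lambda>\<omega>. f (L (t - s) \<omega>))"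
    and sets_\<nu> [measurable_cong]: "sets \<nu> = sets borel"
    and levy_open: "open S \<Longrightarrow> emeasure \<nu> S =
        (\<integral>\<^sup>+\<omega>. emeasure (count_space UNIV) {s\<in>{0<..1}. jump (\<lambda>r. L r \<omega>) s \<in> S - {0}} \<partial>M)"
begin

lemma measurable_F_mono:
  assumes "f \<in> measurable (F s) N" "0 \<le> s" "s \<le> t"
  shows "f \<in> measurable (F t) N"
  using assms F_mono[of s t] space_F[of s] space_F[of t] by (auto simp: measurable_def)

lemma measurable_F_M:
  assumes "f \<in> measurable (F s) N" "0 \<le> s"
  shows "f \<in> measurable M N"
  using assms sets_F[of s] space_F[of s] by (auto simp: measurable_def)

lemma L_measurable: "0 \<le> t \<Longrightarrow> L t \<in> borel_measurable M"
  using L_adapted measurable_F_M by blast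

abbreviation JS :: "(real \<Rightarrow> real^'d \<Rightarrow> ennreal) \<Rightarrow> real \<Rightarrow> real \<Rightarrow> 'a \<Rightarrow> ennreal" where
  "JS w a b \<omega> \<equiv> jsum (\<lambda>t. L t \<omega>) w a b"

text \<open>Induction on the number of increments: \<open>Z\<close> and the first \<open>k\<close>
  increments form a bounded variable known at time \<open>grid a b n k\<close>, hence independent of
  the next increment, whose law is that of \<open>L\<close> at the mesh size.\<close>

lemma exp_increments:
  fixes \<phi> :: "real^'d \<Rightarrow> real"
  assumes ab: "0 \<le> a" "a < b" and n: "0 < n" and [measurable]: "\<phi> \<in> borel_measurable borel" and pos: "\<And>x. 0 \<le> \<phi> x"
    and Z: "Z \<in> borel_measurable (F a)" "\<And>\<omega>. 0 \<le> Z \<omega>" "\<And>\<omega>. Z \<omega> \<le> c"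
  shows "k \<le> n \<Longrightarrow> expectation (\<lambda>\<omega>. Z \<omega> * exp (- (\<Sum>i<k. \<phi> (L (grid a b n (Suc i)) \<omega> - L (grid a b n i) \<omega>))))
    = expectation Z * expectation (\<lambda>\<omega>. exp (- \<phi> (L ((b - a) / n) \<omega>))) ^ k"
proof (induction k)
  case (Suc k)
  define Z' where "Z' \<omega> = Z \<omega> * exp (- (\<Sum>i<k. \<phi> (L (grid a b n (Suc i)) \<omega> - L (grid a b n i) \<omega>)))" for \<omega>
  have g0: "0 \<le> grid a b n i" for i using grid_ge[of a b n i] ab by simp
  have m: "L (grid a b n i) \<in> borel_measurable (F (grid a b n k))" if "i \<le> k" for i
    using measurable_F_mono[OF L_adapted[OF g0, of i] g0 grid_mono] that ab by simp
  have [measurable]: "Z \<in> borel_measurable (F (grid a b n k))"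
    by (rule measurable_F_mono[OF Z(1)]) (use ab grid_ge[of a b n k] in auto)
  have [measurable]: "(\<lambda>\<omega>. \<phi> (L (grid a b n (Suc i)) \<omega> - L (grid a b n i) \<omega>)) \<in> borel_measurable (F (grid a b n k))"
    if "i < k" for i
  proof -
    have [measurable]: "L (grid a b n i) \<in> borel_measurable (F (grid a b n k))"
      "L (grid a b n (Suc i)) \<in> borel_measurable (F (grid a b n k))"
      using m that by auto
    show ?thesis by measurable
  qed
  have Z': "Z' \<in> borel_measurable (F (grid a b n k))"
    unfolding Z'_def by measurable
  have Z'2: "0 \<le> Z' \<omega>" "Z' \<omega> \<le> c" for \<omega>
    using Z(2)[of \<omega>] Z(3)[of \<omega>] mult_left_le[of "exp (- (\<Sum>i<k. \<phi> (L (grid a b n (Suc i)) \<omega> - L (grid a b n i) \<omega>)))" "Z \<omega>"]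
    by (auto simp: Z'_def sum_nonneg pos)
  have "expectation (\<lambda>\<omega>. Z \<omega> * exp (- (\<Sum>i<Suc k. \<phi> (L (grid a b n (Suc i)) \<omega> - L (grid a b n i) \<omega>))))
      = expectation (\<lambda>\<omega>. Z' \<omega> * exp (- \<phi> (L (grid a b n (Suc k)) \<omega> - L (grid a b n k) \<omega>)))"
    by (simp add: Z'_def exp_add[symmetric] mult.assoc exp_minus[symmetric] add.commute)
  also have "\<dots> = expectation Z' * expectation (\<lambda>\<omega>. exp (- \<phi> (L (grid a b n (Suc k) - grid a b n k) \<omega>)))"
    by (rule indep_incr[OF g0 grid_mono Z' Z'2(1) Z'2(2), of "Suc k" "\<lambda>x. exp (- \<phi> x)"]) (use ab pos in auto)
  also have "grid a b n (Suc k) - grid a b n k = (b - a) / n" using grid_step[OF n] by simp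
  finally show ?case using Suc unfolding Z'_def by (simp add: mult_ac)
qed simp

text \<open>Finite since on a bounded interval a cadlag path has only finitely many jumps on which
  \<open>\<phi>\<close> can be nonzero.\<close>

lemma jsum_vanishing:
  fixes \<phi> :: "real^'d \<Rightarrow> real"
  assumes ab: "0 \<le> a" "a < b" and e: "0 < e" and c: "continuous_on UNIV \<phi>" and pos: "\<And>x. 0 \<le> \<phi> x"
    and van: "\<And>x. \<phi> x \<noteq> 0 \<Longrightarrow> e < norm x" and \<omega>: "\<omega> \<in> space M"
  shows "JS (\<lambda>u x. ennreal (\<phi> x)) a b \<omega> < \<top>"
    "(\<lambda>n. \<Sum>i<n. \<phi> (L (grid a b n (Suc i)) \<omega> - L (grid a b n i) \<omega>)) \<longlonglongrightarrow> enn2real (JS (\<lambda>u x. ennreal (\<phi> x)) a b \<omega>)"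
proof -
  obtain J where J: "finite J" "J \<subseteq> {a<..b}" "\<forall>u\<in>{a<..b} - J. \<phi> (jump (\<lambda>t. L t \<omega>) u) = 0"
    "(\<lambda>n. \<Sum>i<n. \<phi> (L (grid a b n (Suc i)) \<omega> - L (grid a b n i) \<omega>)) \<longlonglongrightarrow> (\<Sum>u\<in>J. \<phi> (jump (\<lambda>t. L t \<omega>) u))"
    using grid_sum_tendsto[OF L_cadlag[OF \<omega>] ab e c van] by blast
  note jsum_finite_support[OF J(1-3) pos]
  then show "JS (\<lambda>u x. ennreal (\<phi> x)) a b \<omega> < \<top>"
    "(\<lambda>n. \<Sum>i<n. \<phi> (L (grid a b n (Suc i)) \<omega> - L (grid a b n i) \<omega>)) \<longlonglongrightarrow> enn2real (JS (\<lambda>u x. ennreal (\<phi> x)) a b \<omega>)"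
    using J(4) by (simp_all add: sum_nonneg pos)
qed

lemma jsum_vanishing_measurable:
  fixes \<phi> :: "real^'d \<Rightarrow> real"
  assumes ab: "0 \<le> a" "a < b" and e: "0 < e" and c: "continuous_on UNIV \<phi>" and pos: "\<And>x. 0 \<le> \<phi> x"
    and van: "\<And>x. \<phi> x \<noteq> 0 \<Longrightarrow> e < norm x"
  shows "(\<lambda>\<omega>. enn2real (JS (\<lambda>u x. ennreal (\<phi> x)) a b \<omega>)) \<in> borel_measurable M" (is "?V \<in> _")
    "(\<lambda>\<omega>. JS (\<lambda>u x. ennreal (\<phi> x)) a b \<omega>) \<in> borel_measurable M"
proof -
  have [measurable]: "\<phi> \<in> borel_measurable borel" using c by (rule borel_measurable_continuous_onI)
  have [measurable]: "L (grid a b n i) \<in> borel_measurable M" for n i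
    using grid_ge[of a b n i] ab by (intro L_measurable) simp
  show [measurable]: "?V \<in> borel_measurable M"
    by (rule borel_measurable_LIMSEQ_metric[OF _ jsum_vanishing(2)[OF assms]]) auto
  have "JS (\<lambda>u x. ennreal (\<phi> x)) a b \<omega> = ennreal (?V \<omega>)" if "\<omega> \<in> space M" for \<omega>
    using jsum_vanishing(1)[OF assms that] by simp
  then show "(\<lambda>\<omega>. JS (\<lambda>u x. ennreal (\<phi> x)) a b \<omega>) \<in> borel_measurable M"
    by (subst measurable_cong[where g="\<lambda>\<omega>. ennreal (?V \<omega>)"]) auto
qed

text \<open>The exponentials times \<open>Z\<close> are bounded by \<open>K\<close>, so dominated
  convergence applies along the grids. By \<open>exp_increments\<close> the grid expectations depend
  on the interval only through its length; the case \<open>Z = 1\<close> on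
  \<open>{0<..b - a}\<close> identifies their limit.\<close>

lemma exp_jsum:
  fixes \<phi> :: "real^'d \<Rightarrow> real"
  assumes ab: "0 \<le> a" "a < b" and e: "0 < e" and c: "continuous_on UNIV \<phi>" and pos: "\<And>x. 0 \<le> \<phi> x"
    and van: "\<And>x. \<phi> x \<noteq> 0 \<Longrightarrow> e < norm x"
    and Z: "Z \<in> borel_measurable (F a)" "\<And>\<omega>. 0 \<le> Z \<omega>" "\<And>\<omega>. Z \<omega> \<le> K" and l: "0 \<le> l"
  shows "expectation (\<lambda>\<omega>. Z \<omega> * exp (- (l * enn2real (JS (\<lambda>u x. ennreal (\<phi> x)) a b \<omega>))))
    = expectation Z * expectation (\<lambda>\<omega>. exp (- (l * enn2real (JS (\<lambda>u x. ennreal (\<phi> x)) 0 (b - a) \<omega>))))"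
proof -
  have [measurable]: "\<phi> \<in> borel_measurable borel" using c by (rule borel_measurable_continuous_onI)
  let ?V = "\<lambda>a b \<omega>. enn2real (JS (\<lambda>u x. ennreal (\<phi> x)) a b \<omega>)"
  have lim: "(\<lambda>n. expectation Z * expectation (\<lambda>\<omega>. exp (- (l * \<phi> (L ((b - a) / real n) \<omega>)))) ^ n)
      \<longlonglongrightarrow> expectation (\<lambda>\<omega>. Z \<omega> * exp (- (l * ?V a b \<omega>)))"
    if ab: "0 \<le> a" "a < b" and Z: "Z \<in> borel_measurable (F a)" "\<And>\<omega>. 0 \<le> Z \<omega>" "\<And>\<omega>. Z \<omega> \<le> K"
    for a b Z K
  proof -
    note A = ab e c pos van
    have [measurable]: "Z \<in> borel_measurable M" using Z(1) ab measurable_F_M by blast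
    have [measurable]: "L (grid a b n i) \<in> borel_measurable M" for n i
      using grid_ge[of a b n i] ab by (intro L_measurable) simp
    have [measurable]: "?V a b \<in> borel_measurable M" by (rule jsum_vanishing_measurable[OF A])
    have "(\<lambda>n. expectation (\<lambda>\<omega>. Z \<omega> * exp (- (\<Sum>i<n. l * \<phi> (L (grid a b n (Suc i)) \<omega> - L (grid a b n i) \<omega>)))))
      \<longlonglongrightarrow> expectation (\<lambda>\<omega>. Z \<omega> * exp (- (l * ?V a b \<omega>)))"
    proof (rule integral_dominated_convergence[where w="\<lambda>_. K"])
      show "AE \<omega> in M. (\<lambda>n. Z \<omega> * exp (- (\<Sum>i<n. l * \<phi> (L (grid a b n (Suc i)) \<omega> - L (grid a b n i) \<omega>)))) \<longlonglongrightarrow> Z \<omega> * exp (- (l * ?V a b \<omega>))"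
        unfolding sum_distrib_left[symmetric]
        by (intro AE_I2 tendsto_mult tendsto_const tendsto_exp tendsto_minus jsum_vanishing(2)[OF A])
      show "AE \<omega> in M. norm (Z \<omega> * exp (- (\<Sum>i<n. l * \<phi> (L (grid a b n (Suc i)) \<omega> - L (grid a b n i) \<omega>)))) \<le> K" for n
      proof (rule AE_I2)
        fix \<omega>
        have "0 \<le> (\<Sum>i<n. l * \<phi> (L (grid a b n (Suc i)) \<omega> - L (grid a b n i) \<omega>))"
          using l pos by (intro sum_nonneg) simp
        then show "norm (Z \<omega> * exp (- (\<Sum>i<n. l * \<phi> (L (grid a b n (Suc i)) \<omega> - L (grid a b n i) \<omega>)))) \<le> K"
          using Z(2)[of \<omega>] Z(3)[of \<omega>] mult_left_le[of "exp (- (\<Sum>i<n. l * \<phi> (L (grid a b n (Suc i)) \<omega> - L (grid a b n i) \<omega>)))" "Z \<omega>"]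
          by (simp add: abs_mult)
      qed
    qed auto
    moreover have ev: "\<forall>\<^sub>F n in sequentially. expectation (\<lambda>\<omega>. Z \<omega> * exp (- (\<Sum>i<n. l * \<phi> (L (grid a b n (Suc i)) \<omega> - L (grid a b n i) \<omega>))))
       = expectation Z * expectation (\<lambda>\<omega>. exp (- (l * \<phi> (L ((b - a) / real n) \<omega>)))) ^ n"
      using eventually_gt_at_top[of 0]
      by eventually_elim (rule exp_increments[OF ab _ _ _ Z], use l pos in auto)
    ultimately show ?thesis by (intro tendsto_cong[THEN iffD1, OF ev])
  qed
  let ?q = "\<lambda>n. expectation (\<lambda>\<omega>. exp (- (l * \<phi> (L ((b - a) / real n) \<omega>)))) ^ n"
  have 1: "(\<lambda>n. expectation Z * ?q n) \<longlonglongrightarrow> expectation (\<lambda>\<omega>. Z \<omega> * exp (- (l * ?V a b \<omega>)))"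
    by (rule lim[OF ab Z])
  have 2: "?q \<longlonglongrightarrow> expectation (\<lambda>\<omega>. exp (- (l * ?V 0 (b - a) \<omega>)))"
    using lim[of 0 "b - a" "\<lambda>_. 1" 1] ab by (simp add: prob_space)
  have "(\<lambda>n. expectation Z * ?q n) \<longlonglongrightarrow> expectation Z * expectation (\<lambda>\<omega>. exp (- (l * ?V 0 (b - a) \<omega>)))"
    by (intro tendsto_mult_left 2)
  with 1 show ?thesis by (rule LIMSEQ_unique)
qed

end

section \<open>Real-variable tools: Laplace quotients, Cauchy's equation, dyadic layers\<close>

lemma scaled_exp_le: "0 \<le> x \<Longrightarrow> real (Suc k) * (1 - exp (- (x / Suc k))) \<le> x"
proof -
  have "1 - exp (- (x / Suc k)) \<le> x / Suc k"
    using exp_ge_add_one_self[of "- (x / Suc k)"] by linarith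
  then have "real (Suc k) * (1 - exp (- (x / Suc k))) \<le> real (Suc k) * (x / Suc k)"
    by (rule mult_left_mono) simp
  then show ?thesis by (simp del: of_nat_Suc)
qed

text \<open>Differentiates a Laplace transform at 0 by difference quotients. For fixed
  \<open>k\<close> the quotient is bounded by \<open>Suc k\<close>, hence integrable, and
  \<open>scaled_exp_le\<close> keeps it below \<open>x\<close>. The lower estimate comes from
  \<open>exp (- y) \<le> 1 / (1 + y)\<close>.\<close>

lemma scaled_exp_tendsto:
  fixes x :: real
  assumes "0 \<le> x"
  shows "(\<lambda>k. real (Suc k) * (1 - exp (- (x / Suc k)))) \<longlonglongrightarrow> x"
proof (rule tendsto_sandwich)
  have "x / (1 + x / Suc k) \<le> real (Suc k) * (1 - exp (- (x / Suc k)))" for k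
  proof -
    define y where "y = x / Suc k"
    have y: "0 \<le> y" using assms by (simp add: y_def)
    have "1 + y \<le> exp y" by (rule exp_ge_add_one_self)
    then have "exp (- y) \<le> 1 / (1 + y)"
      using y by (simp add: exp_minus inverse_eq_divide frac_le)
    moreover have "1 - 1 / (1 + y) = y / (1 + y)" using y by (simp add: field_simps)
    ultimately have "real (Suc k) * (y / (1 + y)) \<le> real (Suc k) * (1 - exp (- y))"
      by (intro mult_left_mono) auto
    then show ?thesis by (simp add: y_def)
  qed
  then show "\<forall>\<^sub>F k in sequentially. x / (1 + x / Suc k) \<le> real (Suc k) * (1 - exp (- (x / Suc k)))"
    by (intro always_eventually allI)
  have "(\<lambda>k. x / (1 + x / Suc k)) \<longlonglongrightarrow> x / (1 + 0)"
    by (intro tendsto_divide tendsto_add tendsto_const LIMSEQ_Suc[OF inv_n_tendsto]) simp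
  then show "(\<lambda>k. x / (1 + x / Suc k)) \<longlonglongrightarrow> x" by simp
  show "\<forall>\<^sub>F k in sequentially. real (Suc k) * (1 - exp (- (x / Suc k))) \<le> x"
    using scaled_exp_le[OF assms] by (intro always_eventually allI)
qed (rule tendsto_const)

text \<open>Additivity settles integer multiples. Monotonicity traps \<open>n f(t)\<close> between
  \<open>k f(1)\<close> and \<open>(k + 1) f(1)\<close>, where \<open>k\<close> is the integer part
  of \<open>n t\<close>; as \<open>n\<close> is arbitrary, the gap of size \<open>f 1\<close> is
  immaterial.\<close>

lemma additive_mono_linear:
  fixes f :: "real \<Rightarrow> real"
  assumes add: "\<And>s t. 0 \<le> s \<Longrightarrow> 0 \<le> t \<Longrightarrow> f (s + t) = f s + f t"
    and mono: "\<And>s t. 0 \<le> s \<Longrightarrow> s \<le> t \<Longrightarrow> f s \<le> f t" and t: "0 \<le> t"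
  shows "f t = t * f 1"
proof -
  have f0: "f 0 = 0" using add[of 0 0] by simp
  have mult: "f (real n * s) = real n * f s" if "0 \<le> s" for n s
    by (induction n) (use add that f0 in \<open>auto simp: distrib_right\<close>)
  have f1: "0 \<le> f 1" using mono[of 0 1] f0 by simp
  have b: "real n * \<bar>f t - t * f 1\<bar> \<le> f 1" for n :: nat
  proof -
    define k where "k = nat \<lfloor>real n * t\<rfloor>"
    have "0 \<le> real n * t" using t by simp
    then have "real k = of_int \<lfloor>real n * t\<rfloor>" unfolding k_def by simp
    then have k: "real k \<le> real n * t" "real n * t \<le> real (Suc k)"
      using floor_correct[of "real n * t"] by linarith+
    have "real k * f 1 \<le> real n * f t" "real n * f t \<le> real (Suc k) * f 1"
      using mono[OF _ k(1)] mono[OF _ k(2)] mult[of 1 k] mult[of 1 "Suc k"] mult[OF t, of n] t by auto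
    moreover have "real k * f 1 \<le> real n * t * f 1" "real n * t * f 1 \<le> real (Suc k) * f 1"
      using k f1 by (auto intro: mult_right_mono)
    moreover have "real (Suc k) * f 1 = real k * f 1 + f 1" by (simp add: algebra_simps)
    ultimately have "\<bar>real n * f t - real n * t * f 1\<bar> \<le> f 1" by linarith
    moreover have "real n * f t - real n * t * f 1 = real n * (f t - t * f 1)" by (simp add: algebra_simps)
    ultimately show ?thesis by (simp add: abs_mult)
  qed
  show ?thesis
  proof (rule ccontr)
    assume "f t \<noteq> t * f 1"
    then have "0 < \<bar>f t - t * f 1\<bar>" by simp
    then obtain n :: nat where "f 1 < real n * \<bar>f t - t * f 1\<bar>"
      using reals_Archimedean3 by blast
    then show False using b[of n] by simp
  qed
qed

text \<open>Layer-cake formula. Level \<open>n\<close> has as many layers as the ceiling of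
  \<open>2 ^ n * y\<close> minus one, cut at 0. The strict comparison makes the layers open
  superlevel sets once \<open>y\<close> is a continuous function.\<close>

lemma dyadic_layers:
  fixes y :: real
  assumes "0 \<le> y"
  defines "w n \<equiv> (\<Sum>j. ennreal (1 / 2 ^ n) * (if real (Suc j) / 2 ^ n < y then 1 else 0))"
  shows "incseq w" "(SUP n. w n) = ennreal y"
proof -
  define N where "N n = nat (\<lceil>2 ^ n * y\<rceil> - 1)" for n
  have N: "j < N n \<longleftrightarrow> real (Suc j) / 2 ^ n < y" for j n
  proof -
    have "j < N n \<longleftrightarrow> int j + 1 < \<lceil>2 ^ n * y\<rceil>" by (auto simp: N_def)
    also have "\<dots> \<longleftrightarrow> real_of_int (int j + 1) < 2 ^ n * y" by (rule less_ceiling_iff)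
    also have "\<dots> \<longleftrightarrow> real (Suc j) / 2 ^ n < y" by (simp add: field_simps)
    finally show ?thesis .
  qed
  have w: "w n = ennreal (real (N n) / 2 ^ n)" for n
  proof -
    have "w n = (\<Sum>j<N n. ennreal (1 / 2 ^ n) * (if real (Suc j) / 2 ^ n < y then 1 else 0))"
      unfolding w_def by (rule suminf_finite) (use N in auto)
    also have "\<dots> = (\<Sum>j<N n. ennreal (1 / 2 ^ n))" by (intro sum.cong refl) (use N in auto)
    also have "\<dots> = ennreal (real (N n) * (1 / 2 ^ n))"
      by (simp add: ennreal_of_nat_eq_real_of_nat ennreal_mult'[symmetric])
    finally show ?thesis by simp
  qed
  have lt: "real (N n) \<le> 2 ^ n * y" for n
  proof (cases "N n")
    case (Suc k)
    then have "real (Suc k) / 2 ^ n < y" using N[of k n] by simp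
    then show ?thesis unfolding Suc by (simp add: field_simps)
  qed (use \<open>0 \<le> y\<close> in simp)
  have mono: "real (N n) / 2 ^ n \<le> real (N (Suc n)) / 2 ^ Suc n" for n
  proof -
    have "2 * N n \<le> N (Suc n)"
    proof (cases "N n = 0")
      case False
      have "N n - 1 < N n" using False by simp
      then have "real (N n) / 2 ^ n < y" using N[of "N n - 1" n] False by simp
      then have "real (2 * N n) / 2 ^ Suc n < y" by (simp add: field_simps)
      then have "2 * N n - 1 < N (Suc n)" using N[of "2 * N n - 1" "Suc n"] False by simp
      then show ?thesis by simp
    qed simp
    then have "real (2 * N n) \<le> real (N (Suc n))" by (rule of_nat_mono)
    then show ?thesis by (simp add: field_simps)
  qed
  show inc: "incseq w"
    unfolding w by (intro incseq_SucI ennreal_leI mono)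
  have "(\<lambda>n. real (N n) / 2 ^ n) \<longlonglongrightarrow> y"
  proof (rule tendsto_sandwich)
    have *: "2 ^ n * y - 1 \<le> real (N n)" for n unfolding N_def by linarith
    then have "y - 1 / 2 ^ n \<le> real (N n) / 2 ^ n" for n
    proof -
      have "y - 1 / 2 ^ n = (2 ^ n * y - 1) / 2 ^ n" by (simp add: field_simps)
      also have "\<dots> \<le> real (N n) / 2 ^ n" using * by (intro divide_right_mono) auto
      finally show ?thesis .
    qed
    then show "\<forall>\<^sub>F n in sequentially. y - (1/2) ^ n \<le> real (N n) / 2 ^ n"
      by (intro always_eventually allI) (simp add: power_one_over)
    have "(\<lambda>n. y - (1/2) ^ n) \<longlonglongrightarrow> y - 0" by (intro tendsto_diff tendsto_const LIMSEQ_power_zero) simp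
    then show "(\<lambda>n. y - (1/2) ^ n) \<longlonglongrightarrow> y" by simp
    show "\<forall>\<^sub>F n in sequentially. real (N n) / 2 ^ n \<le> y"
      using lt by (intro always_eventually allI) (simp add: field_simps)
  qed simp
  then have "w \<longlonglongrightarrow> ennreal y" unfolding w by (intro tendsto_ennrealI)
  then show "(SUP n. w n) = ennreal y"
    using LIMSEQ_unique[OF LIMSEQ_SUP[OF inc]] by blast
qed

section \<open>Expected jump sums: independence, stationarity, linearity in time\<close>

context levy_jumps
begin

text \<open>Forms the Laplace quotient on both sides of \<open>exp_jsum\<close> with
  \<open>l = 1 / Suc k\<close>. For each \<open>k\<close> all variables are bounded, so the
  computation takes place among finite expectations.\<close>

lemma jsum_vanishing_indep:
  fixes \<phi> :: "real^'d \<Rightarrow> real"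
  assumes ab: "0 \<le> a" "a < b" and e: "0 < e" and c: "continuous_on UNIV \<phi>" and pos: "\<And>x. 0 \<le> \<phi> x"
    and van: "\<And>x. \<phi> x \<noteq> 0 \<Longrightarrow> e < norm x"
    and Z: "Z \<in> borel_measurable (F a)" "\<And>\<omega>. 0 \<le> Z \<omega>" "\<And>\<omega>. Z \<omega> \<le> K"
  shows "(\<integral>\<^sup>+\<omega>. ennreal (Z \<omega>) * JS (\<lambda>u x. ennreal (\<phi> x)) a b \<omega> \<partial>M)
    = (\<integral>\<^sup>+\<omega>. ennreal (Z \<omega>) \<partial>M) * (\<integral>\<^sup>+\<omega>. JS (\<lambda>u x. ennreal (\<phi> x)) 0 (b - a) \<omega> \<partial>M)"
proof -
  have ba: "0 \<le> (0::real)" "0 < b - a" using ab by auto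
  define V where "V \<omega> = enn2real (JS (\<lambda>u x. ennreal (\<phi> x)) a b \<omega>)" for \<omega>
  define V' where "V' \<omega> = enn2real (JS (\<lambda>u x. ennreal (\<phi> x)) 0 (b - a) \<omega>)" for \<omega>
  have V: "JS (\<lambda>u x. ennreal (\<phi> x)) a b \<omega> = ennreal (V \<omega>)"
    "JS (\<lambda>u x. ennreal (\<phi> x)) 0 (b - a) \<omega> = ennreal (V' \<omega>)" if "\<omega> \<in> space M" for \<omega>
    using jsum_vanishing(1)[OF ab e c pos van that] jsum_vanishing(1)[OF ba e c pos van that]
    by (simp_all add: V_def V'_def)
  have [measurable]: "V \<in> borel_measurable M" "V' \<in> borel_measurable M"
    unfolding V_def V'_def
    using jsum_vanishing_measurable(1)[OF ab e c pos van] jsum_vanishing_measurable(1)[OF ba e c pos van] by auto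
  have V0: "0 \<le> V \<omega>" "0 \<le> V' \<omega>" for \<omega> by (auto simp: V_def V'_def)
  have [measurable]: "Z \<in> borel_measurable M" using Z(1) ab measurable_F_M by blast
  have intZ: "integrable M (\<lambda>\<omega>. Z \<omega> * h \<omega>)" if "h \<in> borel_measurable M" "\<And>\<omega>. 0 \<le> h \<omega> \<and> h \<omega> \<le> 1" for h :: "'a \<Rightarrow> real"
    using that mult_mono[OF Z(3) conjunct2[OF that(2)]] Z(2)
    by (intro integrable_const_bound[where B="K"]) (auto simp: abs_mult intro!: AE_I2 order_trans[OF Z(2) Z(3)])
  let ?f = "\<lambda>k (x::real). real (Suc k) * (1 - exp (- (x / Suc k)))"
  have f0: "0 \<le> ?f k x" if "0 \<le> x" for k x using that by (intro mult_nonneg_nonneg) auto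
  have EZ: "0 \<le> expectation Z" by (intro Bochner_Integration.integral_nonneg Z(2))
  have eq: "expectation (\<lambda>\<omega>. Z \<omega> * ?f k (V \<omega>)) = expectation Z * expectation (\<lambda>\<omega>. ?f k (V' \<omega>))" for k
  proof -
    have 1: "integrable M (\<lambda>\<omega>. Z \<omega> * exp (- (V \<omega> / Suc k)))" by (rule intZ) (use V0 in auto)
    have 2: "integrable M Z" using intZ[of "\<lambda>_. 1"] by simp
    have 3: "integrable M (\<lambda>\<omega>. exp (- (V' \<omega> / Suc k)))"
      by (intro integrable_const_bound[where B="1"]) (use V0 in auto)
    have e: "expectation (\<lambda>\<omega>. Z \<omega> * exp (- (V \<omega> / Suc k))) = expectation Z * expectation (\<lambda>\<omega>. exp (- (V' \<omega> / Suc k)))"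
      using exp_jsum[OF ab e c pos van Z, of "1 / Suc k"] by (simp add: V_def V'_def)
    have "(\<lambda>\<omega>. Z \<omega> * ?f k (V \<omega>)) = (\<lambda>\<omega>. Suc k * (Z \<omega> - Z \<omega> * exp (- (V \<omega> / Suc k))))"
      by (simp add: algebra_simps)
    then have "expectation (\<lambda>\<omega>. Z \<omega> * ?f k (V \<omega>)) = Suc k * (expectation Z - expectation (\<lambda>\<omega>. Z \<omega> * exp (- (V \<omega> / Suc k))))"
      using 1 2 by (simp del: of_nat_Suc)
    also have "\<dots> = expectation Z * (Suc k * (1 - expectation (\<lambda>\<omega>. exp (- (V' \<omega> / Suc k)))))"
      unfolding e by (simp add: algebra_simps)
    also have "Suc k * (1 - expectation (\<lambda>\<omega>. exp (- (V' \<omega> / Suc k)))) = expectation (\<lambda>\<omega>. ?f k (V' \<omega>))"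
      using 3 by (simp add: prob_space del: of_nat_Suc)
    finally show ?thesis .
  qed
  \<comment> \<open>The quotients stay below their limits, so \<open>nn_integral_eq_limit\<close>
    applies even if the expected jump sums are infinite.\<close>
  have "(\<integral>\<^sup>+\<omega>. ennreal (Z \<omega> * V \<omega>) \<partial>M) = (\<integral>\<^sup>+\<omega>. ennreal (expectation Z) * ennreal (V' \<omega>) \<partial>M)"
  proof (rule nn_integral_eq_limit[where G="\<lambda>k \<omega>. ennreal (Z \<omega> * ?f k (V \<omega>))" and H="\<lambda>k \<omega>. ennreal (expectation Z) * ennreal (?f k (V' \<omega>))"])
    fix k
    have b: "?f k x \<le> Suc k" if "0 \<le> x" for x using that mult_left_le[of "1 - exp (- (x / Suc k))" "real (Suc k)"] by auto
    have "integrable M (\<lambda>\<omega>. Suc k * (Z \<omega> * (1 - exp (- (V \<omega> / Suc k)))))"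
      by (intro integrable_mult_right intZ) (use V0 in auto)
    then have "integrable M (\<lambda>\<omega>. Z \<omega> * ?f k (V \<omega>))" by (simp add: mult_ac)
    then have "(\<integral>\<^sup>+\<omega>. ennreal (Z \<omega> * ?f k (V \<omega>)) \<partial>M) = ennreal (expectation (\<lambda>\<omega>. Z \<omega> * ?f k (V \<omega>)))"
      by (intro nn_integral_eq_integral AE_I2 mult_nonneg_nonneg Z f0 V0)
    also have "\<dots> = ennreal (expectation Z) * ennreal (expectation (\<lambda>\<omega>. ?f k (V' \<omega>)))"
      unfolding eq using EZ by (rule ennreal_mult')
    also have "ennreal (expectation (\<lambda>\<omega>. ?f k (V' \<omega>))) = (\<integral>\<^sup>+\<omega>. ennreal (?f k (V' \<omega>)) \<partial>M)"
      by (intro nn_integral_eq_integral[symmetric] AE_I2 f0 V0 integrable_const_bound[where B="Suc k"])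
         (use f0 b V0 in \<open>auto simp del: of_nat_Suc\<close>)
    also have "ennreal (expectation Z) * \<dots> = (\<integral>\<^sup>+\<omega>. ennreal (expectation Z) * ennreal (?f k (V' \<omega>)) \<partial>M)"
      by (rule nn_integral_cmult[symmetric]) auto
    finally show "(\<integral>\<^sup>+\<omega>. ennreal (Z \<omega> * ?f k (V \<omega>)) \<partial>M) = (\<integral>\<^sup>+\<omega>. ennreal (expectation Z) * ennreal (?f k (V' \<omega>)) \<partial>M)" .
  next
    fix \<omega>
    show "(\<lambda>k. ennreal (Z \<omega> * ?f k (V \<omega>))) \<longlonglongrightarrow> ennreal (Z \<omega> * V \<omega>)"
      by (intro tendsto_ennrealI tendsto_mult_left scaled_exp_tendsto V0)
    show "(\<lambda>k. ennreal (expectation Z) * ennreal (?f k (V' \<omega>))) \<longlonglongrightarrow> ennreal (expectation Z) * ennreal (V' \<omega>)"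
      by (intro ennreal_tendsto_cmult tendsto_ennrealI scaled_exp_tendsto V0) simp
    fix k
    show "ennreal (Z \<omega> * ?f k (V \<omega>)) \<le> ennreal (Z \<omega> * V \<omega>)"
      by (intro ennreal_leI mult_left_mono scaled_exp_le V0 Z)
    show "ennreal (expectation Z) * ennreal (?f k (V' \<omega>)) \<le> ennreal (expectation Z) * ennreal (V' \<omega>)"
      by (intro mult_left_mono ennreal_leI scaled_exp_le V0) simp
  qed auto
  also have "\<dots> = ennreal (expectation Z) * (\<integral>\<^sup>+\<omega>. ennreal (V' \<omega>) \<partial>M)"
    by (rule nn_integral_cmult) auto
  also have "ennreal (expectation Z) = (\<integral>\<^sup>+\<omega>. ennreal (Z \<omega>) \<partial>M)"
    using intZ[of "\<lambda>_. 1"] by (intro nn_integral_eq_integral[symmetric] AE_I2 Z) auto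
  also have "(\<integral>\<^sup>+\<omega>. ennreal (V' \<omega>) \<partial>M) = (\<integral>\<^sup>+\<omega>. JS (\<lambda>u x. ennreal (\<phi> x)) 0 (b - a) \<omega> \<partial>M)"
    by (intro nn_integral_cong) (simp add: V)
  also have "(\<integral>\<^sup>+\<omega>. ennreal (Z \<omega> * V \<omega>) \<partial>M) = (\<integral>\<^sup>+\<omega>. ennreal (Z \<omega>) * JS (\<lambda>u x. ennreal (\<phi> x)) a b \<omega> \<partial>M)"
    by (intro nn_integral_cong) (simp add: V ennreal_mult Z V0)
  finally show ?thesis .
qed


text \<open>First stage: independence of the past and stationarity only. The expectation over
  \<open>{0<..b - a}\<close> is left unevaluated; its linearity in the length is proved afterwards,
  for superlevel sets.\<close>

definition indep_weight :: "(real^'d \<Rightarrow> ennreal) \<Rightarrow> bool" where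
  "indep_weight w \<longleftrightarrow> (\<forall>a b. 0 \<le> a \<longrightarrow> a < b \<longrightarrow> (\<lambda>\<omega>. JS (\<lambda>u. w) a b \<omega>) \<in> borel_measurable M \<and>
     (\<forall>Z K. Z \<in> borel_measurable (F a) \<longrightarrow> (\<forall>\<omega>. 0 \<le> Z \<omega> \<and> Z \<omega> \<le> (K::real)) \<longrightarrow>
       (\<integral>\<^sup>+\<omega>. ennreal (Z \<omega>) * JS (\<lambda>u. w) a b \<omega> \<partial>M)
         = (\<integral>\<^sup>+\<omega>. ennreal (Z \<omega>) \<partial>M) * (\<integral>\<^sup>+\<omega>. JS (\<lambda>u. w) 0 (b - a) \<omega> \<partial>M)))"

lemma indep_weightD:
  assumes "indep_weight w" "0 \<le> a" "a < b"
  shows "(\<lambda>\<omega>. JS (\<lambda>u. w) a b \<omega>) \<in> borel_measurable M"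
    "Z \<in> borel_measurable (F a) \<Longrightarrow> (\<And>\<omega>. 0 \<le> Z \<omega>) \<Longrightarrow> (\<And>\<omega>. Z \<omega> \<le> (K::real)) \<Longrightarrow>
     (\<integral>\<^sup>+\<omega>. ennreal (Z \<omega>) * JS (\<lambda>u. w) a b \<omega> \<partial>M)
         = (\<integral>\<^sup>+\<omega>. ennreal (Z \<omega>) \<partial>M) * (\<integral>\<^sup>+\<omega>. JS (\<lambda>u. w) 0 (b - a) \<omega> \<partial>M)"
  using assms unfolding indep_weight_def by blast+

lemma indep_weight_SUP:
  assumes w: "\<And>k. indep_weight (w k)" and inc: "\<And>x. incseq (\<lambda>k. w k x)"
  shows "indep_weight (\<lambda>x. SUP k. w k x)"
  unfolding indep_weight_def
proof (intro allI impI conjI)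
  fix a b :: real assume ab: "0 \<le> a" "a < b"
  have S: "JS (\<lambda>u x. SUP k. w k x) a b \<omega> = (SUP k. JS (\<lambda>u. w k) a b \<omega>)" for a b \<omega>
    by (rule jsum_SUP) (rule inc)
  have [measurable]: "(\<lambda>\<omega>. JS (\<lambda>u. w k) a b \<omega>) \<in> borel_measurable M" for k
    by (rule indep_weightD(1)[OF w ab])
  show "(\<lambda>\<omega>. JS (\<lambda>u x. SUP k. w k x) a b \<omega>) \<in> borel_measurable M"
    unfolding S by measurable
  have [measurable]: "(\<lambda>\<omega>. JS (\<lambda>u. w k) 0 (b - a) \<omega>) \<in> borel_measurable M" for k
    by (rule indep_weightD(1)[OF w]) (use ab in auto)
  have incJ: "incseq (\<lambda>k. JS (\<lambda>u. w k) a b \<omega>)" for a b \<omega>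
    using inc by (auto simp: incseq_def intro!: jsum_mono)
  fix Z K assume Z: "Z \<in> borel_measurable (F a)" "\<forall>\<omega>. 0 \<le> Z \<omega> \<and> Z \<omega> \<le> (K::real)"
  have [measurable]: "Z \<in> borel_measurable M" using Z(1) ab measurable_F_M by blast
  have "(\<integral>\<^sup>+\<omega>. ennreal (Z \<omega>) * JS (\<lambda>u x. SUP k. w k x) a b \<omega> \<partial>M)
      = (\<integral>\<^sup>+\<omega>. (SUP k. ennreal (Z \<omega>) * JS (\<lambda>u. w k) a b \<omega>) \<partial>M)"
    unfolding S by (simp add: SUP_mult_left_ennreal)
  also have "\<dots> = (SUP k. \<integral>\<^sup>+\<omega>. ennreal (Z \<omega>) * JS (\<lambda>u. w k) a b \<omega> \<partial>M)"
    by (intro nn_integral_monotone_convergence_SUP)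
       (use incJ in \<open>auto simp: incseq_def le_fun_def intro!: mult_left_mono\<close>)
  also have "\<dots> = (SUP k. (\<integral>\<^sup>+\<omega>. ennreal (Z \<omega>) \<partial>M) * (\<integral>\<^sup>+\<omega>. JS (\<lambda>u. w k) 0 (b - a) \<omega> \<partial>M))"
    using indep_weightD(2)[OF w ab Z(1), of K] Z(2) by (intro SUP_cong refl) simp
  also have "\<dots> = (\<integral>\<^sup>+\<omega>. ennreal (Z \<omega>) \<partial>M) * (SUP k. \<integral>\<^sup>+\<omega>. JS (\<lambda>u. w k) 0 (b - a) \<omega> \<partial>M)"
    by (simp add: SUP_mult_left_ennreal)
  also have "(SUP k. \<integral>\<^sup>+\<omega>. JS (\<lambda>u. w k) 0 (b - a) \<omega> \<partial>M) = (\<integral>\<^sup>+\<omega>. JS (\<lambda>u x. SUP k. w k x) 0 (b - a) \<omega> \<partial>M)"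
    unfolding S by (intro nn_integral_monotone_convergence_SUP[symmetric])
       (use incJ in \<open>auto simp: incseq_def le_fun_def\<close>)
  finally show "(\<integral>\<^sup>+\<omega>. ennreal (Z \<omega>) * JS (\<lambda>u x. SUP k. w k x) a b \<omega> \<partial>M)
    = (\<integral>\<^sup>+\<omega>. ennreal (Z \<omega>) \<partial>M) * (\<integral>\<^sup>+\<omega>. JS (\<lambda>u x. SUP k. w k x) 0 (b - a) \<omega> \<partial>M)" .
qed

text \<open>Second stage: the expected jump sum is evaluated as length times integral over
  \<open>\<nu>\<close>. The factor \<open>Z\<close>, known at time \<open>a\<close>, later becomes
  the integrand on one grid cell.\<close>

definition levy_weight :: "(real^'d \<Rightarrow> ennreal) \<Rightarrow> bool" where
  "levy_weight w \<longleftrightarrow> w \<in> borel_measurable borel \<and>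
    (\<forall>a b. 0 \<le> a \<longrightarrow> a < b \<longrightarrow> (\<lambda>\<omega>. JS (\<lambda>u. w) a b \<omega>) \<in> borel_measurable M \<and>
     (\<forall>Z K. Z \<in> borel_measurable (F a) \<longrightarrow> (\<forall>\<omega>. 0 \<le> Z \<omega> \<and> Z \<omega> \<le> (K::real)) \<longrightarrow>
       (\<integral>\<^sup>+\<omega>. ennreal (Z \<omega>) * JS (\<lambda>u. w) a b \<omega> \<partial>M)
         = (\<integral>\<^sup>+\<omega>. ennreal (Z \<omega>) \<partial>M) * (ennreal (b - a) * (\<integral>\<^sup>+x. w x \<partial>\<nu>))))"

lemma levy_weightD:
  assumes "levy_weight w" "0 \<le> a" "a < b"
  shows "(\<lambda>\<omega>. JS (\<lambda>u. w) a b \<omega>) \<in> borel_measurable M"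
    "Z \<in> borel_measurable (F a) \<Longrightarrow> (\<And>\<omega>. 0 \<le> Z \<omega>) \<Longrightarrow> (\<And>\<omega>. Z \<omega> \<le> K) \<Longrightarrow>
     (\<integral>\<^sup>+\<omega>. ennreal (Z \<omega>) * JS (\<lambda>u. w) a b \<omega> \<partial>M)
         = (\<integral>\<^sup>+\<omega>. ennreal (Z \<omega>) \<partial>M) * (ennreal (b - a) * (\<integral>\<^sup>+x. w x \<partial>\<nu>))"
    "w \<in> borel_measurable borel"
  using assms unfolding levy_weight_def by blast+

lemma levy_weight_SUP:
  assumes w: "\<And>k. levy_weight (w k)" and inc: "\<And>x. incseq (\<lambda>k. w k x)"
  shows "levy_weight (\<lambda>x. SUP k. w k x)"
  unfolding levy_weight_def
proof (intro allI impI conjI)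
  have w_meas: "w k \<in> borel_measurable borel" for k using w[of k] by (simp add: levy_weight_def)
  note [measurable] = w_meas
  show "(\<lambda>x. SUP k. w k x) \<in> borel_measurable borel" by measurable
  fix a b :: real assume ab: "0 \<le> a" "a < b"
  have S: "JS (\<lambda>u x. SUP k. w k x) a b \<omega> = (SUP k. JS (\<lambda>u. w k) a b \<omega>)" for a b \<omega>
    by (rule jsum_SUP) (rule inc)
  note [measurable] = levy_weightD(1)[OF w ab]
  show "(\<lambda>\<omega>. JS (\<lambda>u x. SUP k. w k x) a b \<omega>) \<in> borel_measurable M"
    unfolding S by measurable
  have incJ: "incseq (\<lambda>k. JS (\<lambda>u. w k) a b \<omega>)" for a b \<omega>
    using inc by (auto simp: incseq_def intro!: jsum_mono)
  fix Z K assume Z: "Z \<in> borel_measurable (F a)" "\<forall>\<omega>. 0 \<le> Z \<omega> \<and> Z \<omega> \<le> (K::real)"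
  have [measurable]: "Z \<in> borel_measurable M" using Z(1) ab measurable_F_M by blast
  have "(\<integral>\<^sup>+\<omega>. ennreal (Z \<omega>) * JS (\<lambda>u x. SUP k. w k x) a b \<omega> \<partial>M)
      = (\<integral>\<^sup>+\<omega>. (SUP k. ennreal (Z \<omega>) * JS (\<lambda>u. w k) a b \<omega>) \<partial>M)"
    unfolding S by (simp add: SUP_mult_left_ennreal)
  also have "\<dots> = (SUP k. \<integral>\<^sup>+\<omega>. ennreal (Z \<omega>) * JS (\<lambda>u. w k) a b \<omega> \<partial>M)"
    by (intro nn_integral_monotone_convergence_SUP)
       (use incJ in \<open>auto simp: incseq_def le_fun_def intro!: mult_left_mono\<close>)
  also have "\<dots> = (SUP k. (\<integral>\<^sup>+\<omega>. ennreal (Z \<omega>) \<partial>M) * (ennreal (b - a) * (\<integral>\<^sup>+x. w k x \<partial>\<nu>)))"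
    using levy_weightD(2)[OF w ab Z(1), of K] Z(2) by (intro SUP_cong refl) simp
  also have "\<dots> = (\<integral>\<^sup>+\<omega>. ennreal (Z \<omega>) \<partial>M) * (ennreal (b - a) * (SUP k. (\<integral>\<^sup>+x. w k x \<partial>\<nu>)))"
    by (simp add: SUP_mult_left_ennreal)
  also have "(SUP k. (\<integral>\<^sup>+x. w k x \<partial>\<nu>)) = (\<integral>\<^sup>+x. (SUP k. w k x) \<partial>\<nu>)"
    by (intro nn_integral_monotone_convergence_SUP[symmetric])
       (use inc w_meas in \<open>auto simp: incseq_def le_fun_def measurable_cong_sets[OF sets_\<nu> refl]\<close>)
  finally show "(\<integral>\<^sup>+\<omega>. ennreal (Z \<omega>) * JS (\<lambda>u x. SUP k. w k x) a b \<omega> \<partial>M)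
    = (\<integral>\<^sup>+\<omega>. ennreal (Z \<omega>) \<partial>M) * (ennreal (b - a) * (\<integral>\<^sup>+x. (SUP k. w k x) \<partial>\<nu>))" .
qed

lemma levy_weight_suminf:
  assumes w: "\<And>k. levy_weight (w k)"
  shows "levy_weight (\<lambda>x. \<Sum>k. c * w k x)"
  unfolding levy_weight_def
proof (intro allI impI conjI)
  have w_meas: "w k \<in> borel_measurable borel" for k using w[of k] by (simp add: levy_weight_def)
  note [measurable] = w_meas
  show "(\<lambda>x. \<Sum>k. c * w k x) \<in> borel_measurable borel" by measurable
  fix a b :: real assume ab: "0 \<le> a" "a < b"
  have S: "JS (\<lambda>u x. \<Sum>k. c * w k x) a b \<omega> = (\<Sum>k. c * JS (\<lambda>u. w k) a b \<omega>)" for a b \<omega>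
    by (simp only: jsum_suminf jsum_cmult)
  note [measurable] = levy_weightD(1)[OF w ab]
  show "(\<lambda>\<omega>. JS (\<lambda>u x. \<Sum>k. c * w k x) a b \<omega>) \<in> borel_measurable M"
    unfolding S by measurable
  fix Z K assume Z: "Z \<in> borel_measurable (F a)" "\<forall>\<omega>. 0 \<le> Z \<omega> \<and> Z \<omega> \<le> (K::real)"
  have [measurable]: "Z \<in> borel_measurable M" using Z(1) ab measurable_F_M by blast
  have [measurable]: "w k \<in> borel_measurable \<nu>" for k using w_meas measurable_cong_sets[OF sets_\<nu> refl] by auto
  have "(\<integral>\<^sup>+\<omega>. ennreal (Z \<omega>) * JS (\<lambda>u x. \<Sum>k. c * w k x) a b \<omega> \<partial>M)
      = (\<integral>\<^sup>+\<omega>. (\<Sum>k. c * (ennreal (Z \<omega>) * JS (\<lambda>u. w k) a b \<omega>)) \<partial>M)"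
    unfolding S by (simp add: mult_ac)
  also have "\<dots> = (\<Sum>k. c * ((\<integral>\<^sup>+\<omega>. ennreal (Z \<omega>) \<partial>M) * (ennreal (b - a) * (\<integral>\<^sup>+x. w k x \<partial>\<nu>))))"
    using levy_weightD(2)[OF w ab Z(1), of K] Z(2) by (subst nn_integral_suminf) (auto simp: nn_integral_cmult)
  also have "\<dots> = (\<integral>\<^sup>+\<omega>. ennreal (Z \<omega>) \<partial>M) * (ennreal (b - a) * (\<Sum>k. c * (\<integral>\<^sup>+x. w k x \<partial>\<nu>)))"
    by (simp add: mult_ac)
  also have "(\<Sum>k. c * (\<integral>\<^sup>+x. w k x \<partial>\<nu>)) = (\<integral>\<^sup>+x. (\<Sum>k. c * w k x) \<partial>\<nu>)"
    by (subst nn_integral_suminf) (auto simp: nn_integral_cmult)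
  finally show "(\<integral>\<^sup>+\<omega>. ennreal (Z \<omega>) * JS (\<lambda>u x. \<Sum>k. c * w k x) a b \<omega> \<partial>M)
    = (\<integral>\<^sup>+\<omega>. ennreal (Z \<omega>) \<partial>M) * (ennreal (b - a) * (\<integral>\<^sup>+x. (\<Sum>k. c * w k x) \<partial>\<nu>))" .
qed

text \<open>The indicator of an open superlevel set is the increasing limit of the continuous
  functions \<open>\<phi> k\<close>, and these vanish near 0 because \<open>g\<close> stays below
  \<open>c\<close> there.\<close>

lemma indep_weight_superlevel:
  fixes g :: "real^'d \<Rightarrow> real"
  assumes g: "continuous_on UNIV g" "g 0 = 0" and c: "0 < c"
  shows "indep_weight (indicator {x. c < g x})"
proof -
  define \<phi> where "\<phi> k x = min 1 (real (Suc k) * max 0 (g x - c))" for k x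
  have "isCont g 0" using g(1) by (simp add: continuous_on_eq_continuous_at)
  then have "\<forall>\<^sub>F x in at 0. g x < c"
    using g(2) c by (auto simp: isCont_def intro: order_tendstoD(2))
  then obtain d where d: "0 < d" "\<And>x. x \<noteq> 0 \<Longrightarrow> norm x < d \<Longrightarrow> g x < c"
    unfolding eventually_at by (auto simp: dist_norm)
  have "indep_weight (\<lambda>x. ennreal (\<phi> k x))" for k
    unfolding indep_weight_def
  proof (intro allI impI conjI)
    have c\<phi>: "continuous_on UNIV (\<phi> k)" unfolding \<phi>_def by (intro continuous_intros g)
    have pos: "0 \<le> \<phi> k x" for x by (auto simp: \<phi>_def)
    \<comment> \<open>\<open>jsum_vanishing_indep\<close> wants a strict inequality, so the radius
      from continuity at 0 is halved.\<close>
    have van: "d / 2 < norm x" if "\<phi> k x \<noteq> 0" for x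
    proof -
      have "c < g x"
      proof (rule ccontr)
        assume "\<not> c < g x"
        then have "\<phi> k x = 0" by (simp add: \<phi>_def max_def)
        then show False using that by simp
      qed
      then have "x \<noteq> 0" using g(2) c by auto
      then have "d \<le> norm x" using d(2)[of x] \<open>c < g x\<close> by force
      then show ?thesis using d(1) by linarith
    qed
    fix a b :: real assume ab: "0 \<le> a" "a < b"
    show "(\<lambda>\<omega>. JS (\<lambda>u x. ennreal (\<phi> k x)) a b \<omega>) \<in> borel_measurable M"
      by (rule jsum_vanishing_measurable(2)[OF ab _ c\<phi> pos van]) (use d in auto)
    fix Z K assume Z: "Z \<in> borel_measurable (F a)" "\<forall>\<omega>. 0 \<le> Z \<omega> \<and> Z \<omega> \<le> (K::real)"
    show "(\<integral>\<^sup>+\<omega>. ennreal (Z \<omega>) * JS (\<lambda>u x. ennreal (\<phi> k x)) a b \<omega> \<partial>M)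
         = (\<integral>\<^sup>+\<omega>. ennreal (Z \<omega>) \<partial>M) * (\<integral>\<^sup>+\<omega>. JS (\<lambda>u x. ennreal (\<phi> k x)) 0 (b - a) \<omega> \<partial>M)"
      by (rule jsum_vanishing_indep[OF ab _ c\<phi> pos van Z(1), of K]) (use d Z in auto)
  qed
  moreover have inc: "incseq (\<lambda>k. ennreal (\<phi> k x))" for x
    unfolding \<phi>_def by (intro monoI ennreal_leI min.mono mult_right_mono) auto
  ultimately have "indep_weight (\<lambda>x. SUP k. ennreal (\<phi> k x))"
    by (rule indep_weight_SUP)
  moreover have "(SUP k. ennreal (\<phi> k x)) = indicator {x. c < g x} x" for x
  proof (cases "c < g x")
    case True
    obtain k where k: "1 < real k * (g x - c)" using reals_Archimedean3[of "g x - c"] True by auto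
    have "real k * (g x - c) \<le> real (Suc k) * (g x - c)" using True by (intro mult_right_mono) auto
    with k have "1 \<le> real (Suc k) * (g x - c)" by linarith
    then have "\<phi> k x = 1" using True by (simp add: \<phi>_def del: of_nat_Suc)
    then have "1 \<le> (SUP k. ennreal (\<phi> k x))" by (intro SUP_upper2[of k]) auto
    moreover have "(SUP k. ennreal (\<phi> k x)) \<le> 1" by (intro SUP_least) (auto simp: \<phi>_def)
    ultimately show ?thesis using True by (auto intro: antisym)
  qed (auto simp: \<phi>_def)
  ultimately show ?thesis by simp
qed

text \<open>The expected number \<open>m t\<close> of jumps into \<open>S\<close> up to time
  \<open>t\<close> is additive and monotone in \<open>t\<close>, hence linear, and
  \<open>m 1\<close> is the measure of \<open>S\<close> by the very definition of the Levy
  measure.\<close>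

lemma levy_weight_superlevel:
  fixes g :: "real^'d \<Rightarrow> real"
  assumes g: "continuous_on UNIV g" "g 0 = 0" and c: "0 < c" and fin: "(\<integral>\<^sup>+x. ennreal (g x) \<partial>\<nu>) < \<top>"
  shows "levy_weight (indicator {x. c < g x})"
proof -
  define S where "S = {x. c < g x}"
  have oS: "open S" unfolding S_def using g(1) by (intro open_Collect_less continuous_intros)
  then have [measurable]: "S \<in> sets \<nu>" by (simp add: sets_\<nu>)
  \<comment> \<open>Markov's inequality: a superlevel set at positive height has finite measure, so
    \<open>m\<close> can be treated as real-valued.\<close>
  have "ennreal c * emeasure \<nu> S = (\<integral>\<^sup>+x. ennreal c * indicator S x \<partial>\<nu>)" by (simp add: nn_integral_cmult_indicator)
  also have "\<dots> \<le> (\<integral>\<^sup>+x. ennreal (g x) \<partial>\<nu>)"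
    by (intro nn_integral_mono) (auto simp: S_def indicator_def intro: ennreal_leI)
  finally have finS: "emeasure \<nu> S < \<top>" using fin c by (auto simp: ennreal_mult_less_top top_unique dest!: order.strict_trans1)
  have iw: "indep_weight (indicator S)" unfolding S_def by (rule indep_weight_superlevel[OF g c])
  define m where "m t = (\<integral>\<^sup>+\<omega>. JS (\<lambda>u. indicator S) 0 t \<omega> \<partial>M)" for t
  have iwD: "(\<lambda>\<omega>. JS (\<lambda>u. indicator S) a b \<omega>) \<in> borel_measurable M"
    "(\<integral>\<^sup>+\<omega>. JS (\<lambda>u. indicator S) a b \<omega> \<partial>M) = m (b - a)" if "0 \<le> a" "a < b" for a b
  proof -
    show "(\<lambda>\<omega>. JS (\<lambda>u. indicator S) a b \<omega>) \<in> borel_measurable M"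
      by (rule indep_weightD(1)[OF iw that])
    show "(\<integral>\<^sup>+\<omega>. JS (\<lambda>u. indicator S) a b \<omega> \<partial>M) = m (b - a)"
      using indep_weightD(2)[OF iw that, of "\<lambda>_. 1" 1] by (simp add: emeasure_space_1 m_def)
  qed
  have madd: "m (s + t) = m s + m t" if "0 \<le> s" "0 \<le> t" for s t
  proof (cases "s = 0 \<or> t = 0")
    case True
    have "m 0 = 0" by (simp add: m_def jsum_def)
    then show ?thesis using True by auto
  next
    case False
    then have st: "0 < s" "0 < t" using that by auto
    have "m (s + t) = (\<integral>\<^sup>+\<omega>. JS (\<lambda>u. indicator S) 0 s \<omega> + JS (\<lambda>u. indicator S) s (s + t) \<omega> \<partial>M)"
      unfolding m_def using st by (intro nn_integral_cong jsum_split) auto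
    also have "\<dots> = m s + m t"
      using st iwD(1)[of 0 s] iwD(1)[of s "s + t"] iwD(2)[of s "s + t"]
      by (subst nn_integral_add) (auto simp: m_def)
    finally show ?thesis .
  qed
  have mmono: "m s \<le> m t" if "0 \<le> s" "s \<le> t" for s t
    using madd[of s "t - s"] that by auto
  \<comment> \<open>Since \<open>g 0 = 0 < c\<close>, the origin is outside \<open>S\<close>, and
    its removal in the definition of the Levy measure changes nothing.\<close>
  have m1: "m 1 = emeasure \<nu> S"
    unfolding levy_open[OF oS] m_def
  proof (intro nn_integral_cong)
    fix \<omega>
    have "0 \<notin> S" using g c by (auto simp: S_def)
    then have "JS (\<lambda>u. indicator S) 0 1 \<omega> = (\<integral>\<^sup>+u. indicator {s \<in> {0<..1}. jump (\<lambda>r. L r \<omega>) s \<in> S - {0}} u \<partial>count_space UNIV)"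
      unfolding jsum_def by (intro nn_integral_cong) (auto simp: indicator_def)
    then show "JS (\<lambda>u. indicator S) 0 1 \<omega> = emeasure (count_space UNIV) {s \<in> {0<..1}. jump (\<lambda>r. L r \<omega>) s \<in> S - {0}}"
      by simp
  qed
  \<comment> \<open>Finiteness spreads from time 1 to the integers by additivity, then to all times
    by monotonicity.\<close>
  have mn: "m (real n) < \<top>" for n
  proof (induction n)
    case (Suc n)
    then show ?case using madd[of "real n" 1] m1 finS by (simp add: add.commute)
  qed (simp add: m_def jsum_def)
  have mfin: "m t < \<top>" if "0 \<le> t" for t
    using mmono[OF that] mn real_arch_simple[of t] by (meson order.strict_trans1)
  have "enn2real (m t) = t * enn2real (m 1)" if "0 \<le> t" for t
  proof (rule additive_mono_linear[OF _ _ that])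
    show "enn2real (m (s + t)) = enn2real (m s) + enn2real (m t)" if "0 \<le> s" "0 \<le> t" for s t
      using madd[OF that] mfin that by (simp add: enn2real_plus)
    show "enn2real (m s) \<le> enn2real (m t)" if "0 \<le> s" "s \<le> t" for s t
      using mmono[OF that] mfin[of t] that by (intro enn2real_mono) auto
  qed
  then have lin: "m t = ennreal t * emeasure \<nu> S" if "0 \<le> t" for t
    using that mfin[OF that] mfin[of 1] unfolding m1[symmetric]
    by (metis (no_types) ennreal_enn2real ennreal_mult enn2real_nonneg zero_le_one)
  show ?thesis
    unfolding S_def[symmetric] levy_weight_def
  proof (intro conjI allI impI)
    show "(indicator S :: _ \<Rightarrow> ennreal) \<in> borel_measurable borel" using oS by auto
    fix a b :: real assume ab: "0 \<le> a" "a < b"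
    show "(\<lambda>\<omega>. JS (\<lambda>u. indicator S) a b \<omega>) \<in> borel_measurable M" by (rule iwD[OF ab])
    fix Z K assume Z: "Z \<in> borel_measurable (F a)" "\<forall>\<omega>. 0 \<le> Z \<omega> \<and> Z \<omega> \<le> (K::real)"
    have "(\<integral>\<^sup>+\<omega>. ennreal (Z \<omega>) * JS (\<lambda>u. indicator S) a b \<omega> \<partial>M) = (\<integral>\<^sup>+\<omega>. ennreal (Z \<omega>) \<partial>M) * m (b - a)"
      using indep_weightD(2)[OF iw ab Z(1), of K] Z(2) by (simp add: m_def)
    then show "(\<integral>\<^sup>+\<omega>. ennreal (Z \<omega>) * JS (\<lambda>u. indicator S) a b \<omega> \<partial>M)
         = (\<integral>\<^sup>+\<omega>. ennreal (Z \<omega>) \<partial>M) * (ennreal (b - a) * (\<integral>\<^sup>+x. indicator S x \<partial>\<nu>))"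
      using lin[of "b - a"] ab by simp
  qed
qed

text \<open>\<open>levy_weight\<close> survives scaled sums over the layers and suprema over the
  dyadic levels, so \<open>dyadic_layers\<close> carries it from superlevel sets to
  \<open>g\<close>.\<close>

lemma levy_weight_continuous:
  fixes g :: "real^'d \<Rightarrow> real"
  assumes g: "continuous_on UNIV g" "g 0 = 0" "\<And>x. 0 \<le> g x" and fin: "(\<integral>\<^sup>+x. ennreal (g x) \<partial>\<nu>) < \<top>"
  shows "levy_weight (\<lambda>x. ennreal (g x))"
proof -
  have ind: "indicator {x. real (Suc j) / 2 ^ n < g x} x = (if real (Suc j) / 2 ^ n < g x then 1 else (0::ennreal))" for j n x
    by (simp add: indicator_def del: of_nat_Suc)
  have "levy_weight (\<lambda>x. SUP n. \<Sum>j. ennreal (1 / 2 ^ n) * indicator {x. real (Suc j) / 2 ^ n < g x} x)"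
    by (intro levy_weight_SUP levy_weight_suminf levy_weight_superlevel g fin)
       (simp, unfold ind, rule dyadic_layers(1)[OF g(3)])
  moreover have "(\<lambda>x. SUP n. \<Sum>j. ennreal (1 / 2 ^ n) * indicator {x. real (Suc j) / 2 ^ n < g x} x) = (\<lambda>x. ennreal (g x))"
    unfolding ind by (intro ext dyadic_layers(2)[OF g(3)])
  ultimately show ?thesis by simp
qed


section \<open>Left-continuous adapted integrands and the compensation formula\<close>

definition left_continuous_adapted :: "(real \<Rightarrow> 'a \<Rightarrow> real) \<Rightarrow> bool" where
  "left_continuous_adapted G \<longleftrightarrow> (\<forall>t\<ge>0. G t \<in> borel_measurable (F t)) \<and>
     (\<forall>\<omega>\<in>space M. \<forall>t>0. ((\<lambda>s. G s \<omega>) \<longlongrightarrow> G t \<omega>) (at_left t))"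

lemma left_continuous_adaptedD:
  assumes "left_continuous_adapted G"
  shows "0 \<le> t \<Longrightarrow> G t \<in> borel_measurable (F t)" "0 \<le> t \<Longrightarrow> G t \<in> borel_measurable M"
    "\<omega> \<in> space M \<Longrightarrow> 0 < t \<Longrightarrow> ((\<lambda>s. G s \<omega>) \<longlongrightarrow> G t \<omega>) (at_left t)"
  using assms measurable_F_M unfolding left_continuous_adapted_def by blast+

lemma left_continuous_adapted_compose:
  fixes h :: "real \<Rightarrow> real"
  assumes G: "left_continuous_adapted G" and h: "continuous_on UNIV h"
  shows "left_continuous_adapted (\<lambda>s \<omega>. h (G s \<omega>))"
  unfolding left_continuous_adapted_def
proof (intro conjI ballI allI impI)
  fix t :: real assume "0 \<le> t"
  then have [measurable]: "G t \<in> borel_measurable (F t)" using left_continuous_adaptedD(1)[OF G] by blast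
  have [measurable]: "h \<in> borel_measurable borel" using h by (rule borel_measurable_continuous_onI)
  show "(\<lambda>\<omega>. h (G t \<omega>)) \<in> borel_measurable (F t)" by measurable
next
  fix \<omega> and t :: real assume "\<omega> \<in> space M" "0 < t"
  from left_continuous_adaptedD(3)[OF G this]
  show "((\<lambda>s. h (G s \<omega>)) \<longlongrightarrow> h (G t \<omega>)) (at_left t)"
    by (rule continuous_on_tendsto_compose[OF h]) auto
qed

text \<open>The value is read at the left end of the cell of \<open>u\<close>, so it precedes every
  jump in that cell. \<open>Suc n\<close> keeps the number of cells positive.\<close>

definition gridded :: "(real \<Rightarrow> 'a \<Rightarrow> real) \<Rightarrow> real \<Rightarrow> nat \<Rightarrow> real \<Rightarrow> 'a \<Rightarrow> real" where
  "gridded G t n u \<omega> = G (grid 0 t (Suc n) (grid_index 0 t (Suc n) u)) \<omega>"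

lemma gridded_tendsto:
  assumes "left_continuous_adapted G" "\<omega> \<in> space M" "0 < u" "u \<le> t"
  shows "(\<lambda>n. gridded G t n u \<omega>) \<longlonglongrightarrow> G u \<omega>"
proof -
  have "(\<lambda>n. G (grid 0 t n (grid_index 0 t n u)) \<omega>) \<longlonglongrightarrow> G u \<omega>"
    by (rule filterlim_compose[OF left_continuous_adaptedD(3)[OF assms(1-3)] grid_tendsto_at_left[OF assms(3,4)]])
  then show ?thesis unfolding gridded_def by (rule LIMSEQ_Suc)
qed

lemma gridded_sum:
  fixes k :: "real \<Rightarrow> 'b::semiring_1"
  assumes "0 < t"
  shows "k (grid 0 t (Suc n) (grid_index 0 t (Suc n) u)) * indicator {0<..t} u
    = (\<Sum>i<Suc n. k (grid 0 t (Suc n) i) * indicator {grid 0 t (Suc n) i<..grid 0 t (Suc n) (Suc i)} u)"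
  using sum_grid_indicator[OF assms, of "Suc n" "\<lambda>i. k (grid 0 t (Suc n) i)" u] by simp

text \<open>A pointwise limit of finite sums of cell indicators times random variables. This is the
  joint measurability that Fubini's theorem asks for.\<close>

lemma left_continuous_joint_measurable:
  assumes G: "left_continuous_adapted G" and t: "0 < t"
  shows "(\<lambda>(s, \<omega>). G s \<omega> * indicator {0<..t} s) \<in> borel_measurable (lborel \<Otimes>\<^sub>M M)"
proof (rule borel_measurable_LIMSEQ_metric)
  fix n
  have g0: "0 \<le> grid 0 t (Suc n) i" for i using grid_ge[of 0 t "Suc n" i] t by simp
  note [measurable] = left_continuous_adaptedD(2)[OF G g0]
  show "(\<lambda>(s, \<omega>). gridded G t n s \<omega> * indicator {0<..t} s) \<in> borel_measurable (lborel \<Otimes>\<^sub>M M)"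
    unfolding gridded_def gridded_sum[OF t, of "\<lambda>v. G v _"] by measurable
next
  fix x :: "real \<times> 'a" assume x: "x \<in> space (lborel \<Otimes>\<^sub>M M)"
  obtain s \<omega> where [simp]: "x = (s, \<omega>)" by (cases x)
  have \<omega>: "\<omega> \<in> space M" using x by (auto simp: space_pair_measure)
  show "(\<lambda>n. case x of (s, \<omega>) \<Rightarrow> gridded G t n s \<omega> * indicator {0<..t} s) \<longlonglongrightarrow> (case x of (s, \<omega>) \<Rightarrow> G s \<omega> * indicator {0<..t} s)"
    using gridded_tendsto[OF G \<omega>, of s t] by (cases "s \<in> {0<..t}") (auto simp: tendsto_const)
qed

text \<open>For the step process the jump sum splits over the cells, and \<open>levy_weight\<close>
  applies in each of them with \<open>Z\<close> the value at the left end. The bound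
  \<open>K\<close> provides majorants for all limits: in the jump sum of a path, in its expectation
  and in the time integral.\<close>

lemma compensation_bounded:
  assumes G: "left_continuous_adapted G" "\<And>s \<omega>. 0 \<le> G s \<omega>" "\<And>s \<omega>. G s \<omega> \<le> K" and t: "0 < t"
    and w: "levy_weight w" "\<And>x. w x < \<top>" and fin: "(\<integral>\<^sup>+x. w x \<partial>\<nu>) < \<top>"
  shows "(\<lambda>\<omega>. JS (\<lambda>u x. ennreal (G u \<omega>) * w x) 0 t \<omega>) \<in> borel_measurable M"
    and "(\<integral>\<^sup>+\<omega>. JS (\<lambda>u x. ennreal (G u \<omega>) * w x) 0 t \<omega> \<partial>M)
      = (\<integral>\<^sup>+s. (\<integral>\<^sup>+\<omega>. ennreal (G s \<omega>) \<partial>M) * indicator {0<..t} s \<partial>lborel) * (\<integral>\<^sup>+x. w x \<partial>\<nu>)"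
proof -
  define J where "J n \<omega> = JS (\<lambda>u x. ennreal (gridded G t n u \<omega>) * w x) 0 t \<omega>" for n \<omega>
  define c where "c = (\<integral>\<^sup>+x. w x \<partial>\<nu>)"
  let ?g = "\<lambda>n i. grid 0 t (Suc n) i"
  have g0: "0 \<le> ?g n i" for n i using grid_ge[of 0 t "Suc n" i] t by simp
  have gS: "?g n i < ?g n (Suc i)" "?g n (Suc i) - ?g n i = t / Suc n" for n i
    using grid_step[of "Suc n" 0 t i] t by auto
  note [measurable] = left_continuous_adaptedD(2)[OF G(1) g0]
  note [measurable] = levy_weightD(1)[OF w(1) g0 gS(1)] levy_weightD(1)[OF w(1) order_refl t]
  have Jsum: "J n \<omega> = (\<Sum>i<Suc n. ennreal (G (?g n i) \<omega>) * JS (\<lambda>u. w) (?g n i) (?g n (Suc i)) \<omega>)" for n \<omega>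
  proof -
    have "J n \<omega> = (\<integral>\<^sup>+u. (ennreal (G (?g n (grid_index 0 t (Suc n) u)) \<omega>) * indicator {0<..t} u) * w (jump (\<lambda>t. L t \<omega>) u) \<partial>count_space UNIV)"
      unfolding J_def jsum_def gridded_def by (simp only: mult_ac)
    also have "\<dots> = (\<integral>\<^sup>+u. (\<Sum>i<Suc n. ennreal (G (?g n i) \<omega>) * (w (jump (\<lambda>t. L t \<omega>) u) * indicator {?g n i<..?g n (Suc i)} u)) \<partial>count_space UNIV)"
      unfolding gridded_sum[OF t, of "\<lambda>v. ennreal (G v \<omega>)"] sum_distrib_right by (simp only: mult_ac)
    also have "\<dots> = (\<Sum>i<Suc n. ennreal (G (?g n i) \<omega>) * JS (\<lambda>u. w) (?g n i) (?g n (Suc i)) \<omega>)"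
      unfolding jsum_def by (subst nn_integral_sum) (auto simp: nn_integral_cmult)
    finally show ?thesis .
  qed
  have Jm [measurable]: "J n \<in> borel_measurable M" for n
    unfolding Jsum[abs_def] by measurable
  have EJ: "(\<integral>\<^sup>+\<omega>. J n \<omega> \<partial>M) = (\<integral>\<^sup>+s. (\<integral>\<^sup>+\<omega>. ennreal (gridded G t n s \<omega>) \<partial>M) * indicator {0<..t} s \<partial>lborel) * c" for n
  proof -
    have "(\<integral>\<^sup>+\<omega>. J n \<omega> \<partial>M) = (\<Sum>i<Suc n. (\<integral>\<^sup>+\<omega>. ennreal (G (?g n i) \<omega>) \<partial>M) * (ennreal (t / Suc n) * c))"
      unfolding Jsum c_def
      using levy_weightD(2)[OF w(1) g0 gS(1) left_continuous_adaptedD(1)[OF G(1) g0] G(2,3)] gS(2)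
      by (subst nn_integral_sum) auto
    also have "\<dots> = (\<Sum>i<Suc n. (\<integral>\<^sup>+\<omega>. ennreal (G (?g n i) \<omega>) \<partial>M) * emeasure lborel {?g n i<..?g n (Suc i)}) * c"
      using gS less_imp_le[OF gS(1)] by (simp add: sum_distrib_right mult.assoc del: sum.lessThan_Suc)
    also have "(\<Sum>i<Suc n. (\<integral>\<^sup>+\<omega>. ennreal (G (?g n i) \<omega>) \<partial>M) * emeasure lborel {?g n i<..?g n (Suc i)})
      = (\<integral>\<^sup>+s. (\<Sum>i<Suc n. (\<integral>\<^sup>+\<omega>. ennreal (G (?g n i) \<omega>) \<partial>M) * indicator {?g n i<..?g n (Suc i)} s) \<partial>lborel)"
      by (subst nn_integral_sum) (auto simp: nn_integral_cmult simp del: sum.lessThan_Suc)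
    finally show ?thesis
      unfolding gridded_def gridded_sum[OF t, of "\<lambda>v. \<integral>\<^sup>+\<omega>. ennreal (G v \<omega>) \<partial>M"] .
  qed
  \<comment> \<open>Supplies two majorants: almost every path has a finite \<open>w\<close>-sum, and
    that sum has finite mean.\<close>
  have EK: "(\<integral>\<^sup>+\<omega>. JS (\<lambda>u. w) 0 t \<omega> \<partial>M) < \<top>"
    using levy_weightD(2)[OF w(1) order_refl t, of "\<lambda>_. 1" 1] fin
    by (simp add: emeasure_space_1 ennreal_mult_less_top)
  then have AEfin: "AE \<omega> in M. JS (\<lambda>u. w) 0 t \<omega> < \<top>"
    using nn_integral_PInf_AE[of "\<lambda>\<omega>. JS (\<lambda>u. w) 0 t \<omega>" M] by (auto simp: less_top)
  have lim: "AE \<omega> in M. (\<lambda>n. J n \<omega>) \<longlonglongrightarrow> JS (\<lambda>u x. ennreal (G u \<omega>) * w x) 0 t \<omega>"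
    using AEfin AE_space
  proof eventually_elim
    case (elim \<omega>)
    show ?case
      unfolding J_def jsum_def
    proof (rule nn_integral_dominated_convergence[where w="\<lambda>u. ennreal K * (w (jump (\<lambda>t. L t \<omega>) u) * indicator {0<..t} u)"])
      show "AE u in count_space UNIV. (\<lambda>n. ennreal (gridded G t n u \<omega>) * w (jump (\<lambda>t. L t \<omega>) u) * indicator {0<..t} u)
        \<longlonglongrightarrow> ennreal (G u \<omega>) * w (jump (\<lambda>t. L t \<omega>) u) * indicator {0<..t} u"
      proof (rule AE_I2)
        fix u :: real
        show "(\<lambda>n. ennreal (gridded G t n u \<omega>) * w (jump (\<lambda>t. L t \<omega>) u) * indicator {0<..t} u)
          \<longlonglongrightarrow> ennreal (G u \<omega>) * w (jump (\<lambda>t. L t \<omega>) u) * indicator {0<..t} u"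
        proof (cases "u \<in> {0<..t}")
          case True
          then have "(\<lambda>n. w (jump (\<lambda>t. L t \<omega>) u) * ennreal (gridded G t n u \<omega>)) \<longlonglongrightarrow> w (jump (\<lambda>t. L t \<omega>) u) * ennreal (G u \<omega>)"
            by (intro ennreal_tendsto_cmult w(2) tendsto_ennrealI gridded_tendsto[OF G(1) elim(2)]) auto
          then show ?thesis using True by (simp add: mult.commute)
        qed simp
      qed
      show "(\<integral>\<^sup>+u. ennreal K * (w (jump (\<lambda>t. L t \<omega>) u) * indicator {0<..t} u) \<partial>count_space UNIV) < \<infinity>"
        using elim(1) by (simp add: nn_integral_cmult jsum_def ennreal_mult_less_top)
      show "AE u in count_space UNIV. ennreal (gridded G t n u \<omega>) * w (jump (\<lambda>t. L t \<omega>) u) * indicator {0<..t} u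
        \<le> ennreal K * (w (jump (\<lambda>t. L t \<omega>) u) * indicator {0<..t} u)" for n
        unfolding gridded_def mult.assoc by (intro AE_I2 mult_right_mono ennreal_leI G(3)) simp
    qed auto
  qed
  \<comment> \<open>The limit superior is a measurable version of the jump sum, which completeness
    of \<open>M\<close> makes measurable itself.\<close>
  have ae: "AE \<omega> in M. JS (\<lambda>u x. ennreal (G u \<omega>) * w x) 0 t \<omega> = limsup (\<lambda>n. J n \<omega>)"
    using lim by eventually_elim (auto simp: lim_imp_Limsup)
  show m [measurable]: "(\<lambda>\<omega>. JS (\<lambda>u x. ennreal (G u \<omega>) * w x) 0 t \<omega>) \<in> borel_measurable M"
    by (rule borel_measurable_AE_complete[OF complete_measure_axioms _ ae]) measurable
  have 1: "(\<lambda>n. \<integral>\<^sup>+\<omega>. J n \<omega> \<partial>M) \<longlonglongrightarrow> (\<integral>\<^sup>+\<omega>. JS (\<lambda>u x. ennreal (G u \<omega>) * w x) 0 t \<omega> \<partial>M)"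
  proof (rule nn_integral_dominated_convergence[where w="\<lambda>\<omega>. ennreal K * JS (\<lambda>u. w) 0 t \<omega>"])
    show "(\<integral>\<^sup>+\<omega>. ennreal K * JS (\<lambda>u. w) 0 t \<omega> \<partial>M) < \<infinity>"
      using EK by (simp add: nn_integral_cmult ennreal_mult_less_top)
    show "AE \<omega> in M. J n \<omega> \<le> ennreal K * JS (\<lambda>u. w) 0 t \<omega>" for n
      unfolding J_def jsum_cmult[symmetric] gridded_def
      by (intro AE_I2 jsum_mono mult_right_mono ennreal_leI G(3)) simp
  qed (use lim in auto)
  have Gm: "(\<lambda>s. (\<integral>\<^sup>+\<omega>. ennreal (G s \<omega>) \<partial>M) * indicator {0<..t} s) \<in> borel_measurable lborel"
  proof -
    have "(\<lambda>(s, \<omega>). ennreal (G s \<omega> * indicator {0<..t} s)) \<in> borel_measurable (lborel \<Otimes>\<^sub>M M)"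
      using left_continuous_joint_measurable[OF G(1) t] by (simp add: split_beta)
    then have "(\<lambda>s. \<integral>\<^sup>+\<omega>. ennreal (G s \<omega> * indicator {0<..t} s) \<partial>M) \<in> borel_measurable lborel"
      by (rule borel_measurable_nn_integral)
    moreover have "(\<integral>\<^sup>+\<omega>. ennreal (G s \<omega> * indicator {0<..t} s) \<partial>M) = (\<integral>\<^sup>+\<omega>. ennreal (G s \<omega>) \<partial>M) * indicator {0<..t} s" for s
      by (auto simp: indicator_def)
    ultimately show ?thesis by simp
  qed
  have "(\<lambda>n. \<integral>\<^sup>+s. (\<integral>\<^sup>+\<omega>. ennreal (gridded G t n s \<omega>) \<partial>M) * indicator {0<..t} s \<partial>lborel)
      \<longlonglongrightarrow> (\<integral>\<^sup>+s. (\<integral>\<^sup>+\<omega>. ennreal (G s \<omega>) \<partial>M) * indicator {0<..t} s \<partial>lborel)"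
  proof (rule nn_integral_dominated_convergence[where w="\<lambda>s. ennreal K * indicator {0<..t} s"])
    fix n
    show "(\<lambda>s. (\<integral>\<^sup>+\<omega>. ennreal (gridded G t n s \<omega>) \<partial>M) * indicator {0<..t} s) \<in> borel_measurable lborel"
      unfolding gridded_def gridded_sum[OF t, of "\<lambda>v. \<integral>\<^sup>+\<omega>. ennreal (G v \<omega>) \<partial>M"] by measurable
    have "(\<integral>\<^sup>+\<omega>. ennreal (gridded G t n s \<omega>) \<partial>M) \<le> (\<integral>\<^sup>+\<omega>. ennreal K \<partial>M)" for s
      unfolding gridded_def by (intro nn_integral_mono ennreal_leI G(3))
    then show "AE s in lborel. (\<integral>\<^sup>+\<omega>. ennreal (gridded G t n s \<omega>) \<partial>M) * indicator {0<..t} s \<le> ennreal K * indicator {0<..t} s"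
      by (intro AE_I2 mult_right_mono) (auto simp: emeasure_space_1)
  next
    show "AE s in lborel. (\<lambda>n. (\<integral>\<^sup>+\<omega>. ennreal (gridded G t n s \<omega>) \<partial>M) * indicator {0<..t} s) \<longlonglongrightarrow> (\<integral>\<^sup>+\<omega>. ennreal (G s \<omega>) \<partial>M) * indicator {0<..t} s"
    proof (rule AE_I2)
      fix s :: real
      show "(\<lambda>n. (\<integral>\<^sup>+\<omega>. ennreal (gridded G t n s \<omega>) \<partial>M) * indicator {0<..t} s) \<longlonglongrightarrow> (\<integral>\<^sup>+\<omega>. ennreal (G s \<omega>) \<partial>M) * indicator {0<..t} s"
      proof (cases "s \<in> {0<..t}")
        case True
        have [measurable]: "G s \<in> borel_measurable M" using left_continuous_adaptedD(2)[OF G(1)] True by auto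
        have "(\<lambda>n. \<integral>\<^sup>+\<omega>. ennreal (gridded G t n s \<omega>) \<partial>M) \<longlonglongrightarrow> (\<integral>\<^sup>+\<omega>. ennreal (G s \<omega>) \<partial>M)"
        proof (rule nn_integral_dominated_convergence[where w="\<lambda>_. ennreal K"])
          show "AE \<omega> in M. (\<lambda>n. ennreal (gridded G t n s \<omega>)) \<longlonglongrightarrow> ennreal (G s \<omega>)"
            using True by (intro AE_I2 tendsto_ennrealI gridded_tendsto[OF G(1)]) auto
          show "AE \<omega> in M. ennreal (gridded G t n s \<omega>) \<le> ennreal K" for n
            unfolding gridded_def by (intro AE_I2 ennreal_leI G(3))
          show "(\<lambda>\<omega>. ennreal (gridded G t n s \<omega>)) \<in> borel_measurable M" for n
            unfolding gridded_def by measurable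
        qed (auto simp: emeasure_space_1)
        then show ?thesis using True by simp
      qed simp
    qed
    show "(\<integral>\<^sup>+s. ennreal K * indicator {0<..t} s \<partial>lborel) < \<infinity>"
      using t by (simp add: nn_integral_cmult_indicator ennreal_mult_less_top)
  qed (use Gm in auto)
  then have "(\<lambda>n. \<integral>\<^sup>+\<omega>. J n \<omega> \<partial>M) \<longlonglongrightarrow> (\<integral>\<^sup>+s. (\<integral>\<^sup>+\<omega>. ennreal (G s \<omega>) \<partial>M) * indicator {0<..t} s \<partial>lborel) * c"
    unfolding EJ mult.commute[of _ c] using fin by (intro ennreal_tendsto_cmult) (simp_all add: c_def)
  with 1 show "(\<integral>\<^sup>+\<omega>. JS (\<lambda>u x. ennreal (G u \<omega>) * w x) 0 t \<omega> \<partial>M)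
      = (\<integral>\<^sup>+s. (\<integral>\<^sup>+\<omega>. ennreal (G s \<omega>) \<partial>M) * indicator {0<..t} s \<partial>lborel) * (\<integral>\<^sup>+x. w x \<partial>\<nu>)"
    unfolding c_def by (rule LIMSEQ_unique)
qed


text \<open>The minimum of \<open>G\<close> and \<open>k\<close> is again left-continuous and
  adapted and increases to \<open>G\<close>; monotone convergence holds on both sides, infinite
  values included.\<close>

lemma compensation_nonneg:
  assumes G: "left_continuous_adapted G" "\<And>s \<omega>. 0 \<le> G s \<omega>" and t: "0 < t"
    and w: "levy_weight w" "\<And>x. w x < \<top>" and fin: "(\<integral>\<^sup>+x. w x \<partial>\<nu>) < \<top>"
  shows "(\<lambda>\<omega>. JS (\<lambda>u x. ennreal (G u \<omega>) * w x) 0 t \<omega>) \<in> borel_measurable M"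
    and "(\<integral>\<^sup>+\<omega>. JS (\<lambda>u x. ennreal (G u \<omega>) * w x) 0 t \<omega> \<partial>M)
      = (\<integral>\<^sup>+s. (\<integral>\<^sup>+\<omega>. ennreal (G s \<omega>) \<partial>M) * indicator {0<..t} s \<partial>lborel) * (\<integral>\<^sup>+x. w x \<partial>\<nu>)"
proof -
  define H where "H k s \<omega> = min (G s \<omega>) (real k)" for k s \<omega>
  have H: "left_continuous_adapted (H k)" "0 \<le> H k s \<omega>" "H k s \<omega> \<le> real k" for k s \<omega>
    unfolding H_def using G(2)
    by (auto intro!: left_continuous_adapted_compose[OF G(1), of "\<lambda>x. min x (real k)"] continuous_intros)
  have inc: "incseq (\<lambda>k. ennreal (H k s \<omega>))" for s \<omega>
    by (auto simp: incseq_def H_def intro!: ennreal_leI)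
  have sup: "(SUP k. ennreal (H k s \<omega>)) = ennreal (G s \<omega>)" for s \<omega>
  proof -
    obtain k :: nat where "G s \<omega> \<le> k" using real_arch_simple by blast
    then have "ennreal (G s \<omega>) \<le> (SUP k. ennreal (H k s \<omega>))"
      by (intro SUP_upper2[of k]) (auto simp: H_def)
    moreover have "(SUP k. ennreal (H k s \<omega>)) \<le> ennreal (G s \<omega>)"
      by (intro SUP_least ennreal_leI) (auto simp: H_def)
    ultimately show ?thesis by (rule antisym[rotated])
  qed
  note m = compensation_bounded(1)[OF H t w fin]
  note [measurable] = m
  have S: "JS (\<lambda>u x. ennreal (G u \<omega>) * w x) 0 t \<omega> = (SUP k. JS (\<lambda>u x. ennreal (H k u \<omega>) * w x) 0 t \<omega>)" for \<omega>
    unfolding sup[symmetric] SUP_mult_right_ennreal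
    by (intro jsum_SUP) (use inc in \<open>auto simp: incseq_def intro!: mult_right_mono\<close>)
  show "(\<lambda>\<omega>. JS (\<lambda>u x. ennreal (G u \<omega>) * w x) 0 t \<omega>) \<in> borel_measurable M"
    unfolding S by measurable
  have Hm: "(\<lambda>s. (\<integral>\<^sup>+\<omega>. ennreal (H k s \<omega>) \<partial>M) * indicator {0<..t} s) \<in> borel_measurable lborel" for k
  proof -
    have "(\<lambda>(s, \<omega>). ennreal (H k s \<omega> * indicator {0<..t} s)) \<in> borel_measurable (lborel \<Otimes>\<^sub>M M)"
      using left_continuous_joint_measurable[OF H(1) t] by (simp add: split_beta)
    then have "(\<lambda>s. \<integral>\<^sup>+\<omega>. ennreal (H k s \<omega> * indicator {0<..t} s) \<partial>M) \<in> borel_measurable lborel"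
      by (rule borel_measurable_nn_integral)
    moreover have "(\<integral>\<^sup>+\<omega>. ennreal (H k s \<omega> * indicator {0<..t} s) \<partial>M) = (\<integral>\<^sup>+\<omega>. ennreal (H k s \<omega>) \<partial>M) * indicator {0<..t} s" for s
      by (auto simp: indicator_def)
    ultimately show ?thesis by simp
  qed
  have EG: "(\<integral>\<^sup>+\<omega>. ennreal (G s \<omega>) \<partial>M) * indicator {0<..t} s = (SUP k. (\<integral>\<^sup>+\<omega>. ennreal (H k s \<omega>) \<partial>M) * indicator {0<..t} s)" for s
  proof (cases "s \<in> {0<..t}")
    case True
    then have [measurable]: "H k s \<in> borel_measurable M" for k using left_continuous_adaptedD(2)[OF H(1)] by auto
    have "(\<integral>\<^sup>+\<omega>. ennreal (G s \<omega>) \<partial>M) = (SUP k. \<integral>\<^sup>+\<omega>. ennreal (H k s \<omega>) \<partial>M)"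
      unfolding sup[symmetric]
      by (intro nn_integral_monotone_convergence_SUP) (use inc in \<open>auto simp: incseq_def le_fun_def\<close>)
    then show ?thesis using True by simp
  qed simp
  have "(\<integral>\<^sup>+\<omega>. JS (\<lambda>u x. ennreal (G u \<omega>) * w x) 0 t \<omega> \<partial>M) = (SUP k. \<integral>\<^sup>+\<omega>. JS (\<lambda>u x. ennreal (H k u \<omega>) * w x) 0 t \<omega> \<partial>M)"
    unfolding S
    by (intro nn_integral_monotone_convergence_SUP)
       (use inc in \<open>auto simp: incseq_def le_fun_def intro!: jsum_mono mult_right_mono\<close>)
  also have "\<dots> = (SUP k. (\<integral>\<^sup>+s. (\<integral>\<^sup>+\<omega>. ennreal (H k s \<omega>) \<partial>M) * indicator {0<..t} s \<partial>lborel) * (\<integral>\<^sup>+x. w x \<partial>\<nu>))"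
    by (intro SUP_cong refl compensation_bounded(2)[OF H t w fin])
  also have "\<dots> = (SUP k. (\<integral>\<^sup>+s. (\<integral>\<^sup>+\<omega>. ennreal (H k s \<omega>) \<partial>M) * indicator {0<..t} s \<partial>lborel)) * (\<integral>\<^sup>+x. w x \<partial>\<nu>)"
    by (simp add: SUP_mult_right_ennreal)
  also have "(SUP k. (\<integral>\<^sup>+s. (\<integral>\<^sup>+\<omega>. ennreal (H k s \<omega>) \<partial>M) * indicator {0<..t} s \<partial>lborel))
     = (\<integral>\<^sup>+s. (\<integral>\<^sup>+\<omega>. ennreal (G s \<omega>) \<partial>M) * indicator {0<..t} s \<partial>lborel)"
    unfolding EG
    by (intro nn_integral_monotone_convergence_SUP[symmetric])
       (use inc Hm in \<open>auto simp: incseq_def le_fun_def intro!: mult_right_mono nn_integral_mono\<close>)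
  finally show "(\<integral>\<^sup>+\<omega>. JS (\<lambda>u x. ennreal (G u \<omega>) * w x) 0 t \<omega> \<partial>M)
      = (\<integral>\<^sup>+s. (\<integral>\<^sup>+\<omega>. ennreal (G s \<omega>) \<partial>M) * indicator {0<..t} s \<partial>lborel) * (\<integral>\<^sup>+x. w x \<partial>\<nu>)" .
qed

text \<open>Fubini on the product of \<open>{0<..t}\<close> and the probability space. The last
  clause separates positive and negative parts, the form in which \<open>compensation\<close>
  assembles its answer.\<close>

lemma left_continuous_product_integral:
  assumes H: "left_continuous_adapted H" and t: "0 < t"
    and fin: "(\<integral>\<^sup>+s. (\<integral>\<^sup>+\<omega>. ennreal \<bar>H s \<omega>\<bar> \<partial>M) * indicator {0<..t} s \<partial>lborel) < \<top>"
  shows "AE \<omega> in M. integrable lborel (\<lambda>s. H s \<omega> * indicator {0<..t} s)"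
    and "integrable M (\<lambda>\<omega>. \<integral>s. H s \<omega> * indicator {0<..t} s \<partial>lborel)"
    and "expectation (\<lambda>\<omega>. \<integral>s. H s \<omega> * indicator {0<..t} s \<partial>lborel) = (\<integral>s. expectation (H s) * indicator {0<..t} s \<partial>lborel)"
    and "expectation (\<lambda>\<omega>. \<integral>s. H s \<omega> * indicator {0<..t} s \<partial>lborel)
      = enn2real (\<integral>\<^sup>+s. (\<integral>\<^sup>+\<omega>. ennreal (H s \<omega>) \<partial>M) * indicator {0<..t} s \<partial>lborel)
        - enn2real (\<integral>\<^sup>+s. (\<integral>\<^sup>+\<omega>. ennreal (- H s \<omega>) \<partial>M) * indicator {0<..t} s \<partial>lborel)"
proof -
  interpret P: pair_sigma_finite lborel M ..
  let ?f = "\<lambda>(s, \<omega>). H s \<omega> * indicator {0<..t} s"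
  have m [measurable]: "?f \<in> borel_measurable (lborel \<Otimes>\<^sub>M M)"
    by (rule left_continuous_joint_measurable[OF H t])
  have nn: "(\<integral>\<^sup>+x. ennreal (h (?f x)) \<partial>(lborel \<Otimes>\<^sub>M M)) = (\<integral>\<^sup>+s. (\<integral>\<^sup>+\<omega>. ennreal (h (H s \<omega>)) \<partial>M) * indicator {0<..t} s \<partial>lborel)"
    if [measurable]: "h \<in> borel_measurable borel" and h0: "h 0 = 0" for h :: "real \<Rightarrow> real"
  proof -
    have "(\<integral>\<^sup>+x. ennreal (h (?f x)) \<partial>(lborel \<Otimes>\<^sub>M M)) = (\<integral>\<^sup>+s. \<integral>\<^sup>+\<omega>. ennreal (h (?f (s, \<omega>))) \<partial>M \<partial>lborel)"
      by (rule nn_integral_fst[symmetric]) measurable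
    also have "\<dots> = (\<integral>\<^sup>+s. (\<integral>\<^sup>+\<omega>. ennreal (h (H s \<omega>)) \<partial>M) * indicator {0<..t} s \<partial>lborel)"
      by (intro nn_integral_cong) (auto simp: indicator_def h0)
    finally show ?thesis .
  qed
  have "(\<integral>\<^sup>+x. ennreal (norm (?f x)) \<partial>(lborel \<Otimes>\<^sub>M M)) < \<infinity>"
    using fin nn[of "\<lambda>x. \<bar>x\<bar>"] by (simp add: split_beta)
  then have int: "integrable (lborel \<Otimes>\<^sub>M M) ?f"
    by (intro integrableI_bounded) auto
  show "AE \<omega> in M. integrable lborel (\<lambda>s. H s \<omega> * indicator {0<..t} s)"
    using P.AE_integrable_snd[of "\<lambda>s \<omega>. H s \<omega> * indicator {0<..t} s"] int by simp
  show "integrable M (\<lambda>\<omega>. \<integral>s. H s \<omega> * indicator {0<..t} s \<partial>lborel)"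
    using P.integrable_snd[of "\<lambda>s \<omega>. H s \<omega> * indicator {0<..t} s"] int by simp
  have eq: "expectation (\<lambda>\<omega>. \<integral>s. H s \<omega> * indicator {0<..t} s \<partial>lborel) = (\<integral>x. ?f x \<partial>(lborel \<Otimes>\<^sub>M M))"
    using P.integral_snd[of "\<lambda>s \<omega>. H s \<omega> * indicator {0<..t} s"] int by simp
  show "expectation (\<lambda>\<omega>. \<integral>s. H s \<omega> * indicator {0<..t} s \<partial>lborel) = (\<integral>s. expectation (H s) * indicator {0<..t} s \<partial>lborel)"
    unfolding eq using P.integral_fst[of "\<lambda>s \<omega>. H s \<omega> * indicator {0<..t} s"] int by simp
  show "expectation (\<lambda>\<omega>. \<integral>s. H s \<omega> * indicator {0<..t} s \<partial>lborel)
      = enn2real (\<integral>\<^sup>+s. (\<integral>\<^sup>+\<omega>. ennreal (H s \<omega>) \<partial>M) * indicator {0<..t} s \<partial>lborel)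
        - enn2real (\<integral>\<^sup>+s. (\<integral>\<^sup>+\<omega>. ennreal (- H s \<omega>) \<partial>M) * indicator {0<..t} s \<partial>lborel)"
    unfolding eq real_lebesgue_integral_def[OF int]
    using nn[of "\<lambda>x. x"] nn[of "\<lambda>x. - x"] by simp
qed

text \<open>Splitting \<open>H\<close> and \<open>g\<close> into positive and negative parts reduces
  the signed formula to four nonnegative ones, each of finite expectation.\<close>

theorem compensation:
  fixes g :: "real^'d \<Rightarrow> real"
  assumes H: "left_continuous_adapted H" and t: "0 < t"
    and fin: "(\<integral>\<^sup>+s. (\<integral>\<^sup>+\<omega>. ennreal \<bar>H s \<omega>\<bar> \<partial>M) * indicator {0<..t} s \<partial>lborel) < \<top>"
    and g: "continuous_on UNIV g" "g 0 = 0" "integrable \<nu> g"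
  shows "AE \<omega> in M. integrable (count_space {0<..t}) (\<lambda>u. H u \<omega> * g (jump (\<lambda>r. L r \<omega>) u))"
    and "integrable M (\<lambda>\<omega>. \<integral>u. H u \<omega> * g (jump (\<lambda>r. L r \<omega>) u) \<partial>count_space {0<..t})"
    and "expectation (\<lambda>\<omega>. \<integral>u. H u \<omega> * g (jump (\<lambda>r. L r \<omega>) u) \<partial>count_space {0<..t})
      = (\<integral>s. expectation (H s) * indicator {0<..t} s \<partial>lborel) * (\<integral>x. g x \<partial>\<nu>)"
proof -
  \<comment> \<open>\<open>True\<close> selects the positive part and \<open>False\<close> the
    negative part, so two Boolean indices cover the four sign combinations.\<close>
  define h :: "bool \<Rightarrow> real \<Rightarrow> real" where "h b x = max 0 (if b then x else - x)" for b x
  have h0: "0 \<le> h b x" for b x by (simp add: h_def)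
  have hle: "h b x \<le> \<bar>x\<bar>" for b x by (cases b) (auto simp: h_def)
  have hcont: "continuous_on UNIV (h b)" for b
    unfolding h_def by (cases b) (auto intro!: continuous_intros)
  have hg: "continuous_on UNIV (\<lambda>x. h b (g x))" for b
    by (rule continuous_on_compose2[OF hcont g(1)]) simp
  have hen: "ennreal (h True x) = ennreal x" "ennreal (h False x) = ennreal (- x)" for x
    by (auto simp: h_def ennreal_neg max_def)
  have gfin: "(\<integral>\<^sup>+x. ennreal (h b (g x)) \<partial>\<nu>) < \<top>" for b
  proof -
    have "(\<integral>\<^sup>+x. ennreal (h b (g x)) \<partial>\<nu>) \<le> (\<integral>\<^sup>+x. ennreal (norm (g x)) \<partial>\<nu>)"
      using hle by (intro nn_integral_mono ennreal_leI) simp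
    also have "\<dots> < \<top>" using g(3) by (auto simp: integrable_iff_bounded)
    finally show ?thesis .
  qed
  have w: "levy_weight (\<lambda>x. ennreal (h b (g x)))" for b
    by (rule levy_weight_continuous[OF hg _ h0 gfin]) (simp add: g h_def)
  have Hlc: "left_continuous_adapted (\<lambda>s \<omega>. h b (H s \<omega>))" for b
    by (rule left_continuous_adapted_compose[OF H hcont])
  define X where "X a b \<omega> = JS (\<lambda>u x. ennreal (h a (H u \<omega>)) * ennreal (h b (g x))) 0 t \<omega>" for a b \<omega>
  define hh where "hh a = (\<integral>\<^sup>+s. (\<integral>\<^sup>+\<omega>. ennreal (h a (H s \<omega>)) \<partial>M) * indicator {0<..t} s \<partial>lborel)" for a
  define gg where "gg b = (\<integral>\<^sup>+x. ennreal (h b (g x)) \<partial>\<nu>)" for b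
  have ggfin: "gg b < \<top>" for b unfolding gg_def by (rule gfin)
  have hhfin: "hh a < \<top>" for a
  proof -
    have "hh a \<le> (\<integral>\<^sup>+s. (\<integral>\<^sup>+\<omega>. ennreal \<bar>H s \<omega>\<bar> \<partial>M) * indicator {0<..t} s \<partial>lborel)"
      unfolding hh_def by (intro nn_integral_mono mult_right_mono ennreal_leI hle) simp
    then show ?thesis using fin by (rule order.strict_trans1)
  qed
  have Xm [measurable]: "X a b \<in> borel_measurable M" for a b
    unfolding X_def by (rule compensation_nonneg(1)[OF Hlc h0 t w _ gfin]) simp
  have EX: "(\<integral>\<^sup>+\<omega>. X a b \<omega> \<partial>M) = hh a * gg b" for a b
    unfolding X_def hh_def gg_def by (rule compensation_nonneg(2)[OF Hlc h0 t w _ gfin]) simp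
  have EXfin: "(\<integral>\<^sup>+\<omega>. X a b \<omega> \<partial>M) < \<top>" for a b
    unfolding EX using hhfin ggfin by (simp add: ennreal_mult_less_top)
  have AEX: "AE \<omega> in M. \<forall>a b. X a b \<omega> < \<top>"
  proof -
    have "AE \<omega> in M. X a b \<omega> \<noteq> \<infinity>" for a b
      using EXfin by (intro nn_integral_PInf_AE) (auto simp: less_top)
    then show ?thesis by (simp add: AE_all_countable less_top)
  qed
  have nnc: "(\<integral>\<^sup>+u. f u \<partial>count_space {0<..t}) = (\<integral>\<^sup>+u. f u * indicator {0<..t} u \<partial>count_space UNIV)" for f
    by (simp add: nn_integral_count_space_indicator)
  let ?j = "\<lambda>\<omega> u. jump (\<lambda>r. L r \<omega>) u"
  \<comment> \<open>Equal signs feed the positive part of the product, opposite signs its negative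
    part; at most one summand is nonzero.\<close>
  have prod_split: "ennreal (y * z) = ennreal (h True y) * ennreal (h True z) + ennreal (h False y) * ennreal (h False z)"
    "ennreal (- (y * z)) = ennreal (h True y) * ennreal (h False z) + ennreal (h False y) * ennreal (h True z)"
    for y z
  proof -
    show "ennreal (y * z) = ennreal (h True y) * ennreal (h True z) + ennreal (h False y) * ennreal (h False z)"
      unfolding ennreal_mult[OF h0 h0, symmetric] ennreal_plus[OF mult_nonneg_nonneg[OF h0 h0] mult_nonneg_nonneg[OF h0 h0], symmetric]
      by (cases "0 \<le> y"; cases "0 \<le> z") (auto simp: h_def max_def ennreal_neg mult_nonneg_nonpos mult_nonneg_nonpos2 not_le)
    show "ennreal (- (y * z)) = ennreal (h True y) * ennreal (h False z) + ennreal (h False y) * ennreal (h True z)"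
      unfolding ennreal_mult[OF h0 h0, symmetric] ennreal_plus[OF mult_nonneg_nonneg[OF h0 h0] mult_nonneg_nonneg[OF h0 h0], symmetric]
      by (cases "0 \<le> y"; cases "0 \<le> z") (auto simp: h_def max_def ennreal_neg mult_nonpos_nonpos not_le)
  qed
  have P: "(\<integral>\<^sup>+u. ennreal (H u \<omega> * g (?j \<omega> u)) \<partial>count_space {0<..t}) = X True True \<omega> + X False False \<omega>"
    "(\<integral>\<^sup>+u. ennreal (- (H u \<omega> * g (?j \<omega> u))) \<partial>count_space {0<..t}) = X True False \<omega> + X False True \<omega>" for \<omega>
    unfolding X_def jsum_add[symmetric] prod_split unfolding nnc jsum_def by simp_all
  have int: "integrable (count_space {0<..t}) (\<lambda>u. H u \<omega> * g (?j \<omega> u))" if "\<forall>a b. X a b \<omega> < \<top>" for \<omega>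
    unfolding real_integrable_def P using that by (auto simp: less_top[symmetric])
  show "AE \<omega> in M. integrable (count_space {0<..t}) (\<lambda>u. H u \<omega> * g (jump (\<lambda>r. L r \<omega>) u))"
    using AEX by eventually_elim (rule int)
  define R where "R a b \<omega> = enn2real (X a b \<omega>)" for a b \<omega>
  have Rm [measurable]: "R a b \<in> borel_measurable M" for a b unfolding R_def by measurable
  have nnR: "(\<integral>\<^sup>+\<omega>. ennreal (R a b \<omega>) \<partial>M) = hh a * gg b" for a b
    unfolding EX[symmetric] R_def using AEX by (intro nn_integral_cong_AE) (auto elim!: eventually_mono)
  have Ri: "integrable M (R a b)" for a b
    using nnR hhfin ggfin by (intro integrableI_nonneg) (auto simp: R_def ennreal_mult_less_top)
  have ER: "expectation (R a b) = enn2real (hh a) * enn2real (gg b)" for a b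
    using nnR[of a b] by (subst integral_eq_nn_integral) (auto simp: R_def enn2real_mult)
  have eq: "AE \<omega> in M. (\<integral>u. H u \<omega> * g (?j \<omega> u) \<partial>count_space {0<..t})
      = R True True \<omega> + R False False \<omega> - (R True False \<omega> + R False True \<omega>)"
    using AEX
  proof eventually_elim
    case (elim \<omega>)
    show ?case unfolding real_lebesgue_integral_def[OF int[OF elim]] P R_def
      using elim by (simp add: enn2real_plus)
  qed
  have m: "(\<lambda>\<omega>. \<integral>u. H u \<omega> * g (?j \<omega> u) \<partial>count_space {0<..t}) \<in> borel_measurable M"
    by (rule borel_measurable_AE_complete[OF complete_measure_axioms _ eq]) measurable
  show "integrable M (\<lambda>\<omega>. \<integral>u. H u \<omega> * g (jump (\<lambda>r. L r \<omega>) u) \<partial>count_space {0<..t})"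
    by (subst integrable_cong_AE[OF m _ eq]) (auto intro!: Ri Bochner_Integration.integrable_diff Bochner_Integration.integrable_add)
  have "expectation (\<lambda>\<omega>. \<integral>u. H u \<omega> * g (?j \<omega> u) \<partial>count_space {0<..t})
      = expectation (\<lambda>\<omega>. R True True \<omega> + R False False \<omega> - (R True False \<omega> + R False True \<omega>))"
    by (rule integral_cong_AE[OF m _ eq]) measurable
  also have "\<dots> = (enn2real (hh True) - enn2real (hh False)) * (enn2real (gg True) - enn2real (gg False))"
    using Ri by (simp add: ER algebra_simps)
  also have "enn2real (gg True) - enn2real (gg False) = (\<integral>x. g x \<partial>\<nu>)"
    unfolding gg_def hen real_lebesgue_integral_def[OF g(3)] ..
  also have "enn2real (hh True) - enn2real (hh False) = (\<integral>s. expectation (H s) * indicator {0<..t} s \<partial>lborel)"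
    unfolding hh_def hen left_continuous_product_integral(3)[OF H t fin, symmetric]
    using left_continuous_product_integral(4)[OF H t fin] by simp
  finally show "expectation (\<lambda>\<omega>. \<integral>u. H u \<omega> * g (jump (\<lambda>r. L r \<omega>) u) \<partial>count_space {0<..t})
      = (\<integral>s. expectation (H s) * indicator {0<..t} s \<partial>lborel) * (\<integral>x. g x \<partial>\<nu>)" .
qed

text \<open>The jump at \<open>t\<close> is one summand of every jump sum over
  \<open>{t - t / Suc n<..t}\<close>, whose expectation is proportional to the length of that
  interval and tends to 0.\<close>

lemma no_fixed_jumps:
  fixes g :: "real^'d \<Rightarrow> real"
  assumes g: "continuous_on UNIV g" "g 0 = 0" "\<And>x. 0 \<le> g x" "integrable \<nu> g" and t: "0 < t"
  shows "AE \<omega> in M. g (jump (\<lambda>r. L r \<omega>) t) = 0"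
proof -
  have fin: "(\<integral>\<^sup>+x. ennreal (g x) \<partial>\<nu>) < \<top>" using g(3,4) by (auto simp: integrable_iff_bounded)
  have w: "levy_weight (\<lambda>x. ennreal (g x))" by (rule levy_weight_continuous[OF g(1-3) fin])
  define c where "c = (\<integral>\<^sup>+x. ennreal (g x) \<partial>\<nu>)"
  have lin: "(\<integral>\<^sup>+\<omega>. JS (\<lambda>u x. ennreal (g x)) a b \<omega> \<partial>M) = ennreal (b - a) * c" if "0 \<le> a" "a < b" for a b
    using levy_weightD(2)[OF w that, of "\<lambda>_. 1" 1] by (simp add: emeasure_space_1 c_def)
  define X where "X n \<omega> = JS (\<lambda>u x. ennreal (g x)) (t - t / Suc n) t \<omega>" for n \<omega>
  have X: "X n \<in> borel_measurable M" "(\<integral>\<^sup>+\<omega>. X n \<omega> \<partial>M) = ennreal (t / Suc n) * c" for n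
  proof -
    have "0 \<le> t - t / Suc n" "t - t / Suc n < t" using t by (auto simp: field_simps)
    then show "X n \<in> borel_measurable M" "(\<integral>\<^sup>+\<omega>. X n \<omega> \<partial>M) = ennreal (t / Suc n) * c"
      unfolding X_def using levy_weightD(1)[OF w] lin by auto
  qed
  have le: "ennreal (g (jump (\<lambda>r. L r \<omega>) t)) \<le> X n \<omega>" for n \<omega>
  proof -
    have "ennreal (g (jump (\<lambda>r. L r \<omega>) t)) = (\<integral>\<^sup>+u. ennreal (g (jump (\<lambda>r. L r \<omega>) t)) * indicator {t} u \<partial>count_space UNIV)"
      by (simp add: nn_integral_cmult_indicator)
    also have "\<dots> \<le> X n \<omega>"
      unfolding X_def jsum_def using t by (intro nn_integral_mono) (auto simp: indicator_def)
    finally show ?thesis .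
  qed
  define I where "I \<omega> = (INF n. X n \<omega>)" for \<omega>
  have [measurable]: "I \<in> borel_measurable M" unfolding I_def using X(1) by measurable
  have "(\<integral>\<^sup>+\<omega>. I \<omega> \<partial>M) \<le> ennreal (t / Suc n) * c" for n
    unfolding X(2)[symmetric] I_def by (intro nn_integral_mono INF_lower) simp
  moreover have "(\<lambda>n. c * ennreal (t / Suc n)) \<longlonglongrightarrow> c * ennreal 0"
    using fin unfolding c_def by (intro ennreal_tendsto_cmult tendsto_ennrealI LIMSEQ_Suc[OF inv_n_tendsto])
  ultimately have "(\<integral>\<^sup>+\<omega>. I \<omega> \<partial>M) \<le> c * ennreal 0"
    by (intro tendsto_lowerbound[of _ _ sequentially]) (auto simp: mult.commute)
  then have "(\<integral>\<^sup>+\<omega>. I \<omega> \<partial>M) = 0" by simp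
  then have "AE \<omega> in M. I \<omega> = 0" by (simp add: nn_integral_0_iff_AE)
  then show ?thesis
  proof eventually_elim
    case (elim \<omega>)
    have "ennreal (g (jump (\<lambda>r. L r \<omega>) t)) \<le> I \<omega>" unfolding I_def using le by (intro INF_greatest)
    then show ?case using elim g(3) by (simp add: antisym)
  qed
qed

end

subsection \<open>Lebesgue-Stieltjes integrals and the product formula\<close>

text \<open>Adding measures replaces subtracting them: an equation between differences of increasing
  functions becomes an equality of two sums, and no signed measure is involved.\<close>

definition measure_sum :: "'a measure \<Rightarrow> 'a measure \<Rightarrow> 'a measure" where
  "measure_sum M N = measure_of (space M) (sets M) (\<lambda>A. emeasure M A + emeasure N A)"

lemma space_measure_sum [simp]: "space (measure_sum M N) = space M"
  and sets_measure_sum [simp, measurable_cong]: "sets (measure_sum M N) = sets M"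
  unfolding measure_sum_def
  by (simp_all add: sets.space_closed sets.sigma_sets_eq space_measure_of_conv)

lemma emeasure_measure_sum:
  assumes "sets N = sets M" "A \<in> sets M"
  shows "emeasure (measure_sum M N) A = emeasure M A + emeasure N A"
  unfolding measure_sum_def
proof (rule emeasure_measure_of_sigma[OF sets.sigma_algebra_axioms _ _ assms(2)])
  show "positive (sets M) (\<lambda>A. emeasure M A + emeasure N A)"
    by (auto simp: positive_def)
  show "countably_additive (sets M) (\<lambda>A. emeasure M A + emeasure N A)"
  proof (rule countably_additiveI)
    fix A :: "nat \<Rightarrow> 'a set" assume A: "range A \<subseteq> sets M" "disjoint_family A" "\<Union> (range A) \<in> sets M"
    then have "(\<Sum>i. emeasure M (A i)) = emeasure M (\<Union>i. A i)" "(\<Sum>i. emeasure N (A i)) = emeasure N (\<Union>i. A i)"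
      using assms(1) by (auto intro!: suminf_emeasure)
    then show "(\<Sum>i. emeasure M (A i) + emeasure N (A i)) = emeasure M (\<Union>i. A i) + emeasure N (\<Union>i. A i)"
      by (subst suminf_add[symmetric]) auto
  qed
qed

lemma nn_integral_measure_sum:
  assumes s: "sets N = sets M" and f: "f \<in> borel_measurable M"
  shows "(\<integral>\<^sup>+x. f x \<partial>measure_sum M N) = (\<integral>\<^sup>+x. f x \<partial>M) + (\<integral>\<^sup>+x. f x \<partial>N)"
proof -
  have sp: "space N = space M" using s by (rule sets_eq_imp_space_eq)
  note [measurable_cong] = s
  show ?thesis using f
  proof induction
    case (cong f g)
    then show ?case using sp by (simp cong: nn_integral_cong_simp)
  next
    case (set A)
    then show ?case using s by (simp add: emeasure_measure_sum)
  next
    case (mult u c)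
    note [measurable] = mult.hyps(2)
    have [measurable]: "u \<in> borel_measurable N" using mult.hyps(2) s by (simp cong: measurable_cong_sets)
    show ?case using mult by (simp add: nn_integral_cmult distrib_left)
  next
    case (add u v)
    note [measurable] = add.hyps(1) add.hyps(3)
    have [measurable]: "u \<in> borel_measurable N" "v \<in> borel_measurable N" using add.hyps(1,3) s by (simp_all cong: measurable_cong_sets)
    show ?case using add by (simp add: nn_integral_add add_ac)
  next
    case (seq U)
    note [measurable] = seq.hyps(1)
    have [measurable]: "U i \<in> borel_measurable N" for i using seq.hyps(1) s by (simp cong: measurable_cong_sets)
    have "(\<integral>\<^sup>+x. (SUP i. U i x) \<partial>K) = (SUP i. \<integral>\<^sup>+x. U i x \<partial>K)" if "\<And>i. U i \<in> borel_measurable K" for K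
      by (rule nn_integral_monotone_convergence_SUP[OF seq.hyps(3) that])
    then have eq: "(\<integral>\<^sup>+x. (SUP i. U i x) \<partial>K) = (SUP i. \<integral>\<^sup>+x. U i x \<partial>K)" if "K \<in> {M, N, measure_sum M N}" for K
      using that by auto
    have "(SUP i. (\<integral>\<^sup>+x. U i x \<partial>M) + (\<integral>\<^sup>+x. U i x \<partial>N)) = (SUP i. \<integral>\<^sup>+x. U i x \<partial>M) + (SUP i. \<integral>\<^sup>+x. U i x \<partial>N)"
      using seq.hyps(3) by (intro ennreal_SUP_add) (auto simp: incseq_def le_fun_def intro!: nn_integral_mono)
    then show ?case using seq by (simp add: eq SUP_apply[abs_def] image_comp)
  qed
qed

lemma integral_measure_sum:
  fixes f :: "'a \<Rightarrow> real"
  assumes s: "sets N = sets M" and f: "integrable M f" "integrable N f"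
  shows "integrable (measure_sum M N) f"
    "integral\<^sup>L (measure_sum M N) f = integral\<^sup>L M f + integral\<^sup>L N f"
proof -
  have [measurable]: "f \<in> borel_measurable M" using f by auto
  have nn: "(\<integral>\<^sup>+x. ennreal (h (f x)) \<partial>measure_sum M N) = (\<integral>\<^sup>+x. ennreal (h (f x)) \<partial>M) + (\<integral>\<^sup>+x. ennreal (h (f x)) \<partial>N)"
    if [measurable]: "h \<in> borel_measurable borel" for h :: "real \<Rightarrow> real"
    by (rule nn_integral_measure_sum[OF s]) measurable
  show i: "integrable (measure_sum M N) f"
    using f nn[of abs] by (auto simp: integrable_iff_bounded)
  have "(\<integral>\<^sup>+x. ennreal (f x) \<partial>K) < \<top>" "(\<integral>\<^sup>+x. ennreal (- f x) \<partial>K) < \<top>" if "K \<in> {M, N}" for K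
    using f that by (auto simp: real_integrable_def less_top)
  then show "integral\<^sup>L (measure_sum M N) f = integral\<^sup>L M f + integral\<^sup>L N f"
    unfolding real_lebesgue_integral_def[OF i] real_lebesgue_integral_def[OF f(1)] real_lebesgue_integral_def[OF f(2)]
    using nn[of "\<lambda>x. x"] nn[of uminus] by (simp add: enn2real_plus)
qed

text \<open>Point masses \<open>w u\<close> at the times \<open>u\<close> in \<open>{0<..t}\<close>,
  negative weights being cut to 0 by \<open>ennreal\<close>. The push-forward along the identity
  replaces the sigma-algebra of all subsets by the Borel sets.\<close>

definition discrete_measure :: "(real \<Rightarrow> real) \<Rightarrow> real \<Rightarrow> real measure" where
  "discrete_measure w t = distr (density (count_space {0<..t}) (\<lambda>u. ennreal (w u))) borel (\<lambda>u. u)"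

lemma sets_discrete_measure [simp, measurable_cong]: "sets (discrete_measure w t) = sets borel"
  by (simp add: discrete_measure_def)

lemma emeasure_discrete_measure:
  assumes "S \<in> sets borel"
  shows "emeasure (discrete_measure w t) S = (\<integral>\<^sup>+u. ennreal (w u) * indicator S u \<partial>count_space {0<..t})"
proof -
  have "emeasure (discrete_measure w t) S = emeasure (density (count_space {0<..t}) (\<lambda>u. ennreal (w u))) (S \<inter> {0<..t})"
    unfolding discrete_measure_def using assms by (subst emeasure_distr) auto
  also have "\<dots> = (\<integral>\<^sup>+u. ennreal (w u) * indicator (S \<inter> {0<..t}) u \<partial>count_space {0<..t})"
    by (subst emeasure_density) auto
  also have "\<dots> = (\<integral>\<^sup>+u. ennreal (w u) * indicator S u \<partial>count_space {0<..t})"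
    by (intro nn_integral_cong) (auto simp: indicator_def)
  finally show ?thesis .
qed

lemma integral_discrete_measure:
  fixes f :: "real \<Rightarrow> real"
  assumes w: "\<And>u. 0 \<le> w u" and f: "f \<in> borel_measurable borel"
  shows "integrable (discrete_measure w t) f \<longleftrightarrow> integrable (count_space {0<..t}) (\<lambda>u. w u * f u)"
    "integral\<^sup>L (discrete_measure w t) f = (\<integral>u. w u * f u \<partial>count_space {0<..t})"
  unfolding discrete_measure_def using w f
  by (simp_all add: integrable_distr_eq integral_distr integrable_density integral_density)

text \<open>The norm of \<open>outer x x\<close> is the squared norm of \<open>x\<close>, so the sum
  converges absolutely; it is an integral against counting measure and commutes with taking entries.
  Time 0 drops out, as the convention for \<open>left_lim\<close> makes the jump there 0.\<close>

lemma disc_qv_entry: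
  fixes f :: "real \<Rightarrow> real^'d"
  assumes "integrable (count_space {0<..t}) (\<lambda>u. (norm (jump f u))\<^sup>2)" "0 \<le> t"
  shows "integrable (count_space {0<..t}) (\<lambda>u. jump f u $ k * jump f u $ l)"
    "disc_qv f t $ k $ l = (\<integral>u. jump f u $ k * jump f u $ l \<partial>count_space {0<..t})"
proof -
  let ?o = "\<lambda>u. outer (jump f u) (jump f u)"
  have "norm (outer x x) = (norm x)\<^sup>2" for x :: "real^'d"
  proof -
    have "norm (outer x x) = sqrt (\<Sum>i\<in>UNIV. (norm (x $ i *\<^sub>R x))\<^sup>2)"
      by (simp add: norm_vec_def L2_set_def outer_def vec_eq_iff)
    also have "(\<Sum>i\<in>UNIV. (norm (x $ i *\<^sub>R x))\<^sup>2) = (\<Sum>i\<in>UNIV. (x $ i)\<^sup>2) * (norm x)\<^sup>2"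
      by (simp add: power_mult_distrib sum_distrib_right)
    also have "(\<Sum>i\<in>UNIV. (x $ i)\<^sup>2) = (norm x)\<^sup>2"
      by (simp add: norm_vec_def L2_set_def sum_nonneg)
    finally show ?thesis by (simp only: real_sqrt_abs2 abs_of_nonneg zero_le_power2)
  qed
  then have int: "integrable (count_space {0<..t}) ?o"
    using assms(1) by (intro Bochner_Integration.integrable_bound[OF assms(1)]) auto
  have comp: "integrable (count_space {0<..t}) (\<lambda>u. ?o u $ k $ l)"
    "(\<integral>u. ?o u $ k $ l \<partial>count_space {0<..t}) = (\<integral>u. ?o u \<partial>count_space {0<..t}) $ k $ l"
    using integrable_bounded_linear[OF bounded_linear_compose[OF bounded_linear_vec_nth bounded_linear_vec_nth] int, of k l]
      integral_bounded_linear[OF bounded_linear_compose[OF bounded_linear_vec_nth bounded_linear_vec_nth] int, of k l]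
    by auto
  show "integrable (count_space {0<..t}) (\<lambda>u. jump f u $ k * jump f u $ l)"
    using comp(1) by (simp add: outer_def)
  have "disc_qv f t = infsum ?o {0<..t}"
    unfolding disc_qv_def
    by (rule infsum_cong_neutral) (use assms(2) in \<open>auto simp: jump_def left_lim_def outer_def vec_eq_iff\<close>)
  also have "\<dots> = infsetsum ?o {0<..t}"
    by (rule infsetsum_infsum[symmetric]) (simp add: abs_summable_on_def int)
  also have "\<dots> = (\<integral>u. ?o u \<partial>count_space {0<..t})" by (simp add: infsetsum_def)
  finally show "disc_qv f t $ k $ l = (\<integral>u. jump f u $ k * jump f u $ l \<partial>count_space {0<..t})"
    using comp(2) by (simp add: outer_def)
qed

text \<open>\<open>has_LS_integral\<close> offers some decomposition \<open>p - n\<close> of the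
  integrator, unrelated to the positive and negative parts \<open>wp\<close> and \<open>wn\<close>
  of the jumps. Rearranged, \<open>p\<close> plus the sum of \<open>wn\<close> and \<open>n\<close>
  plus the sum of \<open>wp\<close> have equal increments, hence define the same measure;
  integrating \<open>h\<close> against it and sorting the terms back gives the jump sum.\<close>

lemma LS_integral_jump_sum:
  fixes w h G :: "real \<Rightarrow> real"
  assumes t: "0 \<le> t" and w: "integrable (count_space {0<..t}) w"
    and G: "\<And>s. 0 \<le> s \<Longrightarrow> s \<le> t \<Longrightarrow> G s = (\<integral>u. w u \<partial>count_space {0<..s})"
    and LS: "has_LS_integral h G t I" and h: "\<And>s. s \<in> {0<..t} \<Longrightarrow> \<bar>h s\<bar> \<le> K"
  shows "integrable (count_space {0<..t}) (\<lambda>u. h u * w u)" "I = (\<integral>u. h u * w u \<partial>count_space {0<..t})"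
proof -
  obtain p n where p: "mono p" "\<And>s. continuous (at_right s) p" and n: "mono n" "\<And>s. continuous (at_right s) n"
    and Gpn: "\<And>s. s \<in> {0..t} \<Longrightarrow> G s = p s - n s"
    and ip: "set_integrable (interval_measure p) {0<..t} h" and in': "set_integrable (interval_measure n) {0<..t} h"
    and I: "I = (LINT s:{0<..t}|interval_measure p. h s) - (LINT s:{0<..t}|interval_measure n. h s)"
    using LS unfolding has_LS_integral_def by blast
  \<comment> \<open>Nothing is known about \<open>h\<close> outside \<open>{0<..t}\<close>. Its
    measurability is extracted from integrability against \<open>interval_measure p\<close>, which
    sees only the product with the indicator.\<close>
  define f where "f u = indicator {0<..t} u * h u" for u
  have f_borel [measurable]: "f \<in> borel_measurable borel"
    using borel_measurable_integrable[OF ip[unfolded set_integrable_def]] by (simp add: f_def[abs_def])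
  have hw': "integrable (count_space {0<..t}) (\<lambda>u. v u * f u)" if "integrable (count_space {0<..t}) v" for v
  proof (rule Bochner_Integration.integrable_bound[where f="\<lambda>u. K * \<bar>v u\<bar>"])
    show "AE u in count_space {0<..t}. norm (v u * f u) \<le> norm (K * \<bar>v u\<bar>)"
      unfolding AE_count_space
    proof
      fix u assume u: "u \<in> {0<..t}"
      have "\<bar>v u\<bar> * \<bar>h u\<bar> \<le> \<bar>v u\<bar> * K" by (intro mult_left_mono h u) simp
      moreover have "0 \<le> K" using h[OF u] by simp
      ultimately show "norm (v u * f u) \<le> norm (K * \<bar>v u\<bar>)" using u by (simp add: f_def abs_mult mult.commute)
    qed
  qed (use that in auto)
  have "integrable (count_space {0<..t}) (\<lambda>u. h u * w u) \<longleftrightarrow> integrable (count_space {0<..t}) (\<lambda>u. w u * f u)"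
    by (intro Bochner_Integration.integrable_cong refl) (simp add: f_def mult.commute)
  with hw'[OF w] show "integrable (count_space {0<..t}) (\<lambda>u. h u * w u)" by blast
  define wp where "wp u = max 0 (w u)" for u
  define wn where "wn u = max 0 (- w u)" for u
  have w0: "0 \<le> wp u" "0 \<le> wn u" for u by (auto simp: wp_def wn_def)
  have wpn: "integrable (count_space {0<..t}) wp" "integrable (count_space {0<..t}) wn"
    unfolding wp_def wn_def using w by auto
  have weq: "w u = wp u - wn u" for u by (auto simp: wp_def wn_def)
  define P where "P = density (interval_measure p) (indicator {0<..t})"
  define N where "N = density (interval_measure n) (indicator {0<..t})"
  have sP [simp]: "sets P = sets borel" "sets N = sets borel" by (auto simp: P_def N_def)
  let ?A = "measure_sum P (discrete_measure wn t)" and ?B = "measure_sum N (discrete_measure wp t)"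
  have emP: "emeasure P {a<..b} = ennreal (p (min b t) - p (max 0 a))" "emeasure N {a<..b} = ennreal (n (min b t) - n (max 0 a))"
    if "max 0 a \<le> min b t" for a b
  proof -
    have "{0<..t} \<inter> {a<..b} = {max 0 a<..min b t}" by auto
    then show "emeasure P {a<..b} = ennreal (p (min b t) - p (max 0 a))" "emeasure N {a<..b} = ennreal (n (min b t) - n (max 0 a))"
      unfolding P_def N_def using that p n
      by (simp_all add: emeasure_density indicator_inter_arith[symmetric] emeasure_interval_measure_Ioc monoD del: max.bounded_iff min.bounded_iff)
  qed
  have emP0: "emeasure P {a<..b} = 0" "emeasure N {a<..b} = 0" if "\<not> max 0 a \<le> min b t" for a b
  proof -
    have z: "(\<lambda>x. indicator {0<..t} x * indicator {a<..b} x) = (\<lambda>x. 0::ennreal)"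
      using that by (auto simp: indicator_def fun_eq_iff)
    show "emeasure P {a<..b} = 0"
      unfolding P_def by (subst emeasure_density, simp, simp, unfold z, simp)
    show "emeasure N {a<..b} = 0"
      unfolding N_def by (subst emeasure_density, simp, simp, unfold z, simp)
  qed
  have emW: "emeasure (discrete_measure v t) {a<..b} = ennreal ((\<integral>u. v u \<partial>count_space {0<..min b t}) - (\<integral>u. v u \<partial>count_space {0<..max 0 a}))"
    if ab: "max 0 a \<le> min b t" and v: "integrable (count_space {0<..t}) v" "\<And>u. 0 \<le> v u" for v a b
  proof -
    have iv: "integrable (count_space S) v" if "S \<subseteq> {0<..t}" for S
      using v(1) abs_summable_on_subset[of v "{0<..t}" S] that unfolding abs_summable_on_def by blast
    have sub: "{0<..max 0 a} \<subseteq> {0<..t}" "{0<..min b t} \<subseteq> {0<..t}" "{max 0 a<..min b t} \<subseteq> {0<..t}" using ab by auto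
    have "emeasure (discrete_measure v t) {a<..b} = (\<integral>\<^sup>+u. ennreal (v u) \<partial>count_space {max 0 a<..min b t})"
      by (subst emeasure_discrete_measure, simp, simp add: nn_integral_count_space_indicator)
         (intro nn_integral_cong, auto simp: indicator_def)
    also have "\<dots> = ennreal (\<integral>u. v u \<partial>count_space {max 0 a<..min b t})"
      using iv[OF sub(3)] v(2) by (intro nn_integral_eq_integral) auto
    also have "(\<integral>u. v u \<partial>count_space {max 0 a<..min b t}) = (\<integral>u. v u \<partial>count_space {0<..min b t}) - (\<integral>u. v u \<partial>count_space {0<..max 0 a})"
    proof -
      have un: "{0<..min b t} = {0<..max 0 a} \<union> {max 0 a<..min b t}" using ab by auto
      have "infsetsum v ({0<..max 0 a} \<union> {max 0 a<..min b t}) = infsetsum v {0<..max 0 a} + infsetsum v {max 0 a<..min b t}"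
        by (rule infsetsum_Un_disjoint) (use iv[OF sub(1)] iv[OF sub(3)] in \<open>auto simp: abs_summable_on_def\<close>)
      then show ?thesis unfolding un[symmetric] infsetsum_def by simp
    qed
    finally show ?thesis .
  qed
  \<comment> \<open>Half-open intervals generate the Borel sets and are stable under intersection,
    and both measures are finite on them.\<close>
  have "?A = ?B"
  proof (rule measure_eqI_generator_eq[where E="range (\<lambda>(a, b). {a<..b::real})" and \<Omega>=UNIV and A="\<lambda>i. {- real i<..real i}"])
    show "Int_stable (range (\<lambda>(a, b). {a<..b::real}))"
      by (auto simp: Int_stable_def)
    show "sets ?A = sigma_sets UNIV (range (\<lambda>(a, b). {a<..b}))" "sets ?B = sigma_sets UNIV (range (\<lambda>(a, b). {a<..b}))"
      by (simp_all add: borel_sigma_sets_Ioc)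
    have un: "x \<in> (\<Union>i. {- real i<..real i})" for x :: real
    proof -
      obtain i :: nat where "\<bar>x\<bar> < i" using reals_Archimedean2 by blast
      then show ?thesis by (intro UN_I[of i]) auto
    qed
    then show "(\<Union>i. {- real i<..real i}) = (UNIV :: real set)" by blast
    have em: "emeasure ?A {a<..b} = emeasure ?B {a<..b} \<and> emeasure ?A {a<..b} \<noteq> \<infinity>" for a b
    proof (cases "max 0 a \<le> min b t")
      case True
      let ?Sp = "\<lambda>s. \<integral>u. wp u \<partial>count_space {0<..s}" and ?Sn = "\<lambda>s. \<integral>u. wn u \<partial>count_space {0<..s}"
      have Gs: "?Sp s - ?Sn s = p s - n s" if "0 \<le> s" "s \<le> t" for s
      proof -
        have sub: "{0<..s} \<subseteq> {0<..t}" using that by auto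
        have i: "integrable (count_space {0<..s}) wp" "integrable (count_space {0<..s}) wn"
          using wpn abs_summable_on_subset[OF _ sub] unfolding abs_summable_on_def by blast+
        show ?thesis using G[OF that] Gpn[of s] that i by (simp add: weq)
      qed
      have m: "p (max 0 a) \<le> p (min b t)" "n (max 0 a) \<le> n (min b t)"
        using p(1) n(1) True by (auto intro: monoD)
      have W: "?Sp (max 0 a) \<le> ?Sp (min b t)" "?Sn (max 0 a) \<le> ?Sn (min b t)"
      proof -
        have sub: "{0<..max 0 a} \<subseteq> {0<..min b t}" "{0<..min b t} \<subseteq> {0<..t}" using True by auto
        have "Infinite_Set_Sum.abs_summable_on wp {0<..min b t}" "Infinite_Set_Sum.abs_summable_on wn {0<..min b t}"
          using wpn abs_summable_on_subset[OF _ sub(2)] unfolding abs_summable_on_def by blast+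
        then have "infsetsum wp {0<..max 0 a} \<le> infsetsum wp {0<..min b t}" "infsetsum wn {0<..max 0 a} \<le> infsetsum wn {0<..min b t}"
          using sub(1) w0 by (auto intro!: infsetsum_mono_neutral_left intro: abs_summable_on_subset)
        then show "?Sp (max 0 a) \<le> ?Sp (min b t)" "?Sn (max 0 a) \<le> ?Sn (min b t)" by (simp_all add: infsetsum_def)
      qed
      have "emeasure ?A {a<..b} = ennreal ((p (min b t) - p (max 0 a)) + (?Sn (min b t) - ?Sn (max 0 a)))"
        using m W emP(1)[OF True] emW[OF True wpn(2) w0(2)] by (simp add: emeasure_measure_sum ennreal_plus)
      moreover have "emeasure ?B {a<..b} = ennreal ((n (min b t) - n (max 0 a)) + (?Sp (min b t) - ?Sp (max 0 a)))"
        using m W emP(2)[OF True] emW[OF True wpn(1) w0(1)] by (simp add: emeasure_measure_sum ennreal_plus)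
      \<comment> \<open>After clipping the end points to \<open>{0..t}\<close> this is the equation
        \<open>p - n = ?Sp - ?Sn\<close> at two times, rearranged.\<close>
      moreover have "(p (min b t) - p (max 0 a)) + (?Sn (min b t) - ?Sn (max 0 a)) = (n (min b t) - n (max 0 a)) + (?Sp (min b t) - ?Sp (max 0 a))"
        using Gs[of "min b t"] Gs[of "max 0 a"] True t by auto
      ultimately show ?thesis by simp
    next
      case False
      have "emeasure (discrete_measure v t) {a<..b} = 0" for v
        using False by (subst emeasure_discrete_measure) (auto intro!: nn_integral_zero' simp: AE_count_space indicator_def)
      then show ?thesis using emP0[OF False] by (simp add: emeasure_measure_sum)
    qed
    show "emeasure ?A X = emeasure ?B X" if "X \<in> range (\<lambda>(a, b). {a<..b})" for X
      using em that by auto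
    show "emeasure ?A {- real i<..real i} \<noteq> \<infinity>" for i using em by blast
  qed auto
  moreover have iP: "integrable P f" "integral\<^sup>L P f = (LINT s:{0<..t}|interval_measure p. h s)"
    "integrable N f" "integral\<^sup>L N f = (LINT s:{0<..t}|interval_measure n. h s)"
  proof -
    have P': "P = density (interval_measure p) (\<lambda>x. ennreal (indicator {0<..t} x))" "N = density (interval_measure n) (\<lambda>x. ennreal (indicator {0<..t} x))"
      unfolding P_def N_def by (simp_all add: ennreal_indicator)
    have ff: "indicator {0<..t} x *\<^sub>R f x = indicator {0<..t} x *\<^sub>R h x" for x by (auto simp: f_def indicator_def)
    show "integrable P f" "integrable N f"
      unfolding P' using ip in' by (subst integrable_density; simp add: ff set_integrable_def del: real_scaleR_def)+
    show "integral\<^sup>L P f = (LINT s:{0<..t}|interval_measure p. h s)" "integral\<^sup>L N f = (LINT s:{0<..t}|interval_measure n. h s)"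
      unfolding P' by (subst integral_density; simp add: ff set_lebesgue_integral_def del: real_scaleR_def)+
  qed
  moreover have iW: "integrable (discrete_measure v t) f" "integral\<^sup>L (discrete_measure v t) f = (\<integral>u. v u * f u \<partial>count_space {0<..t})"
    if "integrable (count_space {0<..t}) v" "\<And>u. 0 \<le> v u" for v
    using integral_discrete_measure[OF that(2) f_borel, where t=t] hw'[OF that(1)] by auto
  ultimately have "integral\<^sup>L P f + (\<integral>u. wn u * f u \<partial>count_space {0<..t}) = integral\<^sup>L N f + (\<integral>u. wp u * f u \<partial>count_space {0<..t})"
    using integral_measure_sum(2)[of "discrete_measure wn t" P f] integral_measure_sum(2)[of "discrete_measure wp t" N f]
      iW[OF wpn(1) w0(1)] iW[OF wpn(2) w0(2)] by simp
  then have "I = (\<integral>u. wp u * f u \<partial>count_space {0<..t}) - (\<integral>u. wn u * f u \<partial>count_space {0<..t})"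
    unfolding I iP by linarith
  also have "\<dots> = (\<integral>u. wp u * f u - wn u * f u \<partial>count_space {0<..t})"
    by (rule Bochner_Integration.integral_diff[symmetric]) (intro hw' wpn)+
  also have "\<dots> = (\<integral>u. h u * w u \<partial>count_space {0<..t})"
    by (intro Bochner_Integration.integral_cong refl) (auto simp: f_def weq algebra_simps)
  finally show "I = (\<integral>u. h u * w u \<partial>count_space {0<..t})" .
qed

section \<open>Integration by parts for paths of finite variation\<close>

lemma integrable_measure_sumD:
  fixes f :: "'a \<Rightarrow> real"
  assumes s: "sets N = sets M" and f: "integrable (measure_sum M N) f"
  shows "integrable M f" "integrable N f"
proof -
  have m: "f \<in> borel_measurable M"
    using borel_measurable_integrable[OF f] measurable_cong_sets[OF sets_measure_sum refl] by blast
  then have m': "f \<in> borel_measurable N" using s by (simp cong: measurable_cong_sets)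
  have "(\<integral>\<^sup>+x. ennreal (norm (f x)) \<partial>measure_sum M N) = (\<integral>\<^sup>+x. ennreal (norm (f x)) \<partial>M) + (\<integral>\<^sup>+x. ennreal (norm (f x)) \<partial>N)"
    by (rule nn_integral_measure_sum[OF s]) (use m in measurable)
  then show "integrable M f" "integrable N f"
    using f m m' by (auto simp: integrable_iff_bounded)
qed

text \<open>Fubini on the square, cut along the diagonal. The diagonal belongs to the part
  \<open>v \<le> u\<close>, so common atoms are counted exactly once.\<close>

lemma product_integral_split:
  fixes f g :: "real \<Rightarrow> real"
  assumes fin: "finite_measure \<mu>" and s [measurable_cong]: "sets \<mu> = sets borel" and f: "integrable \<mu> f" and g: "integrable \<mu> g"
  shows "integrable \<mu> (\<lambda>v. g v * (\<integral>u. f u * indicator {..<v} u \<partial>\<mu>))"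
    "integrable \<mu> (\<lambda>u. f u * (\<integral>v. g v * indicator {..u} v \<partial>\<mu>))"
    "(\<integral>u. f u \<partial>\<mu>) * (\<integral>v. g v \<partial>\<mu>) = (\<integral>v. g v * (\<integral>u. f u * indicator {..<v} u \<partial>\<mu>) \<partial>\<mu>)
      + (\<integral>u. f u * (\<integral>v. g v * indicator {..u} v \<partial>\<mu>) \<partial>\<mu>)"
proof -
  interpret finite_measure \<mu> by fact
  interpret P: pair_sigma_finite \<mu> \<mu> ..
  have [measurable]: "f \<in> borel_measurable \<mu>" "g \<in> borel_measurable \<mu>" using f g by auto
  have F: "integrable (\<mu> \<Otimes>\<^sub>M \<mu>) (\<lambda>(u, v). f u * g v)"
    by (rule P.Fubini_integrable) (use f g in \<open>auto simp: abs_mult\<close>)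
  have A [measurable]: "{p. fst p < snd p} \<in> sets (\<mu> \<Otimes>\<^sub>M \<mu>)"
  proof -
    have "{p \<in> space (\<mu> \<Otimes>\<^sub>M \<mu>). fst p < (snd p :: real)} \<in> sets (\<mu> \<Otimes>\<^sub>M \<mu>)" by measurable
    moreover have "space \<mu> = UNIV" using sets_eq_imp_space_eq[OF s] by simp
    ultimately show ?thesis by (simp add: space_pair_measure)
  qed
  have F1: "integrable (\<mu> \<Otimes>\<^sub>M \<mu>) (\<lambda>(u, v). f u * g v * indicator {p. fst p < snd p} (u, v))"
    using integrable_real_mult_indicator[OF A F] by (simp add: split_beta')
  have F2: "integrable (\<mu> \<Otimes>\<^sub>M \<mu>) (\<lambda>(u, v). f u * g v - f u * g v * indicator {p. fst p < snd p} (u, v))"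
    using Bochner_Integration.integrable_diff[OF F F1] by (simp add: split_beta')
  have e1: "(\<integral>u. f u * g v * indicator {p. fst p < snd p} (u, v) \<partial>\<mu>) = g v * (\<integral>u. f u * indicator {..<v} u \<partial>\<mu>)" for v
    by (subst integral_mult_right_zero[symmetric], rule Bochner_Integration.integral_cong) (auto simp: indicator_def)
  have e2: "(\<integral>v. f u * g v - f u * g v * indicator {p. fst p < snd p} (u, v) \<partial>\<mu>) = f u * (\<integral>v. g v * indicator {..u} v \<partial>\<mu>)" for u
    by (subst integral_mult_right_zero[symmetric], rule Bochner_Integration.integral_cong) (auto simp: indicator_def)
  show "integrable \<mu> (\<lambda>v. g v * (\<integral>u. f u * indicator {..<v} u \<partial>\<mu>))"
    using P.integrable_snd[OF F1] unfolding e1 .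
  show "integrable \<mu> (\<lambda>u. f u * (\<integral>v. g v * indicator {..u} v \<partial>\<mu>))"
    using P.integrable_fst[OF F2] unfolding e2 .
  have "(\<integral>u. f u \<partial>\<mu>) * (\<integral>v. g v \<partial>\<mu>) = (\<integral>p. (case p of (u, v) \<Rightarrow> f u * g v) \<partial>(\<mu> \<Otimes>\<^sub>M \<mu>))"
    using P.integral_fst[OF F] by simp
  also have "\<dots> = (\<integral>p. (case p of (u, v) \<Rightarrow> f u * g v * indicator {p. fst p < snd p} (u, v)) + (case p of (u, v) \<Rightarrow> f u * g v - f u * g v * indicator {p. fst p < snd p} (u, v)) \<partial>(\<mu> \<Otimes>\<^sub>M \<mu>))"
    by (intro Bochner_Integration.integral_cong) auto
  also have "\<dots> = (\<integral>v. g v * (\<integral>u. f u * indicator {..<v} u \<partial>\<mu>) \<partial>\<mu>)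
      + (\<integral>u. f u * (\<integral>v. g v * indicator {..u} v \<partial>\<mu>) \<partial>\<mu>)"
    unfolding Bochner_Integration.integral_add[OF F1 F2] P.integral_snd[OF F1, symmetric] P.integral_fst[OF F2, symmetric] e1 e2 ..
  finally show "(\<integral>u. f u \<partial>\<mu>) * (\<integral>v. g v \<partial>\<mu>) = (\<integral>v. g v * (\<integral>u. f u * indicator {..<v} u \<partial>\<mu>) \<partial>\<mu>)
      + (\<integral>u. f u * (\<integral>v. g v * indicator {..u} v \<partial>\<mu>) \<partial>\<mu>)" .
qed

text \<open>Dominated convergence. An atom at \<open>v\<close> is not seen from the left, hence the
  open half-line in the limit.\<close>

lemma cumulative_integral_left_limit:
  fixes f :: "real \<Rightarrow> real"
  assumes s [measurable_cong]: "sets \<mu> = sets borel" and f: "integrable \<mu> f"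
  shows "((\<lambda>s. \<integral>u. f u * indicator {..s} u \<partial>\<mu>) \<longlongrightarrow> (\<integral>u. f u * indicator {..<v} u \<partial>\<mu>)) (at_left v)"
proof (rule tendsto_at_left_sequentially[of "v - 1"])
  fix S assume S: "\<And>n. S n < v" "incseq S" "S \<longlonglongrightarrow> v"
  have [measurable]: "f \<in> borel_measurable \<mu>" using f by auto
  show "(\<lambda>n. \<integral>u. f u * indicator {..S n} u \<partial>\<mu>) \<longlonglongrightarrow> (\<integral>u. f u * indicator {..<v} u \<partial>\<mu>)"
  proof (rule integral_dominated_convergence[where w="\<lambda>u. \<bar>f u\<bar>"])
    show "AE u in \<mu>. (\<lambda>n. f u * indicator {..S n} u) \<longlonglongrightarrow> f u * indicator {..<v} u"
    proof (rule AE_I2)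
      fix u
      have "\<forall>\<^sub>F n in sequentially. f u * indicator {..S n} u = f u * indicator {..<v} u"
      proof (cases "u < v")
        case True
        then have "\<forall>\<^sub>F n in sequentially. u < S n" by (rule order_tendstoD(1)[OF S(3)])
        then show ?thesis by eventually_elim (use True in auto)
      next
        case False
        then have "\<not> u \<le> S n" for n using S(1)[of n] by linarith
        then show ?thesis using False by auto
      qed
      then show "(\<lambda>n. f u * indicator {..S n} u) \<longlonglongrightarrow> f u * indicator {..<v} u"
        by (rule tendsto_eventually)
    qed
    show "AE u in \<mu>. norm (f u * indicator {..S n} u) \<le> \<bar>f u\<bar>" for n
      by (auto simp: indicator_def)
  qed (use f in auto)
qed auto

lemma integral_count_space_Iic:
  fixes j :: "real \<Rightarrow> real"
  assumes "s \<le> t"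
  shows "(\<integral>u. j u * indicator {..s} u \<partial>count_space {0<..t}) = (\<integral>u. j u \<partial>count_space {0<..s})"
proof -
  have "infsetsum (\<lambda>u. j u * indicator {..s} u) {0<..t} = infsetsum j {0<..s}"
    by (rule infsetsum_cong_neutral) (use assms in auto)
  then show ?thesis by (simp add: infsetsum_def)
qed

text \<open>Both paths become integrals of densities with respect to one finite measure
  \<open>\<mu>\<close>, Lebesgue measure on \<open>{0<..t}\<close> plus atoms at the jump times. The
  product of two such integrals is then cut by \<open>product_integral_split\<close>.\<close>

theorem finite_variation_product:
  fixes x y :: "real \<Rightarrow> real"
  assumes t: "0 < t"
    and d: "integrable lborel (\<lambda>u. d1 u * indicator {0<..t} u)" "integrable lborel (\<lambda>u. d2 u * indicator {0<..t} u)"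
    and j: "integrable (count_space {0<..t}) j1" "integrable (count_space {0<..t}) j2"
    and x: "\<And>s. 0 \<le> s \<Longrightarrow> s \<le> t \<Longrightarrow> x s = x 0 + (\<integral>u. d1 u * indicator {0<..s} u \<partial>lborel) + (\<integral>u. j1 u \<partial>count_space {0<..s})"
    and y: "\<And>s. 0 \<le> s \<Longrightarrow> s \<le> t \<Longrightarrow> y s = y 0 + (\<integral>u. d2 u * indicator {0<..s} u \<partial>lborel) + (\<integral>u. j2 u \<partial>count_space {0<..s})"
  shows "x t * y t = x 0 * y 0
      + (\<integral>s. (left_lim x s * d2 s + left_lim y s * d1 s) * indicator {0<..t} s \<partial>lborel)
      + (\<integral>u. left_lim x u * j2 u + left_lim y u * j1 u + j1 u * j2 u \<partial>count_space {0<..t})"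
    and "\<And>s. 0 < s \<Longrightarrow> s \<le> t \<Longrightarrow> jump x s = j1 s"
proof -
  \<comment> \<open>A summable mass that vanishes in \<open>{0<..t}\<close> only where both jumps
    vanish, so either jump is \<open>c\<close> times a density.\<close>
  define c where "c u = (if u \<in> {0<..t} then \<bar>j1 u\<bar> + \<bar>j2 u\<bar> else 0)" for u
  have c0: "0 \<le> c u" for u by (simp add: c_def)
  \<comment> \<open>One density serves both parts of \<open>\<mu>\<close>: the atoms form a
    countable and hence Lebesgue-null set, and off the atoms the discrete part has no mass.\<close>
  define f where "f d j u = (if c u = 0 then d u * indicator {0<..t} u else j u / c u)" for d j :: "real \<Rightarrow> real" and u
  define P where "P = density lborel (\<lambda>u. ennreal (indicator {0<..t} u))"
  define Q where "Q = discrete_measure c t"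
  define \<mu> where "\<mu> = measure_sum P Q"
  have sets [measurable_cong, simp]: "sets P = sets borel" "sets Q = sets borel" "sets \<mu> = sets borel"
    by (simp_all add: P_def Q_def \<mu>_def)
  have ci: "integrable (count_space {0<..t}) c"
  proof -
    have "integrable (count_space {0<..t}) (\<lambda>u. \<bar>j1 u\<bar> + \<bar>j2 u\<bar>)" using j by auto
    then show ?thesis by (rule Bochner_Integration.integrable_cong[THEN iffD1, rotated 2]) (auto simp: c_def)
  qed
  have J: "countable {u. c u \<noteq> 0}"
  proof -
    have "{u. c u \<noteq> 0} = {u \<in> {0<..t}. c u \<noteq> 0}" by (auto simp: c_def)
    moreover have "Infinite_Set_Sum.abs_summable_on c {0<..t}" using ci by (simp add: abs_summable_on_def)
    ultimately show ?thesis using abs_summable_countable[of c "{0<..t}"] abs_summable_equivalent[of c "{0<..t}"] by simp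
  qed
  have fborel: "f d j \<in> borel_measurable borel" if "integrable lborel (\<lambda>u. d u * indicator {0<..t} u)" for d j
  proof (rule measurable_discrete_difference[of "\<lambda>u. d u * indicator {0<..t} u" borel borel "{u. c u \<noteq> 0}"])
    show "(\<lambda>u. d u * indicator {0<..t} u) \<in> borel_measurable borel" using borel_measurable_integrable[OF that] by simp
  qed (use J in \<open>auto simp: f_def\<close>)
  have intP: "integrable P h \<longleftrightarrow> integrable lborel (\<lambda>u. h u * indicator {0<..t} u)"
    "integral\<^sup>L P h = (\<integral>u. h u * indicator {0<..t} u \<partial>lborel)" if "h \<in> borel_measurable borel" for h :: "real \<Rightarrow> real"
    unfolding P_def using that by (simp_all add: integrable_density integral_density mult.commute)
  have intQ: "integrable Q h \<longleftrightarrow> integrable (count_space {0<..t}) (\<lambda>u. c u * h u)"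
    "integral\<^sup>L Q h = (\<integral>u. c u * h u \<partial>count_space {0<..t})" if "h \<in> borel_measurable borel" for h :: "real \<Rightarrow> real"
    unfolding Q_def using integral_discrete_measure[OF c0 that] by auto
  have AEJ: "AE u in lborel. c u = 0"
    by (rule AE_I'[of "{u. c u \<noteq> 0}"]) (use J countable_imp_null_set_lborel in auto)
  have cf: "c u * f d j u = j u" if "u \<in> {0<..t}" "j \<in> {j1, j2}" for u d j
  proof (cases "c u = 0")
    case True
    then have "\<bar>j1 u\<bar> + \<bar>j2 u\<bar> = 0" using that by (simp add: c_def)
    then have "j1 u = 0" "j2 u = 0" by linarith+
    then show ?thesis using that True by auto
  qed (simp add: f_def)
  have fP: "(\<integral>u. f d j u * h u * indicator {0<..t} u \<partial>lborel) = (\<integral>u. d u * h u * indicator {0<..t} u \<partial>lborel)"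
    "integrable lborel (\<lambda>u. f d j u * h u * indicator {0<..t} u) \<longleftrightarrow> integrable lborel (\<lambda>u. d u * h u * indicator {0<..t} u)"
    if d: "integrable lborel (\<lambda>u. d u * indicator {0<..t} u)" and h [measurable]: "h \<in> borel_measurable borel" for d j h
  proof -
    note [measurable] = fborel[OF d] borel_measurable_integrable[OF d]
    have eq: "(\<lambda>u. d u * h u * indicator {0<..t} u) = (\<lambda>u. (d u * indicator {0<..t} u) * h u)" by auto
    have [measurable]: "(\<lambda>u. d u * h u * indicator {0<..t} u) \<in> borel_measurable lborel" unfolding eq by measurable
    have ae: "AE u in lborel. f d j u * h u * indicator {0<..t} u = d u * h u * indicator {0<..t} u"
      using AEJ by eventually_elim (auto simp: f_def indicator_def)
    show "(\<integral>u. f d j u * h u * indicator {0<..t} u \<partial>lborel) = (\<integral>u. d u * h u * indicator {0<..t} u \<partial>lborel)"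
      by (rule integral_cong_AE[OF _ _ ae]) measurable
    show "integrable lborel (\<lambda>u. f d j u * h u * indicator {0<..t} u) \<longleftrightarrow> integrable lborel (\<lambda>u. d u * h u * indicator {0<..t} u)"
      by (rule integrable_cong_AE[OF _ _ ae]) measurable
  qed
  have fQ: "(\<integral>u. c u * (f d j u * h u) \<partial>count_space {0<..t}) = (\<integral>u. j u * h u \<partial>count_space {0<..t})"
    "integrable (count_space {0<..t}) (\<lambda>u. c u * (f d j u * h u)) \<longleftrightarrow> integrable (count_space {0<..t}) (\<lambda>u. j u * h u)"
    if "j \<in> {j1, j2}" for d j h
  proof -
    have *: "c u * (f d j u * h u) = j u * h u" if "u \<in> {0<..t}" for u
      using cf[OF that \<open>j \<in> {j1, j2}\<close>, of d] by (simp add: mult.assoc[symmetric])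
    show "(\<integral>u. c u * (f d j u * h u) \<partial>count_space {0<..t}) = (\<integral>u. j u * h u \<partial>count_space {0<..t})"
      by (intro Bochner_Integration.integral_cong refl) (use * in auto)
    show "integrable (count_space {0<..t}) (\<lambda>u. c u * (f d j u * h u)) \<longleftrightarrow> integrable (count_space {0<..t}) (\<lambda>u. j u * h u)"
      by (intro Bochner_Integration.integrable_cong refl) (use * in auto)
  qed
  have f\<mu>: "integrable lborel (\<lambda>u. d u * h u * indicator {0<..t} u)" "integrable (count_space {0<..t}) (\<lambda>u. j u * h u)"
    "(\<integral>u. f d j u * h u \<partial>\<mu>) = (\<integral>u. d u * h u * indicator {0<..t} u \<partial>lborel) + (\<integral>u. j u * h u \<partial>count_space {0<..t})"
    if d: "integrable lborel (\<lambda>u. d u * indicator {0<..t} u)" and h [measurable]: "h \<in> borel_measurable borel"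
      and j: "j \<in> {j1, j2}" and i: "integrable \<mu> (\<lambda>u. f d j u * h u)" for d j h
  proof -
    note [measurable] = fborel[OF d]
    have "integrable P (\<lambda>u. f d j u * h u)" "integrable Q (\<lambda>u. f d j u * h u)"
      using integrable_measure_sumD[of Q P] i by (auto simp: \<mu>_def)
    then show "integrable lborel (\<lambda>u. d u * h u * indicator {0<..t} u)" "integrable (count_space {0<..t}) (\<lambda>u. j u * h u)"
      "(\<integral>u. f d j u * h u \<partial>\<mu>) = (\<integral>u. d u * h u * indicator {0<..t} u \<partial>lborel) + (\<integral>u. j u * h u \<partial>count_space {0<..t})"
      unfolding \<mu>_def
      by (simp_all add: integral_measure_sum(2) intP intQ fP[OF d h] fQ[OF j])
  qed
  have fi: "integrable \<mu> (f d j)" if d: "integrable lborel (\<lambda>u. d u * indicator {0<..t} u)" and jj: "j \<in> {j1, j2}" for d j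
  proof -
    note [measurable] = fborel[OF d, of j]
    have "integrable P (f d j)" using d fP(2)[OF d, of "\<lambda>_. 1" j] by (subst intP) simp_all
    moreover have "integrable Q (f d j)" using j jj fQ(2)[OF jj, of d "\<lambda>_. 1"] by (subst intQ) auto
    ultimately show ?thesis unfolding \<mu>_def by (intro integral_measure_sum) auto
  qed
  have fin: "finite_measure \<mu>"
  proof
    have "emeasure P (space P) < \<infinity>" using t by (simp add: P_def emeasure_density ennreal_indicator)
    moreover have "emeasure Q (space Q) = (\<integral>\<^sup>+u. ennreal (c u) \<partial>count_space {0<..t})"
      using emeasure_discrete_measure[of UNIV c t] by (simp add: Q_def discrete_measure_def)
    then have "emeasure Q (space Q) < \<infinity>" using ci c0 by (auto simp: integrable_iff_bounded)
    moreover have "space P = UNIV" "space Q = UNIV" by (simp_all add: P_def Q_def discrete_measure_def)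
    ultimately show "emeasure \<mu> (space \<mu>) \<noteq> \<infinity>" by (simp add: \<mu>_def emeasure_measure_sum less_top)
  qed
  \<comment> \<open>\<open>X\<close> integrates up to and including \<open>s\<close>,
    \<open>Xm\<close> strictly below \<open>s\<close>: the value of the path and its left
    limit.\<close>
  define X where "X z d j s = z + (\<integral>u. f d j u * indicator {..s} u \<partial>\<mu>)" for z d j s
  define Xm where "Xm z d j s = z + (\<integral>u. f d j u * indicator {..<s} u \<partial>\<mu>)" for z d j s
  have X: "X z d j s = z + (\<integral>u. d u * indicator {0<..s} u \<partial>lborel) + (\<integral>u. j u \<partial>count_space {0<..s})"
    if d: "integrable lborel (\<lambda>u. d u * indicator {0<..t} u)" and jj: "j \<in> {j1, j2}" and s: "0 \<le> s" "s \<le> t" for z d j s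
  proof -
    have i: "integrable \<mu> (\<lambda>u. f d j u * indicator {..s} u)" by (intro integrable_real_mult_indicator fi d jj) simp
    have "(\<integral>u. d u * indicator {..s} u * indicator {0<..t} u \<partial>lborel) = (\<integral>u. d u * indicator {0<..s} u \<partial>lborel)"
      by (intro Bochner_Integration.integral_cong) (use s in \<open>auto simp: indicator_def\<close>)
    then show ?thesis unfolding X_def using f\<mu>(3)[OF d _ jj i] integral_count_space_Iic[OF s(2), of j] by simp
  qed
  have Xx: "X (x 0) d1 j1 s = x s" "X (y 0) d2 j2 s = y s" if "0 \<le> s" "s \<le> t" for s
    using x[OF that] y[OF that] X[OF d(1) _ that] X[OF d(2) _ that] by auto
  have ll: "left_lim x s = Xm (x 0) d1 j1 s" "left_lim y s = Xm (y 0) d2 j2 s" if s: "0 < s" "s \<le> t" for s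
  proof -
    have ev: "\<forall>\<^sub>F r in at_left s. 0 \<le> r \<and> r \<le> t"
      using eventually_at_left_real[OF s(1)] by eventually_elim (use s in auto)
    have "((\<lambda>s. X z d j s) \<longlongrightarrow> Xm z d j s) (at_left s)"
      if "integrable lborel (\<lambda>u. d u * indicator {0<..t} u)" "j \<in> {j1, j2}" for z d j
      unfolding X_def Xm_def by (intro tendsto_add tendsto_const cumulative_integral_left_limit fi that) simp
    from this[OF d(1), of j1 "x 0"] this[OF d(2), of j2 "y 0"]
    have 1: "(X (x 0) d1 j1 \<longlongrightarrow> Xm (x 0) d1 j1 s) (at_left s)" and 2: "(X (y 0) d2 j2 \<longlongrightarrow> Xm (y 0) d2 j2 s) (at_left s)" by auto
    have "\<forall>\<^sub>F r in at_left s. X (x 0) d1 j1 r = x r" "\<forall>\<^sub>F r in at_left s. X (y 0) d2 j2 r = y r"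
      using ev by (auto elim!: eventually_mono simp: Xx)
    then have "(x \<longlongrightarrow> Xm (x 0) d1 j1 s) (at_left s)" "(y \<longlongrightarrow> Xm (y 0) d2 j2 s) (at_left s)"
      using Lim_transform_eventually[OF 1] Lim_transform_eventually[OF 2] by auto
    then show "left_lim x s = Xm (x 0) d1 j1 s" "left_lim y s = Xm (y 0) d2 j2 s"
      using s by (auto intro!: left_lim_eqI)
  qed
  have XXm: "X z d j s = Xm z d j s + j s" if d: "integrable lborel (\<lambda>u. d u * indicator {0<..t} u)" and jj: "j \<in> {j1, j2}" and s: "0 < s" "s \<le> t" for z d j s
  proof -
    note [measurable] = fborel[OF d, of j]
    have i: "integrable \<mu> (\<lambda>u. f d j u * indicator {s} u)" "integrable \<mu> (\<lambda>u. f d j u * indicator {..<s} u)"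
      by (intro integrable_real_mult_indicator fi d jj; simp)+
    have "(\<integral>u. f d j u * indicator {..s} u \<partial>\<mu>) = (\<integral>u. f d j u * indicator {..<s} u + f d j u * indicator {s} u \<partial>\<mu>)"
      by (intro Bochner_Integration.integral_cong) (auto simp: indicator_def)
    also have "\<dots> = (\<integral>u. f d j u * indicator {..<s} u \<partial>\<mu>) + (\<integral>u. f d j u * indicator {s} u \<partial>\<mu>)"
      using i by simp
    also have "(\<integral>u. f d j u * indicator {s} u \<partial>\<mu>) = j s"
    proof -
      have "(\<integral>u. d u * indicator {s} u * indicator {0<..t} u \<partial>lborel) = 0"
        using AE_lborel_singleton[of s] by (intro integral_eq_zero_AE) (auto elim: eventually_mono)
      moreover have "infsetsum (\<lambda>u. j u * indicator {s} u) {0<..t} = infsetsum j {s}"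
        by (rule infsetsum_cong_neutral) (use s in auto)
      ultimately show ?thesis using f\<mu>(3)[OF d _ jj i(1)] by (simp add: infsetsum_def[symmetric])
    qed
    finally show ?thesis by (simp add: X_def Xm_def)
  qed
  show "jump x s = j1 s" if "0 < s" "s \<le> t" for s
    using XXm[OF d(1) _ that, of j1 "x 0"] ll[OF that] Xx[of s] that by (simp add: jump_def)
  note split = product_integral_split[OF fin sets(3) fi[OF d(1), of j1] fi[OF d(2), of j2]]
  have f1: "integrable \<mu> (f d1 j1)" and f2: "integrable \<mu> (f d2 j2)" using fi d by auto
  let ?f1 = "f d1 j1" and ?f2 = "f d2 j2"
  have Xt: "X z d j t = z + (\<integral>u. f d j u \<partial>\<mu>)" if d: "integrable lborel (\<lambda>u. d u * indicator {0<..t} u)" and jj: "j \<in> {j1, j2}" for z d j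
    using f\<mu>(3)[OF d, of "\<lambda>_. 1"] fi[OF d jj] X[OF d jj, of t z] t jj by simp
  have i1: "integrable \<mu> (\<lambda>v. ?f2 v * Xm (x 0) d1 j1 v)"
    unfolding Xm_def distrib_left using split(1) f2 by (intro Bochner_Integration.integrable_add integrable_mult_left) auto
  have i2: "integrable \<mu> (\<lambda>v. ?f1 v * X (y 0) d2 j2 v)"
    unfolding X_def distrib_left using split(2) f1 by (intro Bochner_Integration.integrable_add integrable_mult_left) auto
  have "x t * y t = (x 0 + (\<integral>u. ?f1 u \<partial>\<mu>)) * (y 0 + (\<integral>u. ?f2 u \<partial>\<mu>))"
    using Xx[of t] Xt[OF d(1), of j1 "x 0"] Xt[OF d(2), of j2 "y 0"] t by simp
  also have "\<dots> = x 0 * y 0 + (\<integral>v. ?f2 v * Xm (x 0) d1 j1 v \<partial>\<mu>) + (\<integral>v. ?f1 v * X (y 0) d2 j2 v \<partial>\<mu>)"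
    unfolding Xm_def X_def distrib_left using split f1 f2 by (simp add: algebra_simps)
  finally have main: "x t * y t = x 0 * y 0 + (\<integral>v. ?f2 v * Xm (x 0) d1 j1 v \<partial>\<mu>) + (\<integral>v. ?f1 v * X (y 0) d2 j2 v \<partial>\<mu>)" .
  show "x t * y t = x 0 * y 0
      + (\<integral>s. (left_lim x s * d2 s + left_lim y s * d1 s) * indicator {0<..t} s \<partial>lborel)
      + (\<integral>u. left_lim x u * j2 u + left_lim y u * j1 u + j1 u * j2 u \<partial>count_space {0<..t})"
  proof -
    interpret finite_measure \<mu> by fact
    have Xm_borel: "Xm z d j \<in> borel_measurable borel" "X z d j \<in> borel_measurable borel"
      if "integrable lborel (\<lambda>u. d u * indicator {0<..t} u)" for z d j
    proof -
      note [measurable] = fborel[OF that, of j]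
      have 1: "indicator {..<s} u = (if u < s then 1 else (0::real))" "indicator {..s} u = (if u \<le> s then 1 else (0::real))" for s u
        by auto
      show "Xm z d j \<in> borel_measurable borel" "X z d j \<in> borel_measurable borel"
        unfolding Xm_def X_def 1 by measurable
    qed
    note A = f\<mu>[OF d(2) Xm_borel(1)[OF d(1)] _ i1] and B = f\<mu>[OF d(1) Xm_borel(2)[OF d(2)] _ i2]
    \<comment> \<open>In the drift part the value may be replaced by the left limit, as the two
      differ at countably many times only.\<close>
    have ae: "AE u in lborel. d1 u * X (y 0) d2 j2 u * indicator {0<..t} u = d1 u * left_lim y u * indicator {0<..t} u"
      using AEJ
    proof eventually_elim
      case (elim u)
      then have "u \<in> {0<..t} \<Longrightarrow> j2 u = 0" by (auto simp: c_def)
      then show ?case using XXm[OF d(2), of j2 u "y 0"] ll(2)[of u] by (auto simp: indicator_def)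
    qed
    have eq2: "d2 v * Xm (x 0) d1 j1 v * indicator {0<..t} v = d2 v * left_lim x v * indicator {0<..t} v" for v
      using ll(1)[of v] by (auto simp: indicator_def)
    have m: "(\<lambda>u. d1 u * left_lim y u * indicator {0<..t} u) \<in> borel_measurable lborel"
    proof -
      have "(\<lambda>u. d1 u * left_lim y u * indicator {0<..t} u) = (\<lambda>u. (d1 u * indicator {0<..t} u) * Xm (y 0) d2 j2 u)"
        using ll(2) by (auto simp: indicator_def fun_eq_iff)
      then show ?thesis using borel_measurable_integrable[OF d(1)] Xm_borel(1)[OF d(2), of "y 0" j2] by simp
    qed
    have m': "(\<lambda>u. d1 u * X (y 0) d2 j2 u * indicator {0<..t} u) \<in> borel_measurable lborel"
      using B(1) by auto
    have L1: "integrable lborel (\<lambda>u. d1 u * left_lim y u * indicator {0<..t} u)"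
      "(\<integral>u. d1 u * X (y 0) d2 j2 u * indicator {0<..t} u \<partial>lborel) = (\<integral>u. d1 u * left_lim y u * indicator {0<..t} u \<partial>lborel)"
      using integrable_cong_AE[OF m' m ae] integral_cong_AE[OF m' m ae] B(1) by auto
    have L2: "integrable lborel (\<lambda>u. d2 u * left_lim x u * indicator {0<..t} u)"
      using A(1) unfolding eq2 by simp
    have L: "(\<integral>u. d2 u * Xm (x 0) d1 j1 u * indicator {0<..t} u \<partial>lborel) + (\<integral>u. d1 u * X (y 0) d2 j2 u * indicator {0<..t} u \<partial>lborel)
      = (\<integral>s. (left_lim x s * d2 s + left_lim y s * d1 s) * indicator {0<..t} s \<partial>lborel)"
      unfolding L1(2) eq2 Bochner_Integration.integral_add[OF L2 L1(1), symmetric]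
      by (intro Bochner_Integration.integral_cong) (auto simp: algebra_simps)
    \<comment> \<open>In the jump part the difference matters: the value is the left limit plus
      \<open>j2\<close>, which produces the term \<open>j1 * j2\<close>.\<close>
    have C: "(\<integral>u. j2 u * Xm (x 0) d1 j1 u \<partial>count_space {0<..t}) + (\<integral>u. j1 u * X (y 0) d2 j2 u \<partial>count_space {0<..t})
      = (\<integral>u. left_lim x u * j2 u + left_lim y u * j1 u + j1 u * j2 u \<partial>count_space {0<..t})"
      using A(2) B(2)
      by (subst Bochner_Integration.integral_add[symmetric], simp, simp, intro Bochner_Integration.integral_cong)
         (auto simp: ll XXm[OF d(2)] algebra_simps)
    show ?thesis unfolding main using A(3) B(3) L C by simp
  qed
qed

subsection \<open>Square roots of positive definite matrices\<close>

lemma matrix_mult_diff_right: "A ** (B - C) = A ** B - A ** (C :: real^'n^'m)"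
  by (simp add: matrix_matrix_mult_def vec_eq_iff right_diff_distrib sum_subtractf)

lemma matrix_mult_diff_left: "(A - B) ** C = A ** C - B ** (C :: real^'n^'m)"
  by (simp add: matrix_matrix_mult_def vec_eq_iff left_diff_distrib sum_subtractf)

lemma matrix_mult_add_left: "(A + B) ** C = A ** C + B ** (C :: real^'n^'m)"
  by (simp add: matrix_matrix_mult_def vec_eq_iff distrib_right sum.distrib)

lemma matrix_mult_scaleR_left: "(c *\<^sub>R A) ** B = c *\<^sub>R (A ** (B :: real^'n^'m))"
  by (simp add: matrix_matrix_mult_def vec_eq_iff sum_distrib_left mult.assoc)

lemma matrix_mult_scaleR_right: "A ** (c *\<^sub>R B) = c *\<^sub>R (A ** (B :: real^'n^'m))"
  by (simp add: matrix_matrix_mult_def vec_eq_iff sum_distrib_left mult_ac)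

lemma tendsto_matrix_mult [tendsto_intros]:
  fixes f :: "'x \<Rightarrow> real^'n^'m" and g :: "'x \<Rightarrow> real^'p^'n"
  assumes "(f \<longlongrightarrow> a) F" "(g \<longlongrightarrow> b) F"
  shows "((\<lambda>x. f x ** g x) \<longlongrightarrow> a ** b) F"
  unfolding matrix_matrix_mult_def
  by (intro vec_tendstoI) (auto intro!: tendsto_sum tendsto_mult tendsto_vec_nth assms)

lemma tendsto_transpose [tendsto_intros]:
  fixes f :: "'x \<Rightarrow> real^'n^'m"
  assumes "(f \<longlongrightarrow> a) F"
  shows "((\<lambda>x. transpose (f x)) \<longlongrightarrow> transpose a) F"
  unfolding transpose_def by (intro vec_tendstoI) (auto intro!: tendsto_vec_nth assms)

lemma tendsto_matrix_vector_mult [tendsto_intros]: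
  fixes f :: "'x \<Rightarrow> real^'n^'m"
  assumes "(f \<longlongrightarrow> a) F" "(g \<longlongrightarrow> b) F"
  shows "((\<lambda>x. f x *v g x) \<longlongrightarrow> a *v b) F"
  unfolding matrix_vector_mult_def
  by (intro vec_tendstoI) (auto intro!: tendsto_sum tendsto_mult tendsto_vec_nth assms)

lemma symmetric_inner: "transpose A = A \<Longrightarrow> x \<bullet> (A *v y) = (A *v x) \<bullet> (y::real^'n)"
  by (metis dot_lmul_matrix vector_transpose_matrix)

lemma symmetric_entry: "transpose A = A \<Longrightarrow> A $ i $ j = A $ j $ i"
  by (metis transpose_def vec_lambda_beta)

text \<open>Matrices carry the Euclidean norm of their entries. In its inner product a left factor
  acts column by column, so bounds on quadratic forms transfer to matrices.\<close>

lemma inner_matrix_columns: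
  fixes D :: "real^'n^'n"
  shows "inner D (S ** D) = (\<Sum>j\<in>UNIV. column j D \<bullet> (S *v column j D))"
  unfolding inner_vec_def column_def matrix_matrix_mult_def matrix_vector_mult_def
  by (simp) (rule sum.swap)

lemma norm_matrix_columns:
  fixes D :: "real^'n^'n"
  shows "(norm D)\<^sup>2 = (\<Sum>j\<in>UNIV. (norm (column j D))\<^sup>2)"
  unfolding power2_norm_eq_inner inner_vec_def column_def by simp (rule sum.swap)

lemma inner_matrix_rows:
  fixes D :: "real^'n^'n"
  assumes "transpose R = R"
  shows "inner D (D ** R) = (\<Sum>i\<in>UNIV. row i D \<bullet> (R *v row i D))"
  unfolding inner_vec_def row_def matrix_matrix_mult_def matrix_vector_mult_def
  by (simp add: symmetric_entry[OF assms, of _ _] mult.commute)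

text \<open>With \<open>D = S - R\<close> one has \<open>S D + D R = S S - R R\<close>. Pairing with
  \<open>D\<close>, the first term is at least \<open>\<delta>\<close> times the squared norm of
  \<open>D\<close> and the second is nonnegative. This one estimate yields both uniqueness and
  continuity of the root.\<close>

lemma psd_root_distance:
  fixes S R :: "real^'n^'n"
  assumes S: "\<And>y. \<delta> * (norm y)\<^sup>2 \<le> y \<bullet> (S *v y)" and R: "psd R"
  shows "\<delta> * norm (S - R) \<le> norm (S ** S - R ** R)"
proof (cases "S = R")
  case False
  let ?D = "S - R"
  have "S ** ?D + ?D ** R = S ** S - R ** R"
    by (simp add: matrix_mult_diff_right matrix_mult_diff_left)
  then have "inner ?D (S ** S - R ** R) = inner ?D (S ** ?D) + inner ?D (?D ** R)"
    by (simp only: inner_add_right[symmetric])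
  moreover have "\<delta> * (norm ?D)\<^sup>2 \<le> inner ?D (S ** ?D)"
    unfolding inner_matrix_columns norm_matrix_columns sum_distrib_left by (intro sum_mono S)
  moreover have "0 \<le> inner ?D (?D ** R)"
    using R by (subst inner_matrix_rows) (auto simp: psd_def intro!: sum_nonneg)
  ultimately have "\<delta> * (norm ?D)\<^sup>2 \<le> inner ?D (S ** S - R ** R)" by linarith
  also have "\<dots> \<le> norm ?D * norm (S ** S - R ** R)" by (rule norm_cauchy_schwarz)
  finally have "norm ?D * (\<delta> * norm ?D) \<le> norm ?D * norm (S ** S - R ** R)" by (simp add: power2_eq_square algebra_simps)
  then show ?thesis using False by (simp add: mult_le_cancel_left)
qed simp

text \<open>For a symmetric matrix the quadratic form controls the operator norm: polarization with
  a vector parallel to \<open>T *v x\<close>, then the parallelogram law.\<close>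

lemma symmetric_norm_bound:
  fixes T :: "real^'n^'n"
  assumes sym: "transpose T = T" and r: "\<And>x. \<bar>x \<bullet> (T *v x)\<bar> \<le> r * (norm x)\<^sup>2"
  shows "norm (T *v x) \<le> r * norm x"
proof (cases "T *v x = 0 \<or> x = 0")
  case True
  have "0 \<le> r * (norm x)\<^sup>2" using r[of x] by linarith
  then have "0 \<le> r * norm x"
    by (cases "x = 0") (auto simp: zero_le_mult_iff dest: order.trans)
  then show ?thesis using True by auto
next
  case False
  \<comment> \<open>Rescales \<open>T *v x\<close> to the length of \<open>x\<close>, so that its
    inner product with \<open>T *v x\<close> is the product of both norms.\<close>
  define c where "c = norm x / norm (T *v x)"
  define z where "z = c *\<^sub>R (T *v x)"
  have nz: "norm z = norm x" using False by (simp add: z_def c_def)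
  have "4 * (z \<bullet> (T *v x)) = (z + x) \<bullet> (T *v (z + x)) - (z - x) \<bullet> (T *v (z - x))"
    using symmetric_inner[OF sym, of z x] symmetric_inner[OF sym, of x z]
    by (simp add: matrix_vector_right_distrib matrix_vector_mult_diff_distrib inner_diff_left inner_diff_right inner_add_left inner_add_right inner_commute)
  also have "\<dots> \<le> r * (norm (z + x))\<^sup>2 + r * (norm (z - x))\<^sup>2"
    using r[of "z + x"] r[of "z - x"] by linarith
  also have "\<dots> = 4 * (r * (norm x)\<^sup>2)"
  proof -
    have "(norm (z + x))\<^sup>2 + (norm (z - x))\<^sup>2 = 2 * (norm z)\<^sup>2 + 2 * (norm x)\<^sup>2"
      by (simp add: power2_norm_eq_inner inner_add_left inner_add_right inner_diff_left inner_diff_right inner_commute)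
    then show ?thesis using nz by (simp add: distrib_left[symmetric])
  qed
  finally have "z \<bullet> (T *v x) \<le> r * (norm x)\<^sup>2" by simp
  moreover have "z \<bullet> (T *v x) = norm x * norm (T *v x)"
    using False by (simp add: z_def c_def dot_square_norm power2_eq_square)
  ultimately have "norm x * norm (T *v x) \<le> norm x * (r * norm x)" by (simp add: power2_eq_square algebra_simps)
  then show ?thesis using False by (simp add: mult_le_cancel_left)
qed

text \<open>The operator bound of the left factor acts on each column, while the product is measured
  in the entrywise norm, the one used for the contraction below.\<close>

lemma norm_matrix_mult_le:
  fixes X Z :: "real^'n^'n"
  assumes "\<And>x. norm (X *v x) \<le> r * norm x" "0 \<le> r"
  shows "norm (X ** Z) \<le> r * norm Z"
proof -
  have c: "column j (X ** Z) = X *v column j Z" for j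
    by (simp add: column_def matrix_matrix_mult_def matrix_vector_mult_def vec_eq_iff)
  have "(norm (X ** Z))\<^sup>2 \<le> (\<Sum>j\<in>UNIV. (r * norm (column j Z))\<^sup>2)"
    unfolding norm_matrix_columns c by (intro sum_mono power_mono assms) simp
  also have "\<dots> = (r * norm Z)\<^sup>2"
    by (simp add: power_mult_distrib norm_matrix_columns[of Z] sum_distrib_left)
  finally show ?thesis using assms(2) by (simp add: power2_le_iff_abs_le)
qed

lemma norm_transpose: "norm (transpose A) = norm (A :: real^'n^'m)"
proof -
  have "(norm (transpose A))\<^sup>2 = (norm A)\<^sup>2"
    unfolding power2_norm_eq_inner inner_vec_def transpose_def by simp (rule sum.swap)
  then show ?thesis by simp
qed

text \<open>The minimum of the quadratic form over the compact unit sphere, extended by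
  homogeneity.\<close>

lemma posdef_lower_bound:
  fixes V :: "real^'n^'n"
  assumes "posdef V"
  shows "\<exists>c>0. \<forall>x. c * (norm x)\<^sup>2 \<le> x \<bullet> (V *v x)"
proof -
  have "continuous_on (sphere 0 1) (\<lambda>x::real^'n. x \<bullet> (V *v x))"
    by (intro continuous_intros linear_continuous_on_compose[OF continuous_on_id] matrix_vector_mul_linear)
  moreover have "sphere (0::real^'n) 1 \<noteq> {}"
    using norm_axis_1[of undefined] by (auto simp: set_eq_iff intro!: exI[of _ "axis undefined 1"])
  ultimately obtain y where y: "y \<in> sphere (0::real^'n) 1" "\<And>x. x \<in> sphere 0 1 \<Longrightarrow> y \<bullet> (V *v y) \<le> x \<bullet> (V *v x)"
    using continuous_attains_inf[OF compact_sphere] by blast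
  define c where "c = y \<bullet> (V *v y)"
  have "y \<noteq> 0" using y(1) by auto
  then have "0 < c" using assms by (simp add: c_def posdef_def)
  moreover have "c * (norm x)\<^sup>2 \<le> x \<bullet> (V *v x)" for x
  proof (cases "x = 0")
    case False
    have "c \<le> (inverse (norm x) *\<^sub>R x) \<bullet> (V *v (inverse (norm x) *\<^sub>R x))"
      unfolding c_def using False by (intro y(2)) simp
    also have "\<dots> = (x \<bullet> (V *v x)) / (norm x)\<^sup>2"
      by (simp add: matrix_vector_mult_scaleR power2_eq_square field_simps)
    finally show ?thesis using False by (simp add: field_simps)
  qed simp
  ultimately show ?thesis by blast
qed

text \<open>A positive definite \<open>V\<close> is \<open>\<lambda> (I - T)\<close> with \<open>T\<close> of operator norm below 1. The fixed point \<open>X\<close> of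
  the contraction \<open>X \<mapsto> (T + X\<^sup>2) / 2\<close> satisfies \<open>(I - X)\<^sup>2 = I - T\<close>.\<close>

lemma posdef_root_exists:
  fixes V :: "real^'n^'n"
  assumes V: "posdef V"
  shows "\<exists>S \<delta>. psd S \<and> S ** S = V \<and> 0 < \<delta> \<and> (\<forall>y. \<delta> * (norm y)\<^sup>2 \<le> y \<bullet> (S *v y))"
proof -
  have symV: "transpose V = V" using V by (simp add: posdef_def)
  obtain c where c: "0 < c" "\<And>x. c * (norm x)\<^sup>2 \<le> x \<bullet> (V *v x)" using posdef_lower_bound[OF V] by blast
  \<comment> \<open>Adding \<open>c\<close> to the operator norm makes \<open>l\<close> positive and
    at least \<open>c\<close>, so that \<open>r = 1 - c / l\<close> lies in
    \<open>{0..<1}\<close>.\<close>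
  define l where "l = onorm ((*v) V) + c"
  have on: "norm (V *v x) \<le> onorm ((*v) V) * norm x" for x
    by (rule onorm[OF matrix_vector_mul_bounded_linear])
  have on0: "0 \<le> onorm ((*v) V)" by (rule onorm_pos_le[OF matrix_vector_mul_bounded_linear])
  have l: "0 < l" "c \<le> l" using on0 c by (auto simp: l_def)
  have up: "x \<bullet> (V *v x) \<le> l * (norm x)\<^sup>2" for x
  proof -
    have "x \<bullet> (V *v x) \<le> norm x * norm (V *v x)" by (rule norm_cauchy_schwarz)
    also have "\<dots> \<le> norm x * (onorm ((*v) V) * norm x)" by (intro mult_left_mono on) simp
    also have "\<dots> \<le> l * (norm x)\<^sup>2" using c(1) by (simp add: l_def power2_eq_square algebra_simps)
    finally show ?thesis .
  qed
  define T where "T = mat 1 - (1 / l) *\<^sub>R V"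
  define r where "r = 1 - c / l"
  have r: "0 \<le> r" "r < 1" using l c by (auto simp: r_def)
  have symT: "transpose T = T"
    using symV by (simp add: T_def transpose_def mat_def vec_eq_iff)
  have Tv: "T *v x = x - (1 / l) *\<^sub>R (V *v x)" for x
    by (simp add: T_def matrix_vector_mult_diff_rdistrib scaleR_matrix_vector_assoc)
  have "\<bar>x \<bullet> (T *v x)\<bar> \<le> r * (norm x)\<^sup>2" for x
  proof -
    have e: "x \<bullet> (T *v x) = (norm x)\<^sup>2 - (x \<bullet> (V *v x)) / l"
      by (simp add: Tv inner_diff_right power2_norm_eq_inner)
    have "(x \<bullet> (V *v x)) / l \<le> (norm x)\<^sup>2" "c / l * (norm x)\<^sup>2 \<le> (x \<bullet> (V *v x)) / l"
      using up[of x] c(2)[of x] l by (auto simp: field_simps)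
    then show ?thesis unfolding e r_def by (simp add: algebra_simps)
  qed
  then have Tn: "norm (T *v x) \<le> r * norm x" for x by (rule symmetric_norm_bound[OF symT])
  \<comment> \<open>Symmetric matrices of operator norm at most \<open>r\<close>: a closed, hence
    complete, set that contains \<open>T\<close> and is mapped into itself because
    \<open>r * r \<le> r\<close>.\<close>
  define \<S> where "\<S> = {X :: real^'n^'n. transpose X = X \<and> (\<forall>x. norm (X *v x) \<le> r * norm x)}"
  define \<Phi> where "\<Phi> X = (1 / 2) *\<^sub>R (T + X ** X)" for X
  have closed: "closed \<S>"
    unfolding closed_sequential_limits
  proof (intro allI impI, elim conjE)
    fix X l assume X: "\<forall>n. X n \<in> \<S>" "X \<longlonglongrightarrow> l"
    have "(\<lambda>n. transpose (X n)) \<longlonglongrightarrow> transpose l" by (intro tendsto_intros X)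
    then have "transpose l = l" using LIMSEQ_unique X by (auto simp: \<S>_def)
    moreover have "norm (l *v x) \<le> r * norm x" for x
    proof (rule LIMSEQ_le_const2)
      show "(\<lambda>n. norm (X n *v x)) \<longlonglongrightarrow> norm (l *v x)" by (intro tendsto_intros X)
    qed (use X in \<open>auto simp: \<S>_def\<close>)
    ultimately show "l \<in> \<S>" by (simp add: \<S>_def)
  qed
  have "T \<in> \<S>" using symT Tn by (simp add: \<S>_def)
  moreover have "\<Phi> X \<in> \<S>" if X: "X \<in> \<S>" for X
  proof -
    have "transpose (\<Phi> X) = \<Phi> X"
    proof -
      have "transpose (X ** X) = X ** X" using X by (simp add: matrix_transpose_mul \<S>_def)
      then show ?thesis using symT by (simp add: \<Phi>_def transpose_def vec_eq_iff)
    qed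
    moreover have "norm (\<Phi> X *v x) \<le> r * norm x" for x
    proof -
      have "\<Phi> X *v x = (1 / 2) *\<^sub>R (T *v x + X *v (X *v x))"
        by (simp add: \<Phi>_def scaleR_matrix_vector_assoc[symmetric] matrix_vector_mult_add_rdistrib matrix_vector_mul_assoc)
      moreover have "norm (X *v (X *v x)) \<le> r * norm x"
      proof -
        have "norm (X *v (X *v x)) \<le> r * (r * norm x)"
          using X r(1) by (auto simp: \<S>_def intro: order_trans[OF _ mult_left_mono])
        also have "\<dots> \<le> r * (1 * norm x)" using r by (intro mult_left_mono mult_right_mono) auto
        finally show ?thesis by simp
      qed
      ultimately show ?thesis using norm_triangle_ineq[of "T *v x" "X *v (X *v x)"] Tn[of x] by simp
    qed
    ultimately show ?thesis by (simp add: \<S>_def)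
  qed
  moreover have "dist (\<Phi> X) (\<Phi> Y) \<le> r * dist X Y" if X: "X \<in> \<S>" and Y: "Y \<in> \<S>" for X Y
  proof -
    \<comment> \<open>Without commutativity, \<open>X X - Y Y\<close> still telescopes into
      \<open>X (X - Y) + (X - Y) Y\<close>; each term is at most \<open>r\<close> times the
      distance, and the factor 1/2 balances having two of them.\<close>
    have "\<Phi> X - \<Phi> Y = (1 / 2) *\<^sub>R (X ** (X - Y) + (X - Y) ** Y)"
      by (simp add: \<Phi>_def matrix_mult_diff_right matrix_mult_diff_left algebra_simps)
    moreover have "norm (X ** (X - Y)) \<le> r * norm (X - Y)"
      using X r by (intro norm_matrix_mult_le) (auto simp: \<S>_def)
    moreover have "norm ((X - Y) ** Y) \<le> r * norm (X - Y)"
    proof -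
      have "transpose ((X - Y) ** Y) = Y ** transpose (X - Y)" using Y by (simp add: matrix_transpose_mul \<S>_def)
      then have "norm ((X - Y) ** Y) = norm (Y ** transpose (X - Y))" by (metis norm_transpose)
      also have "\<dots> \<le> r * norm (transpose (X - Y))"
        using Y r by (intro norm_matrix_mult_le) (auto simp: \<S>_def)
      finally show ?thesis by (simp add: norm_transpose)
    qed
    ultimately show ?thesis
      using norm_triangle_ineq[of "X ** (X - Y)" "(X - Y) ** Y"] by (simp add: dist_norm)
  qed
  ultimately have "\<exists>!X\<in>\<S>. \<Phi> X = X"
    using r by (intro Banach_fix[OF complete_eq_closed[THEN iffD2, OF closed]]) auto
  then obtain X where X: "X \<in> \<S>" "\<Phi> X = X" by blast
  have symX: "transpose X = X" and Xn: "norm (X *v x) \<le> r * norm x" for x using X by (auto simp: \<S>_def)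
  have XX: "X ** X = 2 *\<^sub>R X - T"
  proof -
    have "2 *\<^sub>R \<Phi> X = T + X ** X" by (simp add: \<Phi>_def)
    then show ?thesis using X(2) by (simp add: algebra_simps)
  qed
  define S where "S = sqrt l *\<^sub>R (mat 1 - X)"
  have "(mat 1 - X) ** (mat 1 - X) = (1 / l) *\<^sub>R V"
  proof -
    have "(mat 1 - X) ** (mat 1 - X) = mat 1 - 2 *\<^sub>R X + X ** X"
      by (simp add: matrix_mult_diff_right matrix_mult_diff_left scaleR_2)
    then show ?thesis by (simp add: XX T_def)
  qed
  then have SS: "S ** S = V"
    using l by (simp add: S_def matrix_mult_scaleR_left matrix_mult_scaleR_right)
  have symS: "transpose S = S" using symX by (simp add: S_def transpose_def mat_def vec_eq_iff)
  \<comment> \<open>Besides positivity this gives the explicit \<open>\<delta>\<close> that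
    \<open>psd_root_distance\<close> asks for.\<close>
  have low: "sqrt l * (1 - r) * (norm y)\<^sup>2 \<le> y \<bullet> (S *v y)" for y
  proof -
    have "S *v y = sqrt l *\<^sub>R (y - X *v y)"
      by (simp add: S_def scaleR_matrix_vector_assoc[symmetric] matrix_vector_mult_diff_rdistrib)
    then have e: "y \<bullet> (S *v y) = sqrt l * ((norm y)\<^sup>2 - y \<bullet> (X *v y))"
      by (simp add: inner_diff_right power2_norm_eq_inner)
    have "y \<bullet> (X *v y) \<le> norm y * norm (X *v y)" by (rule norm_cauchy_schwarz)
    also have "\<dots> \<le> norm y * (r * norm y)" by (intro mult_left_mono Xn) simp
    finally have "(1 - r) * (norm y)\<^sup>2 \<le> (norm y)\<^sup>2 - y \<bullet> (X *v y)" by (simp add: power2_eq_square algebra_simps)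
    then show ?thesis unfolding e mult.assoc using l by (intro mult_left_mono) auto
  qed
  have d: "0 < sqrt l * (1 - r)" using l r by simp
  have "0 \<le> y \<bullet> (S *v y)" for y using low[of y] d by (smt (verit) mult_nonneg_nonneg zero_le_power2)
  then have "psd S" using symS by (simp add: psd_def)
  then show ?thesis using SS low d by blast
qed

text \<open>Existence and uniqueness give the description in the definition its meaning. An
  arbitrary psd root is compared with the one from \<open>posdef_root_exists\<close>, whose lower
  bound also supplies the constant of the third clause; it depends on \<open>V\<close> only.\<close>

lemma psd_sqrt:
  fixes V :: "real^'n^'n"
  assumes "posdef V"
  shows "psd (psd_sqrt V)" "psd_sqrt V ** psd_sqrt V = V"
    and "\<exists>\<delta>>0. \<forall>W. posdef W \<longrightarrow> \<delta> * norm (psd_sqrt V - psd_sqrt W) \<le> norm (V - W)"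
proof -
  have u: "\<exists>!S. psd S \<and> S ** S = W" if W: "posdef W" for W :: "real^'n^'n"
  proof -
    obtain S \<delta> where S: "psd S" "S ** S = W" "0 < \<delta>" "\<And>y. \<delta> * (norm y)\<^sup>2 \<le> y \<bullet> (S *v y)"
      using posdef_root_exists[OF W] by blast
    show ?thesis
    proof (rule ex1I[of _ S])
      fix R assume R: "psd R \<and> R ** R = W"
      have "\<delta> * norm (S - R) \<le> norm (S ** S - R ** R)" by (rule psd_root_distance[OF S(4)]) (use R in simp)
      then have "\<delta> * norm (S - R) \<le> 0" using R S(2) by simp
      then show "R = S" using S(3) by (simp add: mult_le_0_iff)
    qed (use S in simp)
  qed
  have root: "psd (psd_sqrt W) \<and> psd_sqrt W ** psd_sqrt W = W" if "posdef W" for W :: "real^'n^'n"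
    unfolding psd_sqrt_def by (rule theI'[OF u[OF that]])
  show "psd (psd_sqrt V)" "psd_sqrt V ** psd_sqrt V = V" using root[OF assms] by auto
  obtain S \<delta> where S: "psd S" "S ** S = V" "0 < \<delta>" "\<And>y. \<delta> * (norm y)\<^sup>2 \<le> y \<bullet> (S *v y)"
    using posdef_root_exists[OF assms] by blast
  have "S = psd_sqrt V" using u[OF assms] root[OF assms] S by blast
  then have "\<delta> * norm (psd_sqrt V - psd_sqrt W) \<le> norm (V - W)" if "posdef W" for W
    using psd_root_distance[OF S(4), of "psd_sqrt W"] root[OF that] S(2) by auto
  then show "\<exists>\<delta>>0. \<forall>W. posdef W \<longrightarrow> \<delta> * norm (psd_sqrt V - psd_sqrt W) \<le> norm (V - W)"
    using S(3) by blast
qed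

lemma continuous_on_psd_sqrt: "continuous_on {V :: real^'n^'n. posdef V} psd_sqrt"
  unfolding continuous_on_iff
proof (intro ballI allI impI)
  fix V :: "real^'n^'n" and e :: real assume V: "V \<in> {V. posdef V}" and e: "0 < e"
  obtain \<delta> where \<delta>: "0 < \<delta>" "\<And>W. posdef W \<Longrightarrow> \<delta> * norm (psd_sqrt V - psd_sqrt W) \<le> norm (V - W)"
    using psd_sqrt(3)[of V] V by auto
  show "\<exists>d>0. \<forall>W\<in>{V. posdef V}. dist W V < d \<longrightarrow> dist (psd_sqrt W) (psd_sqrt V) < e"
  proof (intro exI[of _ "\<delta> * e"] conjI ballI impI)
    fix W assume W: "W \<in> {V. posdef V}" "dist W V < \<delta> * e"
    have "\<delta> * norm (psd_sqrt V - psd_sqrt W) < \<delta> * e"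
      using \<delta>(2)[of W] W by (simp add: dist_norm norm_minus_commute)
    then show "dist (psd_sqrt W) (psd_sqrt V) < e" using \<delta>(1) by (simp add: dist_norm norm_minus_commute)
  qed (use \<delta> e in simp)
qed

text \<open>A diagonal entry of the square of a symmetric matrix is the squared length of a row, so
  entries of the root grow at most like the square root of \<open>norm V\<close>.\<close>

lemma psd_sqrt_entry_bound:
  fixes V :: "real^'n^'n"
  assumes "posdef V"
  shows "(psd_sqrt V $ i $ k)\<^sup>2 \<le> norm V"
proof -
  note r = psd_sqrt(1,2)[OF assms]
  have "(psd_sqrt V $ i $ k)\<^sup>2 \<le> (\<Sum>k\<in>UNIV. (psd_sqrt V $ i $ k)\<^sup>2)"
    by (rule member_le_sum) auto
  also have "\<dots> = (\<Sum>k\<in>UNIV. psd_sqrt V $ i $ k * psd_sqrt V $ k $ i)"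
    using r(1) by (intro sum.cong refl) (simp add: psd_def power2_eq_square symmetric_entry[of "psd_sqrt V" i])
  also have "\<dots> = V $ i $ i"
    using arg_cong[OF r(2), of "\<lambda>V. V $ i $ i"] by (simp add: matrix_matrix_mult_def)
  also have "\<dots> \<le> norm (V $ i)" using component_le_norm_cart[of "V $ i" i] by linarith
  also have "\<dots> \<le> norm V" by (rule Finite_Cartesian_Product.norm_nth_le)
  finally show ?thesis .
qed

lemma posdef_add_psd: "posdef C \<Longrightarrow> psd X \<Longrightarrow> posdef (C + X)"
  unfolding posdef_def psd_def
  by (auto simp: transpose_def vec_eq_iff matrix_vector_mult_add_rdistrib inner_add_right add_pos_nonneg)

lemma closed_psd: "closed {X :: real^'n^'n. psd X}"
  unfolding closed_sequential_limits
proof (intro allI impI, elim conjE)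
  fix X and l :: "real^'n^'n" assume X: "\<forall>n. X n \<in> {X. psd X}" "X \<longlonglongrightarrow> l"
  have "(\<lambda>n. transpose (X n)) \<longlonglongrightarrow> transpose l" by (intro tendsto_intros X)
  then have "transpose l = l" using LIMSEQ_unique X by (auto simp: psd_def)
  moreover have "0 \<le> x \<bullet> (l *v x)" for x
  proof (rule LIMSEQ_le_const)
    show "(\<lambda>n. x \<bullet> (X n *v x)) \<longlonglongrightarrow> x \<bullet> (l *v x)" by (intro tendsto_intros X)
  qed (use X in \<open>auto simp: psd_def\<close>)
  ultimately show "l \<in> {X. psd X}" by (simp add: psd_def)
qed

subsection \<open>Kronecker products and the moment generator\<close>

lemma UNIV_pair: "(UNIV :: ('a \<times> 'b) set) = UNIV \<times> UNIV"
  by simp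

lemma kron_nth: "(X \<otimes> Y) $ r $ c = X $ fst r $ fst c * Y $ snd r $ snd c"
  by (simp add: kron_def)

lemma sum_UNIV_prod:
  fixes f :: "'a::finite \<times> 'b::finite \<Rightarrow> 'c::comm_monoid_add"
  shows "(\<Sum>p\<in>UNIV. f p) = (\<Sum>a\<in>UNIV. \<Sum>b\<in>UNIV. f (a, b))"
  unfolding UNIV_pair by (simp add: sum.cartesian_product)

lemma kron_mult:
  fixes X :: "real^'n::finite^'m::finite" and X' :: "real^'k::finite^'n"
    and Z :: "real^'p::finite^'q::finite" and Z' :: "real^'r::finite^'p"
  shows "(X \<otimes> Z) ** (X' \<otimes> Z') = (X ** X') \<otimes> (Z ** Z')"
  by (simp add: matrix_matrix_mult_def kron_def vec_eq_iff sum_UNIV_prod sum_product)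
     (simp add: mult_ac)

lemma transpose_kron: "transpose (X \<otimes> Z) = transpose X \<otimes> transpose Z"
  by (simp add: transpose_def kron_def vec_eq_iff)

lemma kron_vec_mat:
  fixes X :: "real^'n::finite^'m::finite" and Z :: "real^'p::finite^'q::finite" and W :: "real^'n^'p"
  shows "(X \<otimes> Z) *v vec_mat W = vec_mat (Z ** W ** transpose X)"
  by (simp add: matrix_vector_mult_def matrix_matrix_mult_def kron_def vec_mat_def transpose_def vec_eq_iff sum_UNIV_prod sum_distrib_right)
     (simp add: mult_ac)

lemma vec_mat_outer: "vec_mat (outer x y) = y \<otimes>\<^sub>v x"
  by (simp add: vec_mat_def outer_def kron_vec_def vec_eq_iff mult.commute)

lemma vec_mat_sandwich:
  fixes X :: "real^'n::finite^'m::finite" and Z :: "real^'p::finite^'q::finite" and W :: "real^'p^'n"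
  shows "vec_mat (X ** W ** transpose Z) = (Z \<otimes> X) *v vec_mat W"
  by (simp add: kron_vec_mat)

lemma matrix_mult_outer: "X ** outer x y = outer (X *v x) (y :: real^'n::finite)"
  by (simp add: matrix_vector_mult_def matrix_matrix_mult_def outer_def vec_eq_iff sum_distrib_right mult.assoc)

lemma outer_mult_transpose: "outer x y ** transpose Z = outer x (Z *v (y :: real^'n::finite))"
  by (simp add: matrix_vector_mult_def matrix_matrix_mult_def outer_def transpose_def vec_eq_iff sum_distrib_left mult_ac)

lemma outer_sandwich: "X ** outer x y ** transpose Z = outer (X *v x) (Z *v (y :: real^'n::finite))"
  by (simp add: matrix_mult_outer outer_mult_transpose)

lemma outer_zero [simp]: "outer 0 y = 0" "outer x 0 = 0"
  by (simp_all add: outer_def vec_eq_iff)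

lemma comm_mat_mult_vector: "(comm_mat *v x) $ p = x $ (snd p, fst p)"
proof -
  have "comm_mat *v x = vec_mat (transpose (unvec x))"
    using comm_mat_vec[of "unvec x"] by simp
  then show ?thesis by (simp add: vec_mat_def transpose_def unvec_def)
qed

lemma comm_mat_nth: "comm_mat $ p $ c = (if c = (snd p, fst p) then 1 else 0)"
proof -
  have "(comm_mat *v axis c 1) $ p = comm_mat $ p $ c"
    by (simp add: matrix_vector_mult_basis column_def)
  then show ?thesis unfolding comm_mat_mult_vector by (auto simp: axis_def)
qed

lemma comm_mat_mult: "(comm_mat ** X) $ p = X $ (snd p, fst p)"
  by (simp add: vec_eq_iff matrix_matrix_mult_def comm_mat_nth if_distrib[of "\<lambda>x. x * _"] cong: if_cong)

lemma mult_comm_mat: "(X ** comm_mat) $ r $ c = X $ r $ (snd c, fst c)"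
proof -
  have "c = (snd k, fst k) \<longleftrightarrow> k = (snd c, fst c)" for k :: "'a \<times> 'a" by auto
  then show ?thesis by (simp add: matrix_matrix_mult_def comm_mat_nth if_distrib[of "\<lambda>x. _ * x"] cong: if_cong)
qed

text \<open>The commutation matrix interchanges the two tensor factors, which is invisible when they
  coincide.\<close>

lemma kron_comm_mat: "(X \<otimes> X) ** comm_mat = comm_mat ** (X \<otimes> (X :: real^'d::finite^'d))"
  by (simp add: vec_eq_iff mult_comm_mat comm_mat_mult kron_nth mult.commute)

text \<open>Exchanging the two middle indices turns products of entries of \<open>vec_mat V\<close>
  into entries of a Kronecker product, up to transposing both factors; symmetry of \<open>V\<close>
  absorbs the transposition.\<close>

lemma Q_map_outer:
  assumes "transpose V = V"
  shows "Q_map (outer (vec_mat V) (vec_mat V)) = V \<otimes> V"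
proof -
  have "Q_map (outer (vec_mat V) (vec_mat V)) $ r $ c = (V \<otimes> V) $ r $ c" for r c
    using symmetric_entry[OF assms, of "fst c" "fst r"] symmetric_entry[OF assms, of "snd c" "snd r"]
    by (simp add: Q_map_def outer_def vec_mat_def kron_def)
  then show ?thesis by (simp add: vec_eq_iff)
qed

lemma Q_map_linear: "Q_map (X + Y) = Q_map X + Q_map Y" "Q_map (c *\<^sub>R X) = c *\<^sub>R Q_map X"
  by (simp_all add: Q_map_def vec_eq_iff)

lemma R_map_linear: "R_map \<rho> (X + Y) = R_map \<rho> X + R_map \<rho> Y" "R_map \<rho> (c *\<^sub>R X) = c *\<^sub>R R_map \<rho> X"
  by (simp_all add: R_map_def Q_map_linear matrix_add_ldistrib matrix_mult_scaleR_right algebra_simps)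

lemma vec_mat_linear: "vec_mat (X + Y) = vec_mat X + vec_mat Y" "vec_mat (c *\<^sub>R X) = c *\<^sub>R vec_mat X"
  by (simp_all add: vec_mat_def vec_eq_iff)

lemma vec_mat_R_map: "vec_mat (R_map \<rho> X) = calR \<rho> *v vec_mat X"
  by (simp add: R_map_def calR_def vec_mat_linear vec_mat_Q_map vec_mat_comm_mat_mult
      matrix_vector_mult_add_rdistrib scaleR_matrix_vector_assoc[symmetric] matrix_vector_mul_assoc)

text \<open>Sandwiching the identity between \<open>A ** S\<close> and its transpose leaves
  \<open>V\<close> between \<open>A\<close> and its transpose: the mean jump depends on
  \<open>V\<close> alone.\<close>

lemma kron_sqrt_mean:
  fixes A S :: "real^'d::finite^'d"
  assumes S: "transpose S = S" "S ** S = V"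
  shows "((A ** S) \<otimes> (A ** S)) *v vec_mat (mat 1) = (A \<otimes> A) *v vec_mat V"
  using S by (simp add: kron_vec_mat matrix_transpose_mul matrix_mul_assoc[symmetric])
     (simp add: matrix_mul_assoc S)

text \<open>Each summand is conjugated on its own: the identity gives \<open>V \<otimes> V\<close>,
  the commutation matrix moves past \<open>S \<otimes> S\<close>, and the rank-one term is carried
  to \<open>vec_mat V\<close>. No root survives, which is why the moment equations close.\<close>

lemma kron_sqrt_covariance:
  fixes A S :: "real^'d::finite^'d"
  assumes S: "transpose S = S" "S ** S = V"
  shows "((A ** S) \<otimes> (A ** S)) ** (\<rho> *\<^sub>R (mat 1 + comm_mat + outer (vec_mat (mat 1)) (vec_mat (mat 1))))
      ** transpose ((A ** S) \<otimes> (A ** S))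
    = (A \<otimes> A) ** R_map \<rho> (outer (vec_mat V) (vec_mat V)) ** (transpose A \<otimes> transpose A)"
proof -
  have symV: "transpose V = V" using S by (metis matrix_transpose_mul)
  let ?S = "S \<otimes> S" and ?A = "A \<otimes> A"
  have N: "(A ** S) \<otimes> (A ** S) = ?A ** ?S" by (simp add: kron_mult)
  have tS: "transpose ?S = ?S" by (simp add: transpose_kron S)
  have SS: "?S ** ?S = V \<otimes> V" by (simp add: kron_mult S)
  have 1: "?S ** mat 1 ** ?S = V \<otimes> V" by (simp add: SS)
  have 2: "?S ** comm_mat ** ?S = comm_mat ** (V \<otimes> V)"
    by (simp add: kron_comm_mat matrix_mul_assoc[symmetric] SS)
  have 3: "?S ** outer (vec_mat (mat 1)) (vec_mat (mat 1)) ** ?S = outer (vec_mat V) (vec_mat V)"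
    using outer_sandwich[of ?S "vec_mat (mat 1)" "vec_mat (mat 1)" ?S] by (simp add: tS kron_vec_mat S)
  have "?S ** (\<rho> *\<^sub>R (mat 1 + comm_mat + outer (vec_mat (mat 1)) (vec_mat (mat 1)))) ** ?S = R_map \<rho> (outer (vec_mat V) (vec_mat V))"
    unfolding R_map_def Q_map_outer[OF symV] matrix_mult_scaleR_right matrix_mult_scaleR_left matrix_add_ldistrib matrix_mult_add_left 1 2 3
    by (simp add: algebra_simps)
  then have "?A ** (?S ** (\<rho> *\<^sub>R (mat 1 + comm_mat + outer (vec_mat (mat 1)) (vec_mat (mat 1)))) ** ?S) ** transpose ?A
     = ?A ** R_map \<rho> (outer (vec_mat V) (vec_mat V)) ** (transpose A \<otimes> transpose A)"
    by (simp add: transpose_kron)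
  then show ?thesis by (simp add: N matrix_transpose_mul[of ?A ?S] tS matrix_mul_assoc)
qed

section \<open>Rates of the first two moments\<close>

definition drift_matrix :: "real^'d^'d \<Rightarrow> real^('d::finite \<times> 'd)^('d \<times> 'd)" where
  "drift_matrix B = B \<otimes> mat 1 + mat 1 \<otimes> B"

lemma vec_mat_drift: "vec_mat (B ** X + X ** transpose B) = drift_matrix B *v vec_mat (X :: real^'d::finite^'d)"
  by (simp add: drift_matrix_def vec_mat_linear matrix_vector_mult_add_rdistrib kron_vec_mat transpose_mat add.commute)

text \<open>The generator of \<open>Y\<close> maps \<open>vec Y (vec Y)\<^sup>*\<close> to \<open>second_moment_rate\<close> at \<open>P = vec Y (vec Y)\<^sup>*\<close>, \<open>m = vec Y\<close>;
  as this is affine in \<open>(P, m)\<close>, the same expression gives the rate of change of the moments.\<close>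

definition second_moment_rate ::
  "real^'d^'d \<Rightarrow> real^'d^'d \<Rightarrow> real^'d^'d \<Rightarrow> real \<Rightarrow> real
    \<Rightarrow> real^('d \<times> 'd)^('d \<times> 'd) \<Rightarrow> real^('d \<times> 'd) \<Rightarrow> real^('d::finite \<times> 'd)^('d \<times> 'd)" where
  "second_moment_rate A B C \<sigma> \<rho> P m =
     drift_matrix B ** P + P ** transpose (drift_matrix B)
     + \<sigma> *\<^sub>R ((A \<otimes> A) ** (P + outer (vec_mat C) m) + (P + outer m (vec_mat C)) ** transpose (A \<otimes> A))
     + (A \<otimes> A) ** R_map \<rho> (P + outer m (vec_mat C) + outer (vec_mat C) m + outer (vec_mat C) (vec_mat C)) ** (transpose A \<otimes> transpose A)"

lemma outer_add: "outer (x + y) z = outer x z + outer y z" "outer z (x + y) = outer z x + outer z y"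
  by (simp_all add: outer_def vec_eq_iff algebra_simps)

lemma outer_scaleR: "outer (c *\<^sub>R x) z = c *\<^sub>R outer x z" "outer z (c *\<^sub>R x) = c *\<^sub>R outer z x"
  by (simp_all add: outer_def vec_eq_iff)

text \<open>The five summands are what the product formula leaves after averaging the jumps: drift
  in either factor, mean jump in either factor, and the second moment of the jump.\<close>

lemma second_moment_rate_generator:
  fixes A B C X S :: "real^'d::finite^'d"
  assumes S: "transpose S = S" "S ** S = C + X"
  defines "N \<equiv> (A ** S) \<otimes> (A ** S)" and "v \<equiv> vec_mat X"
  shows "second_moment_rate A B C \<sigma> \<rho> (outer v v) v
    = outer (drift_matrix B *v v) v + outer v (drift_matrix B *v v)
      + outer (N *v (\<sigma> *\<^sub>R vec_mat (mat 1))) v + outer v (N *v (\<sigma> *\<^sub>R vec_mat (mat 1)))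
      + N ** (\<rho> *\<^sub>R (mat 1 + comm_mat + outer (vec_mat (mat 1)) (vec_mat (mat 1)))) ** transpose N"
proof -
  have 1: "N *v (\<sigma> *\<^sub>R vec_mat (mat 1)) = \<sigma> *\<^sub>R ((A \<otimes> A) *v (vec_mat C + v))"
    unfolding N_def v_def using kron_sqrt_mean[OF S, of A] by (simp add: matrix_vector_mult_scaleR vec_mat_linear)
  have 2: "N ** (\<rho> *\<^sub>R (mat 1 + comm_mat + outer (vec_mat (mat 1)) (vec_mat (mat 1)))) ** transpose N
    = (A \<otimes> A) ** R_map \<rho> (outer (vec_mat C + v) (vec_mat C + v)) ** (transpose A \<otimes> transpose A)"
    unfolding N_def v_def using kron_sqrt_covariance[OF S, of A \<rho>] by (simp add: vec_mat_linear)
  have 3: "outer (vec_mat C + v) (vec_mat C + v) = outer v v + outer v (vec_mat C) + outer (vec_mat C) v + outer (vec_mat C) (vec_mat C)"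
    by (simp add: outer_add algebra_simps)
  show ?thesis
    unfolding 1 2 3 second_moment_rate_def matrix_add_ldistrib matrix_mult_add_left matrix_mult_outer outer_mult_transpose
    by (simp add: outer_scaleR outer_add matrix_vector_right_distrib algebra_simps)
qed

text \<open>Under \<open>vec_mat\<close> a left factor \<open>X\<close> becomes
  \<open>mat 1 \<otimes> X\<close> and a right factor \<open>transpose X\<close> becomes
  \<open>X \<otimes> mat 1\<close>. As \<open>vec_mat (outer x y)\<close> is
  \<open>y \<otimes>\<^sub>v x\<close>, the order of \<open>m\<close> and \<open>vec_mat C\<close>
  is reversed.\<close>

lemma vec_mat_second_moment_rate:
  fixes A B C :: "real^'d::finite^'d"
  shows "vec_mat (second_moment_rate A B C \<sigma> \<rho> P m) = scrC A B \<sigma> \<rho> *v vec_mat P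
     + (\<sigma> *\<^sub>R ((A \<otimes> A) \<otimes> mat 1) + scrA A ** calR \<rho>) *v (vec_mat C \<otimes>\<^sub>v m)
     + (\<sigma> *\<^sub>R (mat 1 \<otimes> (A \<otimes> A)) + scrA A ** calR \<rho>) *v (m \<otimes>\<^sub>v vec_mat C)
     + (scrA A ** calR \<rho>) *v (vec_mat C \<otimes>\<^sub>v vec_mat C)"
proof -
  have l: "vec_mat (X ** W) = (mat 1 \<otimes> X) *v vec_mat W" for X W :: "real^('d \<times> 'd)^('d \<times> 'd)"
    using vec_mat_sandwich[of X W "mat 1"] by (simp add: transpose_mat)
  have r: "vec_mat (W ** transpose X) = (X \<otimes> mat 1) *v vec_mat W" for X W :: "real^('d \<times> 'd)^('d \<times> 'd)"
    using vec_mat_sandwich[of "mat 1" W X] by simp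
  have s: "vec_mat ((A \<otimes> A) ** R_map \<rho> W ** (transpose A \<otimes> transpose A)) = (scrA A ** calR \<rho>) *v vec_mat W" for W
    using vec_mat_sandwich[of "A \<otimes> A" "R_map \<rho> W" "A \<otimes> A"]
    by (simp add: transpose_kron scrA_def vec_mat_R_map matrix_vector_mul_assoc)
  have scrC: "scrC A B \<sigma> \<rho> = drift_matrix B \<otimes> mat 1 + mat 1 \<otimes> drift_matrix B
      + \<sigma> *\<^sub>R ((A \<otimes> A) \<otimes> mat 1 + mat 1 \<otimes> (A \<otimes> A)) + scrA A ** calR \<rho>"
    by (simp add: scrC_def drift_matrix_def)
  show ?thesis
    unfolding second_moment_rate_def vec_mat_linear l[of "drift_matrix B"] l[of "A \<otimes> A"] r s scrC
      matrix_vector_mult_add_rdistrib vec_mat_outer matrix_vector_right_distrib scaleR_matrix_vector_assoc[symmetric]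
    by (simp add: algebra_simps)
qed

text \<open>The rate of \<open>vec_mat (Y t)\<close> itself. It serves to prove \<open>EY\<close>
  continuous in time, so that the second moment can be differentiated.\<close>

definition first_moment_rate :: "real^'d^'d \<Rightarrow> real^'d^'d \<Rightarrow> real^'d^'d \<Rightarrow> real \<Rightarrow> real^('d \<times> 'd) \<Rightarrow> real^('d::finite \<times> 'd)" where
  "first_moment_rate A B C \<sigma> m = drift_matrix B *v m + \<sigma> *\<^sub>R ((A \<otimes> A) *v (vec_mat C + m))"

text \<open>Bounded linear maps commute with expectations, so this decomposition carries the rate at
  random arguments to the rate at the moments.\<close>

lemma second_moment_rate_affine:
  fixes A B C :: "real^'d::finite^'d"
  shows "\<exists>f g. bounded_linear f \<and> bounded_linear g \<and>
    (\<forall>P m. second_moment_rate A B C \<sigma> \<rho> P m = f P + g m + second_moment_rate A B C \<sigma> \<rho> 0 0)"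
proof -
  define f where "f P = drift_matrix B ** P + P ** transpose (drift_matrix B)
     + \<sigma> *\<^sub>R ((A \<otimes> A) ** P + P ** transpose (A \<otimes> A)) + (A \<otimes> A) ** R_map \<rho> P ** (transpose A \<otimes> transpose A)" for P
  define g where "g m = \<sigma> *\<^sub>R ((A \<otimes> A) ** outer (vec_mat C) m + outer m (vec_mat C) ** transpose (A \<otimes> A))
     + (A \<otimes> A) ** R_map \<rho> (outer m (vec_mat C) + outer (vec_mat C) m) ** (transpose A \<otimes> transpose A)" for m
  have "linear f" "linear g"
    unfolding f_def g_def
    by (rule linearI; simp add: matrix_add_ldistrib matrix_mult_add_left matrix_mult_scaleR_left matrix_mult_scaleR_right
        R_map_linear outer_add outer_scaleR scaleR_add_right add_ac mult_ac)+
  moreover have "second_moment_rate A B C \<sigma> \<rho> P m = f P + g m + second_moment_rate A B C \<sigma> \<rho> 0 0" for P m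
    by (simp add: f_def g_def second_moment_rate_def matrix_add_ldistrib matrix_mult_add_left R_map_linear scaleR_add_right)

  ultimately show ?thesis
    unfolding linear_conv_bounded_linear by (intro exI[of _ f] exI[of _ g] conjI allI)
qed

subsection \<open>Moments of the volatility process\<close>

lemma continuous_on_matrix_entry [continuous_intros]:
  fixes f :: "'x::topological_space \<Rightarrow> real^'n^'m"
  shows "continuous_on S f \<Longrightarrow> continuous_on S (\<lambda>x. f x $ i $ j)"
  unfolding continuous_on_def by (auto intro!: tendsto_vec_nth)

lemma continuous_on_matrix_mult [continuous_intros]:
  fixes f :: "'x::topological_space \<Rightarrow> real^'n^'m" and g :: "'x \<Rightarrow> real^'p^'n"
  shows "continuous_on S f \<Longrightarrow> continuous_on S g \<Longrightarrow> continuous_on S (\<lambda>x. f x ** g x)"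
  unfolding continuous_on_def by (auto intro: tendsto_matrix_mult)

lemma has_integral_matrix:
  fixes f :: "real \<Rightarrow> real^'n^'m"
  assumes "\<And>i j. ((\<lambda>s. f s $ i $ j) has_integral c i j) S"
  shows "(f has_integral (\<chi> i j. c i j)) S"
proof -
  define E :: "'m \<Rightarrow> 'n \<Rightarrow> real^'n^'m" where "E i j = (\<chi> a b. if a = i \<and> b = j then 1 else 0)" for i j
  have E: "(\<Sum>i\<in>UNIV. \<Sum>j\<in>UNIV. z i j *\<^sub>R E i j) = (\<chi> i j. z i j)" for z
  proof -
    have "(\<Sum>i\<in>UNIV. \<Sum>j\<in>UNIV. z i j * (if a = i \<and> b = j then 1 else 0)) = z a b" for a b
    proof -
      have "(\<Sum>i\<in>UNIV. \<Sum>j\<in>UNIV. z i j * (if a = i \<and> b = j then 1 else 0)) = (\<Sum>i\<in>UNIV. if a = i then z i b else 0)"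
        by (intro sum.cong refl) (simp add: if_distrib[of "\<lambda>x. _ * x"] cong: if_cong)
      then show ?thesis by simp
    qed
    then show ?thesis by (simp add: vec_eq_iff E_def)
  qed
  have "((\<lambda>s. \<Sum>i\<in>UNIV. \<Sum>j\<in>UNIV. f s $ i $ j *\<^sub>R E i j) has_integral (\<Sum>i\<in>UNIV. \<Sum>j\<in>UNIV. c i j *\<^sub>R E i j)) S"
    by (intro has_integral_sum has_integral_scaleR_left assms) auto
  then show ?thesis unfolding E by simp
qed

section \<open>The volatility process in coordinates\<close>

locale mucogarch = levy_jumps M F L \<nu>
  for M :: "'a measure" and F :: "real \<Rightarrow> 'a measure" and L :: "real \<Rightarrow> 'a \<Rightarrow> real^'d" and \<nu> +
  fixes A B C :: "real^'d^'d" and Y :: "real \<Rightarrow> 'a \<Rightarrow> real^'d^'d" and \<sigma> \<rho> :: real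
  assumes posdef_C: "posdef C"
    and Y_adapted: "0 \<le> t \<Longrightarrow> Y t \<in> borel_measurable (F t)"
    and Y_cadlag: "\<omega> \<in> space M \<Longrightarrow> cadlag (\<lambda>t. Y t \<omega>)"
    and Y_psd: "\<omega> \<in> space M \<Longrightarrow> 0 \<le> t \<Longrightarrow> psd (Y t \<omega>)"
    and solution: "AE \<omega> in M. \<forall>t\<ge>0.
        let Yl = left_lim (\<lambda>r. Y r \<omega>) in
        \<exists>J. has_matrix_LS_integral (\<lambda>s. A ** psd_sqrt (C + Yl s)) (disc_qv (\<lambda>r. L r \<omega>))
              (\<lambda>s. psd_sqrt (C + Yl s) ** transpose A) t J \<and>
            Y t \<omega> = Y 0 \<omega> + integral {0..t} (\<lambda>s. B ** Yl s + Yl s ** transpose B) + J"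
    and second_moment: "has_bochner_integral \<nu> (\<lambda>x. outer x x) (\<sigma> *\<^sub>R mat 1)"
    and fourth_moment: "integrable \<nu> (\<lambda>x. norm x ^ 4)"
    and fourth_moments: "has_bochner_integral \<nu> (\<lambda>x. outer (vec_mat (outer x x)) (vec_mat (outer x x)))
           (\<rho> *\<^sub>R (mat 1 + comm_mat + outer (vec_mat (mat 1)) (vec_mat (mat 1))))"
begin

text \<open>As functions of the jump these entries are continuous and zero at the origin, hence
  admissible weights for \<open>compensation\<close>.\<close>

definition qvec :: "'d \<times> 'd \<Rightarrow> real^'d \<Rightarrow> real" where
  "qvec K x = vec_mat (outer x x) $ K"

lemma qvec_altdef: "qvec K x = x $ snd K * x $ fst K"
  by (simp add: qvec_def vec_mat_def outer_def)

lemma continuous_qvec: "continuous_on UNIV (qvec K)" and qvec_0: "qvec K 0 = 0"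
  unfolding qvec_altdef[abs_def] by (auto intro!: continuous_intros)

lemma bounded_linear_matrix_entry: "bounded_linear (\<lambda>X::real^'n^'m. X $ i $ j)"
  by (rule bounded_linear_compose[OF bounded_linear_vec_nth bounded_linear_vec_nth])

lemma qvec_integral: "integrable \<nu> (qvec K)" "(\<integral>x. qvec K x \<partial>\<nu>) = (\<sigma> *\<^sub>R vec_mat (mat 1)) $ K"
proof -
  have "has_bochner_integral \<nu> (\<lambda>x. outer x x $ snd K $ fst K) ((\<sigma> *\<^sub>R mat 1) $ snd K $ fst K)"
    by (rule has_bochner_integral_bounded_linear[OF bounded_linear_matrix_entry second_moment])
  then show "integrable \<nu> (qvec K)" "(\<integral>x. qvec K x \<partial>\<nu>) = (\<sigma> *\<^sub>R vec_mat (mat 1)) $ K"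
    by (auto simp: has_bochner_integral_iff qvec_altdef[abs_def] outer_def vec_mat_def)
qed

lemma qvec_qvec_integral: "integrable \<nu> (\<lambda>x. qvec K x * qvec K' x)"
  "(\<integral>x. qvec K x * qvec K' x \<partial>\<nu>) = (\<rho> *\<^sub>R (mat 1 + comm_mat + outer (vec_mat (mat 1)) (vec_mat (mat 1)))) $ K $ K'"
proof -
  have "has_bochner_integral \<nu> (\<lambda>x. outer (vec_mat (outer x x)) (vec_mat (outer x x)) $ K $ K')
     ((\<rho> *\<^sub>R (mat 1 + comm_mat + outer (vec_mat (mat 1)) (vec_mat (mat 1)))) $ K $ K')"
    by (rule has_bochner_integral_bounded_linear[OF bounded_linear_matrix_entry fourth_moments])
  then show "integrable \<nu> (\<lambda>x. qvec K x * qvec K' x)"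
    "(\<integral>x. qvec K x * qvec K' x \<partial>\<nu>) = (\<rho> *\<^sub>R (mat 1 + comm_mat + outer (vec_mat (mat 1)) (vec_mat (mat 1)))) $ K $ K'"
    by (auto simp: has_bochner_integral_iff qvec_def outer_def)
qed

text \<open>The trace of the matrix in \<open>second_moment\<close>.\<close>

lemma norm_square_integrable: "integrable \<nu> (\<lambda>x. (norm x)\<^sup>2)"
proof -
  have "(\<lambda>x::real^'d. (norm x)\<^sup>2) = (\<lambda>x. \<Sum>i\<in>UNIV. qvec (i, i) x)"
    by (simp add: qvec_altdef power2_norm_eq_inner inner_vec_def fun_eq_iff)
  then show ?thesis using qvec_integral(1) by simp
qed

lemma qvec_bound: "\<bar>qvec K x\<bar> \<le> (norm x)\<^sup>2"
  unfolding qvec_altdef abs_mult power2_eq_square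
  by (intro mult_mono component_le_norm_cart) auto

text \<open>The sum up to time \<open>Suc n\<close> has expectation \<open>Suc n\<close> times the
  second moment of \<open>\<nu>\<close>, so it is almost surely finite; countably many
  \<open>n\<close> serve all times with one null set.\<close>

lemma square_summable_jumps: "AE \<omega> in M. \<forall>t. integrable (count_space {0<..t}) (\<lambda>u. (norm (jump (\<lambda>r. L r \<omega>) u))\<^sup>2)"
proof -
  have fin: "(\<integral>\<^sup>+x. ennreal ((norm x)\<^sup>2) \<partial>\<nu>) < \<top>" using norm_square_integrable by (auto simp: integrable_iff_bounded)
  have w: "levy_weight (\<lambda>x. ennreal ((norm x)\<^sup>2))"
    by (rule levy_weight_continuous[OF _ _ _ fin]) (auto intro!: continuous_intros)
  have "AE \<omega> in M. JS (\<lambda>u x. ennreal ((norm x)\<^sup>2)) 0 (Suc n) \<omega> \<noteq> \<infinity>" for n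
  proof (rule nn_integral_PInf_AE)
    show "(\<lambda>\<omega>. JS (\<lambda>u x. ennreal ((norm x)\<^sup>2)) 0 (real (Suc n)) \<omega>) \<in> borel_measurable M"
      by (rule levy_weightD(1)[OF w]) auto
    have "(\<integral>\<^sup>+\<omega>. JS (\<lambda>u x. ennreal ((norm x)\<^sup>2)) 0 (real (Suc n)) \<omega> \<partial>M) = ennreal (Suc n) * (\<integral>\<^sup>+x. ennreal ((norm x)\<^sup>2) \<partial>\<nu>)"
      using levy_weightD(2)[OF w order_refl, of "real (Suc n)" "\<lambda>_. 1" 1] by (simp add: emeasure_space_1)
    then show "(\<integral>\<^sup>+\<omega>. JS (\<lambda>u x. ennreal ((norm x)\<^sup>2)) 0 (real (Suc n)) \<omega> \<partial>M) \<noteq> \<infinity>"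
      using fin by (simp add: ennreal_mult_eq_top_iff less_top)
  qed
  then have "AE \<omega> in M. \<forall>n. JS (\<lambda>u x. ennreal ((norm x)\<^sup>2)) 0 (Suc n) \<omega> \<noteq> \<infinity>"
    by (simp add: AE_all_countable)
  then show ?thesis
  proof eventually_elim
    case (elim \<omega>)
    show ?case
    proof
      fix t :: real
      obtain n :: nat where "t \<le> n" using real_arch_simple by blast
      then have n: "{0<..t} \<subseteq> {0<..real (Suc n)}" by auto
      have "(\<integral>\<^sup>+u. ennreal ((norm (jump (\<lambda>r. L r \<omega>) u))\<^sup>2) \<partial>count_space {0<..real (Suc n)}) < \<infinity>"
        using elim[rule_format, of n] by (simp add: jsum_def nn_integral_count_space_indicator less_top)
      then have "integrable (count_space {0<..real (Suc n)}) (\<lambda>u. (norm (jump (\<lambda>r. L r \<omega>) u))\<^sup>2)"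
        by (intro integrableI_nonneg) auto
      then show "integrable (count_space {0<..t}) (\<lambda>u. (norm (jump (\<lambda>r. L r \<omega>) u))\<^sup>2)"
        using abs_summable_on_subset[OF _ n] unfolding abs_summable_on_def by blast
    qed
  qed
qed

definition Yl :: "real \<Rightarrow> 'a \<Rightarrow> real^'d^'d" where
  "Yl s \<omega> = left_lim (\<lambda>r. Y r \<omega>) s"

lemma Yl_psd: "\<omega> \<in> space M \<Longrightarrow> 0 \<le> s \<Longrightarrow> psd (Yl s \<omega>)"
  using left_lim_in_closed[OF Y_cadlag _ closed_psd, of \<omega> s] Y_psd by (simp add: Yl_def)

lemma psd_borel: "{X :: real^'d^'d. psd X} \<in> sets borel"
  by (rule borel_closed[OF closed_psd])

text \<open>Continuity is asked for on the psd cone only, because \<open>psd_sqrt (C + X)\<close> is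
  uncontrolled outside it. At positive times measurability comes from approximating the left limit
  by earlier values of \<open>Y\<close>.\<close>

lemma left_continuous_functional:
  fixes h :: "real^'d^'d \<Rightarrow> real"
  assumes h: "continuous_on {X. psd X} h"
  shows "left_continuous_adapted (\<lambda>s \<omega>. h (Yl s \<omega>))"
  unfolding left_continuous_adapted_def
proof (intro conjI allI impI ballI)
  fix t :: real assume t: "0 \<le> t"
  \<comment> \<open>Extended by 0 off the closed cone, \<open>h\<close> becomes a Borel function
    that agrees with it along the paths.\<close>
  have [measurable]: "(\<lambda>X. indicator {X. psd X} X *\<^sub>R h X) \<in> borel_measurable borel"
    using borel_measurable_continuous_on_indicator[OF psd_borel h] .
  have hY: "(\<lambda>\<omega>. h (Y s \<omega>)) \<in> borel_measurable (F t)" if "0 \<le> s" "s \<le> t" for s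
  proof -
    have [measurable]: "Y s \<in> borel_measurable (F t)"
      using measurable_F_mono[OF Y_adapted that] that by simp
    have "(\<lambda>\<omega>. indicator {X. psd X} (Y s \<omega>) *\<^sub>R h (Y s \<omega>)) \<in> borel_measurable (F t)" by measurable
    then show ?thesis
      by (rule measurable_cong[THEN iffD1, rotated]) (use Y_psd that t space_F in auto)
  qed
  show "(\<lambda>\<omega>. h (Yl t \<omega>)) \<in> borel_measurable (F t)"
  proof (cases "t = 0")
    case True
    then show ?thesis using hY[of 0] by (simp add: Yl_def left_lim_def)
  next
    case False
    then have t0: "0 < t" using t by simp
    show ?thesis
    proof (rule borel_measurable_LIMSEQ_metric)
      fix n
      show "(\<lambda>\<omega>. h (Y (t - t / Suc n) \<omega>)) \<in> borel_measurable (F t)"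
        by (rule hY) (use t0 in \<open>auto simp: field_simps\<close>)
    next
      fix \<omega> assume "\<omega> \<in> space (F t)"
      then have \<omega>: "\<omega> \<in> space M" using space_F[OF t] by simp
      have "filterlim (\<lambda>n. t - t / Suc n) (at_left t) sequentially"
        unfolding filterlim_at
      proof
        have "(\<lambda>n. t - t / Suc n) \<longlonglongrightarrow> t - 0"
          by (rule tendsto_diff[OF tendsto_const LIMSEQ_Suc[OF inv_n_tendsto]])
        then show "(\<lambda>n. t - t / Suc n) \<longlonglongrightarrow> t" by simp
        show "\<forall>\<^sub>F n in sequentially. t - t / Suc n \<in> {..<t} \<and> t - t / Suc n \<noteq> t"
          using t0 by (intro always_eventually) simp
      qed
      from filterlim_compose[OF cadlag_tendsto_left[OF Y_cadlag[OF \<omega>] t0] this]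
      have lim: "(\<lambda>n. Y (t - t / Suc n) \<omega>) \<longlonglongrightarrow> Yl t \<omega>" by (simp add: Yl_def)
      have nn: "0 \<le> t - t / Suc n" for n using t0 by (simp add: field_simps)
      show "(\<lambda>n. h (Y (t - t / Suc n) \<omega>)) \<longlonglongrightarrow> h (Yl t \<omega>)"
        by (rule continuous_on_tendsto_compose[OF h lim]) (use Yl_psd[OF \<omega> t] Y_psd[OF \<omega> nn] in auto)
    qed
  qed
next
  fix \<omega> and t :: real assume \<omega>: "\<omega> \<in> space M" and t: "0 < t"
  have "(Yl t \<omega> \<in> {X. psd X})" using Yl_psd[OF \<omega>] t by auto
  moreover have "\<forall>\<^sub>F s in at_left t. Yl s \<omega> \<in> {X. psd X}"
    using eventually_at_left_pos[OF t] by eventually_elim (use Yl_psd[OF \<omega>] in auto)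
  moreover have "((\<lambda>s. Yl s \<omega>) \<longlongrightarrow> Yl t \<omega>) (at_left t)"
    unfolding Yl_def by (rule left_lim_tendsto_left[OF Y_cadlag[OF \<omega>] t])
  ultimately show "((\<lambda>s. h (Yl s \<omega>)) \<longlongrightarrow> h (Yl t \<omega>)) (at_left t)"
    by (intro continuous_on_tendsto_compose[OF h])
qed

definition jump_matrix :: "real^'d^'d \<Rightarrow> real^('d \<times> 'd)^('d \<times> 'd)" where
  "jump_matrix X = (A ** psd_sqrt (C + X)) \<otimes> (A ** psd_sqrt (C + X))"

lemma continuous_jump_matrix: "continuous_on {X. psd X} (\<lambda>X. jump_matrix X $ I $ K)"
proof -
  have "continuous_on {X. psd X} (\<lambda>X. psd_sqrt (C + X))"
    by (rule continuous_on_compose2[OF continuous_on_psd_sqrt])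
       (auto intro!: continuous_intros posdef_add_psd posdef_C)
  then show ?thesis unfolding jump_matrix_def kron_nth by (intro continuous_intros)
qed

text \<open>An entry is a product of two factors that each grow like the square root of
  \<open>norm (C + X)\<close>. This linear growth is the reason why second moments of
  \<open>Y\<close> control those of its jumps.\<close>

lemma jump_matrix_bound: "\<exists>a\<ge>0. \<forall>X I K. psd X \<longrightarrow> \<bar>jump_matrix X $ I $ K\<bar> \<le> a * (1 + norm X)"
proof -
  define b where "b = (\<Sum>i\<in>UNIV. \<Sum>j\<in>UNIV. \<bar>A $ i $ j\<bar>)"
  have b0: "0 \<le> b" unfolding b_def by (intro sum_nonneg) auto
  have e: "\<bar>(A ** psd_sqrt (C + X)) $ i $ k\<bar> \<le> b * sqrt (norm (C + X))" if "psd X" for X i k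
  proof -
    have s: "\<bar>psd_sqrt (C + X) $ m $ k\<bar> \<le> sqrt (norm (C + X))" for m
      using psd_sqrt_entry_bound[OF posdef_add_psd[OF posdef_C that], of m k] by (simp add: real_le_rsqrt)
    have "\<bar>(A ** psd_sqrt (C + X)) $ i $ k\<bar> \<le> (\<Sum>m\<in>UNIV. \<bar>A $ i $ m\<bar> * \<bar>psd_sqrt (C + X) $ m $ k\<bar>)"
      unfolding matrix_matrix_mult_def abs_mult[symmetric] by simp
    also have "\<dots> \<le> (\<Sum>m\<in>UNIV. \<bar>A $ i $ m\<bar>) * sqrt (norm (C + X))"
      unfolding sum_distrib_right by (intro sum_mono mult_left_mono s) auto
    also have "\<dots> \<le> b * sqrt (norm (C + X))"
      unfolding b_def by (intro mult_right_mono member_le_sum[of i UNIV "\<lambda>i. \<Sum>m\<in>UNIV. \<bar>A $ i $ m\<bar>"]) (auto intro: sum_nonneg)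
    finally show ?thesis .
  qed
  have "\<bar>jump_matrix X $ I $ K\<bar> \<le> b\<^sup>2 * (1 + norm C) * (1 + norm X)" if X: "psd X" for X I K
  proof -
    have "\<bar>jump_matrix X $ I $ K\<bar> \<le> (b * sqrt (norm (C + X))) * (b * sqrt (norm (C + X)))"
      unfolding jump_matrix_def kron_nth abs_mult using b0 by (intro mult_mono e X) auto
    also have "\<dots> = b\<^sup>2 * norm (C + X)" by (simp add: power2_eq_square)
    also have "\<dots> \<le> b\<^sup>2 * ((1 + norm C) * (1 + norm X))"
    proof (rule mult_left_mono)
      have "norm (C + X) \<le> norm C + norm X" by (rule norm_triangle_ineq)
      also have "\<dots> \<le> (1 + norm C) * (1 + norm X)" by (simp add: algebra_simps)
      finally show "norm (C + X) \<le> (1 + norm C) * (1 + norm X)" .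
    qed simp
    finally show ?thesis by (simp add: mult.assoc)
  qed
  then show ?thesis by (intro exI[of _ "b\<^sup>2 * (1 + norm C)"]) auto
qed

lemma Yl_section_measurable:
  fixes h :: "real^'d^'d \<Rightarrow> real"
  assumes "continuous_on {X. psd X} h" "0 < t" "\<omega> \<in> space M"
  shows "(\<lambda>s. h (Yl s \<omega>) * indicator {0<..t} s) \<in> borel_measurable borel"
  using measurable_compose[OF measurable_Pair2'[OF assms(3), of lborel]
      left_continuous_joint_measurable[OF left_continuous_functional[OF assms(1)] assms(2)]]
  by simp

lemma Yl_section_integrable:
  fixes h :: "real^'d^'d \<Rightarrow> real"
  assumes "0 < t" "\<omega> \<in> space M" "continuous_on {X. psd X} h" "\<And>s. s \<in> {0<..t} \<Longrightarrow> \<bar>h (Yl s \<omega>)\<bar> \<le> K"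
  shows "integrable lborel (\<lambda>s. h (Yl s \<omega>) * indicator {0<..t} s)"
proof (rule Bochner_Integration.integrable_bound[where f="\<lambda>s. K * indicator {0<..t} s"])
  show "integrable lborel (\<lambda>s. K * indicator {0<..t} s :: real)" using assms(1) by simp
  show "(\<lambda>s. h (Yl s \<omega>) * indicator {0<..t} s) \<in> borel_measurable lborel"
    using Yl_section_measurable[OF assms(3,1,2)] by simp
  show "AE s in lborel. norm (h (Yl s \<omega>) * indicator {0<..t} s) \<le> norm (K * indicator {0<..t} s :: real)"
  proof (rule AE_I2)
    fix s
    show "norm (h (Yl s \<omega>) * indicator {0<..t} s) \<le> norm (K * indicator {0<..t} s :: real)"
      using assms(4)[of s] by (cases "s \<in> {0<..t}") auto
  qed
qed

definition drift :: "'d \<times> 'd \<Rightarrow> real^'d^'d \<Rightarrow> real" where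
  "drift I X = (drift_matrix B *v vec_mat X) $ I"

definition jmp :: "'d \<times> 'd \<Rightarrow> real \<Rightarrow> 'a \<Rightarrow> real" where
  "jmp I u \<omega> = (\<Sum>K\<in>UNIV. jump_matrix (Yl u \<omega>) $ I $ K * qvec K (jump (\<lambda>r. L r \<omega>) u))"

lemma drift_altdef: "drift I X = (B ** X + X ** transpose B) $ snd I $ fst I"
  by (simp add: drift_def vec_mat_drift[symmetric]) (simp add: vec_mat_def)

lemma continuous_drift: "continuous_on S (drift I)"
  unfolding drift_altdef[abs_def] by (intro continuous_intros)

text \<open>Entry by entry \<open>solution\<close> becomes a scalar equation: left limits are
  bounded on compact intervals, so \<open>LS_integral_jump_sum\<close> applies to each entry of the
  integrator, and the gauge integral of the drift becomes a Lebesgue integral.\<close>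

lemma path_equation:
  "AE \<omega> in M. \<forall>t>0. \<forall>I.
     integrable lborel (\<lambda>s. drift I (Yl s \<omega>) * indicator {0<..t} s) \<and>
     integrable (count_space {0<..t}) (\<lambda>u. jmp I u \<omega>) \<and>
     vec_mat (Y t \<omega>) $ I = vec_mat (Y 0 \<omega>) $ I
       + (\<integral>s. drift I (Yl s \<omega>) * indicator {0<..t} s \<partial>lborel)
       + (\<integral>u. jmp I u \<omega> \<partial>count_space {0<..t})"
  using solution square_summable_jumps AE_space
proof eventually_elim
  case (elim \<omega>)
  show ?case
  proof (intro allI impI)
    fix t :: real and I :: "'d \<times> 'd" assume t: "0 < t"
    \<comment> \<open>\<open>vec_mat\<close> puts the column first, so the row is the second
      component of \<open>I\<close>.\<close>
    define i j where "i = snd I" and "j = fst I"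
    have I: "I = (j, i)" by (simp add: i_def j_def)
    let ?S = "\<lambda>s. psd_sqrt (C + Yl s \<omega>)" and ?\<Delta> = "\<lambda>u. jump (\<lambda>r. L r \<omega>) u"
    obtain J where J: "has_matrix_LS_integral (\<lambda>s. A ** ?S s) (disc_qv (\<lambda>r. L r \<omega>)) (\<lambda>s. ?S s ** transpose A) t J"
      "Y t \<omega> = Y 0 \<omega> + integral {0..t} (\<lambda>s. B ** Yl s \<omega> + Yl s \<omega> ** transpose B) + J"
      using elim(1) t unfolding Let_def Yl_def[symmetric] by (meson less_imp_le)
    obtain Q where Q: "\<And>i j k l. has_LS_integral (\<lambda>s. (A ** ?S s) $ i $ k * (?S s ** transpose A) $ l $ j) (\<lambda>s. disc_qv (\<lambda>r. L r \<omega>) s $ k $ l) t (Q i j k l)"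
      "J = (\<chi> i j. \<Sum>k\<in>UNIV. \<Sum>l\<in>UNIV. Q i j k l)"
      using J(1) unfolding has_matrix_LS_integral_def by blast
    obtain Kb where Kb: "\<And>s. s \<in> {0..t} \<Longrightarrow> norm (Yl s \<omega>) \<le> Kb"
      using cadlag_norm_bound[OF Y_cadlag[OF elim(3)], of t] unfolding Yl_def by blast
    obtain a where a: "0 \<le> a" "\<And>X I K. psd X \<Longrightarrow> \<bar>jump_matrix X $ I $ K\<bar> \<le> a * (1 + norm X)"
      using jump_matrix_bound by blast
    have Nb: "\<bar>jump_matrix (Yl s \<omega>) $ I $ K\<bar> \<le> a * (1 + Kb)" if "s \<in> {0<..t}" for s I K
    proof -
      have "\<bar>jump_matrix (Yl s \<omega>) $ I $ K\<bar> \<le> a * (1 + norm (Yl s \<omega>))"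
        using that by (intro a(2) Yl_psd[OF elim(3)]) auto
      also have "\<dots> \<le> a * (1 + Kb)" using Kb[of s] that a(1) by (intro mult_left_mono) auto
      finally show ?thesis .
    qed
    \<comment> \<open>Symmetry of the root makes the right factor the transpose of the left one,
      whence the Kronecker square.\<close>
    have hN: "(A ** ?S s) $ i $ k * (?S s ** transpose A) $ l $ j = jump_matrix (Yl s \<omega>) $ (j, i) $ (l, k)" if "s \<in> {0<..t}" for s i j k l
    proof -
      have "transpose (?S s) = ?S s"
        using psd_sqrt(1)[OF posdef_add_psd[OF posdef_C Yl_psd[OF elim(3)]], of s] that by (auto simp: psd_def)
      then have "?S s ** transpose A = transpose (A ** ?S s)" by (simp add: matrix_transpose_mul)
      then show ?thesis by (simp add: jump_matrix_def kron_nth transpose_def mult.commute)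
    qed
    have disc: "disc_qv (\<lambda>r. L r \<omega>) s $ k $ l = (\<integral>u. ?\<Delta> u $ k * ?\<Delta> u $ l \<partial>count_space {0<..s})" if "0 \<le> s" "s \<le> t" for s k l
      by (rule disc_qv_entry(2)[OF elim(2)[rule_format] that(1)])
    have LS: "integrable (count_space {0<..t}) (\<lambda>u. jump_matrix (Yl u \<omega>) $ (j, i) $ (l, k) * qvec (l, k) (?\<Delta> u))"
      "Q i j k l = (\<integral>u. jump_matrix (Yl u \<omega>) $ (j, i) $ (l, k) * qvec (l, k) (?\<Delta> u) \<partial>count_space {0<..t})" for i j k l
    proof -
      let ?h = "\<lambda>s. (A ** ?S s) $ i $ k * (?S s ** transpose A) $ l $ j"
      have b: "\<bar>?h s\<bar> \<le> a * (1 + Kb)" if "s \<in> {0<..t}" for s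
        unfolding hN[OF that] by (rule Nb[OF that])
      have R: "integrable (count_space {0<..t}) (\<lambda>u. ?h u * (?\<Delta> u $ k * ?\<Delta> u $ l))"
        "Q i j k l = (\<integral>u. ?h u * (?\<Delta> u $ k * ?\<Delta> u $ l) \<partial>count_space {0<..t})"
        using LS_integral_jump_sum[where w="\<lambda>u. ?\<Delta> u $ k * ?\<Delta> u $ l" and h="?h" and K="a * (1 + Kb)",
            OF less_imp_le[OF t] disc_qv_entry(1)[OF elim(2)[rule_format] less_imp_le[OF t]] disc Q(1) b]
        by auto
      have c: "?h u * (?\<Delta> u $ k * ?\<Delta> u $ l) = jump_matrix (Yl u \<omega>) $ (j, i) $ (l, k) * qvec (l, k) (?\<Delta> u)" if "u \<in> {0<..t}" for u
        by (simp only: hN[OF that] qvec_altdef fst_conv snd_conv)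
      show "integrable (count_space {0<..t}) (\<lambda>u. jump_matrix (Yl u \<omega>) $ (j, i) $ (l, k) * qvec (l, k) (?\<Delta> u))"
        using R(1) c by (subst Bochner_Integration.integrable_cong[OF refl, of _ _ "\<lambda>u. ?h u * (?\<Delta> u $ k * ?\<Delta> u $ l)"]) auto
      show "Q i j k l = (\<integral>u. jump_matrix (Yl u \<omega>) $ (j, i) $ (l, k) * qvec (l, k) (?\<Delta> u) \<partial>count_space {0<..t})"
        unfolding R(2) by (rule Bochner_Integration.integral_cong[OF refl]) (use c in auto)
    qed
    have ji: "integrable (count_space {0<..t}) (\<lambda>u. jump_matrix (Yl u \<omega>) $ I $ K * qvec K (?\<Delta> u))" for K
      using LS(1)[of j i "fst K" "snd K"] by (simp add: I)
    then have i2: "integrable (count_space {0<..t}) (\<lambda>u. jmp I u \<omega>)" unfolding jmp_def by simp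
    have "J $ i $ j = (\<Sum>k\<in>UNIV. \<Sum>l\<in>UNIV. \<integral>u. jump_matrix (Yl u \<omega>) $ I $ (l, k) * qvec (l, k) (?\<Delta> u) \<partial>count_space {0<..t})"
      unfolding Q(2) by (simp add: LS(2) I)
    \<comment> \<open>The pair index is \<open>(l, k)\<close>, column first, which reverses the
      order of summation.\<close>
    also have "\<dots> = (\<Sum>K\<in>UNIV. \<integral>u. jump_matrix (Yl u \<omega>) $ I $ K * qvec K (?\<Delta> u) \<partial>count_space {0<..t})"
      unfolding sum_UNIV_prod by (rule sum.swap)
    also have "\<dots> = (\<integral>u. jmp I u \<omega> \<partial>count_space {0<..t})"
      unfolding jmp_def using ji by simp
    finally have Jij: "J $ i $ j = (\<integral>u. jmp I u \<omega> \<partial>count_space {0<..t})" .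
    let ?d = "\<lambda>s. B ** Yl s \<omega> + Yl s \<omega> ** transpose B"
    have di: "integrable lborel (\<lambda>s. drift I (Yl s \<omega>) * indicator {0<..t} s)" for I
    proof -
      have "compact (drift I ` cball 0 Kb)" by (intro compact_continuous_image continuous_drift compact_cball)
      then obtain Kd where Kd: "\<And>x. x \<in> drift I ` cball 0 Kb \<Longrightarrow> \<bar>x\<bar> \<le> Kd"
        using compact_imp_bounded bounded_iff by (metis real_norm_def)
      show ?thesis
      proof (rule Yl_section_integrable[OF t elim(3) continuous_drift, where K=Kd])
        fix s assume "s \<in> {0<..t}"
        then have "drift I (Yl s \<omega>) \<in> drift I ` cball 0 Kb" using Kb[of s] by auto
        then show "\<bar>drift I (Yl s \<omega>)\<bar> \<le> Kd" by (rule Kd)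
      qed
    qed
    have "((\<lambda>s. ?d s $ i $ j) has_integral (\<integral>s. drift (j, i) (Yl s \<omega>) * indicator {0<..t} s \<partial>lborel)) {0..t}" for i j
    proof -
      have "((\<lambda>s. drift (j, i) (Yl s \<omega>) * indicator {0<..t} s) has_integral (\<integral>s. drift (j, i) (Yl s \<omega>) * indicator {0<..t} s \<partial>lborel)) UNIV"
        by (rule has_integral_integral_lborel[OF di])
      \<comment> \<open>The two integration domains, closed and half-open, differ only at time
        0.\<close>
      then have "((\<lambda>s. if s \<in> {0..t} then ?d s $ i $ j else 0) has_integral (\<integral>s. drift (j, i) (Yl s \<omega>) * indicator {0<..t} s \<partial>lborel)) UNIV"
        by (rule has_integral_spike[of "{0}", rotated 2]) (auto simp: drift_altdef)
      then show ?thesis by (simp only: has_integral_restrict_UNIV)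
    qed
    from integral_unique[OF has_integral_matrix[OF this]]
    have "integral {0..t} ?d $ i $ j = (\<integral>s. drift I (Yl s \<omega>) * indicator {0<..t} s \<partial>lborel)" by (simp add: I)
    then have "vec_mat (Y t \<omega>) $ I = vec_mat (Y 0 \<omega>) $ I
       + (\<integral>s. drift I (Yl s \<omega>) * indicator {0<..t} s \<partial>lborel) + (\<integral>u. jmp I u \<omega> \<partial>count_space {0<..t})"
      unfolding J(2) using Jij by (simp add: vec_mat_def I)
    with di i2 show "integrable lborel (\<lambda>s. drift I (Yl s \<omega>) * indicator {0<..t} s) \<and>
     integrable (count_space {0<..t}) (\<lambda>u. jmp I u \<omega>) \<and>
     vec_mat (Y t \<omega>) $ I = vec_mat (Y 0 \<omega>) $ I
       + (\<integral>s. drift I (Yl s \<omega>) * indicator {0<..t} s \<partial>lborel)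
       + (\<integral>u. jmp I u \<omega> \<partial>count_space {0<..t})" by blast
  qed
qed

end

text \<open>Let \<open>b\<close> be the supremum over \<open>s\<close> of
  \<open>exp (- 2 D s)\<close> times \<open>e s\<close>; the hypothesis yields
  \<open>b \<le> m + D T + b / 2\<close>. The bound \<open>K\<close> ensures that \<open>b\<close>
  is finite and is absent from the conclusion, so it may depend on the truncation level.\<close>

lemma gronwall_nn_integral:
  fixes e :: "real \<Rightarrow> ennreal"
  assumes fin: "\<And>t. 0 < t \<Longrightarrow> t \<le> T \<Longrightarrow> e t \<le> ennreal K"
    and le: "\<And>t. 0 < t \<Longrightarrow> t \<le> T \<Longrightarrow> e t \<le> ennreal m + ennreal D * (\<integral>\<^sup>+s. (1 + e s) * indicator {0<..t} s \<partial>lborel)"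
    and m: "0 \<le> m" and D: "0 < D" and t: "0 < t" "t \<le> T"
  shows "e t \<le> ennreal (2 * (m + D * T) * exp (2 * D * T))"
proof -
  define r where "r s = enn2real (e s)" for s
  have er: "e s = ennreal (r s)" if "0 < s" "s \<le> T" for s
  proof -
    have "e s < \<top>" using fin[OF that] by (rule order.strict_trans1) simp
    then show ?thesis by (simp add: r_def)
  qed
  have rK: "r s \<le> \<bar>K\<bar>" if "0 < s" "s \<le> T" for s
    unfolding r_def using fin[OF that] by (intro enn2real_leI) (auto intro: order_trans ennreal_leI)
  have r0: "0 \<le> r s" for s by (simp add: r_def)
  \<comment> \<open>Integrating \<open>exp (l * u)\<close> produces the factor \<open>1 / l\<close>,
    and \<open>D / l = 1 / 2\<close> allows \<open>b\<close> to be absorbed on the left.\<close>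
  define l where "l = 2 * D"
  define b where "b = (SUP s\<in>{0<..T}. exp (- (l * s)) * r s)"
  have bdd: "bdd_above ((\<lambda>s. exp (- (l * s)) * r s) ` {0<..T})"
  proof (rule bdd_aboveI2)
    fix s assume s: "s \<in> {0<..T}"
    have "exp (- (l * s)) * r s \<le> 1 * \<bar>K\<bar>"
      using s D r0 rK by (intro mult_mono) (auto simp: l_def)
    then show "exp (- (l * s)) * r s \<le> \<bar>K\<bar>" by simp
  qed
  have rb: "r s \<le> b * exp (l * s)" if "0 < s" "s \<le> T" for s
  proof -
    have "exp (- (l * s)) * r s \<le> b" unfolding b_def using that by (intro cSUP_upper bdd) auto
    then have "exp (l * s) * (exp (- (l * s)) * r s) \<le> exp (l * s) * b" by (intro mult_left_mono) auto
    then show ?thesis by (simp only: mult.assoc[symmetric] exp_minus_inverse mult_1 mult.commute[of b])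
  qed
  have b0: "0 \<le> b"
  proof -
    have "0 \<le> exp (- (l * t)) * r t" using r0 by simp
    also have "\<dots> \<le> b" unfolding b_def using t by (intro cSUP_upper bdd) auto
    finally show ?thesis .
  qed
  have key: "exp (- (l * s)) * r s \<le> (m + D * T) + b / 2" if s: "0 < s" "s \<le> T" for s
  proof -
    have "(\<integral>\<^sup>+u. (1 + e u) * indicator {0<..s} u \<partial>lborel) \<le> (\<integral>\<^sup>+u. ennreal (1 + b * exp (l * u)) * indicator {0..s} u \<partial>lborel)"
    proof (rule nn_integral_mono)
      fix u
      have "1 + e u \<le> ennreal (1 + b * exp (l * u))" if "u \<in> {0<..s}"
        using rb[of u] er[of u] r0[of u] s that b0
        by (simp add: ennreal_plus ennreal_leI)
      then show "(1 + e u) * indicator {0<..s} u \<le> ennreal (1 + b * exp (l * u)) * indicator {0..s} u"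
        by (auto simp: indicator_def)
    qed
    also have "\<dots> = ennreal ((s + b * exp (l * s) / l) - (0 + b * exp (l * 0) / l))"
      using s b0 D by (intro nn_integral_FTC_Icc) (auto intro!: derivative_eq_intros add_nonneg_nonneg simp: l_def)
    finally have I: "(\<integral>\<^sup>+u. (1 + e u) * indicator {0<..s} u \<partial>lborel) \<le> ennreal (s + b * exp (l * s) / l - b / l)"
      by simp
    have nn: "0 \<le> s + b * exp (l * s) / l - b / l"
    proof -
      have "b \<le> b * exp (l * s)" using b0 D s by (simp add: l_def mult_le_cancel_left1)
      then have "b / l \<le> b * exp (l * s) / l" using D by (simp add: l_def divide_right_mono)
      then show ?thesis using s by simp
    qed
    have "ennreal (r s) \<le> ennreal m + ennreal D * ennreal (s + b * exp (l * s) / l - b / l)"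
      using order_trans[OF le[OF s] add_left_mono[OF mult_left_mono[OF I]]] er[OF s] by simp
    also have "\<dots> = ennreal (m + D * (s + b * exp (l * s) / l - b / l))"
      using nn m D by (simp add: ennreal_mult ennreal_plus)
    finally have "r s \<le> m + D * (s + b * exp (l * s) / l - b / l)"
      using nn m D by (subst (asm) ennreal_le_iff) auto
    also have "\<dots> = m + D * s + b * exp (l * s) / 2 - b / 2" using D by (simp add: l_def field_simps)
    also have "\<dots> \<le> (m + D * T) + b / 2 * exp (l * s)"
    proof -
      have "D * s \<le> D * T" using s D by (intro mult_left_mono) auto
      then show ?thesis using b0 by (simp add: field_simps)
    qed
    finally have "exp (- (l * s)) * r s \<le> exp (- (l * s)) * ((m + D * T) + b / 2 * exp (l * s))"
      by (intro mult_left_mono) auto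
    also have "\<dots> = exp (- (l * s)) * (m + D * T) + b / 2"
    proof -
      have "exp (- (l * s)) * exp (l * s) = 1" by (simp only: exp_minus_inverse mult.commute[of "exp (- (l * s))"])
      then show ?thesis by (simp add: distrib_left mult.left_commute[of "exp (- (l * s))"])
    qed
    also have "\<dots> \<le> 1 * (m + D * T) + b / 2"
      using m D s by (intro add_right_mono mult_right_mono) (auto simp: l_def)
    finally show ?thesis by simp
  qed
  have "b \<le> (m + D * T) + b / 2" unfolding b_def[of]
    using key t unfolding b_def by (intro cSUP_least) auto
  then have "b \<le> 2 * (m + D * T)" by simp
  then have "b * exp (l * t) \<le> 2 * (m + D * T) * exp (2 * D * T)"
    using b0 t D by (intro mult_mono) (auto simp: l_def)
  then have "r t \<le> 2 * (m + D * T) * exp (2 * D * T)" using rb[OF t] by linarith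
  then show ?thesis unfolding er[OF t] by (rule ennreal_leI)
qed

lemma norm_vec_mat: "norm (vec_mat (X :: real^'n::finite^'m::finite)) = norm X"
proof -
  have "(norm (vec_mat X))\<^sup>2 = (norm X)\<^sup>2"
    unfolding power2_norm_eq_inner inner_vec_def vec_mat_def by (simp add: sum_UNIV_prod) (rule sum.swap)
  then show ?thesis by simp
qed

lemma norm_square_vec_mat: "(norm X)\<^sup>2 = (\<Sum>I\<in>UNIV. (vec_mat (X :: real^'n::finite^'m::finite) $ I)\<^sup>2)"
  unfolding norm_vec_mat[symmetric, of X] power2_norm_eq_inner inner_vec_def by (simp add: power2_eq_square)

lemma vec_mat_entry_bound: "\<bar>vec_mat X $ I\<bar> \<le> norm (X :: real^'n::finite^'m::finite)"
  using component_le_norm_cart[of "vec_mat X" I] by (simp add: norm_vec_mat)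

text \<open>If \<open>f\<close> is not integrable, the left side is 0 by convention, so the bound
  applies without checking integrability.\<close>

lemma ennreal_abs_integral_le: "ennreal \<bar>\<integral>x. f x \<partial>M\<bar> \<le> (\<integral>\<^sup>+x. ennreal \<bar>f x\<bar> \<partial>M)" for f :: "'a \<Rightarrow> real"
  using integral_norm_bound_ennreal[of M f] not_integrable_integral_eq[of M f] by (cases "integrable M f") auto

context levy_jumps
begin

lemma left_continuous_adapted_mult:
  assumes "left_continuous_adapted G" "left_continuous_adapted H"
  shows "left_continuous_adapted (\<lambda>s \<omega>. G s \<omega> * H s \<omega>)"
  using assms unfolding left_continuous_adapted_def by (auto intro!: tendsto_mult borel_measurable_times)

end

section \<open>Product equation, truncation and a priori bounds\<close>

context mucogarch
begin

lemma left_lim_entry: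
  assumes "\<omega> \<in> space M" "0 \<le> s"
  shows "left_lim (\<lambda>r. vec_mat (Y r \<omega>) $ I) s = vec_mat (Yl s \<omega>) $ I"
proof (cases "s = 0")
  case True
  then show ?thesis by (simp add: Yl_def left_lim_def)
next
  case False
  then have s: "0 < s" using assms by simp
  have "((\<lambda>r. Y r \<omega> $ snd I $ fst I) \<longlongrightarrow> Yl s \<omega> $ snd I $ fst I) (at_left s)"
    unfolding Yl_def by (intro tendsto_vec_nth cadlag_tendsto_left[OF Y_cadlag[OF assms(1)] s])
  then show ?thesis using s by (intro left_lim_eqI) (simp_all add: vec_mat_def)
qed

text \<open>\<open>finite_variation_product\<close> for pairs of coordinates, with left limits of
  coordinates rewritten as coordinates of \<open>Yl\<close>. The clause on the size of a jump is
  kept for \<open>Yl_eq_Y\<close>.\<close>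

lemma product_equation:
  "AE \<omega> in M. \<forall>t>0. \<forall>I J.
     vec_mat (Y t \<omega>) $ I * vec_mat (Y t \<omega>) $ J = vec_mat (Y 0 \<omega>) $ I * vec_mat (Y 0 \<omega>) $ J
     + (\<integral>s. (vec_mat (Yl s \<omega>) $ I * drift J (Yl s \<omega>) + vec_mat (Yl s \<omega>) $ J * drift I (Yl s \<omega>)) * indicator {0<..t} s \<partial>lborel)
     + (\<integral>u. vec_mat (Yl u \<omega>) $ I * jmp J u \<omega> + vec_mat (Yl u \<omega>) $ J * jmp I u \<omega> + jmp I u \<omega> * jmp J u \<omega> \<partial>count_space {0<..t})
     \<and> jump (\<lambda>r. vec_mat (Y r \<omega>) $ I) t = jmp I t \<omega>"
  using path_equation AE_space
proof eventually_elim
  case (elim \<omega>)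
  show ?case
  proof (intro allI impI)
    fix t :: real and I J :: "'d \<times> 'd" assume t: "0 < t"
    have eq: "vec_mat (Y s \<omega>) $ I = vec_mat (Y 0 \<omega>) $ I
       + (\<integral>u. drift I (Yl u \<omega>) * indicator {0<..s} u \<partial>lborel) + (\<integral>u. jmp I u \<omega> \<partial>count_space {0<..s})"
      if "0 \<le> s" "s \<le> t" for s I
      using elim(1)[rule_format, of s I] that by (cases "s = 0") (auto simp: lebesgue_integral_count_space_finite)
    have di: "integrable lborel (\<lambda>s. drift I (Yl s \<omega>) * indicator {0<..t} s)" and
      ji: "integrable (count_space {0<..t}) (\<lambda>u. jmp I u \<omega>)" for I
      using elim(1)[rule_format, OF t, of I] by auto
    note P = finite_variation_product[of t "\<lambda>s. drift I (Yl s \<omega>)" "\<lambda>s. drift J (Yl s \<omega>)"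
        "\<lambda>u. jmp I u \<omega>" "\<lambda>u. jmp J u \<omega>" "\<lambda>s. vec_mat (Y s \<omega>) $ I" "\<lambda>s. vec_mat (Y s \<omega>) $ J", OF t di di ji ji eq eq]
    have ll: "left_lim (\<lambda>r. vec_mat (Y r \<omega>) $ I) s = vec_mat (Yl s \<omega>) $ I" if "s \<in> {0<..t}" for s I
      by (rule left_lim_entry[OF elim(2)]) (use that in auto)
    have 1: "(\<integral>s. (left_lim (\<lambda>s. vec_mat (Y s \<omega>) $ I) s * drift J (Yl s \<omega>) + left_lim (\<lambda>s. vec_mat (Y s \<omega>) $ J) s * drift I (Yl s \<omega>)) * indicator {0<..t} s \<partial>lborel)
      = (\<integral>s. (vec_mat (Yl s \<omega>) $ I * drift J (Yl s \<omega>) + vec_mat (Yl s \<omega>) $ J * drift I (Yl s \<omega>)) * indicator {0<..t} s \<partial>lborel)"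
      by (intro Bochner_Integration.integral_cong refl) (simp add: indicator_def ll)
    have 2: "(\<integral>u. left_lim (\<lambda>s. vec_mat (Y s \<omega>) $ I) u * jmp J u \<omega> + left_lim (\<lambda>s. vec_mat (Y s \<omega>) $ J) u * jmp I u \<omega> + jmp I u \<omega> * jmp J u \<omega> \<partial>count_space {0<..t})
      = (\<integral>u. vec_mat (Yl u \<omega>) $ I * jmp J u \<omega> + vec_mat (Yl u \<omega>) $ J * jmp I u \<omega> + jmp I u \<omega> * jmp J u \<omega> \<partial>count_space {0<..t})"
      by (intro Bochner_Integration.integral_cong refl) (simp add: ll)
    show "vec_mat (Y t \<omega>) $ I * vec_mat (Y t \<omega>) $ J = vec_mat (Y 0 \<omega>) $ I * vec_mat (Y 0 \<omega>) $ J
     + (\<integral>s. (vec_mat (Yl s \<omega>) $ I * drift J (Yl s \<omega>) + vec_mat (Yl s \<omega>) $ J * drift I (Yl s \<omega>)) * indicator {0<..t} s \<partial>lborel)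
     + (\<integral>u. vec_mat (Yl u \<omega>) $ I * jmp J u \<omega> + vec_mat (Yl u \<omega>) $ J * jmp I u \<omega> + jmp I u \<omega> * jmp J u \<omega> \<partial>count_space {0<..t})
     \<and> jump (\<lambda>r. vec_mat (Y r \<omega>) $ I) t = jmp I t \<omega>"
      using P(1) P(2)[of t] t unfolding 1 2 by simp
  qed
qed

text \<open>Almost surely \<open>L\<close> has no jump at a fixed time, hence neither has
  \<open>Y\<close>. Pathwise equations contain \<open>Yl\<close> and moments contain
  \<open>Y\<close>; under expectations this lemma bridges the two.\<close>

lemma Yl_eq_Y:
  assumes t: "0 \<le> t"
  shows "AE \<omega> in M. Yl t \<omega> = Y t \<omega>"
proof (cases "t = 0")
  case True
  then show ?thesis by (simp add: Yl_def left_lim_def)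
next
  case False
  then have t: "0 < t" using assms by simp
  have "AE \<omega> in M. (norm (jump (\<lambda>r. L r \<omega>) t))\<^sup>2 = 0"
    by (rule no_fixed_jumps[OF _ _ _ norm_square_integrable t]) (auto intro!: continuous_intros)
  then show ?thesis
    using product_equation AE_space
  proof eventually_elim
    case (elim \<omega>)
    have "vec_mat (Y t \<omega>) $ I = vec_mat (Yl t \<omega>) $ I" for I
    proof -
      have "jump (\<lambda>r. vec_mat (Y r \<omega>) $ I) t = jmp I t \<omega>" using elim(2) t by blast
      also have "\<dots> = 0" using elim(1) by (simp add: jmp_def qvec_0)
      finally show ?thesis using left_lim_entry[OF elim(3), of t I] t by (simp add: jump_def)
    qed
    then have "vec_mat (Y t \<omega>) = vec_mat (Yl t \<omega>)" by (simp add: vec_eq_iff)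
    then show ?case by (metis unvec_vec_mat)
  qed
qed

text \<open>Takes the place of a stopping time. The strict bound \<open>r < s\<close> makes it
  left-continuous in \<open>s\<close>: a large jump at \<open>s\<close> itself is not yet
  noticed.\<close>

definition trunc :: "real \<Rightarrow> real \<Rightarrow> 'a \<Rightarrow> real" where
  "trunc k s \<omega> = (if \<forall>r. 0 \<le> r \<and> r < s \<longrightarrow> norm (Y r \<omega>) \<le> k then 1 else 0)"

lemma trunc_antimono: "s \<le> t \<Longrightarrow> trunc k t \<omega> \<le> trunc k s \<omega>"
  by (auto simp: trunc_def)

lemma trunc_range: "0 \<le> trunc k s \<omega>" "trunc k s \<omega> \<le> 1"
  by (auto simp: trunc_def)

lemma left_continuous_trunc: "left_continuous_adapted (trunc k)"
  unfolding left_continuous_adapted_def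
proof (intro conjI allI impI ballI)
  fix t :: real assume t: "0 \<le> t"
  \<comment> \<open>Rational times leave countably many events. By right-continuity an excess over
    \<open>k\<close> at some \<open>r < t\<close> persists at rationals just after
    \<open>r\<close>.\<close>
  define Q where "Q = \<rat> \<inter> {0..<t}"
  have "countable Q" unfolding Q_def using countable_rat by blast
  have [measurable]: "Y q \<in> borel_measurable (F t)" if "q \<in> Q" for q
    using measurable_F_mono[OF Y_adapted] that unfolding Q_def by auto
  have S: "{\<omega>\<in>space (F t). \<forall>q\<in>Q. norm (Y q \<omega>) \<le> k} \<in> sets (F t)"
  proof (cases "Q = {}")
    case False
    have "(\<Inter>q\<in>Q. {\<omega>\<in>space (F t). norm (Y q \<omega>) \<le> k}) \<in> sets (F t)"
      by (rule sets.countable_INT'[OF \<open>countable Q\<close> False]) auto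
    also have "(\<Inter>q\<in>Q. {\<omega>\<in>space (F t). norm (Y q \<omega>) \<le> k}) = {\<omega>\<in>space (F t). \<forall>q\<in>Q. norm (Y q \<omega>) \<le> k}"
      using False by auto
    finally show ?thesis .
  qed simp
  have eq: "(\<forall>r. 0 \<le> r \<and> r < t \<longrightarrow> norm (Y r \<omega>) \<le> k) \<longleftrightarrow> (\<forall>q\<in>Q. norm (Y q \<omega>) \<le> k)" if \<omega>: "\<omega> \<in> space M" for \<omega>
  proof
    assume H: "\<forall>q\<in>Q. norm (Y q \<omega>) \<le> k"
    show "\<forall>r. 0 \<le> r \<and> r < t \<longrightarrow> norm (Y r \<omega>) \<le> k"
    proof (intro allI impI, rule ccontr)
      fix r assume r: "0 \<le> r \<and> r < t" and "\<not> norm (Y r \<omega>) \<le> k"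
      then have "\<forall>\<^sub>F s in at_right r. k < norm (Y s \<omega>)"
        using tendsto_norm[OF cadlag_tendsto_right[OF Y_cadlag[OF \<omega>], of r]] by (intro order_tendstoD(1)) auto
      then obtain c where c: "c > r" "\<And>s. r < s \<Longrightarrow> s < c \<Longrightarrow> k < norm (Y s \<omega>)"
        unfolding eventually_at_right_field by blast
      obtain q where "q \<in> \<rat>" "r < q" "q < min c t" using Rats_dense_in_real[of r "min c t"] c r by auto
      then show False using H c(2)[of q] r by (force simp: Q_def)
    qed
  qed (auto simp: Q_def)
  have "trunc k t \<omega> = indicator {\<omega>\<in>space (F t). \<forall>q\<in>Q. norm (Y q \<omega>) \<le> k} \<omega>" if "\<omega> \<in> space (F t)" for \<omega>
    using eq[of \<omega>] that space_F[OF t] by (auto simp: trunc_def indicator_def)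
  then show "trunc k t \<in> borel_measurable (F t)"
    using S by (subst measurable_cong[of _ _ "indicator {\<omega>\<in>space (F t). \<forall>q\<in>Q. norm (Y q \<omega>) \<le> k}"]) auto
next
  fix \<omega> and t :: real assume \<omega>: "\<omega> \<in> space M" and t: "0 < t"
  have "\<forall>\<^sub>F s in at_left t. trunc k s \<omega> = trunc k t \<omega>"
  proof (cases "\<forall>r. 0 \<le> r \<and> r < t \<longrightarrow> norm (Y r \<omega>) \<le> k")
    case True
    from eventually_at_left_real[OF t] show ?thesis
      by eventually_elim (use True in \<open>auto simp: trunc_def\<close>)
  next
    case False
    then obtain r where r: "0 \<le> r" "r < t" "\<not> norm (Y r \<omega>) \<le> k" by auto
    from eventually_at_left_real[OF r(2)] show ?thesis
      by eventually_elim (use r in \<open>auto simp: trunc_def\<close>)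
  qed
  then show "((\<lambda>s. trunc k s \<omega>) \<longlongrightarrow> trunc k t \<omega>) (at_left t)"
    by (rule tendsto_eventually)
qed

lemma trunc_Yl_bound:
  assumes "\<omega> \<in> space M" "0 < s"
  shows "trunc k s \<omega> * (norm (Yl s \<omega>))\<^sup>2 \<le> k\<^sup>2"
proof (cases "\<forall>r. 0 \<le> r \<and> r < s \<longrightarrow> norm (Y r \<omega>) \<le> k")
  case True
  have "\<forall>\<^sub>F r in at_left s. Y r \<omega> \<in> cball 0 k"
    using eventually_at_left_real[OF assms(2)] by eventually_elim (use True in auto)
  then have "Yl s \<omega> \<in> cball 0 k"
    unfolding Yl_def by (intro Lim_in_closed_set[OF closed_cball _ _ cadlag_tendsto_left[OF Y_cadlag[OF assms(1)] assms(2)]]) auto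
  then have "norm (Yl s \<omega>) \<le> k" by simp
  then show ?thesis using True by (simp add: trunc_def power_mono)
next
  case False
  then have "trunc k s \<omega> = 0" by (simp add: trunc_def)
  then show ?thesis by simp
qed

text \<open>Majorant of the jump terms in a squared coordinate: the cross term costs the squared
  norm of the jump of \<open>L\<close>, the squared jump of \<open>Y\<close> its fourth
  power.\<close>

definition jump_growth :: "real^'d \<Rightarrow> real" where
  "jump_growth x = (norm x)\<^sup>2 + norm x ^ 4"

lemma jump_growth: "continuous_on UNIV jump_growth" "jump_growth 0 = 0" "0 \<le> jump_growth x" "integrable \<nu> jump_growth"
  using norm_square_integrable fourth_moment
  by (auto simp: jump_growth_def[abs_def] intro!: continuous_intros)

text \<open>Drift and jump coefficients grow linearly, so every term in the equation of a squared
  coordinate is at most quadratic in \<open>X\<close>, a form to which Gronwall's inequality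
  applies.\<close>

lemma growth_bounds:
  "\<exists>c>0. \<forall>X I x. psd X \<longrightarrow> \<bar>2 * vec_mat X $ I * drift I X\<bar> \<le> c * (1 + (norm X)\<^sup>2) \<and>
     \<bar>2 * vec_mat X $ I * (\<Sum>K\<in>UNIV. jump_matrix X $ I $ K * qvec K x) + (\<Sum>K\<in>UNIV. jump_matrix X $ I $ K * qvec K x)\<^sup>2\<bar>
       \<le> c * (1 + (norm X)\<^sup>2) * jump_growth x"
proof -
  obtain a where a: "0 \<le> a" "\<And>X I K. psd X \<Longrightarrow> \<bar>jump_matrix X $ I $ K\<bar> \<le> a * (1 + norm X)" using jump_matrix_bound by blast
  define n where "n = real CARD('d \<times> 'd)"
  define b where "b = (\<Sum>I\<in>UNIV. \<Sum>K\<in>UNIV. \<bar>drift_matrix B $ I $ K\<bar>)"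
  have n0: "0 \<le> n" by (simp add: n_def)
  have b0: "0 \<le> b" unfolding b_def by (intro sum_nonneg) auto
  \<comment> \<open>\<open>2 * b\<close> serves the drift, the next summand the cross term, the one
    after it the squared jump, each doubled by \<open>sq\<close>; the final 1 makes \<open>c\<close>
    positive.\<close>
  define c where "c = 2 * b + 4 * (n * a) + 2 * (n * a)\<^sup>2 + 1"
  have c0: "0 < c" using a b0 n0 by (auto simp: c_def intro!: add_nonneg_pos add_nonneg_nonneg)
  have sq: "(1 + z)\<^sup>2 \<le> 2 * (1 + z\<^sup>2)" for z :: real
    using sum_squares_ge_zero[of "z - 1" 0] by (simp add: power2_eq_square algebra_simps)
  show ?thesis
  proof (intro exI[of _ c] conjI allI impI)
    fix X :: "real^'d^'d" and I :: "'d \<times> 'd" and x :: "real^'d" assume X: "psd X"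
    let ?z = "norm X"
    have "\<bar>drift I X\<bar> \<le> (\<Sum>K\<in>UNIV. \<bar>drift_matrix B $ I $ K\<bar> * \<bar>vec_mat X $ K\<bar>)"
      unfolding drift_def matrix_vector_mult_def abs_mult[symmetric] by simp
    also have "\<dots> \<le> (\<Sum>K\<in>UNIV. \<bar>drift_matrix B $ I $ K\<bar>) * ?z"
      unfolding sum_distrib_right by (intro sum_mono mult_left_mono vec_mat_entry_bound) auto
    also have "\<dots> \<le> b * ?z"
      unfolding b_def by (intro mult_right_mono member_le_sum[of I UNIV "\<lambda>I. \<Sum>K\<in>UNIV. \<bar>drift_matrix B $ I $ K\<bar>"]) (auto intro: sum_nonneg)
    finally have d: "\<bar>drift I X\<bar> \<le> b * ?z" .
    have "\<bar>2 * vec_mat X $ I * drift I X\<bar> \<le> 2 * (?z * (b * ?z))"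
      unfolding abs_mult mult.assoc using d by (auto intro!: mult_mono vec_mat_entry_bound)
    also have "\<dots> = 2 * b * ?z\<^sup>2" by (simp add: power2_eq_square)
    also have "\<dots> \<le> c * (1 + ?z\<^sup>2)"
      using a b0 n0 by (intro mult_mono) (auto simp: c_def)
    finally show "\<bar>2 * vec_mat X $ I * drift I X\<bar> \<le> c * (1 + ?z\<^sup>2)" .
    let ?j = "\<Sum>K\<in>UNIV. jump_matrix X $ I $ K * qvec K x"
    have "\<bar>?j\<bar> \<le> (\<Sum>K\<in>UNIV. \<bar>jump_matrix X $ I $ K\<bar> * \<bar>qvec K x\<bar>)"
      unfolding abs_mult[symmetric] by simp
    also have "\<dots> \<le> (\<Sum>K\<in>(UNIV :: ('d \<times> 'd) set). a * (1 + ?z) * (norm x)\<^sup>2)"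
      by (intro sum_mono mult_mono a(2) X qvec_bound) (use a(1) in auto)
    also have "\<dots> = n * a * (1 + ?z) * (norm x)\<^sup>2" by (simp add: n_def)
    finally have j: "\<bar>?j\<bar> \<le> n * a * (1 + ?z) * (norm x)\<^sup>2" .
    have na: "0 \<le> n * a" using n0 a by simp
    have "\<bar>2 * vec_mat X $ I * ?j\<bar> \<le> 2 * ((1 + ?z) * (n * a * (1 + ?z) * (norm x)\<^sup>2))"
      unfolding abs_mult mult.assoc[of 2] using j vec_mat_entry_bound[of X I] by (auto intro!: mult_mono)
    also have "\<dots> = 2 * (n * a) * (1 + ?z)\<^sup>2 * (norm x)\<^sup>2" by (simp add: power2_eq_square)
    also have "\<dots> \<le> 2 * (n * a) * (2 * (1 + ?z\<^sup>2)) * (norm x)\<^sup>2"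
      using na by (intro mult_right_mono mult_left_mono sq) auto
    finally have 1: "\<bar>2 * vec_mat X $ I * ?j\<bar> \<le> 4 * (n * a) * (1 + ?z\<^sup>2) * (norm x)\<^sup>2" by (simp add: algebra_simps)
    have "?j\<^sup>2 \<le> (n * a * (1 + ?z) * (norm x)\<^sup>2)\<^sup>2" using power_mono[OF j, of 2] by simp
    also have "\<dots> = (n * a)\<^sup>2 * (1 + ?z)\<^sup>2 * norm x ^ 4" by (simp add: power_mult_distrib)
    also have "\<dots> \<le> (n * a)\<^sup>2 * (2 * (1 + ?z\<^sup>2)) * norm x ^ 4"
      by (intro mult_right_mono mult_left_mono sq) auto
    finally have 2: "?j\<^sup>2 \<le> 2 * (n * a)\<^sup>2 * (1 + ?z\<^sup>2) * norm x ^ 4" by (simp add: algebra_simps)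
    have "4 * (n * a) * (1 + ?z\<^sup>2) * (norm x)\<^sup>2 \<le> c * (1 + ?z\<^sup>2) * (norm x)\<^sup>2"
      "2 * (n * a)\<^sup>2 * (1 + ?z\<^sup>2) * norm x ^ 4 \<le> c * (1 + ?z\<^sup>2) * norm x ^ 4"
      using na b0 by (auto intro!: mult_right_mono simp: c_def)
    then have "\<bar>2 * vec_mat X $ I * ?j\<bar> + ?j\<^sup>2 \<le> c * (1 + ?z\<^sup>2) * (norm x)\<^sup>2 + c * (1 + ?z\<^sup>2) * norm x ^ 4"
      using 1 2 by linarith
    also have "\<dots> = c * (1 + ?z\<^sup>2) * jump_growth x" by (simp add: jump_growth_def distrib_left)
    finally show "\<bar>2 * vec_mat X $ I * ?j + ?j\<^sup>2\<bar> \<le> c * (1 + ?z\<^sup>2) * jump_growth x"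
      using abs_triangle_ineq[of "2 * vec_mat X $ I * ?j" "?j\<^sup>2"] by simp
  qed (rule c0)
qed

end

lemma jsum_count_space: "jsum f w a b = (\<integral>\<^sup>+u. w u (jump f u) \<partial>count_space {a<..b})"
  by (simp add: jsum_def nn_integral_count_space_indicator)

context mucogarch
begin

lemma Y_measurable: "0 \<le> t \<Longrightarrow> Y t \<in> borel_measurable M"
  using Y_adapted measurable_F_M by blast

text \<open>If \<open>trunc k t\<close> is 1, it is 1 at all earlier times and can be inserted in
  the integrands; if it is 0, the left side vanishes. Passing to absolute values keeps only
  nonnegative integrals on the right.\<close>

lemma truncated_moment_inequality:
  fixes k :: real
  assumes "0 < t" and c: "0 < c"
    "\<And>X I. psd X \<Longrightarrow> \<bar>2 * vec_mat X $ I * drift I X\<bar> \<le> c * (1 + (norm X)\<^sup>2)"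
    "\<And>X I x. psd X \<Longrightarrow> \<bar>2 * vec_mat X $ I * (\<Sum>K\<in>UNIV. jump_matrix X $ I $ K * qvec K x) + (\<Sum>K\<in>UNIV. jump_matrix X $ I $ K * qvec K x)\<^sup>2\<bar>
       \<le> c * (1 + (norm X)\<^sup>2) * jump_growth x"
  defines "H \<equiv> \<lambda>s \<omega>. trunc k s \<omega> * (c * (1 + (norm (Yl s \<omega>))\<^sup>2))"
  shows "AE \<omega> in M. \<forall>I. ennreal (trunc k t \<omega> * (vec_mat (Y t \<omega>) $ I)\<^sup>2) \<le> ennreal ((vec_mat (Y 0 \<omega>) $ I)\<^sup>2)
    + (\<integral>\<^sup>+s. ennreal (H s \<omega>) * indicator {0<..t} s \<partial>lborel)
    + JS (\<lambda>u x. ennreal (H u \<omega>) * ennreal (jump_growth x)) 0 t \<omega>"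
  using product_equation AE_space
proof eventually_elim
  case (elim \<omega>)
  show ?case
  proof
    fix I :: "'d \<times> 'd"
    let ?R = "ennreal ((vec_mat (Y 0 \<omega>) $ I)\<^sup>2) + (\<integral>\<^sup>+s. ennreal (H s \<omega>) * indicator {0<..t} s \<partial>lborel)
    + JS (\<lambda>u x. ennreal (H u \<omega>) * ennreal (jump_growth x)) 0 t \<omega>"
    show "ennreal (trunc k t \<omega> * (vec_mat (Y t \<omega>) $ I)\<^sup>2) \<le> ?R"
    proof (cases "trunc k t \<omega> = 0")
      case False
      \<comment> \<open>Antitonicity in time: the path has stayed below \<open>k\<close> up to
        \<open>t\<close>, hence up to every earlier time.\<close>
      then have G: "trunc k s \<omega> = 1" if "s \<le> t" for s
        using trunc_antimono[OF that, of k \<omega>] by (auto simp: trunc_def split: if_splits)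
      let ?f = "\<lambda>s. (vec_mat (Yl s \<omega>) $ I * drift I (Yl s \<omega>) + vec_mat (Yl s \<omega>) $ I * drift I (Yl s \<omega>)) * indicator {0<..t} s"
      let ?g = "\<lambda>u. vec_mat (Yl u \<omega>) $ I * jmp I u \<omega> + vec_mat (Yl u \<omega>) $ I * jmp I u \<omega> + jmp I u \<omega> * jmp I u \<omega>"
      have eq: "(vec_mat (Y t \<omega>) $ I)\<^sup>2 = (vec_mat (Y 0 \<omega>) $ I)\<^sup>2 + (\<integral>s. ?f s \<partial>lborel) + (\<integral>u. ?g u \<partial>count_space {0<..t})"
        using elim(1)[rule_format, OF \<open>0 < t\<close>, of I I] by (simp add: power2_eq_square)
      have f: "\<bar>?f s\<bar> \<le> H s \<omega> * indicator {0<..t} s" for s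
      proof (cases "s \<in> {0<..t}")
        case True
        then show ?thesis using c(2)[OF Yl_psd[OF elim(2), of s], of I] G[of s] by (simp add: H_def mult.assoc)
      qed simp
      have g: "\<bar>?g u\<bar> \<le> H u \<omega> * jump_growth (jump (\<lambda>r. L r \<omega>) u)" if "u \<in> {0<..t}" for u
        using c(3)[OF Yl_psd[OF elim(2), of u], of I "jump (\<lambda>r. L r \<omega>) u"] G[of u] that
        by (simp add: H_def jmp_def power2_eq_square mult.assoc)
      have H0: "0 \<le> H s \<omega>" for s using trunc_range(1) c(1) by (auto simp: H_def)
      have "(\<integral>\<^sup>+s. ennreal \<bar>?f s\<bar> \<partial>lborel) \<le> (\<integral>\<^sup>+s. ennreal (H s \<omega>) * indicator {0<..t} s \<partial>lborel)"
      proof (rule nn_integral_mono)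
        fix s
        have "ennreal \<bar>?f s\<bar> \<le> ennreal (H s \<omega> * indicator {0<..t} s)" by (rule ennreal_leI[OF f])
        also have "ennreal (H s \<omega> * indicator {0<..t} s) = ennreal (H s \<omega>) * indicator {0<..t} s"
          by (cases "s \<in> {0<..t}") simp_all
        finally show "ennreal \<bar>?f s\<bar> \<le> ennreal (H s \<omega>) * indicator {0<..t} s" .
      qed
      then have 1: "ennreal \<bar>\<integral>s. ?f s \<partial>lborel\<bar> \<le> (\<integral>\<^sup>+s. ennreal (H s \<omega>) * indicator {0<..t} s \<partial>lborel)"
        by (rule order_trans[OF ennreal_abs_integral_le])
      have "(\<integral>\<^sup>+u. ennreal \<bar>?g u\<bar> \<partial>count_space {0<..t}) \<le> JS (\<lambda>u x. ennreal (H u \<omega>) * ennreal (jump_growth x)) 0 t \<omega>"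
        unfolding jsum_count_space
      proof (rule nn_integral_mono)
        fix u assume "u \<in> space (count_space {0<..t})"
        then have "ennreal \<bar>?g u\<bar> \<le> ennreal (H u \<omega> * jump_growth (jump (\<lambda>r. L r \<omega>) u))"
          by (intro ennreal_leI g) simp
        then show "ennreal \<bar>?g u\<bar> \<le> ennreal (H u \<omega>) * ennreal (jump_growth (jump (\<lambda>r. L r \<omega>) u))"
          by (simp only: ennreal_mult[OF H0 jump_growth(3)])
      qed
      then have 2: "ennreal \<bar>\<integral>u. ?g u \<partial>count_space {0<..t}\<bar> \<le> JS (\<lambda>u x. ennreal (H u \<omega>) * ennreal (jump_growth x)) 0 t \<omega>"
        by (rule order_trans[OF ennreal_abs_integral_le])
      have "(vec_mat (Y t \<omega>) $ I)\<^sup>2 \<le> (vec_mat (Y 0 \<omega>) $ I)\<^sup>2 + \<bar>\<integral>s. ?f s \<partial>lborel\<bar> + \<bar>\<integral>u. ?g u \<partial>count_space {0<..t}\<bar>"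
        unfolding eq by linarith
      then have "ennreal (trunc k t \<omega> * (vec_mat (Y t \<omega>) $ I)\<^sup>2)
        \<le> ennreal ((vec_mat (Y 0 \<omega>) $ I)\<^sup>2 + \<bar>\<integral>s. ?f s \<partial>lborel\<bar> + \<bar>\<integral>u. ?g u \<partial>count_space {0<..t}\<bar>)"
        using G[of t] by (intro ennreal_leI) simp
      also have "\<dots> = ennreal ((vec_mat (Y 0 \<omega>) $ I)\<^sup>2) + ennreal \<bar>\<integral>s. ?f s \<partial>lborel\<bar> + ennreal \<bar>\<integral>u. ?g u \<partial>count_space {0<..t}\<bar>"
        by (simp add: ennreal_plus)
      also have "\<dots> \<le> ?R" by (intro add_mono order_refl 1 2)
      finally show ?thesis .
    qed simp
  qed
qed

text \<open>Expectation of the pathwise inequality, summed over the coordinates. The bound by the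
  square of \<open>k\<close> is the finiteness that \<open>gronwall_nn_integral\<close> asks for,
  whereas \<open>D\<close> is the same for all \<open>k\<close>.\<close>

lemma truncated_moment_bound:
  assumes fin: "(\<integral>\<^sup>+\<omega>. ennreal ((norm (Y 0 \<omega>))\<^sup>2) \<partial>M) \<le> ennreal m" and m: "0 \<le> m"
  shows "\<exists>D>0. \<forall>k t. 0 < t \<longrightarrow>
    (\<integral>\<^sup>+\<omega>. ennreal (trunc k t \<omega> * (norm (Y t \<omega>))\<^sup>2) \<partial>M) \<le> ennreal (k\<^sup>2) \<and>
    (\<integral>\<^sup>+\<omega>. ennreal (trunc k t \<omega> * (norm (Y t \<omega>))\<^sup>2) \<partial>M) \<le> ennreal m + ennreal D *
      (\<integral>\<^sup>+s. (1 + (\<integral>\<^sup>+\<omega>. ennreal (trunc k s \<omega> * (norm (Y s \<omega>))\<^sup>2) \<partial>M)) * indicator {0<..t} s \<partial>lborel)"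
proof -
  obtain c where c: "0 < c"
    "\<And>X I. psd X \<Longrightarrow> \<bar>2 * vec_mat X $ I * drift I X\<bar> \<le> c * (1 + (norm X)\<^sup>2)"
    "\<And>X I x. psd X \<Longrightarrow> \<bar>2 * vec_mat X $ I * (\<Sum>K\<in>UNIV. jump_matrix X $ I $ K * qvec K x) + (\<Sum>K\<in>UNIV. jump_matrix X $ I $ K * qvec K x)\<^sup>2\<bar>
       \<le> c * (1 + (norm X)\<^sup>2) * jump_growth x"
    using growth_bounds by blast
  have gfin: "(\<integral>\<^sup>+x. ennreal (jump_growth x) \<partial>\<nu>) < \<top>"
    using jump_growth(3,4) by (auto simp: integrable_iff_bounded)
  have w: "levy_weight (\<lambda>x. ennreal (jump_growth x))"
    by (rule levy_weight_continuous[OF jump_growth(1-3) gfin])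
  define q where "q = enn2real (\<integral>\<^sup>+x. ennreal (jump_growth x) \<partial>\<nu>)"
  have q: "(\<integral>\<^sup>+x. ennreal (jump_growth x) \<partial>\<nu>) = ennreal q" using gfin by (simp add: q_def)
  define n where "n = real CARD('d \<times> 'd)"
  \<comment> \<open>There are \<open>n\<close> coordinates; each contributes \<open>c\<close>
    through the drift and \<open>c * q\<close> through the jumps.\<close>
  define D where "D = n * c * (1 + q)"
  have n: "0 < n" by (simp add: n_def)
  have q0: "0 \<le> q" by (simp add: q_def)
  have D: "0 < D" using n c q0 by (simp add: D_def)
  show ?thesis
  proof (intro exI[of _ D] conjI allI impI)
    fix k t :: real assume t: "0 < t"
    define e where "e s = (\<integral>\<^sup>+\<omega>. ennreal (trunc k s \<omega> * (norm (Y s \<omega>))\<^sup>2) \<partial>M)" for s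
    define el where "el s = (\<integral>\<^sup>+\<omega>. ennreal (trunc k s \<omega> * (norm (Yl s \<omega>))\<^sup>2) \<partial>M)" for s
    \<comment> \<open>The crude bound and the integrands are available for \<open>Yl\<close>, the
      moments are wanted for \<open>Y\<close>; at a fixed time the expectations coincide.\<close>
    have eel: "e s = el s" if "0 < s" for s
      unfolding e_def el_def using Yl_eq_Y[of s] that by (intro nn_integral_cong_AE) (auto elim!: eventually_mono)
    have "el t \<le> (\<integral>\<^sup>+\<omega>. ennreal (k\<^sup>2) \<partial>M)"
      unfolding el_def by (intro nn_integral_mono ennreal_leI trunc_Yl_bound t)
    then show "(\<integral>\<^sup>+\<omega>. ennreal (trunc k t \<omega> * (norm (Y t \<omega>))\<^sup>2) \<partial>M) \<le> ennreal (k\<^sup>2)"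
      using eel[OF t] by (simp add: e_def emeasure_space_1)
    define H where "H s \<omega> = trunc k s \<omega> * (c * (1 + (norm (Yl s \<omega>))\<^sup>2))" for s \<omega>
    have H0: "0 \<le> H s \<omega>" for s \<omega> using trunc_range(1) c(1) by (auto simp: H_def)
    have Hlc: "left_continuous_adapted H"
      unfolding H_def[abs_def]
      by (intro left_continuous_adapted_mult left_continuous_trunc left_continuous_functional continuous_intros)
    have lcm: "left_continuous_adapted (\<lambda>s \<omega>. trunc k s \<omega> * (norm (Yl s \<omega>))\<^sup>2)"
      by (intro left_continuous_adapted_mult left_continuous_trunc left_continuous_functional continuous_intros)
    have EH: "(\<integral>\<^sup>+\<omega>. ennreal (H s \<omega>) \<partial>M) \<le> ennreal c * (1 + e s)" if s: "0 < s" for s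
    proof -
      have [measurable]: "trunc k s \<in> borel_measurable M" "(\<lambda>\<omega>. trunc k s \<omega> * (norm (Yl s \<omega>))\<^sup>2) \<in> borel_measurable M"
        using left_continuous_adaptedD(2)[OF left_continuous_trunc] left_continuous_adaptedD(2)[OF lcm] s by auto
      have "ennreal (H s \<omega>) = ennreal c * (ennreal (trunc k s \<omega>) + ennreal (trunc k s \<omega> * (norm (Yl s \<omega>))\<^sup>2))" for \<omega>
        using trunc_range(1)[of k s \<omega>] c(1)
        by (subst ennreal_plus[symmetric], simp, simp, subst ennreal_mult'[symmetric], simp) (simp add: H_def algebra_simps)
      then have "(\<integral>\<^sup>+\<omega>. ennreal (H s \<omega>) \<partial>M) = ennreal c * ((\<integral>\<^sup>+\<omega>. ennreal (trunc k s \<omega>) \<partial>M) + el s)"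
        unfolding el_def by (simp add: nn_integral_cmult nn_integral_add)
      also have "\<dots> \<le> ennreal c * ((\<integral>\<^sup>+\<omega>. ennreal 1 \<partial>M) + el s)"
        by (intro mult_left_mono add_right_mono nn_integral_mono ennreal_leI trunc_range) simp
      also have "\<dots> = ennreal c * (1 + e s)" using eel[OF s] by (simp add: emeasure_space_1)
      finally show ?thesis .
    qed
    define h where "h = (\<integral>\<^sup>+s. (\<integral>\<^sup>+\<omega>. ennreal (H s \<omega>) \<partial>M) * indicator {0<..t} s \<partial>lborel)"
    interpret P: pair_sigma_finite lborel M ..
    have jm [measurable]: "(\<lambda>(s, \<omega>). ennreal (H s \<omega>) * indicator {0<..t} s) \<in> borel_measurable (lborel \<Otimes>\<^sub>M M)"
    proof -
      have "(\<lambda>(s, \<omega>). ennreal (H s \<omega>) * indicator {0<..t} s) = (\<lambda>x. ennreal (case x of (s, \<omega>) \<Rightarrow> H s \<omega> * indicator {0<..t} s))"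
        by (auto simp: indicator_def fun_eq_iff)
      then show ?thesis using left_continuous_joint_measurable[OF Hlc t] by simp
    qed
    have 1: "(\<integral>\<^sup>+\<omega>. (\<integral>\<^sup>+s. ennreal (H s \<omega>) * indicator {0<..t} s \<partial>lborel) \<partial>M) = h"
    proof -
      have "(\<integral>\<^sup>+\<omega>. (\<integral>\<^sup>+s. ennreal (H s \<omega>) * indicator {0<..t} s \<partial>lborel) \<partial>M) = (\<integral>\<^sup>+s. (\<integral>\<^sup>+\<omega>. ennreal (H s \<omega>) * indicator {0<..t} s \<partial>M) \<partial>lborel)"
        using P.Fubini'[OF jm] by simp
      also have "\<dots> = h" unfolding h_def by (intro nn_integral_cong) (auto simp: indicator_def)
      finally show ?thesis .
    qed
    have jsm: "(\<lambda>\<omega>. JS (\<lambda>u x. ennreal (H u \<omega>) * ennreal (jump_growth x)) 0 t \<omega>) \<in> borel_measurable M"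
      by (rule compensation_nonneg(1)[OF Hlc H0 t w _ gfin]) simp
    have 2: "(\<integral>\<^sup>+\<omega>. JS (\<lambda>u x. ennreal (H u \<omega>) * ennreal (jump_growth x)) 0 t \<omega> \<partial>M) = h * ennreal q"
      unfolding h_def q[symmetric] by (rule compensation_nonneg(2)[OF Hlc H0 t w _ gfin]) simp
    have "(\<lambda>(\<omega>, s). ennreal (H s \<omega>) * indicator {0<..t} s) \<in> borel_measurable (M \<Otimes>\<^sub>M lborel)"
      using measurable_pair_swap[OF jm] by (simp add: split_beta')
    then have lm [measurable]: "(\<lambda>\<omega>. \<integral>\<^sup>+s. ennreal (H s \<omega>) * indicator {0<..t} s \<partial>lborel) \<in> borel_measurable M"
      by (rule lborel.borel_measurable_nn_integral)
    note [measurable] = jsm Y_measurable[OF order_refl] Y_measurable[OF less_imp_le[OF t]]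
    have vm [measurable]: "(\<lambda>\<omega>. vec_mat (Y s \<omega>) $ I) \<in> borel_measurable M" if "0 \<le> s" for s I
      by (rule measurable_compose[OF Y_measurable[OF that]], rule borel_measurable_continuous_onI)
         (auto simp: vec_mat_def intro!: continuous_intros)
    have [measurable]: "trunc k t \<in> borel_measurable M"
      using left_continuous_adaptedD(2)[OF left_continuous_trunc] t by auto
    have ae: "AE \<omega> in M. \<forall>I. ennreal (trunc k t \<omega> * (vec_mat (Y t \<omega>) $ I)\<^sup>2) \<le> ennreal ((vec_mat (Y 0 \<omega>) $ I)\<^sup>2)
      + (\<integral>\<^sup>+s. ennreal (H s \<omega>) * indicator {0<..t} s \<partial>lborel)
      + JS (\<lambda>u x. ennreal (H u \<omega>) * ennreal (jump_growth x)) 0 t \<omega>"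
      unfolding H_def by (rule truncated_moment_inequality[OF t c])
    have hle: "h \<le> ennreal c * (\<integral>\<^sup>+s. (1 + e s) * indicator {0<..t} s \<partial>lborel)"
    proof -
      have "h \<le> (\<integral>\<^sup>+s. ennreal c * ((1 + el s) * indicator {0<..t} s) \<partial>lborel)"
        unfolding h_def
        by (intro nn_integral_mono) (use EH eel in \<open>auto simp: indicator_def\<close>)
      also have "\<dots> = ennreal c * (\<integral>\<^sup>+s. (1 + el s) * indicator {0<..t} s \<partial>lborel)"
      proof (rule nn_integral_cmult)
        have "(\<lambda>(s, \<omega>). ennreal (trunc k s \<omega> * (norm (Yl s \<omega>))\<^sup>2 * indicator {0<..t} s)) \<in> borel_measurable (lborel \<Otimes>\<^sub>M M)"
          using left_continuous_joint_measurable[OF lcm t] by (simp add: split_beta)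
        then have "(\<lambda>s. \<integral>\<^sup>+\<omega>. ennreal (trunc k s \<omega> * (norm (Yl s \<omega>))\<^sup>2 * indicator {0<..t} s) \<partial>M) \<in> borel_measurable lborel"
          by (rule borel_measurable_nn_integral)
        moreover have "(\<integral>\<^sup>+\<omega>. ennreal (trunc k s \<omega> * (norm (Yl s \<omega>))\<^sup>2 * indicator {0<..t} s) \<partial>M) = el s * indicator {0<..t} s" for s
          by (auto simp: el_def indicator_def)
        ultimately have [measurable]: "(\<lambda>s. el s * indicator {0<..t} s) \<in> borel_measurable lborel" by simp
        have "(\<lambda>s. (1 + el s) * indicator {0<..t} s) = (\<lambda>s. indicator {0<..t} s + el s * indicator {0<..t} s)"
          by (auto simp: distrib_right)
        then show "(\<lambda>s. (1 + el s) * indicator {0<..t} s) \<in> borel_measurable lborel" by simp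
      qed
      also have "(\<integral>\<^sup>+s. (1 + el s) * indicator {0<..t} s \<partial>lborel) = (\<integral>\<^sup>+s. (1 + e s) * indicator {0<..t} s \<partial>lborel)"
        by (intro nn_integral_cong) (use eel in \<open>auto simp: indicator_def\<close>)
      finally show ?thesis .
    qed
    have "e t = (\<integral>\<^sup>+\<omega>. (\<Sum>I\<in>UNIV. ennreal (trunc k t \<omega> * (vec_mat (Y t \<omega>) $ I)\<^sup>2)) \<partial>M)"
      unfolding e_def norm_square_vec_mat sum_distrib_left using trunc_range(1) by simp
    also have "\<dots> \<le> (\<integral>\<^sup>+\<omega>. (\<Sum>I\<in>UNIV. ennreal ((vec_mat (Y 0 \<omega>) $ I)\<^sup>2)
      + (\<integral>\<^sup>+s. ennreal (H s \<omega>) * indicator {0<..t} s \<partial>lborel)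
      + JS (\<lambda>u x. ennreal (H u \<omega>) * ennreal (jump_growth x)) 0 t \<omega>) \<partial>M)"
      using ae by (intro nn_integral_mono_AE) (auto elim!: eventually_mono intro!: sum_mono)
    also have "\<dots> = (\<integral>\<^sup>+\<omega>. ennreal ((norm (Y 0 \<omega>))\<^sup>2) + (ennreal n * (\<integral>\<^sup>+s. ennreal (H s \<omega>) * indicator {0<..t} s \<partial>lborel)
      + ennreal n * JS (\<lambda>u x. ennreal (H u \<omega>) * ennreal (jump_growth x)) 0 t \<omega>) \<partial>M)"
      by (intro nn_integral_cong) (simp add: sum.distrib norm_square_vec_mat n_def ennreal_of_nat_eq_real_of_nat add.assoc distrib_left)
    also have "\<dots> = (\<integral>\<^sup>+\<omega>. ennreal ((norm (Y 0 \<omega>))\<^sup>2) \<partial>M) + (ennreal n * h + ennreal n * (h * ennreal q))"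
      by (subst nn_integral_add, simp, simp, subst nn_integral_add, simp, simp) (simp add: nn_integral_cmult 1 2)
    also have "\<dots> \<le> ennreal m + (ennreal n * h + ennreal n * (h * ennreal q))"
      by (intro add_right_mono fin)
    also have "ennreal n * h + ennreal n * (h * ennreal q) = ennreal (n * (1 + q)) * h"
      using n q0 by (simp add: ennreal_mult distrib_left distrib_right mult_ac)
    also have "ennreal m + ennreal (n * (1 + q)) * h
      \<le> ennreal m + ennreal (n * (1 + q)) * (ennreal c * (\<integral>\<^sup>+s. (1 + e s) * indicator {0<..t} s \<partial>lborel))"
      by (intro add_left_mono mult_left_mono hle) simp
    also have "ennreal (n * (1 + q)) * (ennreal c * (\<integral>\<^sup>+s. (1 + e s) * indicator {0<..t} s \<partial>lborel))
      = ennreal D * (\<integral>\<^sup>+s. (1 + e s) * indicator {0<..t} s \<partial>lborel)"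
      using n q0 c by (simp add: D_def ennreal_mult mult_ac)
    finally show "(\<integral>\<^sup>+\<omega>. ennreal (trunc k t \<omega> * (norm (Y t \<omega>))\<^sup>2) \<partial>M) \<le> ennreal m + ennreal D *
      (\<integral>\<^sup>+s. (1 + (\<integral>\<^sup>+\<omega>. ennreal (trunc k s \<omega> * (norm (Y s \<omega>))\<^sup>2) \<partial>M)) * indicator {0<..t} s \<partial>lborel)"
      unfolding e_def .
  qed (rule D)
qed

text \<open>Gronwall's bound is uniform in the truncation level. Paths are bounded on compact
  intervals, so the truncation is eventually 1 on each of them and Fatou's lemma removes it.\<close>

lemma moment_bound:
  assumes int: "integrable M (\<lambda>\<omega>. (norm (Y 0 \<omega>))\<^sup>2)"
  shows "\<exists>K\<ge>0. \<forall>t. 0 \<le> t \<and> t \<le> T \<longrightarrow> (\<integral>\<^sup>+\<omega>. ennreal ((norm (Y t \<omega>))\<^sup>2) \<partial>M) \<le> ennreal K"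
proof -
  define m where "m = expectation (\<lambda>\<omega>. (norm (Y 0 \<omega>))\<^sup>2)"
  have m: "(\<integral>\<^sup>+\<omega>. ennreal ((norm (Y 0 \<omega>))\<^sup>2) \<partial>M) = ennreal m" "0 \<le> m"
    using int by (auto simp: m_def nn_integral_eq_integral)
  obtain D where D: "0 < D" and B: "\<And>k t. 0 < t \<Longrightarrow>
    (\<integral>\<^sup>+\<omega>. ennreal (trunc k t \<omega> * (norm (Y t \<omega>))\<^sup>2) \<partial>M) \<le> ennreal (k\<^sup>2)"
    "\<And>k t. 0 < t \<Longrightarrow> (\<integral>\<^sup>+\<omega>. ennreal (trunc k t \<omega> * (norm (Y t \<omega>))\<^sup>2) \<partial>M) \<le> ennreal m + ennreal D *
      (\<integral>\<^sup>+s. (1 + (\<integral>\<^sup>+\<omega>. ennreal (trunc k s \<omega> * (norm (Y s \<omega>))\<^sup>2) \<partial>M)) * indicator {0<..t} s \<partial>lborel)"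
    using truncated_moment_bound[OF eq_refl[OF m(1)] m(2)] by blast
  \<comment> \<open>\<open>m\<close> covers time 0, the second summand is the Gronwall bound;
    \<open>\<bar>T\<bar>\<close> keeps the constant nonnegative for every real
    \<open>T\<close>.\<close>
  define K where "K = m + 2 * (m + D * \<bar>T\<bar>) * exp (2 * D * \<bar>T\<bar>)"
  have K: "0 \<le> K" "m \<le> K" "2 * (m + D * \<bar>T\<bar>) * exp (2 * D * \<bar>T\<bar>) \<le> K"
    using m(2) D by (auto simp: K_def)
  have "(\<integral>\<^sup>+\<omega>. ennreal ((norm (Y t \<omega>))\<^sup>2) \<partial>M) \<le> ennreal K" if t: "0 \<le> t" "t \<le> T" for t
  proof (cases "t = 0")
    case True
    then show ?thesis using m K by (simp add: ennreal_leI)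
  next
    case False
    then have t0: "0 < t" using t by simp
    have tr: "(\<integral>\<^sup>+\<omega>. ennreal (trunc k t \<omega> * (norm (Y t \<omega>))\<^sup>2) \<partial>M) \<le> ennreal K" for k
    proof -
      have "(\<integral>\<^sup>+\<omega>. ennreal (trunc k t \<omega> * (norm (Y t \<omega>))\<^sup>2) \<partial>M) \<le> ennreal (2 * (m + D * \<bar>T\<bar>) * exp (2 * D * \<bar>T\<bar>))"
        by (rule gronwall_nn_integral[of "\<bar>T\<bar>" _ "k\<^sup>2"]) (use B m D t t0 in auto)
      also have "\<dots> \<le> ennreal K" by (rule ennreal_leI[OF K(3)])
      finally show ?thesis .
    qed
    have [measurable]: "trunc (real k) t \<in> borel_measurable M" "Y t \<in> borel_measurable M" for k
      using left_continuous_adaptedD(2)[OF left_continuous_trunc t(1)] Y_measurable[OF t(1)] by auto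
    have "(\<integral>\<^sup>+\<omega>. ennreal ((norm (Y t \<omega>))\<^sup>2) \<partial>M) = (\<integral>\<^sup>+\<omega>. liminf (\<lambda>k. ennreal (trunc (real k) t \<omega> * (norm (Y t \<omega>))\<^sup>2)) \<partial>M)"
    proof (rule nn_integral_cong)
      fix \<omega> assume \<omega>: "\<omega> \<in> space M"
      obtain b where b: "\<And>s. s \<in> {0..t} \<Longrightarrow> norm (Y s \<omega>) \<le> b"
        using cadlag_norm_bound[OF Y_cadlag[OF \<omega>], of t] by blast
      have "\<forall>\<^sub>F k in sequentially. b \<le> real k"
        using eventually_ge_at_top[of "nat \<lceil>b\<rceil>"] by eventually_elim linarith
      then have "\<forall>\<^sub>F k in sequentially. ennreal (trunc (real k) t \<omega> * (norm (Y t \<omega>))\<^sup>2) = ennreal ((norm (Y t \<omega>))\<^sup>2)"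
      proof eventually_elim
        case (elim k)
        have "norm (Y r \<omega>) \<le> real k" if "0 \<le> r" "r < t" for r
          using b[of r] that elim by simp
        then show ?case by (simp add: trunc_def)
      qed
      then have "(\<lambda>k. ennreal (trunc (real k) t \<omega> * (norm (Y t \<omega>))\<^sup>2)) \<longlonglongrightarrow> ennreal ((norm (Y t \<omega>))\<^sup>2)"
        by (rule tendsto_eventually)
      then show "ennreal ((norm (Y t \<omega>))\<^sup>2) = liminf (\<lambda>k. ennreal (trunc (real k) t \<omega> * (norm (Y t \<omega>))\<^sup>2))"
        by (simp add: lim_imp_Liminf)
    qed
    also have "\<dots> \<le> liminf (\<lambda>k. \<integral>\<^sup>+\<omega>. ennreal (trunc (real k) t \<omega> * (norm (Y t \<omega>))\<^sup>2) \<partial>M)"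
      by (rule nn_integral_liminf) measurable
    also have "\<dots> \<le> liminf (\<lambda>k::nat. ennreal K)"
      by (intro Liminf_mono always_eventually allI tr)
    also have "\<dots> = ennreal K" by (simp add: Liminf_const)
    finally show ?thesis .
  qed
  then show ?thesis using K(1) by blast
qed

end

section \<open>Functionals of the volatility and their expectations\<close>

lemma lborel_Ioc_integral:
  fixes f :: "real \<Rightarrow> real"
  assumes "integrable lborel (\<lambda>s. f s * indicator {0<..t} s)"
  shows "f integrable_on {0..t}" "integral {0..t} f = (\<integral>s. f s * indicator {0<..t} s \<partial>lborel)"
proof -
  have "((\<lambda>s. f s * indicator {0<..t} s) has_integral (\<integral>s. f s * indicator {0<..t} s \<partial>lborel)) UNIV"
    by (rule has_integral_integral_lborel[OF assms])
  then have "((\<lambda>s. if s \<in> {0..t} then f s else 0) has_integral (\<integral>s. f s * indicator {0<..t} s \<partial>lborel)) UNIV"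
    by (rule has_integral_spike[of "{0}", rotated 2]) auto
  then have "(f has_integral (\<integral>s. f s * indicator {0<..t} s \<partial>lborel)) {0..t}"
    by (simp only: has_integral_restrict_UNIV)
  then show "f integrable_on {0..t}" "integral {0..t} f = (\<integral>s. f s * indicator {0<..t} s \<partial>lborel)"
    by (auto intro: integral_unique)
qed

lemma at_within_Icc_atLeast: "0 \<le> t \<Longrightarrow> at t within {0..t + 1} = at t within {0::real..}"
  by (rule at_within_nhd[of t "{..<t + 1}"]) auto

lemma has_vector_derivative_vec:
  fixes f :: "real \<Rightarrow> real^'n"
  assumes "\<And>i. ((\<lambda>s. f s $ i) has_vector_derivative (d $ i)) (at t within S)"
  shows "(f has_vector_derivative d) (at t within S)"
  using assms unfolding has_vector_derivative_def has_derivative_componentwise_within[of f]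
  by (auto simp: Basis_vec_def inner_axis)

context mucogarch
begin

text \<open>The functionals whose expectations the second moment of \<open>Y\<close> controls.
  Continuity on the cone makes them left-continuous and adapted along \<open>Yl\<close>; products of
  two functionals of linear growth belong to the class.\<close>

definition quadratic_growth :: "(real^'d^'d \<Rightarrow> real) \<Rightarrow> bool" where
  "quadratic_growth h \<longleftrightarrow> continuous_on {X. psd X} h \<and> (\<exists>c\<ge>0. \<forall>X. psd X \<longrightarrow> \<bar>h X\<bar> \<le> c * (1 + (norm X)\<^sup>2))"

definition linear_growth :: "(real^'d^'d \<Rightarrow> real) \<Rightarrow> bool" where
  "linear_growth h \<longleftrightarrow> continuous_on {X. psd X} h \<and> (\<exists>c\<ge>0. \<forall>X. psd X \<longrightarrow> \<bar>h X\<bar> \<le> c * (1 + norm X))"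

lemma linear_growth_mult:
  assumes "linear_growth h" "linear_growth h'"
  shows "quadratic_growth (\<lambda>X. h X * h' X)"
proof -
  obtain c c' where c: "0 \<le> c" "\<And>X. psd X \<Longrightarrow> \<bar>h X\<bar> \<le> c * (1 + norm X)"
    and c': "0 \<le> c'" "\<And>X. psd X \<Longrightarrow> \<bar>h' X\<bar> \<le> c' * (1 + norm X)"
    using assms unfolding linear_growth_def by blast
  have "\<bar>h X * h' X\<bar> \<le> 2 * (c * c') * (1 + (norm X)\<^sup>2)" if X: "psd X" for X
  proof -
    have "\<bar>h X * h' X\<bar> \<le> (c * (1 + norm X)) * (c' * (1 + norm X))"
      unfolding abs_mult using c c' X by (intro mult_mono) auto
    also have "\<dots> = c * c' * (1 + norm X)\<^sup>2" by (simp add: power2_eq_square)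
    also have "\<dots> \<le> c * c' * (2 * (1 + (norm X)\<^sup>2))"
    proof (rule mult_left_mono)
      show "(1 + norm X)\<^sup>2 \<le> 2 * (1 + (norm X)\<^sup>2)"
        using zero_le_power2[of "norm X - 1"] by (simp add: power2_eq_square algebra_simps)
    qed (use c c' in simp)
    finally show ?thesis by (simp add: algebra_simps)
  qed
  moreover have "continuous_on {X. psd X} (\<lambda>X. h X * h' X)"
    using assms unfolding linear_growth_def by (intro continuous_on_mult) auto
  ultimately show ?thesis
    unfolding quadratic_growth_def using c(1) c'(1) by (intro conjI exI[of _ "2 * (c * c')"]) auto
qed

lemma linear_growth_imp_quadratic: "linear_growth h \<Longrightarrow> quadratic_growth h"
  using linear_growth_mult[of h "\<lambda>_. 1"] by (force simp: linear_growth_def intro!: exI[of _ "1::real"])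

lemma quadratic_growth_add:
  assumes "quadratic_growth h" "quadratic_growth h'"
  shows "quadratic_growth (\<lambda>X. h X + h' X)"
proof -
  obtain c c' where c: "0 \<le> c" "\<And>X. psd X \<Longrightarrow> \<bar>h X\<bar> \<le> c * (1 + (norm X)\<^sup>2)"
    and c': "0 \<le> c'" "\<And>X. psd X \<Longrightarrow> \<bar>h' X\<bar> \<le> c' * (1 + (norm X)\<^sup>2)"
    using assms unfolding quadratic_growth_def by blast
  have "\<bar>h X + h' X\<bar> \<le> (c + c') * (1 + (norm X)\<^sup>2)" if X: "psd X" for X
    using c(2)[OF X] c'(2)[OF X] abs_triangle_ineq[of "h X" "h' X"] by (simp add: distrib_right)
  moreover have "continuous_on {X. psd X} (\<lambda>X. h X + h' X)"
    using assms unfolding quadratic_growth_def by (intro continuous_on_add) auto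
  ultimately show ?thesis
    unfolding quadratic_growth_def using c(1) c'(1) by (intro conjI exI[of _ "c + c'"]) auto
qed

lemma linear_growth_jump_matrix: "linear_growth (\<lambda>X. jump_matrix X $ I $ K)"
  using jump_matrix_bound continuous_jump_matrix unfolding linear_growth_def by blast

lemma linear_growth_vec_mat: "linear_growth (\<lambda>X. vec_mat X $ I)"
  unfolding linear_growth_def
proof (intro conjI exI[of _ 1] allI impI)
  show "continuous_on {X. psd X} (\<lambda>X. vec_mat X $ I)"
    by (auto simp: vec_mat_def intro!: continuous_intros)
  fix X :: "real^'d^'d"
  show "\<bar>vec_mat X $ I\<bar> \<le> 1 * (1 + norm X)" using vec_mat_entry_bound[of X I] by simp
qed simp

lemma linear_growth_drift: "linear_growth (drift I)"
  unfolding linear_growth_def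
proof (intro conjI exI[of _ "\<Sum>K\<in>UNIV. \<bar>drift_matrix B $ I $ K\<bar>"] allI impI)
  fix X :: "real^'d^'d"
  have "\<bar>drift I X\<bar> \<le> (\<Sum>K\<in>UNIV. \<bar>drift_matrix B $ I $ K\<bar> * \<bar>vec_mat X $ K\<bar>)"
    unfolding drift_def matrix_vector_mult_def abs_mult[symmetric] by simp
  also have "\<dots> \<le> (\<Sum>K\<in>UNIV. \<bar>drift_matrix B $ I $ K\<bar>) * (1 + norm X)"
    unfolding sum_distrib_right
  proof (intro sum_mono mult_left_mono)
    show "\<bar>vec_mat X $ K\<bar> \<le> 1 + norm X" for K using vec_mat_entry_bound[of X K] by linarith
  qed simp
  finally show "\<bar>drift I X\<bar> \<le> (\<Sum>K\<in>UNIV. \<bar>drift_matrix B $ I $ K\<bar>) * (1 + norm X)" .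
qed (auto intro: continuous_drift sum_nonneg)

lemma functional_measurable:
  fixes h :: "real^'d^'d \<Rightarrow> real"
  assumes "continuous_on {X. psd X} h" "0 \<le> t"
  shows "(\<lambda>\<omega>. h (Y t \<omega>)) \<in> borel_measurable M"
proof -
  have [measurable]: "(\<lambda>X. indicator {X. psd X} X *\<^sub>R h X) \<in> borel_measurable borel"
    using borel_measurable_continuous_on_indicator[OF psd_borel assms(1)] .
  have [measurable]: "Y t \<in> borel_measurable M" by (rule Y_measurable[OF assms(2)])
  have "(\<lambda>\<omega>. indicator {X. psd X} (Y t \<omega>) *\<^sub>R h (Y t \<omega>)) \<in> borel_measurable M" by measurable
  then show ?thesis
    by (rule measurable_cong[THEN iffD1, rotated]) (use Y_psd assms in auto)
qed

context
  assumes int0: "integrable M (\<lambda>\<omega>. (norm (Y 0 \<omega>))\<^sup>2)"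
begin

lemma norm_square_Y_integrable: "0 \<le> t \<Longrightarrow> integrable M (\<lambda>\<omega>. (norm (Y t \<omega>))\<^sup>2)"
proof -
  assume t: "0 \<le> t"
  obtain K where "(\<integral>\<^sup>+\<omega>. ennreal ((norm (Y t \<omega>))\<^sup>2) \<partial>M) \<le> ennreal K"
    using moment_bound[OF int0, of t] t by blast
  then have "(\<integral>\<^sup>+\<omega>. ennreal ((norm (Y t \<omega>))\<^sup>2) \<partial>M) < \<infinity>" by (rule order.strict_trans1) simp
  then show ?thesis using Y_measurable[OF t] by (intro integrableI_nonneg) auto
qed

text \<open>One constant for all times up to \<open>t\<close>: this uniformity gives the joint
  integrability over time and outcomes that \<open>compensation\<close> demands.\<close>

lemma functional_bound:
  assumes h: "quadratic_growth h"
  shows "\<exists>K\<ge>0. \<forall>s. 0 \<le> s \<and> s \<le> t \<longrightarrow> (\<integral>\<^sup>+\<omega>. ennreal \<bar>h (Yl s \<omega>)\<bar> \<partial>M) \<le> ennreal K"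
proof -
  obtain c where c: "0 \<le> c" "\<And>X. psd X \<Longrightarrow> \<bar>h X\<bar> \<le> c * (1 + (norm X)\<^sup>2)"
    using h unfolding quadratic_growth_def by blast
  obtain K where K: "0 \<le> K" "\<And>s. 0 \<le> s \<Longrightarrow> s \<le> t \<Longrightarrow> (\<integral>\<^sup>+\<omega>. ennreal ((norm (Y s \<omega>))\<^sup>2) \<partial>M) \<le> ennreal K"
    using moment_bound[OF int0, of t] by blast
  have "(\<integral>\<^sup>+\<omega>. ennreal \<bar>h (Yl s \<omega>)\<bar> \<partial>M) \<le> ennreal (c * (1 + K))" if s: "0 \<le> s" "s \<le> t" for s
  proof -
    have [measurable]: "Y s \<in> borel_measurable M" by (rule Y_measurable[OF s(1)])
    have "(\<integral>\<^sup>+\<omega>. ennreal \<bar>h (Yl s \<omega>)\<bar> \<partial>M) \<le> (\<integral>\<^sup>+\<omega>. ennreal c * (1 + ennreal ((norm (Y s \<omega>))\<^sup>2)) \<partial>M)"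
    proof (rule nn_integral_mono_AE)
      show "AE \<omega> in M. ennreal \<bar>h (Yl s \<omega>)\<bar> \<le> ennreal c * (1 + ennreal ((norm (Y s \<omega>))\<^sup>2))"
        using Yl_eq_Y[OF s(1)] AE_space
      proof eventually_elim
        case (elim \<omega>)
        have "ennreal \<bar>h (Yl s \<omega>)\<bar> \<le> ennreal (c * (1 + (norm (Y s \<omega>))\<^sup>2))"
          unfolding elim(1) by (intro ennreal_leI c(2) Y_psd elim(2) s)
        then show ?case using c(1) by (simp add: ennreal_mult ennreal_plus)
      qed
    qed
    also have "\<dots> = ennreal c * (1 + (\<integral>\<^sup>+\<omega>. ennreal ((norm (Y s \<omega>))\<^sup>2) \<partial>M))"
      by (simp add: nn_integral_cmult nn_integral_add emeasure_space_1)
    also have "\<dots> \<le> ennreal c * (1 + ennreal K)"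
      by (intro mult_left_mono add_left_mono K s) simp
    also have "\<dots> = ennreal (c * (1 + K))" using c(1) K(1) by (simp add: ennreal_mult ennreal_plus)
    finally show ?thesis .
  qed
  then show ?thesis using c(1) K(1) by (intro exI[of _ "c * (1 + K)"]) auto
qed

lemma functional_finite:
  assumes h: "quadratic_growth h" and t: "0 < t"
  shows "(\<integral>\<^sup>+s. (\<integral>\<^sup>+\<omega>. ennreal \<bar>h (Yl s \<omega>)\<bar> \<partial>M) * indicator {0<..t} s \<partial>lborel) < \<top>"
proof -
  obtain K where K: "0 \<le> K" "\<And>s. 0 \<le> s \<Longrightarrow> s \<le> t \<Longrightarrow> (\<integral>\<^sup>+\<omega>. ennreal \<bar>h (Yl s \<omega>)\<bar> \<partial>M) \<le> ennreal K"
    using functional_bound[OF h, of t] by blast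
  have "(\<integral>\<^sup>+s. (\<integral>\<^sup>+\<omega>. ennreal \<bar>h (Yl s \<omega>)\<bar> \<partial>M) * indicator {0<..t} s \<partial>lborel) \<le> (\<integral>\<^sup>+s. ennreal K * indicator {0<..t} s \<partial>lborel)"
    by (intro nn_integral_mono) (auto simp: indicator_def intro!: K)
  also have "\<dots> < \<top>" using t by (simp add: nn_integral_cmult_indicator ennreal_mult_less_top)
  finally show ?thesis .
qed

lemma functional_left_continuous_adapted: "quadratic_growth h \<Longrightarrow> left_continuous_adapted (\<lambda>s \<omega>. h (Yl s \<omega>))"
  unfolding quadratic_growth_def using left_continuous_functional by blast

lemma functional_integrable:
  assumes h: "quadratic_growth h" and s: "0 \<le> s"
  shows "integrable M (\<lambda>\<omega>. h (Yl s \<omega>))" "integrable M (\<lambda>\<omega>. h (Y s \<omega>))"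
    "expectation (\<lambda>\<omega>. h (Yl s \<omega>)) = expectation (\<lambda>\<omega>. h (Y s \<omega>))"
proof -
  obtain K where K: "(\<integral>\<^sup>+\<omega>. ennreal \<bar>h (Yl s \<omega>)\<bar> \<partial>M) \<le> ennreal K"
    using functional_bound[OF h, of s] s by blast
  then have "(\<integral>\<^sup>+\<omega>. ennreal \<bar>h (Yl s \<omega>)\<bar> \<partial>M) < \<infinity>" by (rule order.strict_trans1) simp
  moreover have m: "(\<lambda>\<omega>. h (Yl s \<omega>)) \<in> borel_measurable M"
    by (rule left_continuous_adaptedD(2)[OF functional_left_continuous_adapted[OF h] s])
  ultimately show i: "integrable M (\<lambda>\<omega>. h (Yl s \<omega>))" by (intro integrableI_bounded) auto
  have m': "(\<lambda>\<omega>. h (Y s \<omega>)) \<in> borel_measurable M"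
    using h s unfolding quadratic_growth_def by (intro functional_measurable) auto
  have ae: "AE \<omega> in M. h (Yl s \<omega>) = h (Y s \<omega>)"
    using Yl_eq_Y[OF s] by eventually_elim simp
  show "integrable M (\<lambda>\<omega>. h (Y s \<omega>))" using integrable_cong_AE[OF m m' ae] i by blast
  show "expectation (\<lambda>\<omega>. h (Yl s \<omega>)) = expectation (\<lambda>\<omega>. h (Y s \<omega>))" by (rule integral_cong_AE[OF m m' ae])
qed

lemma functional_mean_integrable:
  assumes h: "quadratic_growth h" and t: "0 < t"
  shows "integrable lborel (\<lambda>s. expectation (\<lambda>\<omega>. h (Yl s \<omega>)) * indicator {0<..t} s)"
proof -
  obtain K where K: "0 \<le> K" "\<And>s. 0 \<le> s \<Longrightarrow> s \<le> t \<Longrightarrow> (\<integral>\<^sup>+\<omega>. ennreal \<bar>h (Yl s \<omega>)\<bar> \<partial>M) \<le> ennreal K"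
    using functional_bound[OF h, of t] by blast
  have b: "\<bar>expectation (\<lambda>\<omega>. h (Yl s \<omega>))\<bar> \<le> K" if "0 \<le> s" "s \<le> t" for s
    using order_trans[OF ennreal_abs_integral_le K(2)[OF that]] K(1) by simp
  have "(\<lambda>s. expectation (\<lambda>\<omega>. h (Yl s \<omega>) * indicator {0<..t} s)) \<in> borel_measurable lborel"
    using left_continuous_joint_measurable[OF functional_left_continuous_adapted[OF h] t] by (intro borel_measurable_lebesgue_integral) simp
  then have m: "(\<lambda>s. expectation (\<lambda>\<omega>. h (Yl s \<omega>)) * indicator {0<..t} s) \<in> borel_measurable lborel" by simp
  show ?thesis
  proof (rule Bochner_Integration.integrable_bound[OF _ m, where f="\<lambda>s. K * indicator {0<..t} s"])
    show "integrable lborel (\<lambda>s. K * indicator {0<..t} s :: real)" using t by simp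
    show "AE s in lborel. norm (expectation (\<lambda>\<omega>. h (Yl s \<omega>)) * indicator {0<..t} s) \<le> norm (K * indicator {0<..t} s :: real)"
      using b K(1) by (intro AE_I2) (auto simp: indicator_def)
  qed
qed

text \<open>A finite linear combination of instances of \<open>compensation\<close>;
  \<open>R\<close> is the rate at which the expected jump sum grows in a given state. The index set
  will be the entries \<open>K\<close>, or pairs of them.\<close>

lemma jump_sum_expectation:
  fixes g :: "'p \<Rightarrow> real^'d \<Rightarrow> real"
  assumes P: "finite P" and t: "0 < t" and h: "\<And>p. p \<in> P \<Longrightarrow> quadratic_growth (h p)"
    and g: "\<And>p. p \<in> P \<Longrightarrow> continuous_on UNIV (g p)" "\<And>p. p \<in> P \<Longrightarrow> g p 0 = 0" "\<And>p. p \<in> P \<Longrightarrow> integrable \<nu> (g p)"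
  defines "R \<equiv> \<lambda>X. \<Sum>p\<in>P. h p X * (\<integral>x. g p x \<partial>\<nu>)"
  shows "AE \<omega> in M. integrable (count_space {0<..t}) (\<lambda>u. \<Sum>p\<in>P. h p (Yl u \<omega>) * g p (jump (\<lambda>r. L r \<omega>) u))"
    and "integrable M (\<lambda>\<omega>. \<integral>u. (\<Sum>p\<in>P. h p (Yl u \<omega>) * g p (jump (\<lambda>r. L r \<omega>) u)) \<partial>count_space {0<..t})"
    and "expectation (\<lambda>\<omega>. \<integral>u. (\<Sum>p\<in>P. h p (Yl u \<omega>) * g p (jump (\<lambda>r. L r \<omega>) u)) \<partial>count_space {0<..t})
      = (\<integral>s. expectation (\<lambda>\<omega>. R (Yl s \<omega>)) * indicator {0<..t} s \<partial>lborel)"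
    and "quadratic_growth R"
proof -
  let ?x = "\<lambda>p \<omega> u. h p (Yl u \<omega>) * g p (jump (\<lambda>r. L r \<omega>) u)"
  have qg: "quadratic_growth (\<lambda>X. \<Sum>p\<in>Q. h p X * (\<integral>x. g p x \<partial>\<nu>))" if "Q \<subseteq> P" for Q
  proof -
    have one: "quadratic_growth (\<lambda>X. h p X * k)" if p: "quadratic_growth (h p)" for p and k :: real
    proof -
      obtain c where c: "0 \<le> c" "\<And>X. psd X \<Longrightarrow> \<bar>h p X\<bar> \<le> c * (1 + (norm X)\<^sup>2)"
        using p unfolding quadratic_growth_def by blast
      have "\<bar>h p X * k\<bar> \<le> c * \<bar>k\<bar> * (1 + (norm X)\<^sup>2)" if "psd X" for X
        using mult_right_mono[OF c(2)[OF that], of "\<bar>k\<bar>"] by (simp add: abs_mult mult_ac)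
      then show ?thesis using p c(1) unfolding quadratic_growth_def
        by (intro conjI exI[of _ "c * \<bar>k\<bar>"] continuous_on_mult_right) auto
    qed
    have "finite Q" using that P by (rule finite_subset)
    then show ?thesis using that
    proof (induction Q)
      case empty
      then show ?case by (auto simp: quadratic_growth_def)
    next
      case (insert p Q)
      then show ?case using quadratic_growth_add[OF one[OF h[of p]]] by simp
    qed
  qed
  show "quadratic_growth R" unfolding R_def by (rule qg[OF order_refl])
  note C = compensation[OF functional_left_continuous_adapted[OF h] t functional_finite[OF h t] g]
  have "AE \<omega> in M. \<forall>p\<in>P. integrable (count_space {0<..t}) (?x p \<omega>)"
    using P C(1) by (intro AE_finite_allI) auto
  then have ae: "AE \<omega> in M. integrable (count_space {0<..t}) (\<lambda>u. \<Sum>p\<in>P. ?x p \<omega> u)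
      \<and> (\<integral>u. (\<Sum>p\<in>P. ?x p \<omega> u) \<partial>count_space {0<..t}) = (\<Sum>p\<in>P. \<integral>u. ?x p \<omega> u \<partial>count_space {0<..t})"
    by eventually_elim auto
  then show "AE \<omega> in M. integrable (count_space {0<..t}) (\<lambda>u. \<Sum>p\<in>P. ?x p \<omega> u)"
    by eventually_elim simp
  have eq: "AE \<omega> in M. (\<integral>u. (\<Sum>p\<in>P. ?x p \<omega> u) \<partial>count_space {0<..t}) = (\<Sum>p\<in>P. \<integral>u. ?x p \<omega> u \<partial>count_space {0<..t})"
    using ae by eventually_elim simp
  have i: "integrable M (\<lambda>\<omega>. \<Sum>p\<in>P. \<integral>u. ?x p \<omega> u \<partial>count_space {0<..t})"
    using C(2) by (intro Bochner_Integration.integrable_sum) auto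
  have m: "(\<lambda>\<omega>. \<integral>u. (\<Sum>p\<in>P. ?x p \<omega> u) \<partial>count_space {0<..t}) \<in> borel_measurable M"
    by (rule borel_measurable_AE_complete[OF complete_measure_axioms _ eq]) (use i in auto)
  show "integrable M (\<lambda>\<omega>. \<integral>u. (\<Sum>p\<in>P. ?x p \<omega> u) \<partial>count_space {0<..t})"
    using integrable_cong_AE[OF m _ eq] i by auto
  have "expectation (\<lambda>\<omega>. \<integral>u. (\<Sum>p\<in>P. ?x p \<omega> u) \<partial>count_space {0<..t})
      = (\<Sum>p\<in>P. expectation (\<lambda>\<omega>. \<integral>u. ?x p \<omega> u \<partial>count_space {0<..t}))"
    using integral_cong_AE[OF m _ eq] i C(2) by auto
  also have "\<dots> = (\<Sum>p\<in>P. (\<integral>s. expectation (\<lambda>\<omega>. h p (Yl s \<omega>)) * indicator {0<..t} s \<partial>lborel) * (\<integral>x. g p x \<partial>\<nu>))"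
    by (intro sum.cong refl C(3))
  also have "\<dots> = (\<integral>s. (\<Sum>p\<in>P. expectation (\<lambda>\<omega>. h p (Yl s \<omega>)) * indicator {0<..t} s * (\<integral>x. g p x \<partial>\<nu>)) \<partial>lborel)"
    using functional_mean_integrable[OF h t] by (subst Bochner_Integration.integral_sum) auto
  also have "\<dots> = (\<integral>s. expectation (\<lambda>\<omega>. R (Yl s \<omega>)) * indicator {0<..t} s \<partial>lborel)"
  proof (intro Bochner_Integration.integral_cong refl)
    fix s :: real
    show "(\<Sum>p\<in>P. expectation (\<lambda>\<omega>. h p (Yl s \<omega>)) * indicator {0<..t} s * (\<integral>x. g p x \<partial>\<nu>)) = expectation (\<lambda>\<omega>. R (Yl s \<omega>)) * indicator {0<..t} s"
    proof (cases "s \<in> {0<..t}")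
      case True
      then have "expectation (\<lambda>\<omega>. R (Yl s \<omega>)) = (\<Sum>p\<in>P. expectation (\<lambda>\<omega>. h p (Yl s \<omega>)) * (\<integral>x. g p x \<partial>\<nu>))"
        unfolding R_def using functional_integrable(1)[OF h, of _ s] by (subst Bochner_Integration.integral_sum) auto
      then show ?thesis using True by simp
    qed simp
  qed
  finally show "expectation (\<lambda>\<omega>. \<integral>u. (\<Sum>p\<in>P. ?x p \<omega> u) \<partial>count_space {0<..t})
      = (\<integral>s. expectation (\<lambda>\<omega>. R (Yl s \<omega>)) * indicator {0<..t} s \<partial>lborel)" .
qed

end


abbreviation rate :: "real^('d \<times> 'd)^('d \<times> 'd) \<Rightarrow> real^('d \<times> 'd) \<Rightarrow> real^('d \<times> 'd)^('d \<times> 'd)" where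
  "rate \<equiv> second_moment_rate A B C \<sigma> \<rho>"

text \<open>Matches the matrix rate with the sums coming from the product equation: two cross terms
  weighted by the means of \<open>qvec\<close> and a double sum weighted by the means of products of
  two of them.\<close>

lemma generator_entry:
  assumes X: "psd X"
  shows "rate (outer (vec_mat X) (vec_mat X)) (vec_mat X) $ I $ J
    = (vec_mat X $ I * drift J X + vec_mat X $ J * drift I X)
      + (\<Sum>K\<in>UNIV. vec_mat X $ I * jump_matrix X $ J $ K * (\<integral>x. qvec K x \<partial>\<nu>))
      + (\<Sum>K\<in>UNIV. vec_mat X $ J * jump_matrix X $ I $ K * (\<integral>x. qvec K x \<partial>\<nu>))
      + (\<Sum>(K, K')\<in>UNIV. jump_matrix X $ I $ K * jump_matrix X $ J $ K' * (\<integral>x. qvec K x * qvec K' x \<partial>\<nu>))"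
proof -
  let ?S = "psd_sqrt (C + X)" and ?v = "vec_mat X"
  let ?W = "\<rho> *\<^sub>R (mat 1 + comm_mat + outer (vec_mat (mat 1)) (vec_mat (mat 1))) :: real^('d \<times> 'd)^('d \<times> 'd)"
  have S: "transpose ?S = ?S" "?S ** ?S = C + X"
    using psd_sqrt(1,2)[OF posdef_add_psd[OF posdef_C X]] by (auto simp: psd_def)
  have 1: "(jump_matrix X *v (\<sigma> *\<^sub>R vec_mat (mat 1))) $ I = (\<Sum>K\<in>UNIV. jump_matrix X $ I $ K * (\<integral>x. qvec K x \<partial>\<nu>))" for I
    by (simp add: matrix_vector_mult_def qvec_integral(2))
  have 2: "(jump_matrix X ** ?W ** transpose (jump_matrix X)) $ I $ J = (\<Sum>(K, K')\<in>UNIV. jump_matrix X $ I $ K * jump_matrix X $ J $ K' * (\<integral>x. qvec K x * qvec K' x \<partial>\<nu>))"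
  proof -
    have "(jump_matrix X ** ?W ** transpose (jump_matrix X)) $ I $ J = (\<Sum>K'\<in>UNIV. \<Sum>K\<in>UNIV. jump_matrix X $ I $ K * ?W $ K $ K' * jump_matrix X $ J $ K')"
      unfolding matrix_matrix_mult_def transpose_def by (simp only: vec_lambda_beta sum_distrib_right)
    also have "\<dots> = (\<Sum>K\<in>UNIV. \<Sum>K'\<in>UNIV. jump_matrix X $ I $ K * ?W $ K $ K' * jump_matrix X $ J $ K')"
      by (rule sum.swap)
    also have "\<dots> = (\<Sum>(K, K')\<in>UNIV. jump_matrix X $ I $ K * jump_matrix X $ J $ K' * ?W $ K $ K')"
      unfolding UNIV_pair[where 'a="'d \<times> 'd" and 'b="'d \<times> 'd"] sum.cartesian_product[symmetric]
      by (simp only: mult_ac)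
    finally show ?thesis unfolding qvec_qvec_integral(2) .
  qed
  have "rate (outer ?v ?v) ?v
    = outer (drift_matrix B *v ?v) ?v + outer ?v (drift_matrix B *v ?v)
      + outer (jump_matrix X *v (\<sigma> *\<^sub>R vec_mat (mat 1))) ?v + outer ?v (jump_matrix X *v (\<sigma> *\<^sub>R vec_mat (mat 1)))
      + jump_matrix X ** ?W ** transpose (jump_matrix X)"
    unfolding jump_matrix_def by (rule second_moment_rate_generator[OF S])
  then have "rate (outer ?v ?v) ?v $ I $ J
    = drift I X * ?v $ J + ?v $ I * drift J X + (\<Sum>K\<in>UNIV. jump_matrix X $ I $ K * (\<integral>x. qvec K x \<partial>\<nu>)) * ?v $ J
      + ?v $ I * (\<Sum>K\<in>UNIV. jump_matrix X $ J $ K * (\<integral>x. qvec K x \<partial>\<nu>))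
      + (\<Sum>(K, K')\<in>UNIV. jump_matrix X $ I $ K * jump_matrix X $ J $ K' * (\<integral>x. qvec K x * qvec K' x \<partial>\<nu>))"
    by (simp only: vector_add_component 2) (simp add: outer_def 1 drift_def)
  then show ?thesis by (simp only: sum_distrib_left sum_distrib_right mult_ac add_ac)
qed

lemma first_generator_entry:
  assumes X: "psd X"
  shows "first_moment_rate A B C \<sigma> (vec_mat X) $ I = drift I X + (\<Sum>K\<in>UNIV. jump_matrix X $ I $ K * (\<integral>x. qvec K x \<partial>\<nu>))"
proof -
  let ?S = "psd_sqrt (C + X)"
  have S: "transpose ?S = ?S" "?S ** ?S = C + X"
    using psd_sqrt(1,2)[OF posdef_add_psd[OF posdef_C X]] by (auto simp: psd_def)
  have "(jump_matrix X *v (\<sigma> *\<^sub>R vec_mat (mat 1))) $ I = (\<Sum>K\<in>UNIV. jump_matrix X $ I $ K * (\<integral>x. qvec K x \<partial>\<nu>))"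
    by (simp add: matrix_vector_mult_def qvec_integral(2))
  moreover have "jump_matrix X *v (\<sigma> *\<^sub>R vec_mat (mat 1)) = \<sigma> *\<^sub>R ((A \<otimes> A) *v (vec_mat C + vec_mat X))"
    unfolding jump_matrix_def using kron_sqrt_mean[OF S, of A] by (simp add: matrix_vector_mult_scaleR vec_mat_linear)
  ultimately show ?thesis by (simp add: first_moment_rate_def drift_def)
qed

section \<open>Integral equations of the first two moments\<close>

context
  assumes int0: "integrable M (\<lambda>\<omega>. (norm (Y 0 \<omega>))\<^sup>2)"
begin

lemma first_moment_equation:
  assumes t: "0 < t"
  shows "expectation (\<lambda>\<omega>. vec_mat (Y t \<omega>) $ I) = expectation (\<lambda>\<omega>. vec_mat (Y 0 \<omega>) $ I)
      + (\<integral>s. expectation (\<lambda>\<omega>. first_moment_rate A B C \<sigma> (vec_mat (Yl s \<omega>)) $ I) * indicator {0<..t} s \<partial>lborel)"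
    "integrable lborel (\<lambda>s. expectation (\<lambda>\<omega>. first_moment_rate A B C \<sigma> (vec_mat (Yl s \<omega>)) $ I) * indicator {0<..t} s)"
proof -
  let ?R = "\<lambda>X. \<Sum>K\<in>UNIV. jump_matrix X $ I $ K * (\<integral>x. qvec K x \<partial>\<nu>)"
  have qN: "quadratic_growth (\<lambda>X. jump_matrix X $ I $ K)" for K by (rule linear_growth_imp_quadratic[OF linear_growth_jump_matrix])
  have qd: "quadratic_growth (drift I)" by (rule linear_growth_imp_quadratic[OF linear_growth_drift])
  note J = jump_sum_expectation[OF int0 finite_class.finite_UNIV t, of "\<lambda>K X. jump_matrix X $ I $ K" qvec, OF qN continuous_qvec qvec_0 qvec_integral(1)]
  note D = left_continuous_product_integral[OF functional_left_continuous_adapted[OF int0 qd] t functional_finite[OF int0 qd t]]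
  have qR: "quadratic_growth ?R" using J(4) by simp
  have v: "integrable M (\<lambda>\<omega>. vec_mat (Y 0 \<omega>) $ I)"
    by (rule functional_integrable(2)[OF int0 linear_growth_imp_quadratic[OF linear_growth_vec_mat]]) simp
  have pe: "AE \<omega> in M. vec_mat (Y t \<omega>) $ I = vec_mat (Y 0 \<omega>) $ I
       + (\<integral>s. drift I (Yl s \<omega>) * indicator {0<..t} s \<partial>lborel)
       + (\<integral>u. (\<Sum>K\<in>UNIV. jump_matrix (Yl u \<omega>) $ I $ K * qvec K (jump (\<lambda>r. L r \<omega>) u)) \<partial>count_space {0<..t})"
    using path_equation
  proof eventually_elim
    case (elim \<omega>)
    then show ?case using elim[rule_format, OF t, of I] by (simp only: jmp_def)
  qed
  have "expectation (\<lambda>\<omega>. vec_mat (Y t \<omega>) $ I) = expectation (\<lambda>\<omega>. vec_mat (Y 0 \<omega>) $ I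
       + (\<integral>s. drift I (Yl s \<omega>) * indicator {0<..t} s \<partial>lborel)
       + (\<integral>u. (\<Sum>K\<in>UNIV. jump_matrix (Yl u \<omega>) $ I $ K * qvec K (jump (\<lambda>r. L r \<omega>) u)) \<partial>count_space {0<..t}))"
    using functional_integrable(2)[OF int0 linear_growth_imp_quadratic[OF linear_growth_vec_mat[of I]], of t] t v D(2) J(2)
    by (intro integral_cong_AE pe) auto
  also have "\<dots> = expectation (\<lambda>\<omega>. vec_mat (Y 0 \<omega>) $ I)
      + ((\<integral>s. expectation (\<lambda>\<omega>. drift I (Yl s \<omega>)) * indicator {0<..t} s \<partial>lborel)
      + (\<integral>s. expectation (\<lambda>\<omega>. ?R (Yl s \<omega>)) * indicator {0<..t} s \<partial>lborel))"
    using v D(2) J(2) D(3) J(3) by simp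
  also have "(\<integral>s. expectation (\<lambda>\<omega>. drift I (Yl s \<omega>)) * indicator {0<..t} s \<partial>lborel)
      + (\<integral>s. expectation (\<lambda>\<omega>. ?R (Yl s \<omega>)) * indicator {0<..t} s \<partial>lborel)
    = (\<integral>s. expectation (\<lambda>\<omega>. drift I (Yl s \<omega>)) * indicator {0<..t} s + expectation (\<lambda>\<omega>. ?R (Yl s \<omega>)) * indicator {0<..t} s \<partial>lborel)"
    by (intro Bochner_Integration.integral_add[symmetric] functional_mean_integrable[OF int0 _ t] qd qR)
  also have eq: "(\<lambda>s. expectation (\<lambda>\<omega>. drift I (Yl s \<omega>)) * indicator {0<..t} s + expectation (\<lambda>\<omega>. ?R (Yl s \<omega>)) * indicator {0<..t} s)
    = (\<lambda>s. expectation (\<lambda>\<omega>. first_moment_rate A B C \<sigma> (vec_mat (Yl s \<omega>)) $ I) * indicator {0<..t} s)"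
  proof
    fix s
    show "expectation (\<lambda>\<omega>. drift I (Yl s \<omega>)) * indicator {0<..t} s + expectation (\<lambda>\<omega>. ?R (Yl s \<omega>)) * indicator {0<..t} s
      = expectation (\<lambda>\<omega>. first_moment_rate A B C \<sigma> (vec_mat (Yl s \<omega>)) $ I) * indicator {0<..t} s"
    proof (cases "s \<in> {0<..t}")
      case True
      then have s: "0 \<le> s" by simp
      have "expectation (\<lambda>\<omega>. first_moment_rate A B C \<sigma> (vec_mat (Yl s \<omega>)) $ I) = expectation (\<lambda>\<omega>. drift I (Yl s \<omega>) + ?R (Yl s \<omega>))"
        by (intro Bochner_Integration.integral_cong refl first_generator_entry Yl_psd s)
      also have "\<dots> = expectation (\<lambda>\<omega>. drift I (Yl s \<omega>)) + expectation (\<lambda>\<omega>. ?R (Yl s \<omega>))"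
        by (intro Bochner_Integration.integral_add functional_integrable(1)[OF int0] qd qR s)
      finally show ?thesis using True by simp
    qed simp
  qed
  finally show "expectation (\<lambda>\<omega>. vec_mat (Y t \<omega>) $ I) = expectation (\<lambda>\<omega>. vec_mat (Y 0 \<omega>) $ I)
      + (\<integral>s. expectation (\<lambda>\<omega>. first_moment_rate A B C \<sigma> (vec_mat (Yl s \<omega>)) $ I) * indicator {0<..t} s \<partial>lborel)" .
  show "integrable lborel (\<lambda>s. expectation (\<lambda>\<omega>. first_moment_rate A B C \<sigma> (vec_mat (Yl s \<omega>)) $ I) * indicator {0<..t} s)"
    unfolding eq[symmetric] by (intro Bochner_Integration.integrable_add functional_mean_integrable[OF int0 _ t] qd qR)
qed

text \<open>The jump integrand of \<open>product_equation\<close> is sorted into three finite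
  families of the form state times weight, so that \<open>jump_sum_expectation\<close> applies to
  each; \<open>generator_entry\<close> reassembles their rates.\<close>

lemma second_moment_equation:
  assumes t: "0 < t"
  shows "expectation (\<lambda>\<omega>. vec_mat (Y t \<omega>) $ I * vec_mat (Y t \<omega>) $ J) = expectation (\<lambda>\<omega>. vec_mat (Y 0 \<omega>) $ I * vec_mat (Y 0 \<omega>) $ J)
      + (\<integral>s. expectation (\<lambda>\<omega>. rate (outer (vec_mat (Yl s \<omega>)) (vec_mat (Yl s \<omega>))) (vec_mat (Yl s \<omega>)) $ I $ J) * indicator {0<..t} s \<partial>lborel)"
    "integrable lborel (\<lambda>s. expectation (\<lambda>\<omega>. rate (outer (vec_mat (Yl s \<omega>)) (vec_mat (Yl s \<omega>))) (vec_mat (Yl s \<omega>)) $ I $ J) * indicator {0<..t} s)"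
proof -
  let ?v = "\<lambda>X I. vec_mat X $ I"
  let ?d = "\<lambda>X. ?v X I * drift J X + ?v X J * drift I X"
  let ?R1 = "\<lambda>I J X. \<Sum>K\<in>UNIV. ?v X I * jump_matrix X $ J $ K * (\<integral>x. qvec K x \<partial>\<nu>)"
  let ?R3 = "\<lambda>X. \<Sum>(K, K')\<in>UNIV. jump_matrix X $ I $ K * jump_matrix X $ J $ K' * (\<integral>x. qvec K x * qvec K' x \<partial>\<nu>)"
  let ?rate = "\<lambda>X. rate (outer (vec_mat X) (vec_mat X)) (vec_mat X) $ I $ J"
  let ?\<Delta> = "\<lambda>\<omega> u. jump (\<lambda>r. L r \<omega>) u"
  let ?x1 = "\<lambda>I J \<omega> u. \<Sum>K\<in>UNIV. ?v (Yl u \<omega>) I * jump_matrix (Yl u \<omega>) $ J $ K * qvec K (?\<Delta> \<omega> u)"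
  let ?x3 = "\<lambda>\<omega> u. \<Sum>(K, K')\<in>UNIV. jump_matrix (Yl u \<omega>) $ I $ K * jump_matrix (Yl u \<omega>) $ J $ K' * (qvec K (?\<Delta> \<omega> u) * qvec K' (?\<Delta> \<omega> u))"
  have qvv: "quadratic_growth (\<lambda>X. ?v X I * ?v X J)" by (intro linear_growth_mult linear_growth_vec_mat)
  have qd: "quadratic_growth ?d" by (intro quadratic_growth_add linear_growth_mult linear_growth_vec_mat linear_growth_drift)
  have qvN: "quadratic_growth (\<lambda>X. ?v X I * jump_matrix X $ J $ K)" for I J K by (intro linear_growth_mult linear_growth_vec_mat linear_growth_jump_matrix)
  have qNN: "quadratic_growth (\<lambda>X. jump_matrix X $ I $ K * jump_matrix X $ J $ K')" for K K' by (intro linear_growth_mult linear_growth_jump_matrix)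
  note J1 = jump_sum_expectation[OF int0 finite_class.finite_UNIV t, of "\<lambda>K X. ?v X I * jump_matrix X $ J $ K" qvec for I J, OF qvN continuous_qvec qvec_0 qvec_integral(1)]
  have J3: "AE \<omega> in M. integrable (count_space {0<..t}) (?x3 \<omega>)"
    "integrable M (\<lambda>\<omega>. \<integral>u. ?x3 \<omega> u \<partial>count_space {0<..t})"
    "expectation (\<lambda>\<omega>. \<integral>u. ?x3 \<omega> u \<partial>count_space {0<..t}) = (\<integral>s. expectation (\<lambda>\<omega>. ?R3 (Yl s \<omega>)) * indicator {0<..t} s \<partial>lborel)"
    "quadratic_growth ?R3"
    using jump_sum_expectation[OF int0 finite_class.finite_UNIV t, of "\<lambda>p X. jump_matrix X $ I $ fst p * jump_matrix X $ J $ snd p" "\<lambda>p x. qvec (fst p) x * qvec (snd p) x"]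
      qNN continuous_on_mult[OF continuous_qvec continuous_qvec] qvec_0 qvec_qvec_integral(1)
    unfolding case_prod_unfold by auto
  note D = left_continuous_product_integral[OF functional_left_continuous_adapted[OF int0 qd] t functional_finite[OF int0 qd t]]
  note qR1 = J1(4)
  have v: "integrable M (\<lambda>\<omega>. ?v (Y s \<omega>) I * ?v (Y s \<omega>) J)" if "0 \<le> s" for s
    by (rule functional_integrable(2)[OF int0 qvv that])
  have pe: "AE \<omega> in M. ?v (Y t \<omega>) I * ?v (Y t \<omega>) J = ?v (Y 0 \<omega>) I * ?v (Y 0 \<omega>) J
       + (\<integral>s. ?d (Yl s \<omega>) * indicator {0<..t} s \<partial>lborel)
       + ((\<integral>u. ?x1 I J \<omega> u \<partial>count_space {0<..t}) + (\<integral>u. ?x1 J I \<omega> u \<partial>count_space {0<..t}) + (\<integral>u. ?x3 \<omega> u \<partial>count_space {0<..t}))"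
    using product_equation J1(1)[of I J] J1(1)[of J I] J3(1)
  proof eventually_elim
    case (elim \<omega>)
    have "(\<integral>u. ?v (Yl u \<omega>) I * jmp J u \<omega> + ?v (Yl u \<omega>) J * jmp I u \<omega> + jmp I u \<omega> * jmp J u \<omega> \<partial>count_space {0<..t})
      = (\<integral>u. ?x1 I J \<omega> u + ?x1 J I \<omega> u + ?x3 \<omega> u \<partial>count_space {0<..t})"
    proof (intro Bochner_Integration.integral_cong refl)
      fix u
      have "jmp I u \<omega> * jmp J u \<omega> = ?x3 \<omega> u"
        unfolding jmp_def sum_product UNIV_pair[where 'a="'d \<times> 'd" and 'b="'d \<times> 'd"] sum.cartesian_product[symmetric]
        by (intro sum.cong refl) (simp only: mult_ac)
      moreover have "?v (Yl u \<omega>) I * jmp J u \<omega> = ?x1 I J \<omega> u" "?v (Yl u \<omega>) J * jmp I u \<omega> = ?x1 J I \<omega> u"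
        unfolding jmp_def sum_distrib_left by (simp_all only: mult.assoc)
      ultimately show "?v (Yl u \<omega>) I * jmp J u \<omega> + ?v (Yl u \<omega>) J * jmp I u \<omega> + jmp I u \<omega> * jmp J u \<omega>
        = ?x1 I J \<omega> u + ?x1 J I \<omega> u + ?x3 \<omega> u" by (simp only:)
    qed
    also have "\<dots> = (\<integral>u. ?x1 I J \<omega> u \<partial>count_space {0<..t}) + (\<integral>u. ?x1 J I \<omega> u \<partial>count_space {0<..t}) + (\<integral>u. ?x3 \<omega> u \<partial>count_space {0<..t})"
      using elim(2-4) by (subst Bochner_Integration.integral_add, simp, simp, subst Bochner_Integration.integral_add) simp_all
    finally show ?case using elim(1)[rule_format, OF t, of I J] by (simp only:)
  qed
  have "expectation (\<lambda>\<omega>. ?v (Y t \<omega>) I * ?v (Y t \<omega>) J) = expectation (\<lambda>\<omega>. ?v (Y 0 \<omega>) I * ?v (Y 0 \<omega>) J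
       + (\<integral>s. ?d (Yl s \<omega>) * indicator {0<..t} s \<partial>lborel)
       + ((\<integral>u. ?x1 I J \<omega> u \<partial>count_space {0<..t}) + (\<integral>u. ?x1 J I \<omega> u \<partial>count_space {0<..t}) + (\<integral>u. ?x3 \<omega> u \<partial>count_space {0<..t})))"
  proof (rule integral_cong_AE[OF _ _ pe])
    show "(\<lambda>\<omega>. ?v (Y t \<omega>) I * ?v (Y t \<omega>) J) \<in> borel_measurable M"
      using v[of t] t by (intro borel_measurable_integrable) simp
    show "(\<lambda>\<omega>. ?v (Y 0 \<omega>) I * ?v (Y 0 \<omega>) J
       + (\<integral>s. ?d (Yl s \<omega>) * indicator {0<..t} s \<partial>lborel)
       + ((\<integral>u. ?x1 I J \<omega> u \<partial>count_space {0<..t}) + (\<integral>u. ?x1 J I \<omega> u \<partial>count_space {0<..t}) + (\<integral>u. ?x3 \<omega> u \<partial>count_space {0<..t}))) \<in> borel_measurable M"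
      by (intro borel_measurable_integrable Bochner_Integration.integrable_add v[OF order_refl] D(2) J1(2) J3(2))
  qed
  also have "\<dots> = expectation (\<lambda>\<omega>. ?v (Y 0 \<omega>) I * ?v (Y 0 \<omega>) J)
       + expectation (\<lambda>\<omega>. \<integral>s. ?d (Yl s \<omega>) * indicator {0<..t} s \<partial>lborel)
       + (expectation (\<lambda>\<omega>. \<integral>u. ?x1 I J \<omega> u \<partial>count_space {0<..t}) + expectation (\<lambda>\<omega>. \<integral>u. ?x1 J I \<omega> u \<partial>count_space {0<..t})
         + expectation (\<lambda>\<omega>. \<integral>u. ?x3 \<omega> u \<partial>count_space {0<..t}))"
    by (subst Bochner_Integration.integral_add Bochner_Integration.integral_add[OF v D(2)],
        (intro Bochner_Integration.integrable_add v D(2) J1(2) J3(2) order_refl)+)+ (rule refl)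
  also have "\<dots> = expectation (\<lambda>\<omega>. ?v (Y 0 \<omega>) I * ?v (Y 0 \<omega>) J)
      + ((\<integral>s. expectation (\<lambda>\<omega>. ?d (Yl s \<omega>)) * indicator {0<..t} s \<partial>lborel)
      + (\<integral>s. expectation (\<lambda>\<omega>. ?R1 I J (Yl s \<omega>)) * indicator {0<..t} s \<partial>lborel)
      + (\<integral>s. expectation (\<lambda>\<omega>. ?R1 J I (Yl s \<omega>)) * indicator {0<..t} s \<partial>lborel)
      + (\<integral>s. expectation (\<lambda>\<omega>. ?R3 (Yl s \<omega>)) * indicator {0<..t} s \<partial>lborel))"
    unfolding D(3) J1(3) J3(3) by simp
  also have "(\<integral>s. expectation (\<lambda>\<omega>. ?d (Yl s \<omega>)) * indicator {0<..t} s \<partial>lborel)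
      + (\<integral>s. expectation (\<lambda>\<omega>. ?R1 I J (Yl s \<omega>)) * indicator {0<..t} s \<partial>lborel)
      + (\<integral>s. expectation (\<lambda>\<omega>. ?R1 J I (Yl s \<omega>)) * indicator {0<..t} s \<partial>lborel)
      + (\<integral>s. expectation (\<lambda>\<omega>. ?R3 (Yl s \<omega>)) * indicator {0<..t} s \<partial>lborel)
    = (\<integral>s. expectation (\<lambda>\<omega>. ?d (Yl s \<omega>)) * indicator {0<..t} s + expectation (\<lambda>\<omega>. ?R1 I J (Yl s \<omega>)) * indicator {0<..t} s
        + expectation (\<lambda>\<omega>. ?R1 J I (Yl s \<omega>)) * indicator {0<..t} s + expectation (\<lambda>\<omega>. ?R3 (Yl s \<omega>)) * indicator {0<..t} s \<partial>lborel)"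
    using functional_mean_integrable[OF int0 qd t] functional_mean_integrable[OF int0 qR1[of I J] t]
      functional_mean_integrable[OF int0 qR1[of J I] t] functional_mean_integrable[OF int0 J3(4) t]
    by simp
  \<comment> \<open>Only times in \<open>{0<..t}\<close> matter; there \<open>Yl s\<close> is psd
    and all four pieces are integrable. Elsewhere the indicator makes both sides 0.\<close>
  also have eq: "(\<lambda>s. expectation (\<lambda>\<omega>. ?d (Yl s \<omega>)) * indicator {0<..t} s + expectation (\<lambda>\<omega>. ?R1 I J (Yl s \<omega>)) * indicator {0<..t} s
        + expectation (\<lambda>\<omega>. ?R1 J I (Yl s \<omega>)) * indicator {0<..t} s + expectation (\<lambda>\<omega>. ?R3 (Yl s \<omega>)) * indicator {0<..t} s)
    = (\<lambda>s. expectation (\<lambda>\<omega>. ?rate (Yl s \<omega>)) * indicator {0<..t} s)"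
  proof
    fix s
    show "expectation (\<lambda>\<omega>. ?d (Yl s \<omega>)) * indicator {0<..t} s + expectation (\<lambda>\<omega>. ?R1 I J (Yl s \<omega>)) * indicator {0<..t} s
        + expectation (\<lambda>\<omega>. ?R1 J I (Yl s \<omega>)) * indicator {0<..t} s + expectation (\<lambda>\<omega>. ?R3 (Yl s \<omega>)) * indicator {0<..t} s
      = expectation (\<lambda>\<omega>. ?rate (Yl s \<omega>)) * indicator {0<..t} s"
    proof (cases "s \<in> {0<..t}")
      case True
      then have s: "0 \<le> s" by simp
      have "expectation (\<lambda>\<omega>. ?rate (Yl s \<omega>)) = expectation (\<lambda>\<omega>. ?d (Yl s \<omega>) + ?R1 I J (Yl s \<omega>) + ?R1 J I (Yl s \<omega>) + ?R3 (Yl s \<omega>))"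
        by (intro Bochner_Integration.integral_cong refl generator_entry Yl_psd s)
      also have "\<dots> = expectation (\<lambda>\<omega>. ?d (Yl s \<omega>)) + expectation (\<lambda>\<omega>. ?R1 I J (Yl s \<omega>)) + expectation (\<lambda>\<omega>. ?R1 J I (Yl s \<omega>)) + expectation (\<lambda>\<omega>. ?R3 (Yl s \<omega>))"
        using functional_integrable(1)[OF int0 qd s] functional_integrable(1)[OF int0 qR1[of I J] s]
          functional_integrable(1)[OF int0 qR1[of J I] s] functional_integrable(1)[OF int0 J3(4) s]
        by simp
      finally show ?thesis using True by simp
    qed simp
  qed
  finally show "expectation (\<lambda>\<omega>. ?v (Y t \<omega>) I * ?v (Y t \<omega>) J) = expectation (\<lambda>\<omega>. ?v (Y 0 \<omega>) I * ?v (Y 0 \<omega>) J)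
      + (\<integral>s. expectation (\<lambda>\<omega>. ?rate (Yl s \<omega>)) * indicator {0<..t} s \<partial>lborel)" .
  show "integrable lborel (\<lambda>s. expectation (\<lambda>\<omega>. ?rate (Yl s \<omega>)) * indicator {0<..t} s)"
    unfolding eq[symmetric]
    by (intro Bochner_Integration.integrable_add functional_mean_integrable[OF int0 _ t] qd qR1 J3(4))
qed

end

end

section \<open>The differential equation and its stationary form\<close>

lemma bounded_linear_vec_mat: "bounded_linear (vec_mat :: real^'n::finite^'m::finite \<Rightarrow> _)"
  unfolding linear_conv_bounded_linear[symmetric] by (rule linearI) (simp_all add: vec_mat_linear)

lemma norm_outer: "norm (outer x y) = norm (x :: real^'m) * norm (y :: real^'n)"
proof -
  have "norm (outer x y) = sqrt (\<Sum>i\<in>UNIV. (norm (x $ i *\<^sub>R y))\<^sup>2)"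
    by (simp add: norm_vec_def L2_set_def outer_def vec_eq_iff)
  also have "(\<Sum>i\<in>UNIV. (norm (x $ i *\<^sub>R y))\<^sup>2) = (\<Sum>i\<in>UNIV. (x $ i)\<^sup>2) * (norm y)\<^sup>2"
    by (simp add: power_mult_distrib sum_distrib_right)
  also have "(\<Sum>i\<in>UNIV. (x $ i)\<^sup>2) = (norm x)\<^sup>2"
    by (simp add: norm_vec_def L2_set_def sum_nonneg)
  also have "(norm x)\<^sup>2 * (norm y)\<^sup>2 = (norm x * norm y)\<^sup>2" by (simp add: power_mult_distrib)
  finally show ?thesis by simp
qed

lemma continuous_on_outer: "continuous_on UNIV (\<lambda>X :: real^'n::finite^'m::finite. outer (vec_mat X) (vec_mat X))"
  unfolding outer_def vec_mat_def by (intro continuous_on_vec_lambda continuous_intros)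

context mucogarch
begin

context
  assumes int0: "integrable M (\<lambda>\<omega>. (norm (Y 0 \<omega>))\<^sup>2)"
begin

lemma moments_integrable:
  assumes t: "0 \<le> t"
  shows "integrable M (Y t)" "integrable M (\<lambda>\<omega>. vec_mat (Y t \<omega>))" "integrable M (\<lambda>\<omega>. outer (vec_mat (Y t \<omega>)) (vec_mat (Y t \<omega>)))"
proof -
  note [measurable] = Y_measurable[OF t]
  have sq: "integrable M (\<lambda>\<omega>. (norm (Y t \<omega>))\<^sup>2)" by (rule norm_square_Y_integrable[OF int0 t])
  show i: "integrable M (Y t)"
  proof (rule Bochner_Integration.integrable_bound[where f="\<lambda>\<omega>. 1 + (norm (Y t \<omega>))\<^sup>2"])
    have "z \<le> \<bar>1 + z\<^sup>2\<bar>" for z :: real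
      using zero_le_power2[of "z - 1/2"] by (simp add: power2_eq_square algebra_simps)
    then show "AE \<omega> in M. norm (Y t \<omega>) \<le> norm (1 + (norm (Y t \<omega>))\<^sup>2)" by (intro AE_I2) simp
  qed (use sq in auto)
  show "integrable M (\<lambda>\<omega>. vec_mat (Y t \<omega>))" by (rule integrable_bounded_linear[OF bounded_linear_vec_mat i])
  show "integrable M (\<lambda>\<omega>. outer (vec_mat (Y t \<omega>)) (vec_mat (Y t \<omega>)))"
  proof (rule Bochner_Integration.integrable_bound[OF sq])
    show "(\<lambda>\<omega>. outer (vec_mat (Y t \<omega>)) (vec_mat (Y t \<omega>))) \<in> borel_measurable M"
      by (rule measurable_compose[OF Y_measurable[OF t] borel_measurable_continuous_onI[OF continuous_on_outer]])
  qed (simp add: norm_outer norm_vec_mat power2_eq_square)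
qed

lemma moment_entries:
  assumes t: "0 \<le> t"
  shows "EY M (Y t) $ I = expectation (\<lambda>\<omega>. vec_mat (Y t \<omega>) $ I)"
    "EYY M (Y t) $ I $ J = expectation (\<lambda>\<omega>. vec_mat (Y t \<omega>) $ I * vec_mat (Y t \<omega>) $ J)"
  unfolding EY_def EYY_def
  using integral_bounded_linear[OF bounded_linear_vec_nth moments_integrable(2)[OF t], of I]
    integral_bounded_linear[OF bounded_linear_matrix_entry moments_integrable(3)[OF t], of I J]
  by (simp_all add: outer_def)

text \<open>Affinity of the rate moves the expectation into its arguments, after \<open>Yl t\<close>
  has been replaced by \<open>Y t\<close>, which is almost surely the same.\<close>

lemma expected_second_rate:
  assumes t: "0 \<le> t"
  shows "expectation (\<lambda>\<omega>. rate (outer (vec_mat (Yl t \<omega>)) (vec_mat (Yl t \<omega>))) (vec_mat (Yl t \<omega>)) $ I $ J)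
    = rate (EYY M (Y t)) (EY M (Y t)) $ I $ J"
proof -
  obtain f g where f: "bounded_linear f" and g: "bounded_linear g"
    and fg: "\<And>P m. rate P m = f P + g m + rate 0 0"
    using second_moment_rate_affine[of A B C \<sigma> \<rho>] by blast
  let ?R = "\<lambda>X. rate (outer (vec_mat X) (vec_mat X)) (vec_mat X)"
  have i: "integrable M (\<lambda>\<omega>. f (outer (vec_mat (Y t \<omega>)) (vec_mat (Y t \<omega>))))" "integrable M (\<lambda>\<omega>. g (vec_mat (Y t \<omega>)))"
    by (intro integrable_bounded_linear[OF f] integrable_bounded_linear[OF g] moments_integrable t)+
  have R: "(\<lambda>\<omega>. ?R (Y t \<omega>)) = (\<lambda>\<omega>. f (outer (vec_mat (Y t \<omega>)) (vec_mat (Y t \<omega>))) + g (vec_mat (Y t \<omega>)) + rate 0 0)"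
    using fg by (intro ext)
  have iR: "integrable M (\<lambda>\<omega>. ?R (Y t \<omega>))" unfolding R using i by auto
  have ae: "AE \<omega> in M. ?R (Yl t \<omega>) $ I $ J = ?R (Y t \<omega>) $ I $ J"
    using Yl_eq_Y[OF t] by eventually_elim simp
  have mY: "(\<lambda>\<omega>. ?R (Y t \<omega>) $ I $ J) \<in> borel_measurable M"
    using integrable_bounded_linear[OF bounded_linear_matrix_entry iR] by (rule borel_measurable_integrable)
  have "expectation (\<lambda>\<omega>. ?R (Yl t \<omega>) $ I $ J) = expectation (\<lambda>\<omega>. ?R (Y t \<omega>) $ I $ J)"
    by (rule integral_cong_AE[OF borel_measurable_AE_complete[OF complete_measure_axioms mY ae] mY ae])
  also have "\<dots> = expectation (\<lambda>\<omega>. ?R (Y t \<omega>)) $ I $ J"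
    by (rule integral_bounded_linear[OF bounded_linear_matrix_entry iR])
  also have "expectation (\<lambda>\<omega>. ?R (Y t \<omega>)) = f (EYY M (Y t)) + g (EY M (Y t)) + rate 0 0"
    unfolding R EYY_def EY_def
    using i integral_bounded_linear[OF f moments_integrable(3)[OF t]] integral_bounded_linear[OF g moments_integrable(2)[OF t]]
    by (simp add: prob_space)
  finally show ?thesis by (simp only: fg[of "EYY M (Y t)"])
qed

lemma expected_first_rate:
  assumes t: "0 \<le> t"
  shows "expectation (\<lambda>\<omega>. first_moment_rate A B C \<sigma> (vec_mat (Yl t \<omega>)) $ I) = first_moment_rate A B C \<sigma> (EY M (Y t)) $ I"
proof -
  define f :: "real^('d \<times> 'd) \<Rightarrow> real^('d \<times> 'd)" where "f m = drift_matrix B *v m + \<sigma> *\<^sub>R ((A \<otimes> A) *v m)" for m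
  have f: "bounded_linear f"
    unfolding linear_conv_bounded_linear[symmetric] f_def
    by (rule linearI) (simp_all add: matrix_vector_right_distrib matrix_vector_mult_scaleR algebra_simps)
  have fg: "first_moment_rate A B C \<sigma> m = f m + first_moment_rate A B C \<sigma> 0" for m
    by (simp add: first_moment_rate_def f_def matrix_vector_right_distrib algebra_simps)
  let ?R = "\<lambda>X. first_moment_rate A B C \<sigma> (vec_mat X)"
  have i: "integrable M (\<lambda>\<omega>. f (vec_mat (Y t \<omega>)))"
    by (intro integrable_bounded_linear[OF f] moments_integrable t)
  have R: "(\<lambda>\<omega>. ?R (Y t \<omega>)) = (\<lambda>\<omega>. f (vec_mat (Y t \<omega>)) + first_moment_rate A B C \<sigma> 0)"
    using fg by (intro ext)
  have iR: "integrable M (\<lambda>\<omega>. ?R (Y t \<omega>))" unfolding R using i by auto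
  have ae: "AE \<omega> in M. ?R (Yl t \<omega>) $ I = ?R (Y t \<omega>) $ I"
    using Yl_eq_Y[OF t] by eventually_elim simp
  have mY: "(\<lambda>\<omega>. ?R (Y t \<omega>) $ I) \<in> borel_measurable M"
    using integrable_bounded_linear[OF bounded_linear_vec_nth iR] by (rule borel_measurable_integrable)
  have "expectation (\<lambda>\<omega>. ?R (Yl t \<omega>) $ I) = expectation (\<lambda>\<omega>. ?R (Y t \<omega>) $ I)"
    by (rule integral_cong_AE[OF borel_measurable_AE_complete[OF complete_measure_axioms mY ae] mY ae])
  also have "\<dots> = expectation (\<lambda>\<omega>. ?R (Y t \<omega>)) $ I"
    by (rule integral_bounded_linear[OF bounded_linear_vec_nth iR])
  also have "expectation (\<lambda>\<omega>. ?R (Y t \<omega>)) = f (EY M (Y t)) + first_moment_rate A B C \<sigma> 0"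
    unfolding R EY_def
    using i integral_bounded_linear[OF f moments_integrable(2)[OF t]]
    by (simp add: prob_space)
  finally show ?thesis by (simp only: fg[of "EY M (Y t)"])
qed

lemma moment_integral_equations:
  assumes t: "0 \<le> t"
  shows "(\<lambda>s. first_moment_rate A B C \<sigma> (EY M (Y s)) $ I) integrable_on {0..t}"
    "EY M (Y t) $ I = EY M (Y 0) $ I + integral {0..t} (\<lambda>s. first_moment_rate A B C \<sigma> (EY M (Y s)) $ I)"
    "(\<lambda>s. rate (EYY M (Y s)) (EY M (Y s)) $ I $ J) integrable_on {0..t}"
    "EYY M (Y t) $ I $ J = EYY M (Y 0) $ I $ J + integral {0..t} (\<lambda>s. rate (EYY M (Y s)) (EY M (Y s)) $ I $ J)"
proof -
  have "(\<lambda>s. first_moment_rate A B C \<sigma> (EY M (Y s)) $ I) integrable_on {0..t} \<and>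
    EY M (Y t) $ I = EY M (Y 0) $ I + integral {0..t} (\<lambda>s. first_moment_rate A B C \<sigma> (EY M (Y s)) $ I) \<and>
    (\<lambda>s. rate (EYY M (Y s)) (EY M (Y s)) $ I $ J) integrable_on {0..t} \<and>
    EYY M (Y t) $ I $ J = EYY M (Y 0) $ I $ J + integral {0..t} (\<lambda>s. rate (EYY M (Y s)) (EY M (Y s)) $ I $ J)"
  proof (cases "t = 0")
    case False
    then have t0: "0 < t" using t by simp
    have e1: "(\<lambda>s. expectation (\<lambda>\<omega>. first_moment_rate A B C \<sigma> (vec_mat (Yl s \<omega>)) $ I) * indicator {0<..t} s)
       = (\<lambda>s. first_moment_rate A B C \<sigma> (EY M (Y s)) $ I * indicator {0<..t} s)"
      using expected_first_rate by (auto simp: fun_eq_iff indicator_def)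
    have e2: "(\<lambda>s. expectation (\<lambda>\<omega>. rate (outer (vec_mat (Yl s \<omega>)) (vec_mat (Yl s \<omega>))) (vec_mat (Yl s \<omega>)) $ I $ J) * indicator {0<..t} s)
       = (\<lambda>s. rate (EYY M (Y s)) (EY M (Y s)) $ I $ J * indicator {0<..t} s)"
      using expected_second_rate by (auto simp: fun_eq_iff indicator_def)
    note F = first_moment_equation[OF int0 t0, of I, unfolded e1] and S = second_moment_equation[OF int0 t0, of I J, unfolded e2]
    show ?thesis
      using lborel_Ioc_integral[OF F(2)] lborel_Ioc_integral[OF S(2)] F(1) S(1) moment_entries[OF t] moment_entries[OF order_refl]
      by (simp only: conj_absorb simp_thms)
  qed (use integrable_on_refl[where a="0::real"] in \<open>auto simp del: box_real\<close>)
  then show "(\<lambda>s. first_moment_rate A B C \<sigma> (EY M (Y s)) $ I) integrable_on {0..t}"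
    "EY M (Y t) $ I = EY M (Y 0) $ I + integral {0..t} (\<lambda>s. first_moment_rate A B C \<sigma> (EY M (Y s)) $ I)"
    "(\<lambda>s. rate (EYY M (Y s)) (EY M (Y s)) $ I $ J) integrable_on {0..t}"
    "EYY M (Y t) $ I $ J = EYY M (Y 0) $ I $ J + integral {0..t} (\<lambda>s. rate (EYY M (Y s)) (EY M (Y s)) $ I $ J)"
    by blast+
qed

text \<open>Indefinite integrals of integrable functions are continuous, so the integral equations
  themselves show that the moments depend continuously on time.\<close>

lemma continuous_on_moments:
  "continuous_on {0..T} (\<lambda>s. EY M (Y s))" "continuous_on {0..T} (\<lambda>s. EYY M (Y s))"
proof -
  have 1: "continuous_on {0..T} (\<lambda>s. EY M (Y s) $ I)" for I
  proof (cases "0 \<le> T")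
    case True
    have "continuous_on {0..T} (\<lambda>s. EY M (Y 0) $ I + integral {0..s} (\<lambda>s. first_moment_rate A B C \<sigma> (EY M (Y s)) $ I))"
      by (intro continuous_intros indefinite_integral_continuous_1 moment_integral_equations(1) True)
    then show ?thesis
      by (rule continuous_on_eq) (rule moment_integral_equations(2)[symmetric], simp)
  qed auto
  have 2: "continuous_on {0..T} (\<lambda>s. EYY M (Y s) $ I $ J)" for I J
  proof (cases "0 \<le> T")
    case True
    have "continuous_on {0..T} (\<lambda>s. EYY M (Y 0) $ I $ J + integral {0..s} (\<lambda>s. rate (EYY M (Y s)) (EY M (Y s)) $ I $ J))"
      by (intro continuous_intros indefinite_integral_continuous_1 moment_integral_equations(3) True)
    then show ?thesis
      by (rule continuous_on_eq) (rule moment_integral_equations(4)[symmetric], simp)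
  qed auto
  show "continuous_on {0..T} (\<lambda>s. EY M (Y s))"
    using continuous_on_vec_lambda[of "{0..T}" "\<lambda>I s. EY M (Y s) $ I"] 1 by simp
  have "continuous_on {0..T} (\<lambda>s. EYY M (Y s) $ I)" for I
    using continuous_on_vec_lambda[of "{0..T}" "\<lambda>J s. EYY M (Y s) $ I $ J"] 2 by simp
  then show "continuous_on {0..T} (\<lambda>s. EYY M (Y s))"
    using continuous_on_vec_lambda[of "{0..T}" "\<lambda>I s. EYY M (Y s) $ I"] by simp
qed

text \<open>The rate is affine and the moments are continuous, so the integrand is continuous and
  the fundamental theorem of calculus applies entry by entry.\<close>

theorem second_moment_derivative:
  assumes t: "0 \<le> t"
  shows "((\<lambda>s. vec_mat (EYY M (Y s))) has_vector_derivative vec_mat (rate (EYY M (Y t)) (EY M (Y t)))) (at t within {0..})"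
proof (rule has_vector_derivative_vec)
  fix p :: "('d \<times> 'd) \<times> ('d \<times> 'd)"
  obtain f g where f: "bounded_linear f" and g: "bounded_linear g"
    and fg: "\<And>P m. rate P m = f P + g m + rate 0 0"
    using second_moment_rate_affine[of A B C \<sigma> \<rho>] by blast
  let ?r = "\<lambda>s. rate (EYY M (Y s)) (EY M (Y s))"
  \<comment> \<open>Going beyond \<open>t\<close> keeps it from being the right end point, so the
    derivative within this interval is the one within \<open>{0..}\<close>.\<close>
  have "continuous_on {0..t + 1} (\<lambda>s. f (EYY M (Y s)) + g (EY M (Y s)) + rate 0 0)"
    by (intro continuous_on_add continuous_on_const bounded_linear.continuous_on[OF f] bounded_linear.continuous_on[OF g] continuous_on_moments)
  then have "continuous_on {0..t + 1} ?r" unfolding fg[symmetric] .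
  then have "continuous_on {0..t + 1} (\<lambda>s. ?r s $ snd p $ fst p)" by (rule continuous_on_matrix_entry)
  then have "((\<lambda>s. integral {0..s} (\<lambda>s. ?r s $ snd p $ fst p)) has_vector_derivative ?r t $ snd p $ fst p) (at t within {0..t + 1})"
    by (rule integral_has_vector_derivative) (use t in auto)
  then have "((\<lambda>s. EYY M (Y 0) $ snd p $ fst p + integral {0..s} (\<lambda>s. ?r s $ snd p $ fst p)) has_vector_derivative 0 + ?r t $ snd p $ fst p) (at t within {0..t + 1})"
    by (intro has_vector_derivative_add has_vector_derivative_const)
  then have "((\<lambda>s. vec_mat (EYY M (Y s)) $ p) has_vector_derivative 0 + ?r t $ snd p $ fst p) (at t within {0..t + 1})"
  proof (rule has_vector_derivative_transform[rotated 2])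
    fix s assume "s \<in> {0..t + 1}"
    then show "vec_mat (EYY M (Y s)) $ p = EYY M (Y 0) $ snd p $ fst p + integral {0..s} (\<lambda>s. ?r s $ snd p $ fst p)"
      using moment_integral_equations(4)[of s "snd p" "fst p"] by (simp add: vec_mat_def)
  qed (use t in simp)
  then show "((\<lambda>s. vec_mat (EYY M (Y s)) $ p) has_vector_derivative vec_mat (?r t) $ p) (at t within {0..})"
    unfolding at_within_Icc_atLeast[OF t, symmetric] by (simp add: vec_mat_def)
qed

end

text \<open>The covariance at lag 0 and the mean determine the second moment, which is therefore
  constant in time as well.\<close>

lemma stationary_moments:
  assumes st: "second_order_stationary M Y" and t: "0 \<le> t"
  shows "EY M (Y t) = EY M (Y 0)" "EYY M (Y t) = EYY M (Y 0)"
proof -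
  have int0: "integrable M (\<lambda>\<omega>. (norm (Y 0 \<omega>))\<^sup>2)" using st unfolding second_order_stationary_def by auto
  note mi = moments_integrable[OF int0]
  have EYv: "EY M (Y s) = vec_mat (\<integral>\<omega>. Y s \<omega> \<partial>M)" if "0 \<le> s" for s
    unfolding EY_def by (rule integral_bounded_linear[OF bounded_linear_vec_mat mi(1)[OF that]])
  show m: "EY M (Y t) = EY M (Y 0)"
    using st t unfolding EYv[OF t] EYv[OF order_refl] second_order_stationary_def by metis
  have cov: "cov_mat M (\<lambda>\<omega>. vec_mat (Y s \<omega>)) (\<lambda>\<omega>. vec_mat (Y s \<omega>)) = EYY M (Y s) - outer (EY M (Y s)) (EY M (Y s))" if s: "0 \<le> s" for s
  proof -
    let ?m = "EY M (Y s)"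
    have bl: "bounded_linear (\<lambda>x. outer x ?m)" "bounded_linear (\<lambda>x. outer ?m x)"
      unfolding linear_conv_bounded_linear[symmetric] by (rule linearI; simp add: outer_add outer_scaleR)+
    have e: "outer (vec_mat (Y s \<omega>) - ?m) (vec_mat (Y s \<omega>) - ?m)
      = outer (vec_mat (Y s \<omega>)) (vec_mat (Y s \<omega>)) - outer (vec_mat (Y s \<omega>)) ?m - outer ?m (vec_mat (Y s \<omega>)) + outer ?m ?m" for \<omega>
      by (simp add: outer_def vec_eq_iff algebra_simps)
    have i: "integrable M (\<lambda>\<omega>. outer (vec_mat (Y s \<omega>)) ?m)" "integrable M (\<lambda>\<omega>. outer ?m (vec_mat (Y s \<omega>)))"
      by (intro integrable_bounded_linear[OF bl(1)] integrable_bounded_linear[OF bl(2)] mi(2) s)+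
    have E: "expectation (\<lambda>\<omega>. outer (vec_mat (Y s \<omega>)) ?m) = outer ?m ?m" "expectation (\<lambda>\<omega>. outer ?m (vec_mat (Y s \<omega>))) = outer ?m ?m"
      using integral_bounded_linear[OF bl(1) mi(2)[OF s]] integral_bounded_linear[OF bl(2) mi(2)[OF s]] by (simp_all add: EY_def)
    have "cov_mat M (\<lambda>\<omega>. vec_mat (Y s \<omega>)) (\<lambda>\<omega>. vec_mat (Y s \<omega>))
      = expectation (\<lambda>\<omega>. outer (vec_mat (Y s \<omega>)) (vec_mat (Y s \<omega>)) - outer (vec_mat (Y s \<omega>)) ?m - outer ?m (vec_mat (Y s \<omega>)) + outer ?m ?m)"
      unfolding cov_mat_def EY_def[symmetric] e ..
    also have "\<dots> = EYY M (Y s) - outer ?m ?m - outer ?m ?m + outer ?m ?m"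
      using i mi(3)[OF s] E by (simp add: EYY_def prob_space)
    finally show ?thesis by simp
  qed
  \<comment> \<open>Stationarity of the covariance at lag \<open>h = 0\<close>.\<close>
  have "cov_mat M (\<lambda>\<omega>. vec_mat (Y t \<omega>)) (\<lambda>\<omega>. vec_mat (Y t \<omega>)) = cov_mat M (\<lambda>\<omega>. vec_mat (Y 0 \<omega>)) (\<lambda>\<omega>. vec_mat (Y 0 \<omega>))"
    using st t unfolding second_order_stationary_def by (metis add.right_neutral order_refl)
  then show "EYY M (Y t) = EYY M (Y 0)" unfolding cov[OF t] cov[OF order_refl] m by simp
qed

text \<open>A constant function has derivative 0, and the one-sided derivative at time 0 is unique
  because the filter there is nontrivial.\<close>

theorem stationary_rate:
  assumes st: "second_order_stationary M Y"
  shows "rate (EYY M (Y 0)) (EY M (Y 0)) = 0"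
proof -
  have int0: "integrable M (\<lambda>\<omega>. (norm (Y 0 \<omega>))\<^sup>2)" using st unfolding second_order_stationary_def by auto
  have "((\<lambda>s. vec_mat (EYY M (Y 0))) has_vector_derivative vec_mat (rate (EYY M (Y 0)) (EY M (Y 0)))) (at 0 within {0..})"
  proof (rule has_vector_derivative_transform[OF _ _ second_moment_derivative[OF int0 order_refl]])
    fix s :: real assume "s \<in> {0..}"
    then have "EYY M (Y s) = EYY M (Y 0)" by (intro stationary_moments(2)[OF st]) simp
    then show "vec_mat (EYY M (Y 0)) = vec_mat (EYY M (Y s))" by (rule arg_cong[OF sym])
  qed simp
  moreover have "((\<lambda>s. vec_mat (EYY M (Y 0))) has_vector_derivative 0) (at 0 within {0..})"
    by (rule has_vector_derivative_const)
  moreover have "at (0::real) within {0..} \<noteq> bot"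
  proof -
    have "at (0::real) within {0..} = at_right 0"
      using at_within_Icc_atLeast[of 0] at_within_Icc_at_right[of "0::real" 1] by simp
    then show ?thesis using trivial_limit_at_right_real[of "0::real"] by simp
  qed
  ultimately have "vec_mat (rate (EYY M (Y 0)) (EY M (Y 0))) = 0"
    using vector_derivative_unique_within by blast
  then have "rate (EYY M (Y 0)) (EY M (Y 0)) = unvec 0" by (metis unvec_vec_mat)
  also have "unvec 0 = (0 :: real^('d \<times> 'd)^('d \<times> 'd))" by (simp add: unvec_def vec_eq_iff)
  finally show ?thesis .
qed

end

text \<open>\<open>scrB\<close> is the drift matrix plus \<open>\<sigma>\<close> times
  \<open>A \<otimes> A\<close>, so the terms linear in \<open>P\<close> combine on the left and
  those containing \<open>C\<close> move to the right.\<close>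

lemma stationary_matrix_equation:
  assumes "second_moment_rate A B C \<sigma> \<rho> P m = 0"
  shows "scrB A B \<sigma> ** P + P ** transpose (scrB A B \<sigma>) + (A \<otimes> A) ** R_map \<rho> P ** (transpose A \<otimes> transpose A)
       = - (\<sigma> *\<^sub>R (outer ((A \<otimes> A) *v vec_mat C) m + outer m (vec_mat C) ** (transpose A \<otimes> transpose A)))
         - (A \<otimes> A) ** R_map \<rho> (outer m (vec_mat C) + outer (vec_mat C) m + outer (vec_mat C) (vec_mat C)) ** (transpose A \<otimes> transpose A)"
proof -
  have B: "scrB A B \<sigma> = drift_matrix B + \<sigma> *\<^sub>R (A \<otimes> A)" by (simp add: scrB_def drift_matrix_def)
  have tB: "transpose (drift_matrix B + \<sigma> *\<^sub>R (A \<otimes> A)) = transpose (drift_matrix B) + \<sigma> *\<^sub>R transpose (A \<otimes> A)"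
    by (simp add: transpose_def vec_eq_iff)
  show ?thesis
    using assms unfolding second_moment_rate_def B tB transpose_kron[symmetric]
    by (simp add: matrix_add_ldistrib matrix_mult_add_left matrix_mult_scaleR_left matrix_mult_scaleR_right
        matrix_mult_outer R_map_linear algebra_simps) (simp add: eq_neg_iff_add_eq_0 add_ac)
qed

lemma stationary_vector_equation:
  assumes r: "second_moment_rate A B C \<sigma> \<rho> P m = 0" and inv: "invertible (scrC A B \<sigma> \<rho>)"
  shows "vec_mat P = - (matrix_inv (scrC A B \<sigma> \<rho>) *v
               ((scrA A ** calR \<rho>) *v (vec_mat C \<otimes>\<^sub>v vec_mat C)
                + (\<sigma> *\<^sub>R ((A \<otimes> A) \<otimes> mat 1) + scrA A ** calR \<rho>) *v (vec_mat C \<otimes>\<^sub>v m)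
                + (\<sigma> *\<^sub>R (mat 1 \<otimes> (A \<otimes> A)) + scrA A ** calR \<rho>) *v (m \<otimes>\<^sub>v vec_mat C)))" (is "_ = - (?I *v ?R)")
proof -
  have "vec_mat (second_moment_rate A B C \<sigma> \<rho> P m) = 0" using r by (simp add: vec_mat_def vec_eq_iff)
  then have "scrC A B \<sigma> \<rho> *v vec_mat P + ?R = 0"
    unfolding vec_mat_second_moment_rate by (simp add: add_ac)
  then have "scrC A B \<sigma> \<rho> *v vec_mat P = - ?R" by (rule eq_neg_iff_add_eq_0[THEN iffD2])
  then have "?I *v (scrC A B \<sigma> \<rho> *v vec_mat P) = ?I *v (- ?R)" by simp
  moreover have "?I *v (scrC A B \<sigma> \<rho> *v vec_mat P) = vec_mat P"
  proof -
    have "?I ** scrC A B \<sigma> \<rho> = mat 1"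
      using inv unfolding invertible_def matrix_inv_def by (rule someI2_ex) simp
    then show ?thesis by (simp only: matrix_vector_mul_assoc matrix_vector_mul_lid)
  qed
  moreover have "?I *v (- ?R) = - (?I *v ?R)" by (rule linear_neg[OF matrix_vector_mul_linear])
  ultimately show ?thesis by (simp only:)
qed

text \<open>Independence passes to the smaller sigma-algebras generated by \<open>Z\<close> and by
  \<open>f\<close> of the increment, where bounded variables have factorizing expectations. This
  turns the independence in \<open>levy_process\<close> into the form used in
  \<open>levy_jumps\<close>.\<close>

lemma (in prob_space) indep_set_expectation_product:
  fixes Z :: "'a \<Rightarrow> real" and X :: "'a \<Rightarrow> 'b::topological_space" and f :: "'b \<Rightarrow> real"
  assumes ind: "indep_set (sets G) (sets (vimage_algebra (space M) X borel))" and G: "space G = space M" "sets G \<subseteq> sets M"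
    and Z: "Z \<in> borel_measurable G" "\<And>\<omega>. \<bar>Z \<omega>\<bar> \<le> c" and X: "X \<in> borel_measurable M"
    and f: "f \<in> borel_measurable borel" "\<And>x. \<bar>f x\<bar> \<le> c'"
  shows "expectation (\<lambda>\<omega>. Z \<omega> * f (X \<omega>)) = expectation Z * expectation (\<lambda>\<omega>. f (X \<omega>))"
proof -
  have ZM: "Z \<in> borel_measurable M" using Z(1) G by (auto simp: measurable_def)
  have fX: "(\<lambda>\<omega>. f (X \<omega>)) \<in> borel_measurable M" using X f(1) by (rule measurable_compose)
  have sZ: "{Z -` S \<inter> space M |S. S \<in> sets borel} \<subseteq> sets G"
    using measurable_sets[OF Z(1)] G(1) by auto
  have sX: "{(\<lambda>\<omega>. f (X \<omega>)) -` S \<inter> space M |S. S \<in> sets borel} \<subseteq> sets (vimage_algebra (space M) X borel)"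
  proof -
    have "(\<lambda>\<omega>. f (X \<omega>)) -` S \<inter> space M \<in> sets (vimage_algebra (space M) X borel)" if "S \<in> sets borel" for S
    proof -
      have "(\<lambda>\<omega>. f (X \<omega>)) -` S \<inter> space M = X -` (f -` S) \<inter> space M" by auto
      moreover have "f -` S \<in> sets borel" using measurable_sets[OF f(1) that] by simp
      ultimately show ?thesis using X by (auto simp: sets_vimage_algebra2 measurable_def)
    qed
    then show ?thesis by auto
  qed
  have "indep_set (sigma_sets (space M) {Z -` S \<inter> space M |S. S \<in> sets borel}) (sigma_sets (space M) {(\<lambda>\<omega>. f (X \<omega>)) -` S \<inter> space M |S. S \<in> sets borel})"
  proof -
    have 1: "sigma_sets (space M) {Z -` S \<inter> space M |S. S \<in> sets borel} \<subseteq> sets G"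
      using sets.sigma_sets_subset[OF sZ] G(1) by simp
    have 2: "sigma_sets (space M) {(\<lambda>\<omega>. f (X \<omega>)) -` S \<inter> space M |S. S \<in> sets borel} \<subseteq> sets (vimage_algebra (space M) X borel)"
      using sets.sigma_sets_subset[OF sX] by simp
    show ?thesis
      using ind 1 2 unfolding indep_set_def
      by (elim indep_sets_mono_sets) (auto split: bool.split)
  qed
  then have "indep_var borel Z borel (\<lambda>\<omega>. f (X \<omega>))"
    unfolding indep_var_eq using ZM fX by auto
  moreover have "integrable M Z" using ZM Z(2) by (intro integrable_const_bound[where B=c]) auto
  moreover have "integrable M (\<lambda>\<omega>. f (X \<omega>))" using fX f(2) by (intro integrable_const_bound[where B=c']) auto
  ultimately show ?thesis by (intro indep_var_lebesgue_integral)
qed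

section \<open>Passage to paths that are regular at every outcome\<close>

lemma cadlag_const: "cadlag (\<lambda>_. c)"
  by (auto simp: cadlag_def)

lemma psd_zero: "psd 0"
  by (simp add: psd_def transpose_def vec_eq_iff)

text \<open>By the usual conditions null sets belong to \<open>F 0\<close>, so redefining \<open>L\<close> and \<open>Y\<close> on one keeps them adapted.\<close>

lemma mucogarch_modification:
  fixes L :: "real \<Rightarrow> 'a \<Rightarrow> real^'d" and Y :: "real \<Rightarrow> 'a \<Rightarrow> real^'d^'d"
  assumes "usual_filtered_space M F"
    and L: "levy_process M F L"
    and \<nu>: "is_levy_measure M L \<nu>"
    and C: "posdef C"
    and Y: "mucogarch_volatility M F L A B C Y"
    and second: "has_bochner_integral \<nu> (\<lambda>x. outer x x) (\<sigma> *\<^sub>R mat 1)"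
    and fourth: "integrable \<nu> (\<lambda>x. norm x ^ 4)"
    and fourths: "has_bochner_integral \<nu> (\<lambda>x. outer (vec_mat (outer x x)) (vec_mat (outer x x)))
           (\<rho> *\<^sub>R (mat 1 + comm_mat + outer (vec_mat (mat 1)) (vec_mat (mat 1))))"
  shows "\<exists>L' Y'. mucogarch M F L' \<nu> A B C Y' \<sigma> \<rho> \<and> (AE \<omega> in M. \<forall>t. Y' t \<omega> = Y t \<omega>) \<and> (\<forall>t\<ge>0. Y t \<in> borel_measurable M)"
proof -
  interpret usual_filtered_space M F by fact
  have spF: "space (F t) = space M" if "0 \<le> t" for t
    using space_F[of t] that by (simp add: max_def)
  have mono: "sets (F s) \<subseteq> sets (F t)" if "0 \<le> s" "s \<le> t" for s t
    using sets_F_mono[of s t] that by (simp add: max_def)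
  define good where "good \<omega> \<longleftrightarrow> cadlag (\<lambda>t. L t \<omega>) \<and> cadlag (\<lambda>t. Y t \<omega>) \<and> (\<forall>t\<ge>0. psd (Y t \<omega>))" for \<omega>
  have "AE \<omega> in M. good \<omega>"
    using L Y unfolding levy_process_def mucogarch_volatility_def good_def by auto
  then obtain N where N: "N \<in> null_sets M" "\<And>\<omega>. \<omega> \<in> space M \<Longrightarrow> \<omega> \<notin> N \<Longrightarrow> good \<omega>"
    by (auto elim!: AE_E3)
  \<comment> \<open>The zero path is cadlag and, for \<open>Y'\<close>, psd, so the path properties
    hold on \<open>N\<close> as well.\<close>
  define L' where "L' t \<omega> = (if \<omega> \<in> N then 0 else L t \<omega>)" for t \<omega>
  define Y' where "Y' t \<omega> = (if \<omega> \<in> N then 0 else Y t \<omega>)" for t \<omega>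
  have AEN: "AE \<omega> in M. \<omega> \<notin> N" by (rule AE_not_in[OF N(1)])
  have NF: "N \<inter> space (F t) \<in> sets (F t)" if "0 \<le> t" for t
    using N(1) null_sets_F mono[OF order_refl that] sets.Int_space_eq2[of N "F t"] by auto
  have adL: "L t \<in> borel_measurable (F t)" and adY: "Y t \<in> borel_measurable (F t)" if "0 \<le> t" for t
    using L Y that unfolding levy_process_def mucogarch_volatility_def adapted_def by auto
  have toM: "f \<in> measurable M K" if "f \<in> measurable (F t) K" "0 \<le> t" for f K t
    using that sets_F_subset[of t] spF[of t] by (auto simp: measurable_def)
  have Lm: "L t \<in> borel_measurable M" if "0 \<le> t" for t by (rule toM[OF adL that]) (rule that)
  have Lm': "L' t \<in> borel_measurable M" if "0 \<le> t" for t
    unfolding L'_def[abs_def]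
    using N(1) Lm[OF that] by (intro measurable_If_set) auto
  have "mucogarch M F L' \<nu> A B C Y' \<sigma> \<rho>"
  proof
    show "space (F t) = space M" if "0 \<le> t" for t by (rule spF[OF that])
    show "sets (F t) \<subseteq> sets M" if "0 \<le> t" for t by (rule sets_F_subset[OF that])
    show "sets (F s) \<subseteq> sets (F t)" if "0 \<le> s" "s \<le> t" for s t by (rule mono[OF that])
    show "L' t \<in> borel_measurable (F t)" if "0 \<le> t" for t
      unfolding L'_def[abs_def] using adL[OF that] NF[OF that] by (intro measurable_If_set) auto
    show "Y' t \<in> borel_measurable (F t)" if "0 \<le> t" for t
      unfolding Y'_def[abs_def] using adY[OF that] NF[OF that] by (intro measurable_If_set) auto
    show "cadlag (\<lambda>t. L' t \<omega>)" "cadlag (\<lambda>t. Y' t \<omega>)" if "\<omega> \<in> space M" for \<omega>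
      using N(2)[OF that] by (cases "\<omega> \<in> N"; simp add: L'_def Y'_def cadlag_const good_def)+
    show "psd (Y' t \<omega>)" if "\<omega> \<in> space M" "0 \<le> t" for t \<omega>
      using N(2)[OF that(1)] that(2) by (cases "\<omega> \<in> N") (simp_all add: Y'_def psd_zero good_def)
    show "expectation (\<lambda>\<omega>. Z \<omega> * f (L' t \<omega> - L' s \<omega>)) = expectation Z * expectation (\<lambda>\<omega>. f (L' (t - s) \<omega>))"
      if st: "0 \<le> s" "s \<le> t" and Z: "Z \<in> borel_measurable (F s)" "\<And>\<omega>. 0 \<le> Z \<omega>" "\<And>\<omega>. Z \<omega> \<le> c"
        and f: "f \<in> borel_measurable borel" "\<And>x. 0 \<le> f x" "\<And>x. f x \<le> (1::real)" for s t Z c f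
    proof -
      note [measurable] = f(1) toM[OF Z(1) st(1)] Lm[OF st(1)] Lm'[OF st(1)]
      have [measurable]: "L t \<in> borel_measurable M" "L' t \<in> borel_measurable M" "L (t - s) \<in> borel_measurable M" "L' (t - s) \<in> borel_measurable M"
        using Lm[of t] Lm'[of t] Lm[of "t - s"] Lm'[of "t - s"] st by auto
      have "expectation (\<lambda>\<omega>. Z \<omega> * f (L' t \<omega> - L' s \<omega>)) = expectation (\<lambda>\<omega>. Z \<omega> * f (L t \<omega> - L s \<omega>))"
      proof (rule integral_cong_AE)
        show "AE \<omega> in M. Z \<omega> * f (L' t \<omega> - L' s \<omega>) = Z \<omega> * f (L t \<omega> - L s \<omega>)"
          using AEN by eventually_elim (simp add: L'_def)
      qed measurable
      also have "\<dots> = expectation Z * expectation (\<lambda>\<omega>. f (L t \<omega> - L s \<omega>))"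
      proof (rule indep_set_expectation_product[where G="F s" and Z=Z and f=f and X="\<lambda>\<omega>. L t \<omega> - L s \<omega>" and c="\<bar>c\<bar>" and c'=1])
        show "indep_set (sets (F s)) (sets (vimage_algebra (space M) (\<lambda>\<omega>. L t \<omega> - L s \<omega>) borel))"
          using L st unfolding levy_process_def by blast
        show "\<bar>Z \<omega>\<bar> \<le> \<bar>c\<bar>" for \<omega> using Z(2)[of \<omega>] Z(3)[of \<omega>] by linarith
        show "\<bar>f x\<bar> \<le> 1" for x using f(2)[of x] f(3)[of x] by linarith
      qed (use st Z(1) sets_F_subset spF in auto)
      also have "expectation (\<lambda>\<omega>. f (L t \<omega> - L s \<omega>)) = (\<integral>x. f x \<partial>distr M borel (\<lambda>\<omega>. L t \<omega> - L s \<omega>))"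
        by (rule integral_distr[symmetric]) auto
      also have "distr M borel (\<lambda>\<omega>. L t \<omega> - L s \<omega>) = distr M borel (L (t - s))"
        using L st unfolding levy_process_def by blast
      also have "(\<integral>x. f x \<partial>distr M borel (L (t - s))) = expectation (\<lambda>\<omega>. f (L (t - s) \<omega>))"
        by (rule integral_distr) auto
      also have "\<dots> = expectation (\<lambda>\<omega>. f (L' (t - s) \<omega>))"
      proof (rule integral_cong_AE)
        show "AE \<omega> in M. f (L (t - s) \<omega>) = f (L' (t - s) \<omega>)"
          using AEN by eventually_elim (simp add: L'_def)
      qed measurable
      finally show ?thesis .
    qed
    show "sets \<nu> = sets borel" using \<nu> unfolding is_levy_measure_def by simp
    show "emeasure \<nu> S = (\<integral>\<^sup>+\<omega>. emeasure (count_space UNIV) {s\<in>{0<..1}. jump (\<lambda>r. L' r \<omega>) s \<in> S - {0}} \<partial>M)" if "open S" for S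
    proof -
      have "emeasure \<nu> S = (\<integral>\<^sup>+\<omega>. emeasure (count_space UNIV) {s\<in>{0<..1}. jump (\<lambda>r. L r \<omega>) s \<in> S - {0}} \<partial>M)"
        using \<nu> borel_open[OF that] unfolding is_levy_measure_def by blast
      also have "\<dots> = (\<integral>\<^sup>+\<omega>. emeasure (count_space UNIV) {s\<in>{0<..1}. jump (\<lambda>r. L' r \<omega>) s \<in> S - {0}} \<partial>M)"
        using AEN by (intro nn_integral_cong_AE) (auto elim!: eventually_mono simp: L'_def)
      finally show ?thesis .
    qed
    have "AE \<omega> in M. \<forall>t\<ge>0.
        let Yl = left_lim (\<lambda>r. Y r \<omega>) in
        \<exists>J. has_matrix_LS_integral (\<lambda>s. A ** psd_sqrt (C + Yl s)) (disc_qv (\<lambda>r. L r \<omega>))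
              (\<lambda>s. psd_sqrt (C + Yl s) ** transpose A) t J \<and>
            Y t \<omega> = Y 0 \<omega> + integral {0..t} (\<lambda>s. B ** Yl s + Yl s ** transpose B) + J"
      using Y unfolding mucogarch_volatility_def by blast
    then show "AE \<omega> in M. \<forall>t\<ge>0.
        let Yl = left_lim (\<lambda>r. Y' r \<omega>) in
        \<exists>J. has_matrix_LS_integral (\<lambda>s. A ** psd_sqrt (C + Yl s)) (disc_qv (\<lambda>r. L' r \<omega>))
              (\<lambda>s. psd_sqrt (C + Yl s) ** transpose A) t J \<and>
            Y' t \<omega> = Y' 0 \<omega> + integral {0..t} (\<lambda>s. B ** Yl s + Yl s ** transpose B) + J"
      using AEN
    proof eventually_elim
      case (elim \<omega>)
      have "(\<lambda>r. Y' r \<omega>) = (\<lambda>r. Y r \<omega>)" "(\<lambda>r. L' r \<omega>) = (\<lambda>r. L r \<omega>)" "Y' t \<omega> = Y t \<omega>" for t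
        using elim(2) by (simp_all add: Y'_def L'_def)
      then show ?case using elim(1) by (simp only:)
    qed
  qed (fact C second fourth fourths)+
  moreover have "AE \<omega> in M. \<forall>t. Y' t \<omega> = Y t \<omega>"
    using AEN by eventually_elim (simp add: Y'_def)
  moreover have "\<forall>t\<ge>0. Y t \<in> borel_measurable M" using toM[OF adY] by blast
  ultimately show ?thesis by blast
qed

theorem theorem4p15:
  fixes M :: "'a measure" and F :: "real \<Rightarrow> 'a measure"
    and L :: "real \<Rightarrow> 'a \<Rightarrow> real^'d" and \<nu> :: "(real^'d) measure"
    and A B C :: "real^'d^'d" and Y :: "real \<Rightarrow> 'a \<Rightarrow> real^'d^'d"
    and \<sigma> \<rho> :: real
  assumes "usual_filtered_space M F"
    and "levy_process M F L"
    and "is_levy_measure M L \<nu>"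
    and "posdef C"
    and "mucogarch_volatility M F L A B C Y"
    and "0 \<le> \<sigma>"
    and "has_bochner_integral \<nu> (\<lambda>x. outer x x) (\<sigma> *\<^sub>R mat 1)"
    and "integrable \<nu> (\<lambda>x. norm x ^ 4)"
    and "has_bochner_integral \<nu> (\<lambda>x. outer (vec_mat (outer x x)) (vec_mat (outer x x)))
           (\<rho> *\<^sub>R (mat 1 + comm_mat + outer (vec_mat (mat 1)) (vec_mat (mat 1))))"
  shows
    "(integrable M (\<lambda>\<omega>. (norm (Y 0 \<omega>))\<^sup>2) \<longrightarrow>
       (\<forall>t\<ge>0. integrable M (\<lambda>\<omega>. (norm (Y t \<omega>))\<^sup>2)) \<and>
       (\<forall>t\<ge>0. let D = scrC A B \<sigma> \<rho> *v vec_mat (EYY M (Y t))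
                 + (\<sigma> *\<^sub>R ((A \<otimes> A) \<otimes> mat 1) + scrA A ** calR \<rho>) *v (vec_mat C \<otimes>\<^sub>v EY M (Y t))
                 + (\<sigma> *\<^sub>R (mat 1 \<otimes> (A \<otimes> A)) + scrA A ** calR \<rho>) *v (EY M (Y t) \<otimes>\<^sub>v vec_mat C)
                 + (scrA A ** calR \<rho>) *v (vec_mat C \<otimes>\<^sub>v vec_mat C)
              in ((\<lambda>s. vec_mat (EYY M (Y s))) has_vector_derivative D) (at t within {0..}) \<and>
                 ((\<lambda>s. \<integral>\<omega>. vec_mat (Y s \<omega>) \<otimes>\<^sub>v vec_mat (Y s \<omega>) \<partial>M) has_vector_derivative D)
                   (at t within {0..})))
    \<and>
    (second_order_stationary M Y \<longrightarrow>
       scrB A B \<sigma> ** EYY M (Y 0) + EYY M (Y 0) ** transpose (scrB A B \<sigma>)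
         + (A \<otimes> A) ** R_map \<rho> (EYY M (Y 0)) ** (transpose A \<otimes> transpose A)
       = - (\<sigma> *\<^sub>R (outer ((A \<otimes> A) *v vec_mat C) (EY M (Y 0))
                  + outer (EY M (Y 0)) (vec_mat C) ** (transpose A \<otimes> transpose A)))
         - (A \<otimes> A) ** R_map \<rho> (outer (EY M (Y 0)) (vec_mat C) + outer (vec_mat C) (EY M (Y 0))
                               + outer (vec_mat C) (vec_mat C)) ** (transpose A \<otimes> transpose A) \<and>
       (invertible (scrC A B \<sigma> \<rho>) \<longrightarrow>
         vec_mat (EYY M (Y 0)) =
           - (matrix_inv (scrC A B \<sigma> \<rho>) *v
               ((scrA A ** calR \<rho>) *v (vec_mat C \<otimes>\<^sub>v vec_mat C)
                + (\<sigma> *\<^sub>R ((A \<otimes> A) \<otimes> mat 1) + scrA A ** calR \<rho>) *v (vec_mat C \<otimes>\<^sub>v EY M (Y 0))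
                + (\<sigma> *\<^sub>R (mat 1 \<otimes> (A \<otimes> A)) + scrA A ** calR \<rho>) *v (EY M (Y 0) \<otimes>\<^sub>v vec_mat C)))))"
proof -
  obtain L' Y' where "mucogarch M F L' \<nu> A B C Y' \<sigma> \<rho>" and ae: "AE \<omega> in M. \<forall>t. Y' t \<omega> = Y t \<omega>"
    and Ym: "\<And>t. 0 \<le> t \<Longrightarrow> Y t \<in> borel_measurable M"
    using mucogarch_modification[OF assms(1-5,7-9)] by blast
  then interpret mucogarch M F L' \<nu> A B C Y' \<sigma> \<rho> by simp
  \<comment> \<open>The moments in the statement are expectations of continuous functions of
    \<open>Y\<close> at one time, hence unchanged by the modification; covariances between two times
    are compared separately.\<close>
  have cong: "integral\<^sup>L M (\<lambda>\<omega>. h (Y' t \<omega>)) = integral\<^sup>L M (\<lambda>\<omega>. h (Y t \<omega>))"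
    "integrable M (\<lambda>\<omega>. h (Y' t \<omega>)) \<longleftrightarrow> integrable M (\<lambda>\<omega>. h (Y t \<omega>))"
    if t: "0 \<le> t" and h: "continuous_on UNIV h" for t and h :: "real^'d^'d \<Rightarrow> 'z::{banach, second_countable_topology}"
  proof -
    have m: "(\<lambda>\<omega>. h (Y t \<omega>)) \<in> borel_measurable M" "(\<lambda>\<omega>. h (Y' t \<omega>)) \<in> borel_measurable M"
      using measurable_compose[OF _ borel_measurable_continuous_onI[OF h]] Ym[OF t] Y_measurable[OF t] by blast+
    have e: "AE \<omega> in M. h (Y' t \<omega>) = h (Y t \<omega>)" using ae by eventually_elim simp
    show "integral\<^sup>L M (\<lambda>\<omega>. h (Y' t \<omega>)) = integral\<^sup>L M (\<lambda>\<omega>. h (Y t \<omega>))" by (rule integral_cong_AE[OF m(2,1) e])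
    show "integrable M (\<lambda>\<omega>. h (Y' t \<omega>)) \<longleftrightarrow> integrable M (\<lambda>\<omega>. h (Y t \<omega>))" by (rule integrable_cong_AE[OF m(2,1) e])
  qed
  have cont: "continuous_on UNIV (\<lambda>X::real^'d^'d. (norm X)\<^sup>2)" "continuous_on UNIV (vec_mat :: real^'d^'d \<Rightarrow> _)"
    by (intro continuous_intros) (rule linear_continuous_on[OF bounded_linear_vec_mat])
  have EY': "EY M (Y' t) = EY M (Y t)" "EYY M (Y' t) = EYY M (Y t)" if "0 \<le> t" for t
    unfolding EY_def EYY_def by (intro cong(1)[OF that] cont continuous_on_outer)+
  have part1: "(\<forall>t\<ge>0. integrable M (\<lambda>\<omega>. (norm (Y t \<omega>))\<^sup>2)) \<and>
       (\<forall>t\<ge>0. let D = scrC A B \<sigma> \<rho> *v vec_mat (EYY M (Y t))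
                 + (\<sigma> *\<^sub>R ((A \<otimes> A) \<otimes> mat 1) + scrA A ** calR \<rho>) *v (vec_mat C \<otimes>\<^sub>v EY M (Y t))
                 + (\<sigma> *\<^sub>R (mat 1 \<otimes> (A \<otimes> A)) + scrA A ** calR \<rho>) *v (EY M (Y t) \<otimes>\<^sub>v vec_mat C)
                 + (scrA A ** calR \<rho>) *v (vec_mat C \<otimes>\<^sub>v vec_mat C)
              in ((\<lambda>s. vec_mat (EYY M (Y s))) has_vector_derivative D) (at t within {0..}) \<and>
                 ((\<lambda>s. \<integral>\<omega>. vec_mat (Y s \<omega>) \<otimes>\<^sub>v vec_mat (Y s \<omega>) \<partial>M) has_vector_derivative D)
                   (at t within {0..}))"
    if int: "integrable M (\<lambda>\<omega>. (norm (Y 0 \<omega>))\<^sup>2)"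
  proof -
    have int0: "integrable M (\<lambda>\<omega>. (norm (Y' 0 \<omega>))\<^sup>2)"
      using int cong(2)[OF order_refl cont(1)] by blast
    have "integrable M (\<lambda>\<omega>. (norm (Y t \<omega>))\<^sup>2)" if "0 \<le> t" for t
      using norm_square_Y_integrable[OF int0 that] cong(2)[OF that cont(1)] by blast
    moreover have d1: "((\<lambda>s. vec_mat (EYY M (Y s))) has_vector_derivative vec_mat (rate (EYY M (Y t)) (EY M (Y t)))) (at t within {0..})"
      if t: "0 \<le> t" for t
    proof -
      have "((\<lambda>s. vec_mat (EYY M (Y s))) has_vector_derivative vec_mat (rate (EYY M (Y' t)) (EY M (Y' t)))) (at t within {0..})"
      proof (rule has_vector_derivative_transform[OF _ _ second_moment_derivative[OF int0 t]])
        fix s :: real assume "s \<in> {0..}"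
        then show "vec_mat (EYY M (Y s)) = vec_mat (EYY M (Y' s))" using EY'(2)[of s] by simp
      qed (use t in simp)
      then show ?thesis unfolding EY'[OF t] .
    qed
    moreover have "((\<lambda>s. \<integral>\<omega>. vec_mat (Y s \<omega>) \<otimes>\<^sub>v vec_mat (Y s \<omega>) \<partial>M) has_vector_derivative vec_mat (rate (EYY M (Y t)) (EY M (Y t)))) (at t within {0..})"
      if t: "0 \<le> t" for t
    proof (rule has_vector_derivative_transform[OF _ _ d1[OF t]])
      fix s :: real assume "s \<in> {0..}"
      then have s: "0 \<le> s" by simp
      have i: "integrable M (\<lambda>\<omega>. outer (vec_mat (Y s \<omega>)) (vec_mat (Y s \<omega>)))"
        using moments_integrable(3)[OF int0 s] cong(2)[OF s continuous_on_outer] by blast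
      \<comment> \<open>\<open>vec_mat\<close> of an outer product is a Kronecker product, and
        \<open>vec_mat\<close> commutes with the expectation: the two derivatives in the statement
        belong to the same function.\<close>
      show "(\<integral>\<omega>. vec_mat (Y s \<omega>) \<otimes>\<^sub>v vec_mat (Y s \<omega>) \<partial>M) = vec_mat (EYY M (Y s))"
        unfolding EYY_def vec_mat_outer[symmetric] by (rule integral_bounded_linear[OF bounded_linear_vec_mat i])
    qed (use t in simp)
    ultimately show ?thesis
      unfolding Let_def vec_mat_second_moment_rate[symmetric] by blast
  qed
  have part2: "rate (EYY M (Y 0)) (EY M (Y 0)) = 0" if st: "second_order_stationary M Y"
  proof -
    have cov: "cov_mat M (\<lambda>\<omega>. vec_mat (Y' t \<omega>)) (\<lambda>\<omega>. vec_mat (Y' s \<omega>)) = cov_mat M (\<lambda>\<omega>. vec_mat (Y t \<omega>)) (\<lambda>\<omega>. vec_mat (Y s \<omega>))"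
      if ts: "0 \<le> t" "0 \<le> s" for t s
    proof -
      have E: "integral\<^sup>L M (\<lambda>\<omega>. vec_mat (Y' t \<omega>)) = integral\<^sup>L M (\<lambda>\<omega>. vec_mat (Y t \<omega>))" if "0 \<le> t" for t
        by (rule cong(1)[OF that cont(2)])
      have m [measurable]: "(\<lambda>\<omega>. vec_mat (Z t \<omega>)) \<in> borel_measurable M" if "0 \<le> t" "Z \<in> {Y, Y'}" for Z t
        using measurable_compose[OF _ borel_measurable_continuous_onI[OF cont(2)]] Ym Y_measurable that by blast
      have mm: "(\<lambda>\<omega>. outer (vec_mat (Z t \<omega>) - a) (vec_mat (Z s \<omega>) - b)) \<in> borel_measurable M" if "Z \<in> {Y, Y'}" for Z a b
      proof -
        have c: "continuous_on UNIV (\<lambda>p. outer (fst p - a) (snd p - b))"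
          unfolding outer_def by (intro continuous_on_vec_lambda continuous_intros)
        have "(\<lambda>\<omega>. (vec_mat (Z t \<omega>), vec_mat (Z s \<omega>))) \<in> borel_measurable M"
          using m[OF ts(1) that] m[OF ts(2) that] by (rule borel_measurable_Pair)
        from measurable_compose[OF this borel_measurable_continuous_onI[OF c]] show ?thesis by simp
      qed
      have "AE \<omega> in M. outer (vec_mat (Y' t \<omega>) - a) (vec_mat (Y' s \<omega>) - b) = outer (vec_mat (Y t \<omega>) - a) (vec_mat (Y s \<omega>) - b)" for a b
        using ae by eventually_elim simp
      then show ?thesis unfolding cov_mat_def E[OF ts(1)] E[OF ts(2)]
        by (intro integral_cong_AE mm) auto
    qed
    have id: "continuous_on UNIV (\<lambda>X::real^'d^'d. X)" by simp
    \<comment> \<open>\<open>stationary_rate\<close> speaks of the modification, so stationarity is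
      first carried over from \<open>Y\<close>.\<close>
    have "second_order_stationary M Y'"
      unfolding second_order_stationary_def
    proof (intro conjI allI impI)
      fix t :: real assume t: "0 \<le> t"
      show "Y' t \<in> borel_measurable M" by (rule Y_measurable[OF t])
      show "integrable M (\<lambda>\<omega>. (norm (Y' t \<omega>))\<^sup>2)"
        using st t cong(2)[OF t cont(1)] unfolding second_order_stationary_def by blast
      show "(\<integral>\<omega>. Y' t \<omega> \<partial>M) = (\<integral>\<omega>. Y' 0 \<omega> \<partial>M)"
      proof -
        have "(\<integral>\<omega>. Y t \<omega> \<partial>M) = (\<integral>\<omega>. Y 0 \<omega> \<partial>M)"
          using st t unfolding second_order_stationary_def by blast
        then show ?thesis by (simp only: cong(1)[OF t id] cong(1)[OF order_refl id])
      qed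
      fix h :: real assume h: "0 \<le> h"
      show "cov_mat M (\<lambda>\<omega>. vec_mat (Y' (t + h) \<omega>)) (\<lambda>\<omega>. vec_mat (Y' t \<omega>)) = cov_mat M (\<lambda>\<omega>. vec_mat (Y' h \<omega>)) (\<lambda>\<omega>. vec_mat (Y' 0 \<omega>))"
      proof -
        have "cov_mat M (\<lambda>\<omega>. vec_mat (Y (t + h) \<omega>)) (\<lambda>\<omega>. vec_mat (Y t \<omega>)) = cov_mat M (\<lambda>\<omega>. vec_mat (Y h \<omega>)) (\<lambda>\<omega>. vec_mat (Y 0 \<omega>))"
          using st t h unfolding second_order_stationary_def by blast
        then show ?thesis using t h by (simp only: cov add_nonneg_nonneg order_refl)
      qed
    qed
    from stationary_rate[OF this] show ?thesis by (simp only: EY'[OF order_refl])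
  qed
  show ?thesis
    using part1 stationary_matrix_equation[OF part2] stationary_vector_equation[OF part2] by blast
qed

end
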